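(* Let $k\ge2$ and let $f,g:\mathcal W_k\to\mathbb R$ be continuous functions that are invariant under measure-preserving transformations. For $\beta>0$ let $\mathbb P_{n,\beta}$ be the probability measure on $\mathcal C_n^k$ with $\mathbb P_{n,\beta}(\mathscr X)$ proportional to $\exp\{n^2(\beta f(\mathbf W^{\mathscr X})+g(\mathbf W^{\mathscr X}))\}$, and let $\widetilde{\mathbb P}_{n,\beta}$ be its pushforward to $\widetilde{\mathcal W}_k$ under $\mathscr X\mapsto\widetilde{\mathbf W}^{\mathscr X}$. Let $$\Gamma_\beta=\operatorname*{arg\,max}_{\widetilde{\mathbf W}\in\widetilde{\mathcal W}_k}\Big\{\beta f(\widetilde{\mathbf W})+g(\widetilde{\mathbf W})-\tfrac12\mathcal I(\widetilde{\mathbf W})\Big\},\quad \mathcal N_f=\operatorname*{arg\,max}_{\widetilde{\mathbf W}\in\widetilde{\mathcal W}_k}f(\widetilde{\mathbf W}),\quad \mathcal N^*=\operatorname*{arg\,max}_{\widetilde{\mathbf W}\in\mathcal N_f}\Big(g(\widetilde{\mathbf W})-\tfrac12\mathcal I(\widetilde{\mathbf W})\Big).$$ For $\varepsilon>0$ let $\mathcal S_\varepsilon=\{\widetilde{\mathbf W}\in\widetilde{\mathcal W}_k:\delta_\square(\widetilde{\mathbf W},\mathcal N^* )\ge\varepsilon\}$. Then for every $\varepsilon>0$ there exist constants $\beta_0=\beta_0(\varepsilon)>0$ and $K=K(\varepsilon)>0$ such that for every fixed $\beta\ge\beta_0$ there exists $n_0=n_0(\varepsilon,\beta)$ such that for all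 $n\ge n_0$, $$\widetilde{\mathbb P}_{n,\beta}(\mathcal S_\varepsilon)=\mathbb P_{n,\beta}\big(\delta_\square(\widetilde{\mathbf W}^{\mathscr X},\mathcal N^* )\ge\varepsilon\big)\le\exp(-Kn^2).$$ Further, $$\lim_{\beta\to\infty}\ \sup_{\widetilde{\mathbf W}\in\Gamma_\beta}\delta_\square(\widetilde{\mathbf W},\mathcal N^* )=0.$$
   Context: Let $[k]=\{1,\dots,k\}$ and $\Delta_k=\{\mu\in[0,1]^k:\sum_a\mu_a=1\}$. A $k$-colored probability graphon is a measurable symmetric map $\mathbf W=(W_1,\dots,W_k):[0,1]^2\to\Delta_k$; $\mathcal W_k$ is the set of these. For bounded measurable $U:[0,1]^2\to\mathbb R$, $\|U\|_\square=\sup_{S,T\subset[0,1]}|\int_{S\times T}U|$; for vector-valued $\mathbf U$, $\|\mathbf U\|_\square=\sum_a\|U_a\|_\square$. $\delta_\square(\mathbf U,\mathbf W)=\inf_\phi\|\mathbf U-\mathbf W^\phi\|_\square$ over measure-preserving bijections $\phi$ of $[0,1]$, $\mathbf W^\phi(x,y)=\mathbf W(\phi(x),\phi(y))$. $\widetilde{\mathcal W}_k$ is the quotient of $\mathcal W_k$ by $\delta_\square=0$, with induced metric; $\widetilde{\mathbf W}$ is the class of $\mathbf W$. For $A\subseteq\widetilde{\mathcal W}_k$, $\delta_\square(\widetilde{\mathbf W},A)=\inf_{\widetilde{\mathbf U}\in A}\delta_\square(\widetilde{\mathbf W},\widetilde{\mathbf U})$. Continuity of $f,g$ is with respect to the cut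 topology, so that, being invariant, they induce continuous functions (same notation) on $(\widetilde{\mathcal W}_k,\delta_\square)$. $\mathcal C_n^k$ is the set of all maps $\mathscr X$ from the edge set of the complete graph $K_n$ on $\{1,\dots,n\}$ to $[k]$. The empirical graphon $\mathbf W^{\mathscr X}\in\mathcal W_k$ has $W^{\mathscr X}_a(x,y)=\mathbf 1\{\mathscr X(\{u,v\})=a\}$ for $(x,y)\in(\frac{u-1}n,\frac un]\times(\frac{v-1}n,\frac vn]$, $u\ne v$, and $\mathbf W^{\mathscr X}=(\frac1k,\dots,\frac1k)$ on the diagonal blocks $u=v$. $\mathcal I(\mathbf W)=\sum_{a=1}^k\int_{[0,1]^2}W_a\log W_a\,dx\,dy$ (with $0\log0=0$); it depends only on the class $\widetilde{\mathbf W}$. *)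

theory Defs
  imports "HOL-Probability.Probability"
begin

text \<open>
  The colour set \<open>[k]\<close> is a finite type \<open>'k\<close> with \<open>k = CARD('k)\<close>.  Measurability on \<open>[0,1]\<close> and
  \<open>[0,1]\<^sup>2\<close> is Lebesgue measurability.
\<close>

type_synonym 'k kernel = "real \<times> real \<Rightarrow> real ^ 'k"

abbreviation unit_square :: "(real \<times> real) set" where
  "unit_square \<equiv> {0..1} \<times> {0..1}"

definition prob_simplex :: "(real ^ 'k::finite) set" where
  "prob_simplex = {\<mu>. (\<forall>a. \<mu> $ a \<in> {0..1}) \<and> (\<Sum>a\<in>UNIV. \<mu> $ a) = 1}"

text \<open>Graphons are functions on the square, represented extensionally (\<open>undefined\<close> outside).\<close>

definition graphons :: "'k::finite kernel set" where
  "graphons = {W \<in> unit_square \<rightarrow>\<^sub>E prob_simplex.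
      W \<in> borel_measurable (lebesgue_on unit_square) \<and>
      (\<forall>x\<in>{0..1}. \<forall>y\<in>{0..1}. W (x, y) = W (y, x))}"


subsection \<open>Cut norm and cut distance\<close>

definition cut_norm :: "(real \<times> real \<Rightarrow> real) \<Rightarrow> real" where
  "cut_norm U = (SUP (S, T) \<in> sets (lebesgue_on {0..1}) \<times> sets (lebesgue_on {0..1}).
      \<bar>LINT z:S \<times> T|lebesgue. U z\<bar>)"

definition cut_norm_vec :: "'k::finite kernel \<Rightarrow> real" where
  "cut_norm_vec U = (\<Sum>a\<in>UNIV. cut_norm (\<lambda>z. U z $ a))"

text \<open>
  Measurability of the inverse is automatic for a bijection of \<open>[0,1]\<close> that is measurable and
  measure preserving (Lusin--Souslin); it is listed so that the inverse is visibly of the same kind.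
\<close>

definition mp_bijections :: "(real \<Rightarrow> real) set" where
  "mp_bijections = {\<phi>. bij_betw \<phi> {0..1} {0..1} \<and>
      \<phi> \<in> measurable (lebesgue_on {0..1}) (lebesgue_on {0..1}) \<and>
      inv_into {0..1} \<phi> \<in> measurable (lebesgue_on {0..1}) (lebesgue_on {0..1}) \<and>
      distr (lebesgue_on {0..1}) (lebesgue_on {0..1}) \<phi> = lebesgue_on {0..1}}"

definition relabel :: "(real \<Rightarrow> real) \<Rightarrow> 'k::finite kernel \<Rightarrow> 'k kernel" where
  "relabel \<phi> W = restrict (\<lambda>(x, y). W (\<phi> x, \<phi> y)) unit_square"

definition cut_dist :: "'k::finite kernel \<Rightarrow> 'k kernel \<Rightarrow> real" where
  "cut_dist U W = (INF \<phi>\<in>mp_bijections. cut_norm_vec (\<lambda>z. U z - relabel \<phi> W z))"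

definition relabelling_invariant :: "('k::finite kernel \<Rightarrow> real) \<Rightarrow> bool" where
  "relabelling_invariant f \<longleftrightarrow> (\<forall>W\<in>graphons. \<forall>\<phi>\<in>mp_bijections. f (relabel \<phi> W) = f W)"

text \<open>The cut topology on labelled graphons is generated by the (pseudo)metric of the cut norm.\<close>

definition cut_topology :: "'k::finite kernel topology" where
  "cut_topology = topology (\<lambda>V. V \<subseteq> graphons \<and>
      (\<forall>W\<in>V. \<exists>r>0. {U \<in> graphons. cut_norm_vec (\<lambda>z. U z - W z) < r} \<subseteq> V))"

lemma openin_cut_topology:
  "openin cut_topology V \<longleftrightarrow> V \<subseteq> (graphons :: 'k::finite kernel set) \<and>
      (\<forall>W\<in>V. \<exists>r>0. {U \<in> graphons. cut_norm_vec (\<lambda>z. U z - W z) < r} \<subseteq> V)"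
proof -
  define P where "P = (\<lambda>V. V \<subseteq> (graphons :: 'k kernel set) \<and>
      (\<forall>W\<in>V. \<exists>r>0. {U \<in> graphons. cut_norm_vec (\<lambda>z. U z - W z) < r} \<subseteq> V))"
  have "istopology P"
    unfolding istopology_def
  proof (intro conjI allI impI)
    fix S T assume S: "P S" and T: "P T"
    show "P (S \<inter> T)"
      unfolding P_def
    proof (intro conjI ballI)
      show "S \<inter> T \<subseteq> graphons" using S by (auto simp: P_def)
      fix W assume "W \<in> S \<inter> T"
      then obtain r s where "r > 0" "{U \<in> graphons. cut_norm_vec (\<lambda>z. U z - W z) < r} \<subseteq> S"
        and "s > 0" "{U \<in> graphons. cut_norm_vec (\<lambda>z. U z - W z) < s} \<subseteq> T"
        using S T unfolding P_def by (meson IntD1 IntD2)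
      then show "\<exists>r>0. {U \<in> graphons. cut_norm_vec (\<lambda>z. U z - W z) < r} \<subseteq> S \<inter> T"
        by (intro exI[of _ "min r s"]) auto
    qed
  next
    fix \<K> assume K: "\<forall>K\<in>\<K>. P K"
    show "P (\<Union>\<K>)"
      unfolding P_def
    proof (intro conjI ballI)
      show "\<Union>\<K> \<subseteq> graphons" using K by (auto simp: P_def)
      fix W assume "W \<in> \<Union>\<K>"
      then obtain V where V: "V \<in> \<K>" "W \<in> V" by blast
      then obtain r where "r > 0" "{U \<in> graphons. cut_norm_vec (\<lambda>z. U z - W z) < r} \<subseteq> V"
        using K unfolding P_def by meson
      then show "\<exists>r>0. {U \<in> graphons. cut_norm_vec (\<lambda>z. U z - W z) < r} \<subseteq> \<Union>\<K>"
        using V by blast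
    qed
  qed
  then show ?thesis
    unfolding cut_topology_def P_def by (simp add: topology_inverse')
qed

lemma topspace_cut_topology: "topspace cut_topology = (graphons :: 'k::finite kernel set)"
proof -
  have "openin cut_topology (graphons :: 'k kernel set)"
    unfolding openin_cut_topology by (auto intro: exI[of _ 1])
  then show ?thesis
    using openin_subset[of cut_topology "graphons :: 'k kernel set"]
      openin_topspace[of "cut_topology :: 'k kernel topology"]
    unfolding openin_cut_topology by blast
qed


subsection \<open>The quotient space of unlabelled graphons\<close>

definition cut_equiv :: "('k::finite kernel \<times> 'k kernel) set" where
  "cut_equiv = {(U, W). U \<in> graphons \<and> W \<in> graphons \<and> cut_dist U W = 0}"

type_synonym 'k unlabelled = "'k kernel set"

definition ugraphons :: "'k::finite unlabelled set" where
  "ugraphons = graphons // cut_equiv"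

definition unlabel :: "'k::finite kernel \<Rightarrow> 'k unlabelled" where
  "unlabel W = cut_equiv `` {W}"

text \<open>The value on a class of a function that is constant on classes.\<close>

definition induced :: "('k::finite kernel \<Rightarrow> real) \<Rightarrow> 'k unlabelled \<Rightarrow> real" where
  "induced h A = the_elem (h ` A)"

definition ucut_dist :: "'k::finite unlabelled \<Rightarrow> 'k unlabelled \<Rightarrow> real" where
  "ucut_dist A B = the_elem ((\<lambda>(U, W). cut_dist U W) ` (A \<times> B))"

definition ucut_dist_set :: "'k::finite unlabelled \<Rightarrow> 'k unlabelled set \<Rightarrow> real" where
  "ucut_dist_set A \<B> = (INF B\<in>\<B>. ucut_dist A B)"


subsection \<open>Entropy and the variational problems\<close>

text \<open>The convention \<open>0 log 0 = 0\<close> holds for the HOL term \<open>0 * ln 0\<close>.\<close>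

definition entropy_fun :: "'k::finite kernel \<Rightarrow> real" where
  "entropy_fun W = (\<Sum>a\<in>UNIV. LINT z:unit_square|lebesgue. W z $ a * ln (W z $ a))"

definition argmax_on :: "('a \<Rightarrow> real) \<Rightarrow> 'a set \<Rightarrow> 'a set" where
  "argmax_on F A = {x. is_arg_max F (\<lambda>y. y \<in> A) x}"

definition Gamma_set ::
  "('k::finite kernel \<Rightarrow> real) \<Rightarrow> ('k kernel \<Rightarrow> real) \<Rightarrow> real \<Rightarrow> 'k unlabelled set" where
  "Gamma_set f g \<beta> =
    argmax_on (\<lambda>A. \<beta> * induced f A + induced g A - 1/2 * induced entropy_fun A) ugraphons"

definition N_set :: "('k::finite kernel \<Rightarrow> real) \<Rightarrow> 'k unlabelled set" where
  "N_set f = argmax_on (induced f) ugraphons"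

definition N_star ::
  "('k::finite kernel \<Rightarrow> real) \<Rightarrow> ('k kernel \<Rightarrow> real) \<Rightarrow> 'k unlabelled set" where
  "N_star f g = argmax_on (\<lambda>A. induced g A - 1/2 * induced entropy_fun A) (N_set f)"

definition far_set ::
  "('k::finite kernel \<Rightarrow> real) \<Rightarrow> ('k kernel \<Rightarrow> real) \<Rightarrow> real \<Rightarrow> 'k unlabelled set" where
  "far_set f g \<epsilon> = {A \<in> ugraphons. ucut_dist_set A (N_star f g) \<ge> \<epsilon>}"


subsection \<open>Edge colourings and the exponential random coloured graph\<close>

definition complete_edges :: "nat \<Rightarrow> nat set set" where
  "complete_edges n = {e. e \<subseteq> {1..n} \<and> card e = 2}"

definition colourings :: "nat \<Rightarrow> (nat set \<Rightarrow> 'k::finite) set" where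
  "colourings n = (complete_edges n \<rightarrow>\<^sub>E UNIV)"

text \<open>
  The index \<open>u\<close> with \<open>x \<in> ((u - 1)/n, u/n]\<close>.  The point \<open>x = 0\<close>, which lies in none of these
  intervals, is put into the first one.
\<close>

definition block :: "nat \<Rightarrow> real \<Rightarrow> nat" where
  "block n x = max 1 (nat \<lceil>real n * x\<rceil>)"

definition empirical_graphon :: "nat \<Rightarrow> (nat set \<Rightarrow> 'k::finite) \<Rightarrow> 'k kernel" where
  "empirical_graphon n X = restrict (\<lambda>(x, y).
      let u = block n x; v = block n y
      in if u = v then (\<chi> a. 1 / real CARD('k)) else (\<chi> a. if X {u, v} = a then 1 else 0))
    unit_square"

definition gibbs_weight ::
  "('k::finite kernel \<Rightarrow> real) \<Rightarrow> ('k kernel \<Rightarrow> real) \<Rightarrow> nat \<Rightarrow> real \<Rightarrow> (nat set \<Rightarrow> 'k) \<Rightarrow> real" where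
  "gibbs_weight f g n \<beta> X =
    exp ((real n)\<^sup>2 * (\<beta> * f (empirical_graphon n X) + g (empirical_graphon n X)))"

definition gibbs ::
  "('k::finite kernel \<Rightarrow> real) \<Rightarrow> ('k kernel \<Rightarrow> real) \<Rightarrow> nat \<Rightarrow> real \<Rightarrow> (nat set \<Rightarrow> 'k) pmf" where
  "gibbs f g n \<beta> = embed_pmf (\<lambda>X. if X \<in> colourings n
      then gibbs_weight f g n \<beta> X / (\<Sum>Y\<in>colourings n. gibbs_weight f g n \<beta> Y) else 0)"

text \<open>
  The law of the class of the empirical graphon.  It is finitely supported, so it is given as a
  \<open>pmf\<close>, under which every subset of the quotient space is measurable.
\<close>

definition ugibbs ::
  "('k::finite kernel \<Rightarrow> real) \<Rightarrow> ('k kernel \<Rightarrow> real) \<Rightarrow> nat \<Rightarrow> real \<Rightarrow> 'k unlabelled pmf" where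
  "ugibbs f g n \<beta> = map_pmf (\<lambda>X. unlabel (empirical_graphon n X)) (gibbs f g n \<beta>)"


lemma finite_colourings: "finite (colourings n :: (nat set \<Rightarrow> 'k::finite) set)"
proof -
  have "finite (complete_edges n)"
    by (rule finite_subset[of _ "Pow {1..n}"]) (auto simp: complete_edges_def)
  then show ?thesis
    by (auto simp: colourings_def intro!: finite_PiE)
qed

lemma colourings_nonempty: "(colourings n :: (nat set \<Rightarrow> 'k::finite) set) \<noteq> {}"
  by (simp add: colourings_def PiE_eq_empty_iff)

lemma pmf_gibbs:
  fixes f g :: "'k::finite kernel \<Rightarrow> real"
  shows "pmf (gibbs f g n \<beta>) X = (if X \<in> colourings n
      then gibbs_weight f g n \<beta> X / (\<Sum>Y\<in>colourings n. gibbs_weight f g n \<beta> Y) else 0)"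
proof -
  let ?C = "colourings n :: (nat set \<Rightarrow> 'k) set"
  let ?w = "gibbs_weight f g n \<beta>"
  let ?Z = "\<Sum>Y\<in>?C. ?w Y"
  have Z: "?Z > 0"
    using finite_colourings colourings_nonempty
    by (intro sum_pos) (auto simp: gibbs_weight_def)
  have nn: "0 \<le> (if X \<in> ?C then ?w X / ?Z else 0)" for X
    using Z by (simp add: gibbs_weight_def)
  have "(\<integral>\<^sup>+X. ennreal (if X \<in> ?C then ?w X / ?Z else 0) \<partial>count_space UNIV)
      = (\<Sum>X\<in>?C. ennreal (if X \<in> ?C then ?w X / ?Z else 0))"
    by (rule nn_integral_count_space') (auto simp: finite_colourings)
  also have "\<dots> = ennreal (\<Sum>X\<in>?C. if X \<in> ?C then ?w X / ?Z else 0)"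
    using nn by (intro sum_ennreal) blast
  also have "(\<Sum>X\<in>?C. if X \<in> ?C then ?w X / ?Z else 0) = 1"
    using Z by (simp add: sum_divide_distrib[symmetric])
  finally have one: "(\<integral>\<^sup>+X. ennreal (if X \<in> ?C then ?w X / ?Z else 0) \<partial>count_space UNIV) = 1"
    by simp
  show ?thesis
    unfolding gibbs_def by (rule pmf_embed_pmf[OF nn one])
qed

lemma empirical_graphon_in_graphons:
  "empirical_graphon n (X :: nat set \<Rightarrow> 'k::finite) \<in> graphons"
proof -
  let ?h = "\<lambda>u v. if u = v then (\<chi> a. 1 / real CARD('k)) else (\<chi> a. if X {u, v} = a then 1 else 0)"
  have simplex: "?h u v \<in> prob_simplex" for u v :: nat
    by (auto simp: prob_simplex_def)
  have eq: "empirical_graphon n X = restrict (\<lambda>z. ?h (block n (fst z)) (block n (snd z))) unit_square"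
    by (auto simp: empirical_graphon_def Let_def intro!: restrict_ext)
  have [measurable]: "block n \<in> borel \<rightarrow>\<^sub>M count_space UNIV"
    unfolding block_def by measurable
  have "(\<lambda>z. ?h (block n (fst z)) (block n (snd z))) \<in> borel_measurable borel"
  proof -
    have pair: "(\<lambda>z. (block n (fst z), block n (snd z))) \<in> (borel :: (real \<times> real) measure) \<rightarrow>\<^sub>M count_space UNIV"
    proof -
      have "(\<lambda>z. (block n (fst z), block n (snd z))) \<in> (borel :: (real \<times> real) measure) \<rightarrow>\<^sub>M count_space UNIV \<Otimes>\<^sub>M count_space UNIV"
        unfolding borel_prod[symmetric] by measurable
      then show ?thesis
        by (simp add: pair_measure_countable)
    qed
    have "(\<lambda>p. ?h (fst p) (snd p)) \<in> count_space UNIV \<rightarrow>\<^sub>M borel"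
      by simp
    from measurable_compose[OF pair this] show ?thesis
      unfolding fst_conv snd_conv .
  qed
  then have "(\<lambda>z. ?h (block n (fst z)) (block n (snd z))) \<in> borel_measurable (lebesgue_on unit_square)"
    by (intro measurable_restrict_space1 measurable_completion) simp
  then have "empirical_graphon n X \<in> borel_measurable (lebesgue_on unit_square)"
    unfolding eq by (subst measurable_cong[where g = "\<lambda>z. ?h (block n (fst z)) (block n (snd z))"]) auto
  moreover have "empirical_graphon n X \<in> unit_square \<rightarrow>\<^sub>E prob_simplex"
    unfolding eq using simplex by (intro restrict_PiE_iff[THEN iffD2]) auto
  ultimately show ?thesis
    by (auto simp: graphons_def empirical_graphon_def Let_def insert_commute)
qed

end

theory Submission
  imports Defs "HOL-Real_Asymp.Real_Asymp"
begin

text \<open>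
  The entropy of a graphon \<open>W\<close> is the supremum of the pairings \<open>\<Sum>\<^sub>a \<integral> W\<^sub>a ln V\<^sub>a\<close> over positive step
  graphons \<open>V\<close>.  Each pairing is continuous in the cut norm, so the entropy is lower semicontinuous.
  Moreover the sum over all colourings \<open>X\<close> of \<open>\<Prod>\<^sub>e V\<^bsub>X(e)\<^esub>(e)\<close> is \<open>1\<close>, and an exponential Chebyshev bound
  shows that at most \<open>exp (n\<^sup>2 (\<kappa> - I(W)/2))\<close> colourings have an empirical graphon close to \<open>W\<close>.  A
  rearrangement of \<open>[0,1]\<close> only enters through a fractional assignment of the vertices to the \<open>m\<close> steps
  of \<open>V\<close>; the pairing is multilinear in it up to diagonal terms, so it suffices to sum over the
  \<open>m\<^sup>n\<close> integral assignments.

  The partition function is bounded below by the Gibbs variational principle, applied to independent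
  edge colours whose laws are smoothed block averages of \<open>W\<close>: their empirical graphon is close to \<open>W\<close> in
  cut norm with high probability.

  The space of unlabelled graphons is compact: totally bounded by the Frieze-Kannan energy decrement
  followed by a rearrangement of small blocks, and complete because weak limits exist by Radon-Nikodym.
  Compactness gives the maximisers, finite covers for the upper bound, and the gap: if for \<open>\<beta> \<rightarrow> \<infinity>\<close> graphons
  at distance at least \<open>\<epsilon>\<close> from the optimal set came close to the maximal free energy, a limit point
  would maximise \<open>f\<close> and, by semicontinuity, be optimal.
\<close>


subsection \<open>Lebesgue measure on the unit square\<close>

text \<open>The relabellings of [0,1] form an infinite family, so no count and no union bound can
  run over them. All that a relabelling does to n vertices is recorded in m fractions per vertex.
  The price of rounding these, \<open>m ^ n\<close>, and the \<open>4 ^ n\<close> pairs of vertex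
  sets in the concentration bound have logarithms of order n and are negligible against exp(\<kappa>
  n^2). The factor 1/2 at the entropy appears because n^2 times an integral over the square runs
  over ordered pairs of vertices, while a colouring has one colour per unordered pair.

  \<open>K\<close> must be chosen before \<beta>. This is possible because on the optimal set the
  free energy is \<beta> max f plus a constant, whereas elsewhere \<beta> f is at most \<beta> max
  f: larger \<beta> never helps a competitor. The compactness argument gives some gap but no rate.
  Half of the gap is given up to the approximation errors at fixed \<beta>; the covering used there
  depends on \<beta>, hence so does the threshold for n.

  Lebesgue measure on the square is the completion of the Borel product, not a product of
  completions. Facts about it are therefore proved on Borel rectangles and carried over null
  sets.\<close>

abbreviation unit_measure :: "real measure" where
  "unit_measure \<equiv> lebesgue_on {0..1}"

abbreviation square_measure :: "(real \<times> real) measure" where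
  "square_measure \<equiv> lebesgue_on unit_square"

text \<open>Borel measurability is clear; for the completion one also needs that the cylinder over a
  null set is null, which holds because its area is zero times infinity, that is zero.\<close>

lemma measurable_fst_lebesgue: "(fst :: real \<times> real \<Rightarrow> real) \<in> lebesgue \<rightarrow>\<^sub>M lebesgue"
proof -
  have f: "(fst :: real \<times> real \<Rightarrow> real) \<in> lebesgue \<rightarrow>\<^sub>M lborel"
    by (intro measurable_completion) (simp add: borel_prod[symmetric])
  show ?thesis
  proof (rule completion.measurable_completion2[OF f], rule subsetI)
    fix N :: "real set" assume N: "N \<in> null_sets lborel"
    have eq: "fst -` N \<inter> space lebesgue = N \<times> (UNIV :: real set)" by auto
    have "emeasure (lborel \<Otimes>\<^sub>M lborel) (N \<times> (UNIV::real set)) = 0"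
      using N by (subst lborel.emeasure_pair_measure_Times) (auto simp: null_sets_def)
    then have 0: "emeasure lborel (N \<times> (UNIV::real set)) = 0" by (simp add: lborel_prod)
    have "N \<times> (UNIV::real set) \<in> sets (lborel :: (real \<times> real) measure)"
      using N unfolding lborel_prod[symmetric] by auto
    then have "N \<times> (UNIV::real set) \<in> null_sets lborel" using 0 by auto
    then have "N \<times> (UNIV::real set) \<in> null_sets lebesgue" by (rule null_sets_completionI)
    then have e0: "emeasure lebesgue (N \<times> (UNIV::real set)) = 0" by (rule null_setsD1)
    have Ns: "N \<in> sets lborel" using N by auto
    have "emeasure (distr lebesgue lborel (fst :: real \<times> real \<Rightarrow> real)) N = 0"
      unfolding emeasure_distr[OF f Ns] eq by (rule e0)
    then show "N \<in> null_sets (distr lebesgue lborel (fst :: real \<times> real \<Rightarrow> real))"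
      using Ns by (intro null_setsI) auto
  qed
qed

lemma measurable_snd_lebesgue: "(snd :: real \<times> real \<Rightarrow> real) \<in> lebesgue \<rightarrow>\<^sub>M lebesgue"
proof -
  have f: "(snd :: real \<times> real \<Rightarrow> real) \<in> lebesgue \<rightarrow>\<^sub>M lborel"
    by (intro measurable_completion) (simp add: borel_prod[symmetric])
  show ?thesis
  proof (rule completion.measurable_completion2[OF f], rule subsetI)
    fix N :: "real set" assume N: "N \<in> null_sets lborel"
    have eq: "snd -` N \<inter> space lebesgue = (UNIV :: real set) \<times> N" by auto
    have "emeasure (lborel \<Otimes>\<^sub>M lborel) ((UNIV::real set) \<times> N) = 0"
      using N by (subst lborel.emeasure_pair_measure_Times) (auto simp: null_sets_def)
    then have 0: "emeasure lborel ((UNIV::real set) \<times> N) = 0" by (simp add: lborel_prod)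
    have "(UNIV::real set) \<times> N \<in> sets (lborel :: (real \<times> real) measure)"
      using N unfolding lborel_prod[symmetric] by auto
    then have "(UNIV::real set) \<times> N \<in> null_sets lborel" using 0 by auto
    then have "(UNIV::real set) \<times> N \<in> null_sets lebesgue" by (rule null_sets_completionI)
    then have e0: "emeasure lebesgue ((UNIV::real set) \<times> N) = 0" by (rule null_setsD1)
    have Ns: "N \<in> sets lborel" using N by auto
    have "emeasure (distr lebesgue lborel (snd :: real \<times> real \<Rightarrow> real)) N = 0"
      unfolding emeasure_distr[OF f Ns] eq by (rule e0)
    then show "N \<in> null_sets (distr lebesgue lborel (snd :: real \<times> real \<Rightarrow> real))"
      using Ns by (intro null_setsI) auto
  qed
qed

lemma sets_lebesgue_Times:
  assumes "S \<in> sets lebesgue" "T \<in> sets lebesgue"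
  shows "(S :: real set) \<times> (T :: real set) \<in> sets lebesgue"
proof -
  have "S \<times> T = (fst -` S \<inter> space lebesgue) \<inter> (snd -` T \<inter> space lebesgue)" by auto
  then show ?thesis
    using measurable_sets[OF measurable_fst_lebesgue assms(1)]
      measurable_sets[OF measurable_snd_lebesgue assms(2)] by (metis sets.Int)
qed

text \<open>Replacing both sides by their Borel main parts changes the rectangle only inside two
  null strips, and for Borel sides the product formula is that of the product measure.\<close>

lemma emeasure_lebesgue_Times:
  assumes S: "S \<in> sets lebesgue" and T: "T \<in> sets lebesgue"
  shows "emeasure lebesgue ((S :: real set) \<times> (T :: real set)) = emeasure lebesgue S * emeasure lebesgue T"
proof -
  let ?S = "main_part lborel S" and ?T = "main_part lborel T"
  have b: "?S \<in> sets lborel" "?T \<in> sets lborel"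
    using main_part_sets[OF S] main_part_sets[OF T] by auto
  obtain N1 where N1: "null_part lborel S \<subseteq> N1" "N1 \<in> null_sets lborel" using null_part[OF S] by auto
  obtain N2 where N2: "null_part lborel T \<subseteq> N2" "N2 \<in> null_sets lborel" using null_part[OF T] by auto
  have SS: "S = ?S \<union> null_part lborel S" and TT: "T = ?T \<union> null_part lborel T"
    using S T main_part_null_part_Un by auto
  have nl: "N \<times> (UNIV::real set) \<in> null_sets lborel" "(UNIV::real set) \<times> N \<in> null_sets lborel"
    if N: "N \<in> null_sets lborel" for N :: "real set"
  proof -
    have s: "N \<times> UNIV \<in> sets (lborel :: (real \<times> real) measure)"
      "UNIV \<times> N \<in> sets (lborel :: (real \<times> real) measure)"
      using N unfolding lborel_prod[symmetric] by auto
    have "emeasure (lborel \<Otimes>\<^sub>M lborel) ((UNIV::real set) \<times> N) = 0"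
      "emeasure (lborel \<Otimes>\<^sub>M lborel) (N \<times> (UNIV::real set)) = 0"
      using N by (subst lborel.emeasure_pair_measure_Times; auto simp: null_sets_def)+
    then show "N \<times> (UNIV::real set) \<in> null_sets lborel" "(UNIV::real set) \<times> N \<in> null_sets lborel"
      using s unfolding lborel_prod by (auto intro!: null_setsI)
  qed
  have sub: "S \<times> T - ?S \<times> ?T \<subseteq> N1 \<times> UNIV \<union> UNIV \<times> N2" "?S \<times> ?T \<subseteq> S \<times> T"
    using SS TT N1 N2 by blast+
  have "N1 \<times> UNIV \<union> UNIV \<times> N2 \<in> null_sets lborel"
    by (intro null_sets.Un nl N1 N2)
  then have "S \<times> T - ?S \<times> ?T \<in> null_sets lebesgue"
    using sub(1) by (metis null_sets_completion_subset null_sets_completionI)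
  then have "emeasure lebesgue (S \<times> T) = emeasure lebesgue (?S \<times> ?T)"
    using sub(2) b by (metis Un_Diff_cancel sup.absorb2 emeasure_Un_null_set sets_lebesgue_Times
      sets_completionI_sets)
  also have "\<dots> = emeasure (lborel \<Otimes>\<^sub>M lborel) (?S \<times> ?T)"
    using b by (simp add: lborel_prod flip: borel_prod)
  also have "\<dots> = emeasure lborel ?S * emeasure lborel ?T"
    using b by (rule lborel.emeasure_pair_measure_Times)
  finally show ?thesis using S T by simp
qed

lemma sets_unit_measure: "A \<in> sets unit_measure \<longleftrightarrow> A \<subseteq> {0..1} \<and> A \<in> sets lebesgue"
  by (subst sets_restrict_space_iff) auto

lemma unit_square_lebesgue [measurable, simp]: "unit_square \<in> sets lebesgue"
  by (intro sets_lebesgue_Times) auto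

lemma sets_square_measure: "A \<in> sets square_measure \<longleftrightarrow> A \<subseteq> unit_square \<and> A \<in> sets lebesgue"
  by (subst sets_restrict_space_iff) auto

lemma emeasure_square_measure: "A \<in> sets square_measure \<Longrightarrow> emeasure square_measure A = emeasure lebesgue A"
  by (subst emeasure_restrict_space) (auto simp: sets_square_measure)

lemma emeasure_unit_measure: "A \<in> sets unit_measure \<Longrightarrow> emeasure unit_measure A = emeasure lebesgue A"
  by (subst emeasure_restrict_space) (auto simp: sets_unit_measure)

lemma Times_in_square:
  "S \<in> sets unit_measure \<Longrightarrow> T \<in> sets unit_measure \<Longrightarrow> S \<times> T \<in> sets square_measure"
  by (auto simp: sets_square_measure sets_unit_measure intro!: sets_lebesgue_Times)

lemma emeasure_square_Times:
  assumes "S \<in> sets unit_measure" "T \<in> sets unit_measure"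
  shows "emeasure square_measure (S \<times> T) = emeasure unit_measure S * emeasure unit_measure T"
  using assms by (simp add: emeasure_square_measure emeasure_unit_measure Times_in_square
    emeasure_lebesgue_Times sets_unit_measure)

lemma prob_space_unit: "prob_space unit_measure"
  by (rule prob_spaceI) (subst emeasure_unit_measure, auto simp: sets_unit_measure)

lemma prob_space_square: "prob_space square_measure"
proof (rule prob_spaceI)
  have "emeasure square_measure (space square_measure) = emeasure square_measure ({0..1} \<times> {0..1})" by simp
  also have "\<dots> = emeasure unit_measure {0..1} * emeasure unit_measure {0..1}"
    by (rule emeasure_square_Times) (auto simp: sets_unit_measure)
  also have "\<dots> = 1"
    using prob_space.emeasure_space_1[OF prob_space_unit] by simp
  finally show "emeasure square_measure (space square_measure) = 1" .
qed

interpretation unit: prob_space unit_measure by (rule prob_space_unit)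
interpretation square: prob_space square_measure by (rule prob_space_square)

lemma measure_square_Times:
  assumes "S \<in> sets unit_measure" "T \<in> sets unit_measure"
  shows "measure square_measure (S \<times> T) = measure unit_measure S * measure unit_measure T"
  using emeasure_square_Times[OF assms]
  by (simp add: measure_def enn2real_mult)

text \<open>Checking rectangles with Borel sides is enough: a Borel measure on the plane is
  determined by them if it agrees there with a product, and completeness of
  \<open>square_measure\<close> then extends measurability and invariance from Borel to Lebesgue
  sets.\<close>

lemma square_measure_preservingI:
  fixes \<Phi> :: "real \<times> real \<Rightarrow> real \<times> real"
  assumes sq: "\<And>z. z \<in> unit_square \<Longrightarrow> \<Phi> z \<in> unit_square"
    and rect: "\<And>A B. A \<in> sets borel \<Longrightarrow> B \<in> sets borel \<Longrightarrow>
      \<Phi> -` (A \<times> B) \<inter> unit_square \<in> sets square_measure"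
    and em: "\<And>A B. A \<in> sets borel \<Longrightarrow> B \<in> sets borel \<Longrightarrow>
      emeasure square_measure (\<Phi> -` (A \<times> B) \<inter> unit_square) =
      emeasure unit_measure (A \<inter> {0..1}) * emeasure unit_measure (B \<inter> {0..1})"
  shows "\<Phi> \<in> square_measure \<rightarrow>\<^sub>M square_measure" "distr square_measure square_measure \<Phi> = square_measure"
proof -
  define M1 where "M1 = distr unit_measure borel (\<lambda>x. x)"
  have bm: "(\<lambda>x. x) \<in> unit_measure \<rightarrow>\<^sub>M (borel :: real measure)"
    by (intro measurable_restrict_space1 measurable_completion) simp
  have p1: "prob_space M1" unfolding M1_def by (rule unit.prob_space_distr[OF bm])
  interpret M1: prob_space M1 by (rule p1)
  have s1: "sets M1 = sets borel" "space M1 = UNIV" by (auto simp: M1_def)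
  have e1: "emeasure M1 A = emeasure unit_measure (A \<inter> {0..1})" if "A \<in> sets borel" for A
    using that unfolding M1_def by (subst emeasure_distr[OF bm]) auto
  have idm: "(\<lambda>z. z) \<in> square_measure \<rightarrow>\<^sub>M (borel :: (real \<times> real) measure)"
    by (intro measurable_restrict_space1 measurable_completion) simp
  have \<Phi>b: "\<Phi> \<in> square_measure \<rightarrow>\<^sub>M borel"
  proof -
    have "\<Phi> \<in> square_measure \<rightarrow>\<^sub>M sigma UNIV {A \<times> B |A B. A \<in> sets (borel::real measure) \<and> B \<in> sets (borel::real measure)}"
      by (rule measurable_sigma_sets[where \<Omega> = UNIV and A = "{A \<times> B |A B. A \<in> sets (borel::real measure) \<and> B \<in> sets (borel::real measure)}"])
        (auto simp: rect)
    moreover have "sets (sigma UNIV {A \<times> B |A B. A \<in> sets (borel::real measure) \<and> B \<in> sets (borel::real measure)})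
      = sets (borel :: (real \<times> real) measure)"
      unfolding borel_prod[symmetric] sets_pair_measure by simp
    ultimately show ?thesis by (simp cong: measurable_cong_sets)
  qed
  \<comment> \<open>The image under \<Phi> and, next, the image under the identity are both
    identified with the product of the Borel restriction \<open>M1\<close> of
    \<open>unit_measure\<close>.\<close>
  have eqP: "M1 \<Otimes>\<^sub>M M1 = distr square_measure borel \<Phi>"
  proof (rule pair_measure_eqI)
    show "sigma_finite_measure M1" "sigma_finite_measure M1" by (rule M1.sigma_finite_measure_axioms)+
    show "sets (M1 \<Otimes>\<^sub>M M1) = sets (distr square_measure borel \<Phi>)"
      using s1 by (simp add: borel_prod[symmetric] cong: sets_pair_measure_cong)
    fix A B assume AB: "A \<in> sets M1" "B \<in> sets M1"
    then have "A \<times> B \<in> sets (borel :: (real \<times> real) measure)" by (simp add: s1 borel_prod[symmetric])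
    then show "emeasure M1 A * emeasure M1 B = emeasure (distr square_measure borel \<Phi>) (A \<times> B)"
      using AB by (subst emeasure_distr[OF \<Phi>b]) (auto simp: s1 e1 em)
  qed
  have eqI: "M1 \<Otimes>\<^sub>M M1 = distr square_measure borel (\<lambda>z. z)"
  proof (rule pair_measure_eqI)
    show "sigma_finite_measure M1" "sigma_finite_measure M1" by (rule M1.sigma_finite_measure_axioms)+
    show "sets (M1 \<Otimes>\<^sub>M M1) = sets (distr square_measure borel (\<lambda>z. z))"
      using s1 by (simp add: borel_prod[symmetric] cong: sets_pair_measure_cong)
    fix A B assume AB: "A \<in> sets M1" "B \<in> sets M1"
    then have ab: "A \<times> B \<in> sets (borel :: (real \<times> real) measure)" by (simp add: s1 borel_prod[symmetric])
    have "(A \<times> B) \<inter> unit_square = (A \<inter> {0..1}) \<times> (B \<inter> {0..1})" by auto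
    moreover have "A \<inter> {0..1} \<in> sets unit_measure" "B \<inter> {0..1} \<in> sets unit_measure"
      using AB by (auto simp: sets_unit_measure s1)
    ultimately show "emeasure M1 A * emeasure M1 B = emeasure (distr square_measure borel (\<lambda>z. z)) (A \<times> B)"
      using AB ab by (subst emeasure_distr[OF idm]) (auto simp: s1 e1 emeasure_square_Times)
  qed
  have borel_eq: "emeasure square_measure (\<Phi> -` A \<inter> unit_square) = emeasure square_measure (A \<inter> unit_square)"
    if "A \<in> sets borel" for A
  proof -
    have "emeasure (distr square_measure borel \<Phi>) A = emeasure (distr square_measure borel (\<lambda>z. z)) A"
      using eqP eqI by simp
    then show ?thesis using that by (simp add: emeasure_distr[OF \<Phi>b] emeasure_distr[OF idm])
  qed
  interpret C: complete_measure square_measure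
  proof
    fix A B assume *: "B \<subseteq> A" "A \<in> null_sets square_measure"
    then have "A \<in> null_sets lebesgue"
      by (auto simp: null_sets_def sets_square_measure emeasure_square_measure)
    then have "B \<in> null_sets lebesgue" using *(1)
      by (metis null_sets_completion_subset)
    then show "B \<in> sets square_measure" using * by (auto simp: sets_square_measure null_sets_def)
  qed
  \<comment> \<open>A Lebesgue set is a Borel set together with part of a Borel null set, and \<Phi>
    pulls Borel null sets back to null sets by \<open>borel_eq\<close>.\<close>
  have key: "\<Phi> -` A \<inter> unit_square \<in> sets square_measure \<and>
      emeasure square_measure (\<Phi> -` A \<inter> unit_square) = emeasure square_measure A"
    if A: "A \<in> sets square_measure" for A
  proof -
    have AL: "A \<in> sets lebesgue" "A \<subseteq> unit_square" using A by (auto simp: sets_square_measure)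
    let ?m = "main_part lborel A"
    obtain N where N: "null_part lborel A \<subseteq> N" "N \<in> null_sets lborel" using null_part[OF AL(1)] by auto
    have Am: "A = ?m \<union> null_part lborel A" using main_part_null_part_Un[OF AL(1)] by auto
    have mb: "?m \<in> sets borel" using main_part_sets[OF AL(1)] by simp
    have Nb: "N \<in> sets borel" using N by auto
    have NQ: "N \<inter> unit_square \<in> null_sets square_measure"
    proof -
      have "N \<inter> unit_square \<in> null_sets lebesgue"
        using N by (metis inf_le1 null_sets_completion_subset null_sets_completionI)
      then show ?thesis by (auto simp: null_sets_def sets_square_measure emeasure_square_measure)
    qed
    have inv: "\<Phi> -` B \<inter> unit_square \<in> sets square_measure" if "B \<in> sets borel" for B
      using measurable_sets[OF \<Phi>b that] by simp
    have N0: "\<Phi> -` N \<inter> unit_square \<in> null_sets square_measure"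
      using borel_eq[OF Nb] NQ inv[OF Nb] by (auto simp: null_sets_def)
    have n0: "\<Phi> -` null_part lborel A \<inter> unit_square \<in> null_sets square_measure"
      by (rule C.complete2[OF _ N0]) (use N in auto)
    have n1: "null_part lborel A \<inter> unit_square \<in> null_sets square_measure"
      by (rule C.complete2[OF _ NQ]) (use N in auto)
    have e: "\<Phi> -` A \<inter> unit_square = (\<Phi> -` ?m \<inter> unit_square) \<union> (\<Phi> -` null_part lborel A \<inter> unit_square)"
      using Am by blast
    have e': "A = (?m \<inter> unit_square) \<union> (null_part lborel A \<inter> unit_square)"
      using Am AL(2) by blast
    have mq: "?m \<inter> unit_square \<in> sets square_measure"
      using mb by (auto simp: sets_square_measure)
    show ?thesis
    proof
      show "\<Phi> -` A \<inter> unit_square \<in> sets square_measure"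
        unfolding e using inv[OF mb] n0 by auto
      have "emeasure square_measure (\<Phi> -` A \<inter> unit_square) = emeasure square_measure (\<Phi> -` ?m \<inter> unit_square)"
        unfolding e using inv[OF mb] n0 by (rule emeasure_Un_null_set)
      also have "\<dots> = emeasure square_measure (?m \<inter> unit_square)" by (rule borel_eq[OF mb])
      also have "\<dots> = emeasure square_measure A"
        by (subst (2) e') (use mq n1 in \<open>rule emeasure_Un_null_set[symmetric]\<close>)
      finally show "emeasure square_measure (\<Phi> -` A \<inter> unit_square) = emeasure square_measure A" .
    qed
  qed
  show m: "\<Phi> \<in> square_measure \<rightarrow>\<^sub>M square_measure"
    by (rule measurableI) (use sq key in auto)
  show "distr square_measure square_measure \<Phi> = square_measure"
    by (rule measure_eqI) (use m key in \<open>auto simp: emeasure_distr\<close>)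
qed

section \<open>The coordinate swap and measure-preserving bijections\<close>

lemma swap_square:
  "prod.swap \<in> square_measure \<rightarrow>\<^sub>M square_measure"
  "distr square_measure square_measure prod.swap = square_measure"
proof -
  have 1: "prod.swap -` (A \<times> B) \<inter> unit_square = (B \<inter> {0..1}) \<times> (A \<inter> {0..1})" for A B :: "real set"
    by auto
  have 2: "A \<inter> {0..1} \<in> sets unit_measure" if "A \<in> sets borel" for A
    using that by (auto simp: sets_unit_measure)
  have 3: "prod.swap z \<in> unit_square" if "z \<in> unit_square" for z
    using that by auto
  have 4: "prod.swap -` (A \<times> B) \<inter> unit_square \<in> sets square_measure"
    "emeasure square_measure (prod.swap -` (A \<times> B) \<inter> unit_square) =
      emeasure unit_measure (A \<inter> {0..1}) * emeasure unit_measure (B \<inter> {0..1})"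
    if "A \<in> sets borel" "B \<in> sets borel" for A B
    unfolding 1 using 2[OF that(1)] 2[OF that(2)]
    by (simp_all add: Times_in_square emeasure_square_Times mult.commute)
  show "prod.swap \<in> square_measure \<rightarrow>\<^sub>M square_measure"
    "distr square_measure square_measure prod.swap = square_measure"
    by (rule square_measure_preservingI[OF 3 4]; assumption)+
qed

lemma mp_bijectionsD:
  assumes "\<phi> \<in> mp_bijections"
  shows "bij_betw \<phi> {0..1} {0..1}" "\<phi> \<in> unit_measure \<rightarrow>\<^sub>M unit_measure"
    "inv_into {0..1} \<phi> \<in> unit_measure \<rightarrow>\<^sub>M unit_measure"
    "distr unit_measure unit_measure \<phi> = unit_measure"
    "\<And>x. x \<in> {0..1} \<Longrightarrow> \<phi> x \<in> {0..1}"
    "\<And>A. A \<in> sets unit_measure \<Longrightarrow> \<phi> -` A \<inter> {0..1} \<in> sets unit_measure"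
    "\<And>A. A \<in> sets unit_measure \<Longrightarrow> emeasure unit_measure (\<phi> -` A \<inter> {0..1}) = emeasure unit_measure A"
proof -
  show 1: "bij_betw \<phi> {0..1} {0..1}" "\<phi> \<in> unit_measure \<rightarrow>\<^sub>M unit_measure"
    "inv_into {0..1} \<phi> \<in> unit_measure \<rightarrow>\<^sub>M unit_measure"
    "distr unit_measure unit_measure \<phi> = unit_measure"
    using assms by (auto simp: mp_bijections_def)
  show "\<And>x. x \<in> {0..1} \<Longrightarrow> \<phi> x \<in> {0..1}" using 1(1) by (auto simp: bij_betw_def)
  fix A assume A: "A \<in> sets unit_measure"
  show "\<phi> -` A \<inter> {0..1} \<in> sets unit_measure" using measurable_sets[OF 1(2) A] by simp
  have "emeasure (distr unit_measure unit_measure \<phi>) A = emeasure unit_measure A" using 1(4) by simp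
  then show "emeasure unit_measure (\<phi> -` A \<inter> {0..1}) = emeasure unit_measure A"
    using A 1(2) by (subst (asm) emeasure_distr) auto
qed

lemma mp_bijection_square:
  assumes "\<phi> \<in> mp_bijections"
  shows "map_prod \<phi> \<phi> \<in> square_measure \<rightarrow>\<^sub>M square_measure"
    "distr square_measure square_measure (map_prod \<phi> \<phi>) = square_measure"
proof -
  note D = mp_bijectionsD[OF assms]
  have 1: "map_prod \<phi> \<phi> -` (A \<times> B) \<inter> unit_square =
    (\<phi> -` (A \<inter> {0..1}) \<inter> {0..1}) \<times> (\<phi> -` (B \<inter> {0..1}) \<inter> {0..1})" for A B :: "real set"
    using D(5) by auto
  have 2: "A \<inter> {0..1} \<in> sets unit_measure" if "A \<in> sets borel" for A
    using that by (auto simp: sets_unit_measure)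
  have 3: "map_prod \<phi> \<phi> z \<in> unit_square" if "z \<in> unit_square" for z
    using that D(5)[of "fst z"] D(5)[of "snd z"] by (cases z) auto
  have 4: "map_prod \<phi> \<phi> -` (A \<times> B) \<inter> unit_square \<in> sets square_measure"
    "emeasure square_measure (map_prod \<phi> \<phi> -` (A \<times> B) \<inter> unit_square) =
      emeasure unit_measure (A \<inter> {0..1}) * emeasure unit_measure (B \<inter> {0..1})"
    if "A \<in> sets borel" "B \<in> sets borel" for A B
    unfolding 1 using D(6,7)[OF 2[OF that(1)]] D(6,7)[OF 2[OF that(2)]]
    by (simp_all only: Times_in_square emeasure_square_Times)
  show "map_prod \<phi> \<phi> \<in> square_measure \<rightarrow>\<^sub>M square_measure"
    "distr square_measure square_measure (map_prod \<phi> \<phi>) = square_measure"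
    by (rule square_measure_preservingI[OF 3 4]; assumption)+
qed

text \<open>An explicit measurable left inverse coincides with \<open>inv_into\<close> on [0,1], so
  measurability of the latter never has to be shown from its choice-based definition.\<close>

lemma mp_bijectionsI:
  assumes "bij_betw \<phi> {0..1} {0..1}" "\<phi> \<in> unit_measure \<rightarrow>\<^sub>M unit_measure"
    "distr unit_measure unit_measure \<phi> = unit_measure"
    and "\<psi> \<in> unit_measure \<rightarrow>\<^sub>M unit_measure" "\<And>x. x \<in> {0..1} \<Longrightarrow> \<psi> (\<phi> x) = x"
  shows "\<phi> \<in> mp_bijections"
proof -
  have "inv_into {0..1} \<phi> y = \<psi> y" if y: "y \<in> {0..1}" for y
  proof -
    obtain x where "x \<in> {0..1}" "y = \<phi> x" using assms(1) y by (metis bij_betw_def imageE)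
    then show ?thesis using assms by (simp add: bij_betw_def inv_into_f_f)
  qed
  then have "inv_into {0..1} \<phi> \<in> unit_measure \<rightarrow>\<^sub>M unit_measure"
    by (subst measurable_cong[where g = \<psi>]) (use assms in auto)
  then show ?thesis using assms by (auto simp: mp_bijections_def)
qed

lemma id_mp_bijections: "(\<lambda>x. x) \<in> mp_bijections"
  by (rule mp_bijectionsI[where \<psi> = "\<lambda>x. x"]) (auto simp: bij_betw_def distr_id2 measurable_ident)

lemma comp_mp_bijections:
  assumes "\<phi> \<in> mp_bijections" "\<psi> \<in> mp_bijections"
  shows "(\<lambda>x. \<phi> (\<psi> x)) \<in> mp_bijections"
proof (rule mp_bijectionsI[where \<psi> = "\<lambda>x. inv_into {0..1} \<psi> (inv_into {0..1} \<phi> x)"])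
  note P = mp_bijectionsD[OF assms(1)] and Q = mp_bijectionsD[OF assms(2)]
  show "bij_betw (\<lambda>x. \<phi> (\<psi> x)) {0..1} {0..1}" using bij_betw_trans[OF Q(1) P(1)] by (simp add: comp_def)
  show "(\<lambda>x. \<phi> (\<psi> x)) \<in> unit_measure \<rightarrow>\<^sub>M unit_measure" by (rule measurable_compose[OF Q(2) P(2)])
  show "(\<lambda>x. inv_into {0..1} \<psi> (inv_into {0..1} \<phi> x)) \<in> unit_measure \<rightarrow>\<^sub>M unit_measure"
    by (rule measurable_compose[OF P(3) Q(3)])
  have "distr unit_measure unit_measure (\<phi> \<circ> \<psi>) = distr (distr unit_measure unit_measure \<psi>) unit_measure \<phi>"
    by (rule distr_distr[symmetric]) (use P Q in auto)
  then show "distr unit_measure unit_measure (\<lambda>x. \<phi> (\<psi> x)) = unit_measure"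
    using P(4) Q(4) by (simp add: comp_def)
  fix x :: real assume "x \<in> {0..1}"
  then show "inv_into {0..1} \<psi> (inv_into {0..1} \<phi> (\<phi> (\<psi> x))) = x"
    using P Q by (simp add: bij_betw_def inv_into_f_f)
qed

text \<open>The inverse preserves measure because pulling a set back first along the inverse and
  then along \<phi> returns the set, and the second pull-back does not change the measure.\<close>

lemma inv_mp_bijections:
  assumes "\<phi> \<in> mp_bijections"
  obtains \<psi> where "\<psi> \<in> mp_bijections" "\<And>x. x \<in> {0..1} \<Longrightarrow> \<psi> (\<phi> x) = x" "\<And>x. x \<in> {0..1} \<Longrightarrow> \<phi> (\<psi> x) = x"
proof
  note P = mp_bijectionsD[OF assms(1)]
  let ?\<psi> = "inv_into {0..1} \<phi>"
  show 1: "?\<psi> (\<phi> x) = x" if "x \<in> {0..1}" for x using that P by (simp add: bij_betw_def inv_into_f_f)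
  show 2: "\<phi> (?\<psi> x) = x" if "x \<in> {0..1}" for x using that P by (metis bij_betw_def f_inv_into_f)
  have b: "bij_betw ?\<psi> {0..1} {0..1}" using P(1) by (rule bij_betw_inv_into)
  show "?\<psi> \<in> mp_bijections"
  proof (rule mp_bijectionsI[OF b P(3) _ P(2)])
    show "distr unit_measure unit_measure ?\<psi> = unit_measure"
    proof (rule measure_eqI)
      fix A assume "A \<in> sets (distr unit_measure unit_measure ?\<psi>)"
      then have A: "A \<in> sets unit_measure" by simp
      have As: "A \<subseteq> {0..1}" using A by (simp add: sets_unit_measure)
      have B: "?\<psi> -` A \<inter> {0..1} \<in> sets unit_measure" using measurable_sets[OF P(3) A] by simp
      have "\<phi> -` (?\<psi> -` A \<inter> {0..1}) \<inter> {0..1} = A" using As 1 P(5) by auto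
      then have "emeasure unit_measure (?\<psi> -` A \<inter> {0..1}) = emeasure unit_measure A"
        using P(7)[OF B] by simp
      then show "emeasure (distr unit_measure unit_measure ?\<psi>) A = emeasure unit_measure A"
        using A P(3) by (subst emeasure_distr) auto
    qed simp
  qed (rule 2)
qed

subsection \<open>Bounded kernels and the cut norm\<close>

text \<open>A class closed under the algebraic operations on which all integrals below exist. The
  bound is required on the square only, since graphons are \<open>undefined\<close> outside
  it.\<close>

definition bkernel :: "(real \<times> real \<Rightarrow> real) \<Rightarrow> bool" where
  "bkernel U \<longleftrightarrow> U \<in> borel_measurable square_measure \<and> (\<exists>B. \<forall>z\<in>unit_square. \<bar>U z\<bar> \<le> B)"

definition rect_integral :: "real set \<Rightarrow> real set \<Rightarrow> (real \<times> real \<Rightarrow> real) \<Rightarrow> real" where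
  "rect_integral S T U = (\<integral>z. indicator (S \<times> T) z * U z \<partial>square_measure)"

lemma bkernelI: "U \<in> borel_measurable square_measure \<Longrightarrow> (\<And>z. z \<in> unit_square \<Longrightarrow> \<bar>U z\<bar> \<le> B) \<Longrightarrow> bkernel U"
  by (auto simp: bkernel_def)

lemma bkernel_measurable: "bkernel U \<Longrightarrow> U \<in> borel_measurable square_measure"
  by (simp add: bkernel_def)

lemma bkernel_const [simp]: "bkernel (\<lambda>z. c)"
  by (auto simp: bkernel_def)

lemma bkernel_indicator [simp]: "A \<in> sets square_measure \<Longrightarrow> bkernel (indicator A)"
  by (rule bkernelI[where B = 1]) (auto simp: indicator_def)

lemma bkernel_add [intro]: "bkernel U \<Longrightarrow> bkernel V \<Longrightarrow> bkernel (\<lambda>z. U z + V z)"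
proof -
  assume "bkernel U" "bkernel V"
  then obtain B C where "\<forall>z\<in>unit_square. \<bar>U z\<bar> \<le> B" "\<forall>z\<in>unit_square. \<bar>V z\<bar> \<le> C"
    "U \<in> borel_measurable square_measure" "V \<in> borel_measurable square_measure" by (auto simp: bkernel_def)
  note * = this
  show ?thesis
  proof (rule bkernelI[where B = "B + C"])
    fix z assume z: "z \<in> unit_square"
    show "\<bar>U z + V z\<bar> \<le> B + C" using bspec[OF *(1) z] bspec[OF *(2) z] by linarith
  qed (use * in measurable)
qed

lemma bkernel_mult [intro]: "bkernel U \<Longrightarrow> bkernel V \<Longrightarrow> bkernel (\<lambda>z. U z * V z)"
proof -
  assume "bkernel U" "bkernel V"
  then obtain B C where *: "\<forall>z\<in>unit_square. \<bar>U z\<bar> \<le> B" "\<forall>z\<in>unit_square. \<bar>V z\<bar> \<le> C"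
    "U \<in> borel_measurable square_measure" "V \<in> borel_measurable square_measure" by (auto simp: bkernel_def)
  show ?thesis
  proof (rule bkernelI[where B = "\<bar>B\<bar> * \<bar>C\<bar>"])
    fix z assume "z \<in> unit_square"
    then have "\<bar>U z\<bar> \<le> \<bar>B\<bar>" "\<bar>V z\<bar> \<le> \<bar>C\<bar>" using * by (meson abs_ge_self order_trans)+
    then show "\<bar>U z * V z\<bar> \<le> \<bar>B\<bar> * \<bar>C\<bar>" by (simp add: abs_mult mult_mono)
  qed (use * in measurable)
qed

lemma bkernel_cmult [intro]: "bkernel U \<Longrightarrow> bkernel (\<lambda>z. c * U z)"
  by (rule bkernel_mult) simp_all

lemma bkernel_uminus [intro]: "bkernel U \<Longrightarrow> bkernel (\<lambda>z. - U z)"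
  using bkernel_cmult[of U "-1"] by simp

lemma bkernel_diff [intro]: "bkernel U \<Longrightarrow> bkernel V \<Longrightarrow> bkernel (\<lambda>z. U z - V z)"
  using bkernel_add[OF _ bkernel_uminus, of U V] by simp

lemma bkernel_sum [intro]: "(\<And>i. i \<in> I \<Longrightarrow> bkernel (U i)) \<Longrightarrow> bkernel (\<lambda>z. \<Sum>i\<in>I. U i z)"
  by (induction I rule: infinite_finite_induct) auto

lemma bkernel_abs [intro]: "bkernel U \<Longrightarrow> bkernel (\<lambda>z. \<bar>U z\<bar>)"
  by (auto simp: bkernel_def)

lemma bkernel_relabel:
  assumes "bkernel U" "\<phi> \<in> mp_bijections"
  shows "bkernel (\<lambda>z. U (map_prod \<phi> \<phi> z))"
proof -
  obtain B where B: "\<forall>z\<in>unit_square. \<bar>U z\<bar> \<le> B" "U \<in> borel_measurable square_measure"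
    using assms by (auto simp: bkernel_def)
  show ?thesis
  proof (rule bkernelI[where B = B])
    show "(\<lambda>z. U (map_prod \<phi> \<phi> z)) \<in> borel_measurable square_measure"
      using measurable_compose[OF mp_bijection_square(1)[OF assms(2)] B(2)] .
    fix z assume "z \<in> unit_square"
    then have "map_prod \<phi> \<phi> z \<in> unit_square" using mp_bijectionsD(5)[OF assms(2)] by (cases z) auto
    then show "\<bar>U (map_prod \<phi> \<phi> z)\<bar> \<le> B" by (rule bspec[OF B(1)])
  qed
qed

lemma bkernel_integrable: "bkernel U \<Longrightarrow> integrable square_measure U"
proof -
  assume "bkernel U"
  then obtain B where B: "\<forall>z\<in>unit_square. \<bar>U z\<bar> \<le> B" "U \<in> borel_measurable square_measure"
    by (auto simp: bkernel_def)
  show ?thesis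
    by (rule square.integrable_const_bound[where B = B]) (use B in auto)
qed

lemma bkernel_cong:
  assumes "bkernel U" "\<And>z. z \<in> unit_square \<Longrightarrow> U z = V z" shows "bkernel V"
proof -
  obtain B where B: "\<forall>z\<in>unit_square. \<bar>U z\<bar> \<le> B" "U \<in> borel_measurable square_measure"
    using assms by (auto simp: bkernel_def)
  show ?thesis
  proof (rule bkernelI[where B = B])
    show "V \<in> borel_measurable square_measure"
      by (subst measurable_cong[where g = U]) (use assms B in auto)
  qed (use assms B in auto)
qed

lemma bkernel_rect [intro]:
  "S \<in> sets unit_measure \<Longrightarrow> T \<in> sets unit_measure \<Longrightarrow> bkernel U \<Longrightarrow> bkernel (\<lambda>z. indicator (S \<times> T) z * U z)"
  by (intro bkernel_mult bkernel_indicator Times_in_square)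

lemma set_integral_rect:
  assumes "S \<in> sets unit_measure" "T \<in> sets unit_measure"
  shows "(LINT z:S \<times> T|lebesgue. U z) = rect_integral S T U"
proof -
  have sub: "S \<times> T \<subseteq> unit_square" using assms by (auto simp: sets_unit_measure)
  have "rect_integral S T U = (\<integral>z. indicator unit_square z *\<^sub>R (indicator (S \<times> T) z * U z) \<partial>lebesgue)"
    unfolding rect_integral_def by (subst integral_restrict_space) auto
  also have "\<dots> = (LINT z:S \<times> T|lebesgue. U z)"
    unfolding set_lebesgue_integral_def
    by (intro Bochner_Integration.integral_cong) (use sub in \<open>auto simp: indicator_def\<close>)
  finally show ?thesis by simp
qed

lemma cut_norm_alt:
  "cut_norm U = (SUP (S, T) \<in> sets unit_measure \<times> sets unit_measure. \<bar>rect_integral S T U\<bar>)"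
  unfolding cut_norm_def by (intro SUP_cong) (auto simp: set_integral_rect)

lemma rect_integral_cong:
  assumes "\<And>z. z \<in> unit_square \<Longrightarrow> U z = V z"
  shows "rect_integral S T U = rect_integral S T V"
  unfolding rect_integral_def by (intro Bochner_Integration.integral_cong) (use assms in auto)

lemma cut_norm_cong:
  assumes "\<And>z. z \<in> unit_square \<Longrightarrow> U z = V z"
  shows "cut_norm U = cut_norm V"
  unfolding cut_norm_alt using rect_integral_cong[of U V] assms by simp

lemma rect_integral_add:
  "S \<in> sets unit_measure \<Longrightarrow> T \<in> sets unit_measure \<Longrightarrow> bkernel U \<Longrightarrow> bkernel V \<Longrightarrow>
   rect_integral S T (\<lambda>z. U z + V z) = rect_integral S T U + rect_integral S T V"
  unfolding rect_integral_def distrib_left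
  by (intro Bochner_Integration.integral_add bkernel_integrable bkernel_rect)

lemma rect_integral_diff:
  "S \<in> sets unit_measure \<Longrightarrow> T \<in> sets unit_measure \<Longrightarrow> bkernel U \<Longrightarrow> bkernel V \<Longrightarrow>
   rect_integral S T (\<lambda>z. U z - V z) = rect_integral S T U - rect_integral S T V"
  unfolding rect_integral_def right_diff_distrib
  by (intro Bochner_Integration.integral_diff bkernel_integrable bkernel_rect)

lemma rect_integral_cmult: "rect_integral S T (\<lambda>z. c * U z) = c * rect_integral S T U"
  unfolding rect_integral_def by (subst integral_mult_right_zero[symmetric]) (simp add: algebra_simps)

lemma rect_integral_uminus: "rect_integral S T (\<lambda>z. - U z) = - rect_integral S T U"
  using rect_integral_cmult[of S T "-1" U] by simp

lemma abs_rect_integral_le_L1: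
  assumes "S \<in> sets unit_measure" "T \<in> sets unit_measure" "bkernel U"
  shows "\<bar>rect_integral S T U\<bar> \<le> (\<integral>z. \<bar>U z\<bar> \<partial>square_measure)"
proof -
  have "\<bar>rect_integral S T U\<bar> \<le> (\<integral>z. \<bar>indicator (S \<times> T) z * U z\<bar> \<partial>square_measure)"
    unfolding rect_integral_def using integral_norm_bound[of square_measure "\<lambda>z. indicator (S \<times> T) z * U z"] by simp
  also have "\<dots> \<le> (\<integral>z. \<bar>U z\<bar> \<partial>square_measure)"
    by (intro integral_mono bkernel_integrable bkernel_abs bkernel_rect assms) (auto simp: indicator_def)
  finally show ?thesis .
qed

lemma bdd_above_rect_integral:
  assumes "bkernel U"
  shows "bdd_above ((\<lambda>(S, T). \<bar>rect_integral S T U\<bar>) ` (sets unit_measure \<times> sets unit_measure))"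
  using abs_rect_integral_le_L1[OF _ _ assms] by (auto simp: bdd_above_def)

lemma abs_rect_integral_le_cut_norm:
  assumes "S \<in> sets unit_measure" "T \<in> sets unit_measure" "bkernel U"
  shows "\<bar>rect_integral S T U\<bar> \<le> cut_norm U"
  unfolding cut_norm_alt
  using cSUP_upper[OF _ bdd_above_rect_integral[OF assms(3)], of "(S, T)"] assms by simp

lemma cut_norm_leI:
  assumes "\<And>S T. S \<in> sets unit_measure \<Longrightarrow> T \<in> sets unit_measure \<Longrightarrow> \<bar>rect_integral S T U\<bar> \<le> c"
  shows "cut_norm U \<le> c"
  unfolding cut_norm_alt by (rule cSUP_least) (use assms in auto)

lemma cut_norm_nonneg: "bkernel U \<Longrightarrow> 0 \<le> cut_norm U"
  using abs_rect_integral_le_cut_norm[of "{}" "{}" U] by simp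

lemma cut_norm_le_L1: "bkernel U \<Longrightarrow> cut_norm U \<le> (\<integral>z. \<bar>U z\<bar> \<partial>square_measure)"
  by (intro cut_norm_leI abs_rect_integral_le_L1)

lemma cut_norm_add:
  assumes "bkernel U" "bkernel V"
  shows "cut_norm (\<lambda>z. U z + V z) \<le> cut_norm U + cut_norm V"
proof (rule cut_norm_leI)
  fix S T assume "S \<in> sets unit_measure" "T \<in> sets unit_measure"
  then show "\<bar>rect_integral S T (\<lambda>z. U z + V z)\<bar> \<le> cut_norm U + cut_norm V"
    using abs_rect_integral_le_cut_norm[of S T U] abs_rect_integral_le_cut_norm[of S T V] assms
    by (simp add: rect_integral_add)
qed

lemma cut_norm_uminus: "cut_norm (\<lambda>z. - U z) = cut_norm U"
  unfolding cut_norm_alt rect_integral_uminus by simp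

lemma cut_norm_minus_commute: "cut_norm (\<lambda>z. U z - V z) = cut_norm (\<lambda>z. V z - U z)"
  using cut_norm_uminus[of "\<lambda>z. U z - V z"] by simp

lemma cut_norm_triangle:
  assumes "bkernel U" "bkernel V" "bkernel W"
  shows "cut_norm (\<lambda>z. U z - W z) \<le> cut_norm (\<lambda>z. U z - V z) + cut_norm (\<lambda>z. V z - W z)"
  using cut_norm_add[of "\<lambda>z. U z - V z" "\<lambda>z. V z - W z"] assms by (simp add: bkernel_diff)

lemma integral_relabel:
  assumes "bkernel U" "\<phi> \<in> mp_bijections"
  shows "(\<integral>z. U (map_prod \<phi> \<phi> z) \<partial>square_measure) = (\<integral>z. U z \<partial>square_measure)"
  using integral_distr[OF mp_bijection_square(1)[OF assms(2)] bkernel_measurable[OF assms(1)]]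
  by (simp add: mp_bijection_square(2)[OF assms(2)])

text \<open>The substitution turns an integral over S x T into one over the preimages of S and T
  under the inverse of \<phi>, again a measurable rectangle. Equality follows by applying the same
  bound to the inverse.\<close>

lemma cut_norm_relabel_le:
  assumes U: "bkernel U" and \<phi>: "\<phi> \<in> mp_bijections"
  shows "cut_norm (\<lambda>z. U (map_prod \<phi> \<phi> z)) \<le> cut_norm U"
proof (rule cut_norm_leI)
  fix S T assume ST: "S \<in> sets unit_measure" "T \<in> sets unit_measure"
  obtain \<psi> where \<psi>: "\<psi> \<in> mp_bijections" "\<And>x. x \<in> {0..1} \<Longrightarrow> \<psi> (\<phi> x) = x" "\<And>x. x \<in> {0..1} \<Longrightarrow> \<phi> (\<psi> x) = x"
    using inv_mp_bijections[OF \<phi>] by blast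
  define S' T' where "S' = \<psi> -` S \<inter> {0..1}" and "T' = \<psi> -` T \<inter> {0..1}"
  have ST': "S' \<in> sets unit_measure" "T' \<in> sets unit_measure"
    using mp_bijectionsD(6)[OF \<psi>(1)] ST by (auto simp: S'_def T'_def)
  have "rect_integral S T (\<lambda>z. U (map_prod \<phi> \<phi> z))
    = (\<integral>z. indicator (S' \<times> T') (map_prod \<phi> \<phi> z) * U (map_prod \<phi> \<phi> z) \<partial>square_measure)"
    unfolding rect_integral_def
    by (intro Bochner_Integration.integral_cong)
      (use mp_bijectionsD(5)[OF \<phi>] \<psi> in \<open>auto simp: S'_def T'_def indicator_def\<close>)
  also have "\<dots> = rect_integral S' T' U"
    unfolding rect_integral_def by (rule integral_relabel) (use U ST' \<phi> in auto)
  finally show "\<bar>rect_integral S T (\<lambda>z. U (map_prod \<phi> \<phi> z))\<bar> \<le> cut_norm U"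
    using abs_rect_integral_le_cut_norm[OF ST' U] by simp
qed

lemma cut_norm_relabel:
  assumes U: "bkernel U" and \<phi>: "\<phi> \<in> mp_bijections"
  shows "cut_norm (\<lambda>z. U (map_prod \<phi> \<phi> z)) = cut_norm U"
proof (rule antisym[OF cut_norm_relabel_le[OF assms]])
  obtain \<psi> where \<psi>: "\<psi> \<in> mp_bijections" "\<And>x. x \<in> {0..1} \<Longrightarrow> \<psi> (\<phi> x) = x" "\<And>x. x \<in> {0..1} \<Longrightarrow> \<phi> (\<psi> x) = x"
    using inv_mp_bijections[OF \<phi>] by blast
  have "cut_norm U = cut_norm (\<lambda>z. U (map_prod \<phi> \<phi> (map_prod \<psi> \<psi> z)))"
    by (rule cut_norm_cong) (auto simp: \<psi>(3))
  also have "\<dots> \<le> cut_norm (\<lambda>z. U (map_prod \<phi> \<phi> z))"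
    by (rule cut_norm_relabel_le[OF bkernel_relabel[OF U \<phi>] \<psi>(1)])
  finally show "cut_norm U \<le> cut_norm (\<lambda>z. U (map_prod \<phi> \<phi> z))" .
qed

subsection \<open>Cut distance of vector-valued kernels\<close>

definition vkernel :: "'k::finite kernel \<Rightarrow> bool" where
  "vkernel W \<longleftrightarrow> (\<forall>a. bkernel (\<lambda>z. W z $ a))"

lemma vkernel_component: "vkernel W \<Longrightarrow> bkernel (\<lambda>z. W z $ a)"
  by (simp add: vkernel_def)

lemma cut_norm_vec_cong:
  assumes "\<And>z. z \<in> unit_square \<Longrightarrow> U z = V z"
  shows "cut_norm_vec U = cut_norm_vec V"
  unfolding cut_norm_vec_def by (intro sum.cong refl cut_norm_cong) (simp add: assms)

lemma vkernel_diff: "vkernel U \<Longrightarrow> vkernel V \<Longrightarrow> vkernel (\<lambda>z. U z - V z)"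
  by (auto simp: vkernel_def)

lemma cut_norm_vec_nonneg: "vkernel U \<Longrightarrow> 0 \<le> cut_norm_vec U"
  unfolding cut_norm_vec_def by (intro sum_nonneg cut_norm_nonneg vkernel_component)

lemma cut_norm_le_vec: "vkernel U \<Longrightarrow> cut_norm (\<lambda>z. U z $ a) \<le> cut_norm_vec U"
  unfolding cut_norm_vec_def
  by (rule member_le_sum[of a UNIV "\<lambda>a. cut_norm (\<lambda>z. U z $ a)"]) (auto intro: cut_norm_nonneg vkernel_component)

lemma cut_norm_vec_minus_commute: "cut_norm_vec (\<lambda>z. U z - V z) = cut_norm_vec (\<lambda>z. V z - U z)"
  unfolding cut_norm_vec_def vector_minus_component by (intro sum.cong refl cut_norm_minus_commute)

lemma cut_norm_vec_triangle:
  assumes "vkernel U" "vkernel V" "vkernel W"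
  shows "cut_norm_vec (\<lambda>z. U z - W z) \<le> cut_norm_vec (\<lambda>z. U z - V z) + cut_norm_vec (\<lambda>z. V z - W z)"
  unfolding cut_norm_vec_def sum.distrib[symmetric] vector_minus_component
  by (intro sum_mono cut_norm_triangle vkernel_component assms)

lemma cut_norm_vec_self [simp]: "cut_norm_vec (\<lambda>z. U z - U z) = 0"
proof -
  have "cut_norm (\<lambda>z. 0) = 0"
    by (rule antisym[OF cut_norm_leI cut_norm_nonneg]) (auto simp: rect_integral_def)
  then show ?thesis by (simp add: cut_norm_vec_def)
qed

lemma relabel_apply: "z \<in> unit_square \<Longrightarrow> relabel \<phi> W z = W (map_prod \<phi> \<phi> z)"
  by (auto simp: relabel_def)

lemma cut_norm_vec_relabel:
  assumes "vkernel U" "\<phi> \<in> mp_bijections"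
  shows "cut_norm_vec (relabel \<phi> U) = cut_norm_vec U"
proof -
  have "cut_norm_vec (relabel \<phi> U) = (\<Sum>a\<in>UNIV. cut_norm (\<lambda>z. U (map_prod \<phi> \<phi> z) $ a))"
    unfolding cut_norm_vec_def by (intro sum.cong refl cut_norm_cong) (simp add: relabel_apply)
  also have "\<dots> = cut_norm_vec U" unfolding cut_norm_vec_def
    by (intro sum.cong refl cut_norm_relabel vkernel_component assms)
  finally show ?thesis .
qed

lemma cut_norm_vec_relabel_diff:
  assumes "vkernel U" "vkernel V" "\<phi> \<in> mp_bijections"
  shows "cut_norm_vec (\<lambda>z. relabel \<phi> U z - relabel \<phi> V z) = cut_norm_vec (\<lambda>z. U z - V z)"
  using cut_norm_vec_relabel[OF vkernel_diff[OF assms(1,2)] assms(3)]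
  by (subst (asm) cut_norm_vec_cong[where V = "\<lambda>z. relabel \<phi> U z - relabel \<phi> V z"]) (simp_all add: relabel_apply)

lemma relabel_relabel:
  assumes "\<psi> \<in> mp_bijections" "z \<in> unit_square"
  shows "relabel \<psi> (relabel \<phi> W) z = relabel (\<lambda>x. \<phi> (\<psi> x)) W z"
proof (cases z)
  case (Pair x y)
  then show ?thesis
    using assms(2) mp_bijectionsD(5)[OF assms(1), of x] mp_bijectionsD(5)[OF assms(1), of y]
    by (simp add: relabel_def)
qed

lemma graphon_simplex: "W \<in> graphons \<Longrightarrow> z \<in> unit_square \<Longrightarrow> W z \<in> prob_simplex"
  by (auto simp: graphons_def PiE_def Pi_def)

lemma graphon_bounds:
  assumes "W \<in> graphons" "z \<in> unit_square"
  shows "0 \<le> W z $ a" "W z $ a \<le> 1" "(\<Sum>a\<in>UNIV. W z $ a) = 1"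
  using graphon_simplex[OF assms] by (auto simp: prob_simplex_def)

lemma graphon_sym: "W \<in> graphons \<Longrightarrow> x \<in> {0..1} \<Longrightarrow> y \<in> {0..1} \<Longrightarrow> W (x, y) = W (y, x)"
  by (auto simp: graphons_def)

lemma measurable_vec_nth: "(\<lambda>x::real^'k::finite. x $ a) \<in> borel_measurable borel"
  by (intro borel_measurable_continuous_onI continuous_intros)

lemma graphon_vkernel: "W \<in> graphons \<Longrightarrow> vkernel W"
  unfolding vkernel_def
proof
  fix a assume W: "W \<in> graphons"
  then have "W \<in> borel_measurable square_measure" by (auto simp: graphons_def)
  then have "(\<lambda>z. W z $ a) \<in> borel_measurable square_measure"
    by (rule measurable_compose[OF _ measurable_vec_nth])
  then show "bkernel (\<lambda>z. W z $ a)"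
    by (rule bkernelI[where B = 1]) (use graphon_bounds(1,2)[OF W] in \<open>metis abs_of_nonneg\<close>)
qed

lemma graphon_diff_vkernel: "U \<in> graphons \<Longrightarrow> W \<in> graphons \<Longrightarrow> vkernel (\<lambda>z. U z - W z)"
  by (intro vkernel_diff graphon_vkernel)

text \<open>The bound by 1 comes from nonnegativity and the sum, and measurability may be checked
  coordinate by coordinate.\<close>

lemma graphonsI:
  assumes "\<And>a. (\<lambda>z. W z $ a) \<in> borel_measurable square_measure"
    "\<And>z a. z \<in> unit_square \<Longrightarrow> 0 \<le> W z $ a" "\<And>z. z \<in> unit_square \<Longrightarrow> (\<Sum>a\<in>UNIV. W z $ a) = 1"
    "\<And>x y. x \<in> {0..1} \<Longrightarrow> y \<in> {0..1} \<Longrightarrow> W (x, y) = W (y, x)"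
  shows "restrict W unit_square \<in> graphons"
proof -
  have "W z $ a \<le> 1" if "z \<in> unit_square" for z a
    using member_le_sum[of a UNIV "\<lambda>a. W z $ a"] assms(2,3) that by fastforce
  then have "restrict W unit_square \<in> unit_square \<rightarrow>\<^sub>E prob_simplex"
    using assms by (auto simp: prob_simplex_def)
  moreover have "W \<in> borel_measurable square_measure"
  proof (rule borel_measurable_euclidean_space[THEN iffD2], intro ballI)
    fix i :: "real^'a" assume "i \<in> Basis"
    then obtain a where "i = axis a 1" by (auto simp: Basis_vec_def)
    then show "(\<lambda>z. W z \<bullet> i) \<in> borel_measurable square_measure"
      using assms(1)[of a] by (simp add: inner_axis)
  qed
  then have "restrict W unit_square \<in> borel_measurable square_measure"
    by (subst measurable_cong[where g = W]) auto
  ultimately show ?thesis using assms(4) by (auto simp: graphons_def)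
qed

lemma relabel_graphon:
  assumes "W \<in> graphons" "\<phi> \<in> mp_bijections"
  shows "relabel \<phi> W \<in> graphons"
  unfolding relabel_def
proof (rule graphonsI)
  have sq: "map_prod \<phi> \<phi> z \<in> unit_square" if "z \<in> unit_square" for z
    using that mp_bijectionsD(5)[OF assms(2)] by (cases z) auto
  show "(\<lambda>z. (case z of (x, y) \<Rightarrow> W (\<phi> x, \<phi> y)) $ a) \<in> borel_measurable square_measure" for a
    using bkernel_measurable[OF bkernel_relabel[OF vkernel_component[OF graphon_vkernel[OF assms(1)]] assms(2)], of a]
    by (simp add: case_prod_unfold map_prod_def)
  show "0 \<le> (case z of (x, y) \<Rightarrow> W (\<phi> x, \<phi> y)) $ a" if "z \<in> unit_square" for z a
    using graphon_bounds(1)[OF assms(1) sq[OF that]] by (simp add: case_prod_unfold map_prod_def)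
  show "(\<Sum>a\<in>UNIV. (case z of (x, y) \<Rightarrow> W (\<phi> x, \<phi> y)) $ a) = 1" if "z \<in> unit_square" for z
    using graphon_bounds(3)[OF assms(1) sq[OF that]] by (simp add: case_prod_unfold map_prod_def)
  show "(case (x, y) of (x, y) \<Rightarrow> W (\<phi> x, \<phi> y)) = (case (y, x) of (x, y) \<Rightarrow> W (\<phi> x, \<phi> y))"
    if "x \<in> {0..1}" "y \<in> {0..1}" for x y
    using graphon_sym[OF assms(1)] mp_bijectionsD(5)[OF assms(2)] that by simp
qed

lemma cut_dist_bdd_below:
  assumes "U \<in> graphons" "W \<in> graphons"
  shows "bdd_below ((\<lambda>\<phi>. cut_norm_vec (\<lambda>z. U z - relabel \<phi> W z)) ` mp_bijections)"
  by (rule bdd_belowI[of _ 0]) (auto intro!: cut_norm_vec_nonneg graphon_diff_vkernel relabel_graphon assms)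

lemma cut_dist_le:
  assumes "U \<in> graphons" "W \<in> graphons" "\<phi> \<in> mp_bijections"
  shows "cut_dist U W \<le> cut_norm_vec (\<lambda>z. U z - relabel \<phi> W z)"
  unfolding cut_dist_def by (rule cINF_lower[OF cut_dist_bdd_below assms(3)]) (use assms in auto)

lemma cut_dist_lessD:
  assumes "U \<in> graphons" "W \<in> graphons" "cut_dist U W < r"
  obtains \<phi> where "\<phi> \<in> mp_bijections" "cut_norm_vec (\<lambda>z. U z - relabel \<phi> W z) < r"
  using assms(3) unfolding cut_dist_def
  by (subst (asm) cINF_less_iff[OF _ cut_dist_bdd_below[OF assms(1,2)]]) (use id_mp_bijections in auto)

lemma cut_dist_nonneg:
  assumes "U \<in> graphons" "W \<in> graphons" shows "0 \<le> cut_dist U W"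
  unfolding cut_dist_def
  by (rule cINF_greatest) (use id_mp_bijections in \<open>auto intro!: cut_norm_vec_nonneg graphon_diff_vkernel relabel_graphon assms\<close>)

lemma cut_dist_le_norm:
  assumes "U \<in> graphons" "W \<in> graphons"
  shows "cut_dist U W \<le> cut_norm_vec (\<lambda>z. U z - W z)"
  using cut_dist_le[OF assms id_mp_bijections] by (subst (asm) cut_norm_vec_cong[where V = "\<lambda>z. U z - W z"]) (auto simp: relabel_def)

lemma cut_dist_self: "W \<in> graphons \<Longrightarrow> cut_dist W W = 0"
  using cut_dist_le_norm[of W W, unfolded cut_norm_vec_self] cut_dist_nonneg[of W W] by simp

text \<open>Relabelling both arguments by the inverse of \<phi> leaves the cut norm unchanged and
  moves the relabelling to the other side. The definition of \<open>cut_dist\<close> relabels its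
  second argument only; this restores the symmetry.\<close>

lemma relabel_shift:
  assumes "U \<in> graphons" "W \<in> graphons" "\<phi> \<in> mp_bijections"
  obtains \<psi> where "\<psi> \<in> mp_bijections"
    "cut_norm_vec (\<lambda>z. relabel \<psi> U z - W z) = cut_norm_vec (\<lambda>z. U z - relabel \<phi> W z)"
proof -
  obtain \<psi> where \<psi>: "\<psi> \<in> mp_bijections" "\<And>x. x \<in> {0..1} \<Longrightarrow> \<psi> (\<phi> x) = x" "\<And>x. x \<in> {0..1} \<Longrightarrow> \<phi> (\<psi> x) = x"
    using inv_mp_bijections[OF assms(3)] by blast
  have "cut_norm_vec (\<lambda>z. relabel \<psi> U z - W z) = cut_norm_vec (\<lambda>z. U z - relabel \<phi> W z)"
  proof -
    have "cut_norm_vec (\<lambda>z. U z - relabel \<phi> W z)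
      = cut_norm_vec (\<lambda>z. relabel \<psi> U z - relabel \<psi> (relabel \<phi> W) z)"
      by (rule cut_norm_vec_relabel_diff[symmetric]) (auto intro: graphon_vkernel relabel_graphon assms \<psi>)
    also have "\<dots> = cut_norm_vec (\<lambda>z. relabel \<psi> U z - W z)"
      by (rule cut_norm_vec_cong) (auto simp: relabel_relabel[OF \<psi>(1)], auto simp: relabel_def \<psi>)
    finally show ?thesis by simp
  qed
  with \<psi>(1) show ?thesis by (rule that)
qed

lemma cut_dist_commute_le:
  assumes "U \<in> graphons" "W \<in> graphons" shows "cut_dist W U \<le> cut_dist U W"
  unfolding cut_dist_def[of U W]
proof (rule cINF_greatest)
  show "mp_bijections \<noteq> {}" using id_mp_bijections by auto
  fix \<phi> assume \<phi>: "\<phi> \<in> mp_bijections"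
  then obtain \<psi> where \<psi>: "\<psi> \<in> mp_bijections"
    "cut_norm_vec (\<lambda>z. relabel \<psi> U z - W z) = cut_norm_vec (\<lambda>z. U z - relabel \<phi> W z)"
    by (rule relabel_shift[OF assms])
  then show "cut_dist W U \<le> cut_norm_vec (\<lambda>z. U z - relabel \<phi> W z)"
    using cut_dist_le[OF assms(2,1) \<psi>(1)] cut_norm_vec_minus_commute[of W "relabel \<psi> U"] by simp
qed

lemma cut_dist_commute: "U \<in> graphons \<Longrightarrow> W \<in> graphons \<Longrightarrow> cut_dist U W = cut_dist W U"
  by (intro antisym cut_dist_commute_le)

lemma cut_dist_triangle:
  assumes "U \<in> graphons" "V \<in> graphons" "W \<in> graphons"
  shows "cut_dist U W \<le> cut_dist U V + cut_dist V W"
proof (rule field_le_epsilon)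
  fix e :: real assume e: "e > 0"
  obtain \<phi> where \<phi>: "\<phi> \<in> mp_bijections" "cut_norm_vec (\<lambda>z. U z - relabel \<phi> V z) < cut_dist U V + e/2"
    using cut_dist_lessD[OF assms(1,2), of "cut_dist U V + e/2"] e by auto
  obtain \<psi> where \<psi>: "\<psi> \<in> mp_bijections" "cut_norm_vec (\<lambda>z. V z - relabel \<psi> W z) < cut_dist V W + e/2"
    using cut_dist_lessD[OF assms(2,3), of "cut_dist V W + e/2"] e by auto
  have vk: "vkernel U" "vkernel V" "vkernel W" "vkernel (relabel \<phi> V)" "vkernel (relabel \<psi> W)"
    "vkernel (relabel \<phi> (relabel \<psi> W))"
    using assms \<phi> \<psi> by (auto intro: graphon_vkernel relabel_graphon)
  \<comment> \<open>Relabelling is contravariant: relabelling first by \<psi> and then by \<phi> is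
    relabelling by the map that applies \<phi> first.\<close>
  have c: "(\<lambda>x. \<psi> (\<phi> x)) \<in> mp_bijections" by (rule comp_mp_bijections[OF \<psi>(1) \<phi>(1)])
  have "cut_dist U W \<le> cut_norm_vec (\<lambda>z. U z - relabel (\<lambda>x. \<psi> (\<phi> x)) W z)"
    by (rule cut_dist_le[OF assms(1,3) c])
  also have "\<dots> = cut_norm_vec (\<lambda>z. U z - relabel \<phi> (relabel \<psi> W) z)"
    by (rule cut_norm_vec_cong) (simp add: relabel_relabel[OF \<phi>(1)])
  also have "\<dots> \<le> cut_norm_vec (\<lambda>z. U z - relabel \<phi> V z) + cut_norm_vec (\<lambda>z. relabel \<phi> V z - relabel \<phi> (relabel \<psi> W) z)"
    by (rule cut_norm_vec_triangle) (use vk in auto)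
  also have "cut_norm_vec (\<lambda>z. relabel \<phi> V z - relabel \<phi> (relabel \<psi> W) z) = cut_norm_vec (\<lambda>z. V z - relabel \<psi> W z)"
    by (rule cut_norm_vec_relabel_diff) (use vk \<phi> in auto)
  finally show "cut_dist U W \<le> cut_dist U V + cut_dist V W + e" using \<phi> \<psi> by linarith
qed

subsection \<open>Step functions\<close>

text \<open>The map \<open>t\<close> labels the points of [0,1] by a finite set, and the integrand
  is tested against a function of the two labels. The label type is arbitrary because
  \<open>t\<close> will be a block index, a block index after a relabelling, or a pair of
  these.\<close>

lemma step_integral:
  fixes t :: "real \<Rightarrow> 'i"
  assumes U: "bkernel U" and I: "finite I" "\<And>x. x \<in> {0..1} \<Longrightarrow> t x \<in> I"
    and m: "\<And>i. i \<in> I \<Longrightarrow> {x \<in> {0..1}. t x = i} \<in> sets unit_measure"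
  shows "(\<integral>z. U z * H (t (fst z)) (t (snd z)) \<partial>square_measure) =
    (\<Sum>i\<in>I. \<Sum>j\<in>I. H i j * rect_integral {x \<in> {0..1}. t x = i} {x \<in> {0..1}. t x = j} U)" (is "?L = ?R")
    and "bkernel (\<lambda>z. H (t (fst z)) (t (snd z)))"
proof -
  let ?S = "\<lambda>i. {x \<in> {0..1}. t x = i}"
  have pt: "(\<Sum>i\<in>I. \<Sum>j\<in>I. H i j * (indicator (?S i \<times> ?S j) z * V)) = V * H (t (fst z)) (t (snd z))"
    if "z \<in> unit_square" for z and V :: real
  proof -
    have *: "H i j * (indicator (?S i \<times> ?S j) z * V) =
      (if j = t (snd z) then (if i = t (fst z) then H i j * V else 0) else 0)" for i j
      using that by (cases z) (simp add: indicator_def)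
    have "t (fst z) \<in> I" "t (snd z) \<in> I" using that I(2) by auto
    then show ?thesis unfolding * using I(1) by (simp add: sum.delta)
  qed
  have bk: "bkernel (\<lambda>z. indicator (?S i \<times> ?S j) z * U z)" if "i \<in> I" "j \<in> I" for i j
    by (intro bkernel_rect m U that)
  have "?L = (\<integral>z. (\<Sum>i\<in>I. \<Sum>j\<in>I. H i j * (indicator (?S i \<times> ?S j) z * U z)) \<partial>square_measure)"
    by (rule Bochner_Integration.integral_cong[OF refl], subst pt) auto
  also have "\<dots> = (\<Sum>i\<in>I. \<integral>z. (\<Sum>j\<in>I. H i j * (indicator (?S i \<times> ?S j) z * U z)) \<partial>square_measure)"
    by (intro Bochner_Integration.integral_sum bkernel_integrable bkernel_sum bkernel_cmult bk)
  also have "\<dots> = (\<Sum>i\<in>I. \<Sum>j\<in>I. (\<integral>z. H i j * (indicator (?S i \<times> ?S j) z * U z) \<partial>square_measure))"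
    by (intro sum.cong refl Bochner_Integration.integral_sum bkernel_integrable bkernel_cmult bk)
  also have "\<dots> = ?R" by (simp add: rect_integral_def)
  finally show "?L = ?R" .
  have "bkernel (\<lambda>z. \<Sum>i\<in>I. \<Sum>j\<in>I. H i j * (indicator (?S i \<times> ?S j) z * 1))"
    by (intro bkernel_sum bkernel_cmult bkernel_rect m bkernel_const)
  then show "bkernel (\<lambda>z. H (t (fst z)) (t (snd z)))"
    by (rule bkernel_cong) (subst pt, auto)
qed

text \<open>Each label pair contributes one rectangle integral, which the cut norm bounds. So
  functionals given by fixed step functions are continuous in the cut norm, uniformly in the
  measurable partition.\<close>

lemma step_integral_cut_norm:
  fixes t :: "real \<Rightarrow> 'i"
  assumes U: "bkernel U" and I: "finite I" "\<And>x. x \<in> {0..1} \<Longrightarrow> t x \<in> I"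
    and m: "\<And>i. i \<in> I \<Longrightarrow> {x \<in> {0..1}. t x = i} \<in> sets unit_measure"
  shows "\<bar>\<integral>z. U z * H (t (fst z)) (t (snd z)) \<partial>square_measure\<bar> \<le> (\<Sum>i\<in>I. \<Sum>j\<in>I. \<bar>H i j\<bar>) * cut_norm U"
proof -
  let ?S = "\<lambda>i. {x \<in> {0..1}. t x = i}"
  have "\<bar>\<integral>z. U z * H (t (fst z)) (t (snd z)) \<partial>square_measure\<bar>
    = \<bar>\<Sum>i\<in>I. \<Sum>j\<in>I. H i j * rect_integral (?S i) (?S j) U\<bar>"
    by (subst step_integral[OF assms]) auto
  also have "\<dots> \<le> (\<Sum>i\<in>I. \<Sum>j\<in>I. \<bar>H i j * rect_integral (?S i) (?S j) U\<bar>)"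
    by (rule order_trans[OF sum_abs sum_mono[OF sum_abs]])
  also have "\<dots> \<le> (\<Sum>i\<in>I. \<Sum>j\<in>I. \<bar>H i j\<bar> * cut_norm U)"
    unfolding abs_mult
    by (intro sum_mono mult_left_mono abs_rect_integral_le_cut_norm m U) auto
  finally show ?thesis by (simp add: sum_distrib_right)
qed

section \<open>The partition of [0,1] into equal cells\<close>

abbreviation cell :: "nat \<Rightarrow> nat \<Rightarrow> real set" where
  "cell n u \<equiv> {x \<in> {0..1}. block n x = u}"

lemma block_range: "n \<ge> 1 \<Longrightarrow> x \<in> {0..1} \<Longrightarrow> block n x \<in> {1..n}"
proof -
  assume "n \<ge> 1" "x \<in> {0..1}"
  then have "real n * x \<le> real n" by (simp add: mult_left_le)
  then have "nat \<lceil>real n * x\<rceil> \<le> n" by linarith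
  then show ?thesis using \<open>n \<ge> 1\<close> by (auto simp: block_def)
qed

text \<open>The second alternative is there because \<open>block\<close> puts the point 0, which no
  half-open interval contains, into the first cell.\<close>

lemma block_eq_iff:
  assumes "n \<ge> 1" "x \<in> {0..1}" "u \<ge> 1"
  shows "block n x = u \<longleftrightarrow> (real u - 1) / n < x \<and> x \<le> u / n \<or> u = 1 \<and> x = 0"
proof (cases "x = 0")
  case True then show ?thesis using assms by (auto simp: block_def field_simps)
next
  case False
  then have x: "x > 0" "real n * x > 0" using assms by auto
  then have "\<lceil>real n * x\<rceil> \<ge> 1" by linarith
  then have "block n x = u \<longleftrightarrow> \<lceil>real n * x\<rceil> = int u" using assms(3) unfolding block_def by linarith
  also have "\<dots> \<longleftrightarrow> real u - 1 < real n * x \<and> real n * x \<le> real u" by (simp add: ceiling_eq_iff)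
  also have "\<dots> \<longleftrightarrow> (real u - 1) / n < x \<and> x \<le> u / n" using assms by (simp add: field_simps)
  finally show ?thesis using False by simp
qed

lemma cell_eq:
  assumes "n \<ge> 1" "u \<in> {1..n}"
  shows "cell n u = {(real u - 1) / n<..u / n} \<union> (if u = 1 then {0} else {})"
proof -
  have b: "(real u - 1) / n \<ge> 0" "real u / n \<le> 1" "u \<ge> 1" using assms by (auto simp: field_simps)
  show ?thesis
  proof (intro set_eqI iffI)
    fix x assume "x \<in> cell n u"
    then show "x \<in> {(real u - 1) / n<..u / n} \<union> (if u = 1 then {0} else {})"
      using block_eq_iff[OF assms(1) _ b(3), of x] by auto
  next
    fix x assume x: "x \<in> {(real u - 1) / n<..u / n} \<union> (if u = 1 then {0} else {})"
    then have "(real u - 1) / n < x \<and> x \<le> u / n \<or> x = 0" by (auto split: if_splits)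
    then have "0 \<le> x" "x \<le> 1" using b by linarith+
    then have "x \<in> {0..1}" by simp
    then show "x \<in> cell n u"
      using x block_eq_iff[OF assms(1) _ b(3), of x] by (auto split: if_splits)
  qed
qed

lemma cell_measurable: "cell n u \<in> sets unit_measure"
proof -
  have [measurable]: "block n \<in> borel \<rightarrow>\<^sub>M count_space UNIV"
    unfolding block_def by measurable
  have "{x. block n x = u} \<in> sets borel" using measurable_sets[of "block n" borel "count_space UNIV" "{u}"]
    by (simp add: vimage_def)
  then show ?thesis
    unfolding sets_unit_measure by (auto simp: Collect_conj_eq Int_def[symmetric] intro!: sets.Int)
qed

lemma cell_measure:
  assumes "n \<ge> 1" "u \<in> {1..n}"
  shows "measure unit_measure (cell n u) = 1 / n"
proof -
  let ?a = "(real u - 1) / n"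
  have "emeasure unit_measure (cell n u) = emeasure lebesgue (cell n u)"
    by (rule emeasure_unit_measure[OF cell_measurable])
  also have "\<dots> = emeasure lebesgue {?a<..u / n}"
    unfolding cell_eq[OF assms] by (rule emeasure_Un_null_set) auto
  also have "\<dots> = ennreal (u / n - ?a)" using assms by (simp add: divide_right_mono)
  also have "u / n - ?a = 1 / n" using assms by (simp add: field_simps)
  finally show ?thesis by (simp add: measure_def)
qed

subsection \<open>Approximation by step functions on equal blocks\<close>

text \<open>Regularity gives a compact K inside A and an open G around A, both close to A in
  measure. K has a positive distance \<delta> to the complement of G, so any D between K and its
  \<delta>-neighbourhood also lies between K and G.\<close>

lemma lebesgue_sandwich:
  fixes A :: "'a::euclidean_space set"
  assumes A: "A \<in> sets lebesgue" "bounded A" and e: "e > 0"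
  obtains K \<delta> where "\<delta> > 0" "K \<subseteq> A"
    "\<And>D. D \<in> sets lebesgue \<Longrightarrow> K \<subseteq> D \<Longrightarrow> D \<subseteq> (\<Union>x\<in>K. ball x \<delta>) \<Longrightarrow>
      emeasure lebesgue ((A - D) \<union> (D - A)) < ennreal e"
proof -
  have e2: "e / 2 > 0" using e by simp
  obtain G where G: "open G" "A \<subseteq> G" "G - A \<in> lmeasurable" "emeasure lebesgue (G - A) < ennreal (e/2)"
    using sets_lebesgue_outer_open[OF A(1) e2] by blast
  obtain K where K: "closed K" "K \<subseteq> A" "A - K \<in> lmeasurable" "emeasure lebesgue (A - K) < ennreal (e/2)"
    using sets_lebesgue_inner_closed[OF A(1) e2] by blast
  have "compact K" using K A(2) by (meson bounded_subset compact_eq_bounded_closed)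
  moreover have "closed (- G)" "K \<inter> - G = {}" using G K by auto
  ultimately obtain d where d: "d > 0" "\<And>x y. x \<in> K \<Longrightarrow> y \<in> - G \<Longrightarrow> d \<le> dist x y"
    using separate_compact_closed[of K "- G"] by metis
  show ?thesis
  proof (rule that[OF d(1) K(2)])
    fix D assume D: "D \<in> sets lebesgue" "K \<subseteq> D" "D \<subseteq> (\<Union>x\<in>K. ball x d)"
    have "D \<subseteq> G" using D(3) d(2) by (force simp: not_less[symmetric])
    then have sub: "(A - D) \<union> (D - A) \<subseteq> (A - K) \<union> (G - A)" using D(2) by blast
    have m: "(A - K) \<in> sets lebesgue" "(G - A) \<in> sets lebesgue" using G(3) K(3) by auto
    have "emeasure lebesgue ((A - D) \<union> (D - A)) \<le> emeasure lebesgue ((A - K) \<union> (G - A))"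
      by (rule emeasure_mono[OF sub]) (use m in auto)
    also have "\<dots> \<le> emeasure lebesgue (A - K) + emeasure lebesgue (G - A)"
      by (rule emeasure_subadditive) (use m in auto)
    also have "\<dots> < ennreal (e/2) + ennreal (e/2)" using G K by (metis ennreal_plus add_mono_ennreal e2 less_imp_le)
    also have "\<dots> = ennreal e" using e by (simp flip: ennreal_plus)
    finally show "emeasure lebesgue ((A - D) \<union> (D - A)) < ennreal e" .
  qed
qed

lemma block_close:
  assumes "n \<ge> 1" "x \<in> {0..1}" "y \<in> {0..1}" "block n x = block n y"
  shows "\<bar>x - y\<bar> \<le> 1 / n"
proof -
  let ?u = "block n x"
  have u: "?u \<ge> 1" using block_range[OF assms(1,2)] by auto
  have *: "(real ?u - 1) / n \<le> z \<and> z \<le> real ?u / n" if "z \<in> {0..1}" "block n z = ?u" for z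
    using block_eq_iff[OF assms(1) that(1) u] that(2) u assms(1) by auto
  have "real ?u / n - (real ?u - 1) / n = 1 / n" using assms(1) by (simp add: field_simps)
  then show ?thesis using *[of x] *[of y] assms by auto
qed

lemma block_union_measurable: "{x \<in> {0..1}. block n x \<in> P} \<in> sets unit_measure"
proof -
  have [measurable]: "block n \<in> borel \<rightarrow>\<^sub>M count_space UNIV"
    unfolding block_def by measurable
  have "{x. block n x \<in> P} \<in> sets borel" using measurable_sets[of "block n" borel "count_space UNIV" P]
    by (simp add: vimage_def)
  then show ?thesis
    unfolding sets_unit_measure by (auto simp: Collect_conj_eq Int_def[symmetric] intro!: sets.Int)
qed

lemma emeasure_square_less:
  "A \<in> sets square_measure \<Longrightarrow> emeasure lebesgue A < ennreal e \<Longrightarrow> measure square_measure A < e"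
  by (metis emeasure_square_measure square.emeasure_eq_measure ennreal_less_iff measure_nonneg)

lemma emeasure_unit_less:
  "A \<in> sets unit_measure \<Longrightarrow> emeasure lebesgue A < ennreal e \<Longrightarrow> measure unit_measure A < e"
  by (metis emeasure_unit_measure unit.emeasure_eq_measure ennreal_less_iff measure_nonneg)

text \<open>The union of all cells that meet the compact core K of S contains K and stays in its
  \<delta>-neighbourhood as soon as cells are shorter than \<delta>.\<close>

lemma block_approx_interval:
  assumes S: "S \<in> sets unit_measure" and e: "e > 0"
  obtains n0 where "n0 \<ge> 1" "\<And>n. n \<ge> n0 \<Longrightarrow> \<exists>P \<subseteq> {1..n}.
    measure unit_measure ((S - {x \<in> {0..1}. block n x \<in> P}) \<union> ({x \<in> {0..1}. block n x \<in> P} - S)) < e"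
proof -
  have SL: "S \<in> sets lebesgue" "S \<subseteq> {0..1}" using S by (auto simp: sets_unit_measure)
  have "bounded S" using SL(2) bounded_subset bounded_closed_interval by blast
  then obtain K \<delta> where K: "\<delta> > 0" "K \<subseteq> S"
    "\<And>D. D \<in> sets lebesgue \<Longrightarrow> K \<subseteq> D \<Longrightarrow> D \<subseteq> (\<Union>x\<in>K. ball x \<delta>) \<Longrightarrow>
      emeasure lebesgue ((S - D) \<union> (D - S)) < ennreal e"
    using lebesgue_sandwich[OF SL(1) _ e] by metis
  obtain n0 :: nat where n0: "1 / \<delta> < n0" using reals_Archimedean2 by blast
  have n0p: "n0 \<ge> 1" using n0 K(1) by (cases n0) (auto simp: field_simps)
  show ?thesis
  proof (rule that[OF n0p])
    fix n assume n: "n \<ge> n0"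
    have n1: "n \<ge> 1" using n n0p by simp
    have "1 / \<delta> < n" using n n0 by linarith
    then have nd: "1 / n < \<delta>" using K(1) n1 by (simp add: field_simps)
    let ?P = "block n ` K" and ?D = "{x \<in> {0..1}. block n x \<in> block n ` K}"
    have Dm: "?D \<in> sets unit_measure" by (rule block_union_measurable)
    have KS: "K \<subseteq> {0..1}" using K(2) SL(2) by blast
    have "?D \<subseteq> (\<Union>x\<in>K. ball x \<delta>)"
    proof
      fix x assume "x \<in> ?D"
      then obtain y where y: "y \<in> K" "block n x = block n y" "x \<in> {0..1}" by auto
      then have "\<bar>x - y\<bar> \<le> 1 / n" using block_close[OF n1] KS by blast
      then show "x \<in> (\<Union>x\<in>K. ball x \<delta>)" using y nd by (auto simp: dist_real_def intro!: bexI[of _ y])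
    qed
    moreover have "K \<subseteq> ?D" using KS by auto
    moreover have "?D \<in> sets lebesgue" using Dm by (simp add: sets_unit_measure)
    ultimately have "emeasure lebesgue ((S - ?D) \<union> (?D - S)) < ennreal e" by (intro K(3))
    then have "measure unit_measure ((S - ?D) \<union> (?D - S)) < e"
      by (intro emeasure_unit_less) (use S Dm in auto)
    moreover have "?P \<subseteq> {1..n}" using block_range[OF n1] KS by blast
    ultimately show "\<exists>P \<subseteq> {1..n}.
      measure unit_measure ((S - {x \<in> {0..1}. block n x \<in> P}) \<union> ({x \<in> {0..1}. block n x \<in> P} - S)) < e"
      by blast
  qed
qed

lemma block2_measurable: "{z \<in> unit_square. (block n (fst z), block n (snd z)) \<in> P} \<in> sets square_measure"
proof -
  have [measurable]: "block n \<in> borel \<rightarrow>\<^sub>M count_space UNIV"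
    unfolding block_def by measurable
  have "(\<lambda>z. (block n (fst z), block n (snd z))) \<in> (borel :: (real \<times> real) measure) \<rightarrow>\<^sub>M count_space UNIV \<Otimes>\<^sub>M count_space UNIV"
    unfolding borel_prod[symmetric] by measurable
  then have m: "(\<lambda>z. (block n (fst z), block n (snd z))) \<in> (borel :: (real \<times> real) measure) \<rightarrow>\<^sub>M count_space UNIV"
    by (simp add: pair_measure_countable)
  have "{z. (block n (fst z), block n (snd z)) \<in> P} \<in> sets borel"
    using measurable_sets[OF m, of P] by (simp add: vimage_def)
  then have "{z. (block n (fst z), block n (snd z)) \<in> P} \<inter> unit_square \<in> sets lebesgue"
    by (intro sets.Int) auto
  moreover have "{z. (block n (fst z), block n (snd z)) \<in> P} \<inter> unit_square
    = {z \<in> unit_square. (block n (fst z), block n (snd z)) \<in> P}" by blast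
  ultimately show ?thesis by (simp add: sets_square_measure)
qed

lemma block_approx_square:
  assumes A: "A \<in> sets square_measure" and e: "e > 0"
  obtains n0 where "n0 \<ge> 1" "\<And>n. n \<ge> n0 \<Longrightarrow> \<exists>P.
    measure square_measure ((A - {z \<in> unit_square. (block n (fst z), block n (snd z)) \<in> P})
      \<union> ({z \<in> unit_square. (block n (fst z), block n (snd z)) \<in> P} - A)) < e"
proof -
  have AL: "A \<in> sets lebesgue" "A \<subseteq> unit_square" using A by (auto simp: sets_square_measure)
  have "bounded A" using AL(2) by (rule bounded_subset[rotated]) (intro bounded_Times bounded_closed_interval)
  then obtain K \<delta> where K: "\<delta> > 0" "K \<subseteq> A"
    "\<And>D. D \<in> sets lebesgue \<Longrightarrow> K \<subseteq> D \<Longrightarrow> D \<subseteq> (\<Union>x\<in>K. ball x \<delta>) \<Longrightarrow>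
      emeasure lebesgue ((A - D) \<union> (D - A)) < ennreal e"
    using lebesgue_sandwich[OF AL(1) _ e] by metis
  \<comment> \<open>Two points in the same product of cells differ by at most 1/n in each
    coordinate, hence by at most 2/n.\<close>
  obtain n0 :: nat where n0: "2 / \<delta> < n0" using reals_Archimedean2 by blast
  have n0p: "n0 \<ge> 1" using n0 K(1) by (cases n0) (auto simp: field_simps)
  show ?thesis
  proof (rule that[OF n0p])
    fix n assume n: "n \<ge> n0"
    have n1: "n \<ge> 1" using n n0p by simp
    have "2 / \<delta> < n" using n n0 by linarith
    then have nd: "2 / n < \<delta>" using K(1) n1 by (simp add: field_simps)
    let ?b = "\<lambda>z. (block n (fst z), block n (snd z))"
    let ?D = "{z \<in> unit_square. ?b z \<in> ?b ` K}"
    have Dm: "?D \<in> sets square_measure" by (rule block2_measurable)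
    have KS: "K \<subseteq> unit_square" using K(2) AL(2) by (rule order_trans)
    have "?D \<subseteq> (\<Union>x\<in>K. ball x \<delta>)"
    proof
      fix z assume z: "z \<in> ?D"
      then obtain y where y: "y \<in> K" "?b z = ?b y" by (auto simp del: mem_Times_iff)
      have m: "fst z \<in> {0..1}" "snd z \<in> {0..1}" "fst y \<in> {0..1}" "snd y \<in> {0..1}"
        using z subsetD[OF KS y(1)] by (auto simp: mem_Times_iff)
      have "dist y z \<le> dist (fst y) (fst z) + dist (snd y) (snd z)"
        unfolding dist_prod_def by (rule sqrt_sum_squares_le_sum) auto
      also have "\<dots> \<le> 1 / n + 1 / n"
        using block_close[OF n1 m(1) m(3)] block_close[OF n1 m(2) m(4)] y(2)
        by (intro add_mono) (auto simp: dist_real_def)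
      finally have "dist y z < \<delta>" using nd by simp
      then show "z \<in> (\<Union>x\<in>K. ball x \<delta>)" using y by auto
    qed
    moreover have "K \<subseteq> ?D" using KS by auto
    moreover have "?D \<in> sets lebesgue" using Dm by (simp add: sets_square_measure)
    ultimately have "emeasure lebesgue ((A - ?D) \<union> (?D - A)) < ennreal e" by (intro K(3))
    then have "measure square_measure ((A - ?D) \<union> (?D - A)) < e"
      by (intro emeasure_square_less sets.Un sets.Diff A Dm)
    then show "\<exists>P. measure square_measure ((A - {z \<in> unit_square. ?b z \<in> P}) \<union> ({z \<in> unit_square. ?b z \<in> P} - A)) < e"
      by (rule exI)
  qed
qed

section \<open>Approximation in L1 by functions that are constant on products of cells\<close>

lemma integral_abs_indicator_diff:
  assumes "A \<in> sets square_measure" "D \<in> sets square_measure"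
  shows "(\<integral>z. \<bar>indicator A z - indicator D z :: real\<bar> \<partial>square_measure) = measure square_measure ((A - D) \<union> (D - A))"
proof -
  have "(\<integral>z. \<bar>indicator A z - indicator D z :: real\<bar> \<partial>square_measure) = (\<integral>z. indicator ((A - D) \<union> (D - A)) z \<partial>square_measure)"
    by (rule Bochner_Integration.integral_cong) (auto simp: indicator_def)
  also have "\<dots> = measure square_measure (((A - D) \<union> (D - A)) \<inter> space square_measure)"
    by (rule Bochner_Integration.integral_indicator)
  also have "((A - D) \<union> (D - A)) \<inter> space square_measure = (A - D) \<union> (D - A)"
    using assms[THEN sets.sets_into_space] by blast
  finally show ?thesis .
qed

text \<open>The number of thresholds i/m that do not exceed x is the integer part of m x.\<close>

lemma layer_cake_bound:
  fixes x :: real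
  assumes "0 \<le> x" "x \<le> 1" "m \<ge> 1"
  shows "\<bar>x - (\<Sum>i=1..m. (if real i / m \<le> x then 1 else 0)) / m\<bar> \<le> 1 / m"
proof -
  have "{i \<in> {1..m}. real i / m \<le> x} = {1..nat \<lfloor>m * x\<rfloor>}"
  proof -
    have q: "real i / m \<le> x \<longleftrightarrow> i \<le> nat \<lfloor>m * x\<rfloor>" for i
    proof -
      have "0 \<le> \<lfloor>m * x\<rfloor>" using assms by simp
      then have "i \<le> nat \<lfloor>m * x\<rfloor> \<longleftrightarrow> real i \<le> m * x" by (simp add: le_nat_iff le_floor_iff)
      then show ?thesis using assms by (simp add: field_simps)
    qed
    have r: "nat \<lfloor>m * x\<rfloor> \<le> m"
    proof -
      have "real m * x \<le> m" using assms by (simp add: mult_left_le)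
      then show ?thesis by linarith
    qed
    show ?thesis
    proof (rule set_eqI)
      fix i
      show "i \<in> {i \<in> {1..m}. real i / m \<le> x} \<longleftrightarrow> i \<in> {1..nat \<lfloor>m * x\<rfloor>}"
        unfolding mem_Collect_eq atLeastAtMost_iff q using r by linarith
    qed
  qed
  then have s: "(\<Sum>i=1..m. (if real i / m \<le> x then 1 else 0)) = real (nat \<lfloor>m * x\<rfloor>)"
    by (simp add: sum.If_cases Int_def)
  have "0 \<le> \<lfloor>m * x\<rfloor>" using assms by simp
  then have "\<bar>m * x - real (nat \<lfloor>m * x\<rfloor>)\<bar> \<le> 1" by linarith
  then have "\<bar>m * x - real (nat \<lfloor>m * x\<rfloor>)\<bar> / m \<le> 1 / m" by (rule divide_right_mono) simp
  moreover have "\<bar>x - real (nat \<lfloor>m * x\<rfloor>) / m\<bar> = \<bar>m * x - real (nat \<lfloor>m * x\<rfloor>)\<bar> / \<bar>real m\<bar>"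
    unfolding abs_divide[symmetric] using assms(3) by (simp add: diff_divide_distrib)
  ultimately show ?thesis unfolding s by simp
qed

lemma bkernel_block: "n \<ge> 1 \<Longrightarrow> bkernel (\<lambda>z. h (block n (fst z)) (block n (snd z)))"
  using step_integral(2)[OF bkernel_const[of 1], of "{1..n}" "block n" h] block_range[of n] cell_measurable[of n]
  by simp

text \<open>The layer cake formula reduces the approximation of U to that of its m superlevel sets.
  Each of them is replaced by a union of products of cells, and averaging the indicators gives the
  step function.\<close>

lemma block_approx_L1:
  assumes U: "bkernel U" "\<And>z. z \<in> unit_square \<Longrightarrow> 0 \<le> U z" "\<And>z. z \<in> unit_square \<Longrightarrow> U z \<le> 1" and e: "e > 0"
  obtains n0 where "n0 \<ge> 1" "\<And>n. n \<ge> n0 \<Longrightarrow> \<exists>h.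
    (\<integral>z. \<bar>U z - h (block n (fst z)) (block n (snd z))\<bar> \<partial>square_measure) < e"
proof -
  obtain m :: nat where m0: "2 / e < m" using reals_Archimedean2 by blast
  have m1: "m \<ge> 1" using m0 e by (cases m) (auto simp: field_simps)
  have me: "1 / m < e / 2" using m0 m1 e by (simp add: field_simps)
  let ?b = "\<lambda>n z. (block n (fst z), block n (snd z))"
  define A where "A i = {z \<in> unit_square. real i / m \<le> U z}" for i :: nat
  have A: "A i \<in> sets square_measure" for i
  proof -
    have "{z \<in> space square_measure. real i / m \<le> U z} \<in> sets square_measure"
      using bkernel_measurable[OF U(1)] by measurable
    then show ?thesis by (simp add: A_def)
  qed
  define Q where "Q i n P \<longleftrightarrow> measure square_measure ((A i - {z \<in> unit_square. ?b n z \<in> P})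
      \<union> ({z \<in> unit_square. ?b n z \<in> P} - A i)) < e/2" for i n P
  have e2: "e / 2 > 0" using e by simp
  have "\<exists>n0\<ge>1. \<forall>n\<ge>n0. \<exists>P. Q i n P" for i
  proof -
    obtain n0 where "n0 \<ge> 1" "\<And>n. n \<ge> n0 \<Longrightarrow> \<exists>P. Q i n P"
      using block_approx_square[OF A[of i] e2, folded Q_def] by metis
    then show ?thesis by blast
  qed
  then obtain N where N: "\<And>i. N i \<ge> 1" "\<And>i n. n \<ge> N i \<Longrightarrow> \<exists>P. Q i n P" by metis
  define n0 where "n0 = Max (N ` {0..m})"
  have n0: "N i \<le> n0" if "i \<in> {1..m}" for i unfolding n0_def using that by (intro Max_ge) auto
  have n01: "n0 \<ge> 1" using n0[of 1] N(1)[of 1] m1 by auto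
  show ?thesis
  proof (rule that[OF n01])
    fix n assume n: "n \<ge> n0"
    then have n1: "n \<ge> 1" using n01 by simp
    have "\<exists>P. Q i n P" if "i \<in> {1..m}" for i
      using N(2)[of i n] n0[OF that] n by simp
    then obtain P where P: "\<And>i. i \<in> {1..m} \<Longrightarrow> Q i n (P i)" by metis
    define D where "D i = {z \<in> unit_square. ?b n z \<in> P i}" for i
    have D: "D i \<in> sets square_measure" for i unfolding D_def by (rule block2_measurable)
    define h where "h u v = (\<Sum>i=1..m. (if (u, v) \<in> P i then 1 else 0 :: real)) / m" for u v
    have bkd: "bkernel (\<lambda>z. \<bar>indicator (A i) z - indicator (D i) z\<bar>)" for i
      by (intro bkernel_abs bkernel_diff bkernel_indicator A D)
    have "(\<integral>z. \<bar>U z - h (block n (fst z)) (block n (snd z))\<bar> \<partial>square_measure)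
      \<le> (\<integral>z. 1 / m + 1 / m * (\<Sum>i=1..m. \<bar>indicator (A i) z - indicator (D i) z\<bar>) \<partial>square_measure)"
    proof (rule integral_mono)
      show "integrable square_measure (\<lambda>z. \<bar>U z - h (block n (fst z)) (block n (snd z))\<bar>)"
        by (intro bkernel_integrable bkernel_abs bkernel_diff U bkernel_block n1)
      show "integrable square_measure (\<lambda>z. 1 / m + 1 / m * (\<Sum>i=1..m. \<bar>indicator (A i) z - indicator (D i) z\<bar>))"
        by (intro bkernel_integrable bkernel_add bkernel_const bkernel_cmult bkernel_sum bkd)
      fix z assume "z \<in> space square_measure"
      then have z: "z \<in> unit_square" by simp
      have 1: "h (block n (fst z)) (block n (snd z)) = (\<Sum>i=1..m. indicator (D i) z) / m"
        unfolding h_def D_def using z by (intro arg_cong[where f = "\<lambda>s. s / real m"] sum.cong) (auto simp: indicator_def)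
      have 2: "(\<Sum>i=1..m. (if real i / m \<le> U z then 1 else 0)) = (\<Sum>i=1..m. indicator (A i) z :: real)"
        unfolding A_def using z by (intro sum.cong) (auto simp: indicator_def)
      have "\<bar>U z - (\<Sum>i=1..m. indicator (A i) z) / m\<bar> \<le> 1 / m"
        using layer_cake_bound[OF U(2)[OF z] U(3)[OF z] m1] unfolding 2 .
      moreover have "\<bar>(\<Sum>i=1..m. indicator (A i) z) / m - (\<Sum>i=1..m. indicator (D i) z) / m\<bar>
        \<le> 1 / m * (\<Sum>i=1..m. \<bar>indicator (A i) z - indicator (D i) z\<bar>)"
        using sum_abs[of "\<lambda>i. indicator (A i) z - indicator (D i) z :: real" "{1..m}"] m1
        by (simp add: diff_divide_distrib[symmetric] sum_subtractf[symmetric] divide_right_mono)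
      ultimately show "\<bar>U z - h (block n (fst z)) (block n (snd z))\<bar>
        \<le> 1 / m + 1 / m * (\<Sum>i=1..m. \<bar>indicator (A i) z - indicator (D i) z\<bar>)"
        unfolding 1 by linarith
    qed
    also have "\<dots> = 1 / m + 1 / m * (\<Sum>i=1..m. measure square_measure ((A i - D i) \<union> (D i - A i)))"
    proof -
      have "(\<integral>z. (\<Sum>i=1..m. \<bar>indicator (A i) z - indicator (D i) z\<bar>) \<partial>square_measure)
        = (\<Sum>i=1..m. measure square_measure ((A i - D i) \<union> (D i - A i)))"
        unfolding integral_abs_indicator_diff[OF A D, symmetric]
        by (intro Bochner_Integration.integral_sum bkernel_integrable bkd)
      moreover have "integrable square_measure (\<lambda>z. 1 / m * (\<Sum>i=1..m. \<bar>indicator (A i) z - indicator (D i) z\<bar>))"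
        by (intro bkernel_integrable bkernel_cmult bkernel_sum bkd)
      ultimately show ?thesis
        by (subst Bochner_Integration.integral_add) (simp_all add: square.prob_space[simplified])
    qed
    also have "\<dots> \<le> 1 / m + 1 / m * (\<Sum>i=1..m. e / 2)"
      using P unfolding Q_def D_def[symmetric]
      by (intro add_left_mono mult_left_mono sum_mono) (auto intro: less_imp_le)
    also have "\<dots> = 1 / m + e / 2" using m1 by simp
    also have "\<dots> < e" using me by simp
    finally show "\<exists>h. (\<integral>z. \<bar>U z - h (block n (fst z)) (block n (snd z))\<bar> \<partial>square_measure) < e" by blast
  qed
qed

section \<open>Averages over products of cells\<close>

definition block_avg :: "nat \<Rightarrow> (real \<times> real \<Rightarrow> real) \<Rightarrow> nat \<Rightarrow> nat \<Rightarrow> real" where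
  "block_avg n U u v = (real n)\<^sup>2 * rect_integral (cell n u) (cell n v) U"

lemma rect_integral_const_cell:
  assumes "n \<ge> 1" "u \<in> {1..n}" "v \<in> {1..n}"
  shows "rect_integral (cell n u) (cell n v) (\<lambda>z. 1) = 1 / (real n)\<^sup>2"
proof -
  have "rect_integral (cell n u) (cell n v) (\<lambda>z. 1) = measure square_measure ((cell n u \<times> cell n v) \<inter> space square_measure)"
    unfolding rect_integral_def by simp
  also have "(cell n u \<times> cell n v) \<inter> space square_measure = cell n u \<times> cell n v" by auto
  also have "measure square_measure \<dots> = 1 / n * (1 / n)"
    by (simp only: measure_square_Times[OF cell_measurable cell_measurable] cell_measure[OF assms(1,2)] cell_measure[OF assms(1,3)])
  finally show ?thesis by (simp add: power2_eq_square)
qed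

lemma integral_block:
  assumes "n \<ge> 1"
  shows "(\<integral>z. h (block n (fst z)) (block n (snd z)) \<partial>square_measure) = (\<Sum>u=1..n. \<Sum>v=1..n. h u v) / (real n)\<^sup>2"
proof -
  have "(\<integral>z. 1 * h (block n (fst z)) (block n (snd z)) \<partial>square_measure) =
    (\<Sum>u=1..n. \<Sum>v=1..n. h u v * rect_integral (cell n u) (cell n v) (\<lambda>z. 1))"
    by (rule step_integral(1)[OF bkernel_const]) (use block_range[OF assms] cell_measurable in auto)
  also have "\<dots> = (\<Sum>u=1..n. \<Sum>v=1..n. h u v / (real n)\<^sup>2)"
    by (intro sum.cong refl) (simp only: rect_integral_const_cell[OF assms] times_divide_eq_right mult_1_right)
  finally show ?thesis by (simp add: sum_divide_distrib)
qed

lemma integral_cells: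
  assumes "n \<ge> 1" "bkernel U"
  shows "(\<integral>z. U z \<partial>square_measure) = (\<Sum>u=1..n. \<Sum>v=1..n. rect_integral (cell n u) (cell n v) U)"
proof -
  have "(\<integral>z. U z * 1 \<partial>square_measure) =
    (\<Sum>u=1..n. \<Sum>v=1..n. 1 * rect_integral (cell n u) (cell n v) U)"
    by (rule step_integral(1)[OF assms(2)]) (use block_range[OF assms(1)] cell_measurable in auto)
  then show ?thesis by simp
qed

text \<open>Averaging over cells contracts the L1 norm and fixes step functions, so the averages of
  U are at least as close to h as U itself is. The triangle inequality then gives the factor 2:
  averages are as good as any step approximation up to this factor.\<close>

lemma block_avg_L1_le:
  assumes n: "n \<ge> 1" and U: "bkernel U"
  shows "(\<integral>z. \<bar>U z - block_avg n U (block n (fst z)) (block n (snd z))\<bar> \<partial>square_measure)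
    \<le> 2 * (\<integral>z. \<bar>U z - h (block n (fst z)) (block n (snd z))\<bar> \<partial>square_measure)"
proof -
  let ?h = "\<lambda>z. h (block n (fst z)) (block n (snd z))"
  let ?w = "\<lambda>z. block_avg n U (block n (fst z)) (block n (snd z))"
  have bk: "bkernel (\<lambda>z. \<bar>U z - ?h z\<bar>)" "bkernel (\<lambda>z. \<bar>?h z - ?w z\<bar>)" "bkernel (\<lambda>z. \<bar>U z - ?w z\<bar>)"
    "bkernel ?h" "bkernel (\<lambda>z. U z - ?h z)"
    by (intro bkernel_abs bkernel_diff U bkernel_block n)+
  have "(\<integral>z. \<bar>?h z - ?w z\<bar> \<partial>square_measure) = (\<Sum>u=1..n. \<Sum>v=1..n. \<bar>h u v - block_avg n U u v\<bar>) / (real n)\<^sup>2"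
    using integral_block[OF n, of "\<lambda>u v. \<bar>h u v - block_avg n U u v\<bar>"] .
  also have "\<dots> = (\<Sum>u=1..n. \<Sum>v=1..n. \<bar>rect_integral (cell n u) (cell n v) (\<lambda>z. U z - ?h z)\<bar>)"
    unfolding sum_divide_distrib
  proof (intro sum.cong refl)
    fix u v assume uv: "u \<in> {1..n}" "v \<in> {1..n}"
    have "rect_integral (cell n u) (cell n v) ?h = rect_integral (cell n u) (cell n v) (\<lambda>z. h u v * 1)"
      unfolding rect_integral_def by (rule Bochner_Integration.integral_cong) (auto simp: indicator_def)
    also have "\<dots> = h u v / (real n)\<^sup>2"
      unfolding rect_integral_cmult rect_integral_const_cell[OF n uv] by simp
    finally have "rect_integral (cell n u) (cell n v) (\<lambda>z. U z - ?h z)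
      = rect_integral (cell n u) (cell n v) U - h u v / (real n)\<^sup>2"
      using rect_integral_diff[OF cell_measurable cell_measurable U bk(4)] by simp
    also have "\<dots> = - ((h u v - block_avg n U u v) / (real n)\<^sup>2)"
      using n by (simp add: block_avg_def field_simps)
    finally show "\<bar>h u v - block_avg n U u v\<bar> / (real n)\<^sup>2 = \<bar>rect_integral (cell n u) (cell n v) (\<lambda>z. U z - ?h z)\<bar>"
      by simp
  qed
  also have "\<dots> \<le> (\<Sum>u=1..n. \<Sum>v=1..n. rect_integral (cell n u) (cell n v) (\<lambda>z. \<bar>U z - ?h z\<bar>))"
  proof (intro sum_mono)
    fix u v
    have "\<bar>rect_integral (cell n u) (cell n v) (\<lambda>z. U z - ?h z)\<bar>
      \<le> (\<integral>z. \<bar>indicator (cell n u \<times> cell n v) z * (U z - ?h z)\<bar> \<partial>square_measure)"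
      unfolding rect_integral_def using integral_norm_bound[of square_measure "\<lambda>z. indicator (cell n u \<times> cell n v) z * (U z - ?h z)"] by simp
    also have "\<dots> = rect_integral (cell n u) (cell n v) (\<lambda>z. \<bar>U z - ?h z\<bar>)"
      unfolding rect_integral_def by (rule Bochner_Integration.integral_cong) (auto simp: indicator_def)
    finally show "\<bar>rect_integral (cell n u) (cell n v) (\<lambda>z. U z - ?h z)\<bar> \<le> rect_integral (cell n u) (cell n v) (\<lambda>z. \<bar>U z - ?h z\<bar>)" .
  qed
  also have "\<dots> = (\<integral>z. \<bar>U z - ?h z\<bar> \<partial>square_measure)"
    by (rule integral_cells[OF n bk(1), symmetric])
  finally have hw: "(\<integral>z. \<bar>?h z - ?w z\<bar> \<partial>square_measure) \<le> (\<integral>z. \<bar>U z - ?h z\<bar> \<partial>square_measure)" .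
  have "(\<integral>z. \<bar>U z - ?w z\<bar> \<partial>square_measure) \<le> (\<integral>z. \<bar>U z - ?h z\<bar> + \<bar>?h z - ?w z\<bar> \<partial>square_measure)"
    by (intro integral_mono bkernel_integrable bk bkernel_add) linarith
  also have "\<dots> = (\<integral>z. \<bar>U z - ?h z\<bar> \<partial>square_measure) + (\<integral>z. \<bar>?h z - ?w z\<bar> \<partial>square_measure)"
    by (intro Bochner_Integration.integral_add bkernel_integrable bk)
  finally show ?thesis using hw by linarith
qed

lemma block_avg_L1:
  assumes U: "bkernel U" "\<And>z. z \<in> unit_square \<Longrightarrow> 0 \<le> U z" "\<And>z. z \<in> unit_square \<Longrightarrow> U z \<le> 1" and e: "e > 0"
  obtains n0 where "n0 \<ge> 1" "\<And>n. n \<ge> n0 \<Longrightarrow>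
    (\<integral>z. \<bar>U z - block_avg n U (block n (fst z)) (block n (snd z))\<bar> \<partial>square_measure) < e"
proof -
  obtain n0 where n0: "n0 \<ge> 1" "\<And>n. n \<ge> n0 \<Longrightarrow> \<exists>h.
    (\<integral>z. \<bar>U z - h (block n (fst z)) (block n (snd z))\<bar> \<partial>square_measure) < e/2"
    using block_approx_L1[OF U, of "e/2"] e by auto
  show ?thesis
  proof (rule that[OF n0(1)])
    fix n assume n: "n \<ge> n0"
    then obtain h where "(\<integral>z. \<bar>U z - h (block n (fst z)) (block n (snd z))\<bar> \<partial>square_measure) < e/2"
      using n0(2) by blast
    then show "(\<integral>z. \<bar>U z - block_avg n U (block n (fst z)) (block n (snd z))\<bar> \<partial>square_measure) < e"
      using block_avg_L1_le[OF _ U(1), of n h] n n0(1) by linarith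
  qed
qed

lemma rect_integral_swap:
  assumes "S \<in> sets unit_measure" "T \<in> sets unit_measure" "bkernel U"
  shows "rect_integral S T (\<lambda>z. U (prod.swap z)) = rect_integral T S U"
proof -
  have "rect_integral S T (\<lambda>z. U (prod.swap z))
    = (\<integral>z. indicator (T \<times> S) (prod.swap z) * U (prod.swap z) \<partial>square_measure)"
    unfolding rect_integral_def by (rule Bochner_Integration.integral_cong) (auto simp: indicator_def)
  also have "\<dots> = (\<integral>z. indicator (T \<times> S) z * U z \<partial>distr square_measure square_measure prod.swap)"
    by (rule integral_distr[symmetric, OF swap_square(1)]) (intro bkernel_measurable bkernel_rect assms)
  finally show ?thesis by (simp add: swap_square(2) rect_integral_def)
qed

lemma block_avg_graphon:
  assumes W: "W \<in> graphons" and n: "n \<ge> 1" and uv: "u \<in> {1..n}" "v \<in> {1..n}"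
  shows "block_avg n (\<lambda>z. W z $ a) u v \<ge> 0"
    "block_avg n (\<lambda>z. W z $ a) u v = block_avg n (\<lambda>z. W z $ a) v u"
    "(\<Sum>a\<in>UNIV. block_avg n (\<lambda>z. W z $ a) u v) = 1"
    "block_avg n (\<lambda>z. W z $ a) u v \<le> 1"
proof -
  have bk: "bkernel (\<lambda>z. W z $ a)" for a by (intro vkernel_component graphon_vkernel W)
  show nn: "block_avg n (\<lambda>z. W z $ a) u v \<ge> 0" for a
    unfolding block_avg_def rect_integral_def
    by (intro mult_nonneg_nonneg integral_nonneg_AE AE_I2) (use graphon_bounds(1)[OF W] in auto)
  have "rect_integral (cell n u) (cell n v) (\<lambda>z. W z $ a) = rect_integral (cell n u) (cell n v) (\<lambda>z. W (prod.swap z) $ a)"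
    by (rule rect_integral_cong) (use graphon_sym[OF W] in \<open>auto simp: prod.swap_def\<close>)
  also have "\<dots> = rect_integral (cell n v) (cell n u) (\<lambda>z. W z $ a)"
    by (rule rect_integral_swap[OF cell_measurable cell_measurable bk])
  finally show "block_avg n (\<lambda>z. W z $ a) u v = block_avg n (\<lambda>z. W z $ a) v u"
    by (simp add: block_avg_def)
  have "(\<Sum>a\<in>UNIV. rect_integral (cell n u) (cell n v) (\<lambda>z. W z $ a))
    = (\<integral>z. (\<Sum>a\<in>UNIV. indicator (cell n u \<times> cell n v) z * W z $ a) \<partial>square_measure)"
    unfolding rect_integral_def
    by (intro Bochner_Integration.integral_sum[symmetric] bkernel_integrable bkernel_rect cell_measurable bk)
  also have "\<dots> = rect_integral (cell n u) (cell n v) (\<lambda>z. 1)"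
    unfolding rect_integral_def sum_distrib_left[symmetric]
    by (rule Bochner_Integration.integral_cong) (simp_all add: graphon_bounds(3)[OF W])
  finally show s: "(\<Sum>a\<in>UNIV. block_avg n (\<lambda>z. W z $ a) u v) = 1"
    using n unfolding block_avg_def sum_distrib_left[symmetric] rect_integral_const_cell[OF n uv] by simp
  show "block_avg n (\<lambda>z. W z $ a) u v \<le> 1"
    using member_le_sum[of a UNIV "\<lambda>a. block_avg n (\<lambda>z. W z $ a) u v"] nn s by simp
qed

lemma step_graphon_L1:
  assumes W: "W \<in> graphons" and e: "e > 0"
  obtains n0 where "n0 \<ge> 1" "\<And>n a. n \<ge> n0 \<Longrightarrow>
    (\<integral>z. \<bar>W z $ a - block_avg n (\<lambda>z. W z $ a) (block n (fst z)) (block n (snd z))\<bar> \<partial>square_measure) < e"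
proof -
  define d where "d a n = (\<integral>z. \<bar>W z $ a - block_avg n (\<lambda>z. W z $ a) (block n (fst z)) (block n (snd z))\<bar> \<partial>square_measure)" for a n
  have "\<exists>n0\<ge>1. \<forall>n\<ge>n0. d a n < e" for a
    using block_avg_L1[OF vkernel_component[OF graphon_vkernel[OF W]] graphon_bounds(1,2)[OF W] e, of a, folded d_def] by metis
  then obtain N where N: "\<And>a. N a \<ge> 1" "\<And>a n. n \<ge> N a \<Longrightarrow> d a n < e" by metis
  show ?thesis
  proof (rule that)
    have le: "N a \<le> Max (range N)" for a by (rule Max_ge) auto
    show "Max (range N) \<ge> 1" using N(1) le order_trans by blast
    show "(\<integral>z. \<bar>W z $ a - block_avg n (\<lambda>z. W z $ a) (block n (fst z)) (block n (snd z))\<bar> \<partial>square_measure) < e"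
      if "n \<ge> Max (range N)" for n a
      using N(2)[of a n] le[of a] that by (simp add: d_def)
  qed
qed

subsection \<open>Entropy\<close>

lemma set_integral_square: "(LINT z:unit_square|lebesgue. U z) = (\<integral>z. U z \<partial>square_measure)" for U :: "real \<times> real \<Rightarrow> real"
  unfolding set_lebesgue_integral_def by (subst integral_restrict_space) auto

lemma entropy_fun_alt: "entropy_fun W = (\<Sum>a\<in>UNIV. \<integral>z. W z $ a * ln (W z $ a) \<partial>square_measure)"
  unfolding entropy_fun_def set_integral_square ..

lemma xlnx_bounds: "0 \<le> x \<Longrightarrow> x \<le> 1 \<Longrightarrow> -1 \<le> x * ln x \<and> x * ln x \<le> (0::real)"
proof (cases "x = 0")
  case False
  assume x: "0 \<le> x" "x \<le> 1"
  then have "x > 0" using False by simp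
  have "ln (1 / x) \<le> 1 / x - 1" using \<open>x > 0\<close> by (intro ln_le_minus_one) simp
  then have "- ln x \<le> 1 / x - 1" using \<open>x > 0\<close> by (simp add: ln_div)
  then have "x * - ln x \<le> x * (1 / x - 1)" using x by (intro mult_left_mono)
  then have "-1 \<le> x * ln x" using \<open>x > 0\<close> by (simp add: algebra_simps)
  moreover have "x * ln x \<le> 0" using x \<open>x > 0\<close> by (simp add: mult_le_0_iff)
  ultimately show ?thesis ..
qed simp

lemma bkernel_xlnx:
  assumes "W \<in> graphons" shows "bkernel (\<lambda>z. W z $ a * ln (W z $ a))"
proof (rule bkernelI[where B = 1])
  have "(\<lambda>z. W z $ a) \<in> borel_measurable square_measure"
    by (intro bkernel_measurable vkernel_component graphon_vkernel assms)
  then show "(\<lambda>z. W z $ a * ln (W z $ a)) \<in> borel_measurable square_measure" by measurable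
  fix z assume "z \<in> unit_square"
  then show "\<bar>W z $ a * ln (W z $ a)\<bar> \<le> 1"
    using xlnx_bounds[OF graphon_bounds(1,2)[OF assms]] by (simp add: abs_le_iff)
qed

text \<open>Nonnegativity of the relative entropy of \<open>w\<close> with respect to the
  distribution exp(h), obtained termwise from ln x \<le> x - 1. Writing the reference law as an
  exponential keeps it positive, while \<open>w\<close> may vanish.\<close>

lemma gibbs_inequality:
  fixes w h :: "'i \<Rightarrow> real"
  assumes "\<And>a. a \<in> A \<Longrightarrow> w a \<ge> 0" "(\<Sum>a\<in>A. w a) = 1" "(\<Sum>a\<in>A. exp (h a)) = 1"
  shows "(\<Sum>a\<in>A. w a * h a) \<le> (\<Sum>a\<in>A. w a * ln (w a))"
proof -
  have "w a * h a - w a * ln (w a) \<le> exp (h a) - w a" if "a \<in> A" for a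
  proof (cases "w a = 0")
    case False
    then have w: "w a > 0" using assms(1)[OF that] by simp
    have "ln (exp (h a) / w a) \<le> exp (h a) / w a - 1" using w by (intro ln_le_minus_one) simp
    then have "h a - ln (w a) \<le> exp (h a) / w a - 1" using w by (simp add: ln_div)
    then have "w a * (h a - ln (w a)) \<le> w a * (exp (h a) / w a - 1)" using w by (intro mult_left_mono) auto
    then show ?thesis using w by (simp add: algebra_simps)
  qed simp
  then have "(\<Sum>a\<in>A. w a * h a - w a * ln (w a)) \<le> (\<Sum>a\<in>A. exp (h a) - w a)" by (rule sum_mono)
  then show ?thesis using assms by (simp add: sum_subtractf)
qed

section \<open>Pairings of graphons with logarithms of step graphons\<close>

text \<open>The relabelling acts on the test function \<open>H\<close>, not on \<open>U\<close>.
  Thus \<open>U\<close> can be an empirical graphon with its vertices in their given order.\<close>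

definition step_pairing :: "nat \<Rightarrow> ('k::finite \<Rightarrow> nat \<Rightarrow> nat \<Rightarrow> real) \<Rightarrow> (real \<Rightarrow> real) \<Rightarrow> 'k kernel \<Rightarrow> real" where
  "step_pairing m H \<phi> U =
    (\<Sum>a\<in>UNIV. \<integral>z. U z $ a * H a (block m (\<phi> (fst z))) (block m (\<phi> (snd z))) \<partial>square_measure)"

text \<open>These \<open>H\<close> are exactly the logarithms of strictly positive symmetric step
  graphons on m equal blocks: at each pair of blocks exp(H) is a probability vector over the
  colours.\<close>

definition log_step :: "nat \<Rightarrow> ('k::finite \<Rightarrow> nat \<Rightarrow> nat \<Rightarrow> real) \<Rightarrow> bool" where
  "log_step m H \<longleftrightarrow> m \<ge> 1 \<and> (\<forall>i\<in>{1..m}. \<forall>j\<in>{1..m}.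
     (\<forall>a. H a i j \<le> 0 \<and> H a i j = H a j i) \<and> (\<Sum>a\<in>UNIV. exp (H a i j)) = 1)"

lemma block_relabel:
  assumes "m \<ge> 1" "\<phi> \<in> mp_bijections"
  shows "x \<in> {0..1} \<Longrightarrow> block m (\<phi> x) \<in> {1..m}"
    "{x \<in> {0..1}. block m (\<phi> x) = i} \<in> sets unit_measure"
proof -
  show "x \<in> {0..1} \<Longrightarrow> block m (\<phi> x) \<in> {1..m}"
    by (intro block_range assms mp_bijectionsD(5)[OF assms(2)])
  have "{x \<in> {0..1}. block m (\<phi> x) = i} = \<phi> -` cell m i \<inter> {0..1}"
    unfolding vimage_def using mp_bijectionsD(5)[OF assms(2)] by blast
  then show "{x \<in> {0..1}. block m (\<phi> x) = i} \<in> sets unit_measure"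
    using mp_bijectionsD(6)[OF assms(2) cell_measurable] by simp
qed

lemma bkernel_step_relabel:
  assumes "m \<ge> 1" "\<phi> \<in> mp_bijections"
  shows "bkernel (\<lambda>z. h (block m (\<phi> (fst z))) (block m (\<phi> (snd z))))"
  by (rule step_integral(2)[where t = "\<lambda>x. block m (\<phi> x)", OF bkernel_const[of 1] finite_atLeastAtMost])
    (use block_relabel[OF assms] in auto)

lemma step_pairing_lipschitz:
  assumes m: "m \<ge> 1" and \<phi>: "\<phi> \<in> mp_bijections" and U: "vkernel U" "vkernel V"
  shows "\<bar>step_pairing m H \<phi> U - step_pairing m H \<phi> V\<bar>
    \<le> (\<Sum>a\<in>UNIV. \<Sum>i=1..m. \<Sum>j=1..m. \<bar>H a i j\<bar>) * cut_norm_vec (\<lambda>z. U z - V z)"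
proof -
  let ?h = "\<lambda>a z. H a (block m (\<phi> (fst z))) (block m (\<phi> (snd z)))"
  have bk: "bkernel (\<lambda>z. U z $ a * ?h a z)" "bkernel (\<lambda>z. V z $ a * ?h a z)" for a
    by (intro bkernel_mult vkernel_component U bkernel_step_relabel m \<phi>)+
  have bd: "bkernel (\<lambda>z. (U z - V z) $ a)" for a by (intro vkernel_component vkernel_diff U)
  have "step_pairing m H \<phi> U - step_pairing m H \<phi> V = (\<Sum>a\<in>UNIV. \<integral>z. (U z - V z) $ a * ?h a z \<partial>square_measure)"
    unfolding step_pairing_def sum_subtractf[symmetric]
    by (intro sum.cong refl, subst Bochner_Integration.integral_diff[symmetric])
      (auto intro: bkernel_integrable bk simp: left_diff_distrib)
  then have "\<bar>step_pairing m H \<phi> U - step_pairing m H \<phi> V\<bar>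
    \<le> (\<Sum>a\<in>UNIV. \<bar>\<integral>z. (U z - V z) $ a * ?h a z \<partial>square_measure\<bar>)" by (simp add: sum_abs)
  also have "\<dots> \<le> (\<Sum>a\<in>UNIV. (\<Sum>i=1..m. \<Sum>j=1..m. \<bar>H a i j\<bar>) * cut_norm_vec (\<lambda>z. U z - V z))"
  proof (rule sum_mono)
    fix a
    have "\<bar>\<integral>z. (U z - V z) $ a * ?h a z \<partial>square_measure\<bar>
      \<le> (\<Sum>i=1..m. \<Sum>j=1..m. \<bar>H a i j\<bar>) * cut_norm (\<lambda>z. (U z - V z) $ a)"
      by (rule step_integral_cut_norm[where t = "\<lambda>x. block m (\<phi> x)", OF bd finite_atLeastAtMost])
        (use block_relabel[OF m \<phi>] in auto)
    also have "\<dots> \<le> (\<Sum>i=1..m. \<Sum>j=1..m. \<bar>H a i j\<bar>) * cut_norm_vec (\<lambda>z. U z - V z)"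
      by (intro mult_left_mono cut_norm_le_vec vkernel_diff U sum_nonneg) auto
    finally show "\<bar>\<integral>z. (U z - V z) $ a * ?h a z \<partial>square_measure\<bar> \<le> \<dots>" .
  qed
  finally show ?thesis by (simp add: sum_distrib_right)
qed

lemma step_pairing_relabel:
  assumes m: "m \<ge> 1" and \<phi>: "\<phi> \<in> mp_bijections" and W: "vkernel W"
  shows "step_pairing m H \<phi> (relabel \<phi> W) = step_pairing m H (\<lambda>x. x) W"
  unfolding step_pairing_def
proof (intro sum.cong refl)
  fix a
  have "(\<integral>z. relabel \<phi> W z $ a * H a (block m (\<phi> (fst z))) (block m (\<phi> (snd z))) \<partial>square_measure)
    = (\<integral>z. W (map_prod \<phi> \<phi> z) $ a * H a (block m (fst (map_prod \<phi> \<phi> z))) (block m (snd (map_prod \<phi> \<phi> z))) \<partial>square_measure)"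
    by (rule Bochner_Integration.integral_cong) (auto simp: relabel_def)
  also have "\<dots> = (\<integral>z. W z $ a * H a (block m (fst z)) (block m (snd z)) \<partial>square_measure)"
    by (rule integral_relabel) (intro bkernel_mult vkernel_component W bkernel_block m \<phi>)+
  finally show "(\<integral>z. relabel \<phi> W z $ a * H a (block m (\<phi> (fst z))) (block m (\<phi> (snd z))) \<partial>square_measure)
    = (\<integral>z. W z $ a * H a (block m (fst z)) (block m (snd z)) \<partial>square_measure)" .
qed

text \<open>The Gibbs inequality at each point of the square, with exp(H) as the reference law on
  colours, integrated.\<close>

lemma step_pairing_le_entropy:
  assumes H: "log_step m H" and \<phi>: "\<phi> \<in> mp_bijections" and U: "U \<in> graphons"
  shows "step_pairing m H \<phi> U \<le> entropy_fun U"
proof -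
  have m: "m \<ge> 1" using H by (simp add: log_step_def)
  let ?h = "\<lambda>a z. H a (block m (\<phi> (fst z))) (block m (\<phi> (snd z)))"
  have bk: "bkernel (\<lambda>z. U z $ a * ?h a z)" for a
    by (intro bkernel_mult vkernel_component graphon_vkernel U bkernel_step_relabel m \<phi>)
  have "step_pairing m H \<phi> U = (\<integral>z. (\<Sum>a\<in>UNIV. U z $ a * ?h a z) \<partial>square_measure)"
    unfolding step_pairing_def by (intro Bochner_Integration.integral_sum[symmetric] bkernel_integrable bk)
  also have "\<dots> \<le> (\<integral>z. (\<Sum>a\<in>UNIV. U z $ a * ln (U z $ a)) \<partial>square_measure)"
  proof (rule integral_mono)
    fix z assume "z \<in> space square_measure"
    then have z: "z \<in> unit_square" by simp
    then have "block m (\<phi> (fst z)) \<in> {1..m}" "block m (\<phi> (snd z)) \<in> {1..m}"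
      using block_relabel(1)[OF m \<phi>] by auto
    then have "(\<Sum>a\<in>UNIV. exp (?h a z)) = 1" using H by (auto simp: log_step_def)
    then show "(\<Sum>a\<in>UNIV. U z $ a * ?h a z) \<le> (\<Sum>a\<in>UNIV. U z $ a * ln (U z $ a))"
      by (intro gibbs_inequality graphon_bounds[OF U z])
  qed (intro bkernel_integrable bkernel_sum bk bkernel_xlnx U)+
  also have "\<dots> = entropy_fun U"
    unfolding entropy_fun_alt by (intro Bochner_Integration.integral_sum bkernel_integrable bkernel_xlnx U)
  finally show ?thesis .
qed

text \<open>It serves twice: its logarithm is the test function that detects the entropy, and it is
  the law of the independent edge colours in the lower bound. Both uses need every colour to have
  positive weight.\<close>

definition smooth_avg :: "real \<Rightarrow> nat \<Rightarrow> 'k::finite kernel \<Rightarrow> 'k \<Rightarrow> nat \<Rightarrow> nat \<Rightarrow> real" where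
  "smooth_avg \<theta> n W a u v = (1 - \<theta>) * block_avg n (\<lambda>z. W z $ a) u v + \<theta> / real CARD('k)"

lemma smooth_avg_props:
  fixes W :: "'k::finite kernel"
  assumes W: "W \<in> graphons" and n: "n \<ge> 1" and \<theta>: "0 < \<theta>" "\<theta> < 1" and uv: "u \<in> {1..n}" "v \<in> {1..n}"
  shows "\<theta> / real CARD('k) \<le> smooth_avg \<theta> n W a u v" "0 < smooth_avg \<theta> n W a u v"
    "(\<Sum>a\<in>UNIV. smooth_avg \<theta> n W a u v) = 1" "smooth_avg \<theta> n W a u v \<le> 1"
    "smooth_avg \<theta> n W a u v = smooth_avg \<theta> n W a v u"
    "\<bar>smooth_avg \<theta> n W a u v - block_avg n (\<lambda>z. W z $ a) u v\<bar> \<le> \<theta>"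
proof -
  note B = block_avg_graphon[OF W n uv]
  have k: "real CARD('k) \<ge> 1" by (simp add: Suc_leI)
  have pos: "\<theta> / real CARD('k) > 0" using \<theta> k by simp
  show lo: "\<theta> / real CARD('k) \<le> smooth_avg \<theta> n W a u v" for a
    using B(1)[of a] \<theta> by (simp add: smooth_avg_def)
  show p: "0 < smooth_avg \<theta> n W a u v" for a using lo[of a] pos by linarith
  show s: "(\<Sum>a\<in>UNIV. smooth_avg \<theta> n W a u v) = 1"
    unfolding smooth_avg_def sum.distrib sum_distrib_left[symmetric] B(3) using k by simp
  have "smooth_avg \<theta> n W a u v \<le> (\<Sum>a\<in>UNIV. smooth_avg \<theta> n W a u v)"
    by (rule member_le_sum) (auto intro: less_imp_le p)
  then show "smooth_avg \<theta> n W a u v \<le> 1" using s by simp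
  show "smooth_avg \<theta> n W a u v = smooth_avg \<theta> n W a v u" using B(2)[of a] by (simp add: smooth_avg_def)
  have "smooth_avg \<theta> n W a u v - block_avg n (\<lambda>z. W z $ a) u v = \<theta> / real CARD('k) - \<theta> * block_avg n (\<lambda>z. W z $ a) u v"
    by (simp add: smooth_avg_def algebra_simps)
  moreover have "0 \<le> \<theta> * block_avg n (\<lambda>z. W z $ a) u v" "\<theta> * block_avg n (\<lambda>z. W z $ a) u v \<le> \<theta>"
    using B(1,4)[of a] \<theta> by (auto simp: mult_left_le)
  moreover have "\<theta> / real CARD('k) \<le> \<theta>" using \<theta> k by (simp add: divide_le_eq mult_left_le)
  ultimately show "\<bar>smooth_avg \<theta> n W a u v - block_avg n (\<lambda>z. W z $ a) u v\<bar> \<le> \<theta>"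
    using pos by linarith
qed

lemma log_step_smooth_avg:
  assumes W: "W \<in> graphons" and n: "n \<ge> 1" and \<theta>: "0 < \<theta>" "\<theta> < 1"
  shows "log_step n (\<lambda>a u v. ln (smooth_avg \<theta> n W a u v))"
  unfolding log_step_def
proof (intro conjI n ballI allI)
  fix i j a assume ij: "i \<in> {1..n}" "j \<in> {1..n}"
  note P = smooth_avg_props[OF W n \<theta> ij]
  show "ln (smooth_avg \<theta> n W a i j) \<le> 0" using P(2,4)[of a] by simp
  show "ln (smooth_avg \<theta> n W a i j) = ln (smooth_avg \<theta> n W a j i)" using P(5)[of a] by simp
next
  fix i j assume ij: "i \<in> {1..n}" "j \<in> {1..n}"
  show "(\<Sum>a\<in>UNIV. exp (ln (smooth_avg \<theta> n W a i j))) = 1"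
    using smooth_avg_props(2,3)[OF W n \<theta> ij] by simp
qed

text \<open>The witness is \<open>H = ln ((1 - \<theta>) W\<^sub>m + \<theta>/k)\<close> with the block averages \<open>W\<^sub>m\<close> of \<open>W\<close>; mixing in the
  uniform graphon bounds the argument of the logarithm away from \<open>0\<close>.\<close>

lemma entropy_approx:
  fixes W :: "'k::finite kernel"
  assumes W: "W \<in> graphons" and \<kappa>: "\<kappa> > 0"
  obtains m H where "log_step m H" "entropy_fun W - \<kappa> \<le> step_pairing m H (\<lambda>x. x) W"
proof -
  define k where "k = real CARD('k)"
  have k: "k \<ge> 1" unfolding k_def by (simp add: Suc_leI)
  \<comment> \<open>The loss \<kappa> is shared equally: \<open>ln (1 - \<theta>)\<close> is
    -\<kappa>/2, and the L1 error of the block averages, after division by the lower bound p of V,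
    costs \<kappa>/(2k) for each of the k colours.\<close>
  define \<theta> where "\<theta> = 1 - exp (- \<kappa> / 2)"
  have \<theta>: "0 < \<theta>" "\<theta> < 1" "ln (1 - \<theta>) = - \<kappa> / 2" using \<kappa> by (auto simp: \<theta>_def)
  define p where "p = \<theta> / k"
  have p: "p > 0" using \<theta> k by (simp add: p_def)
  have pos: "\<kappa> * p / (2 * k) > 0" using \<kappa> p k by simp
  define d where "d a n = (\<integral>z. \<bar>W z $ a - block_avg n (\<lambda>z. W z $ a) (block n (fst z)) (block n (snd z))\<bar> \<partial>square_measure)" for a n
  obtain m where m: "m \<ge> 1" and L1: "\<And>a. d a m < \<kappa> * p / (2 * k)"
    using step_graphon_L1[OF W pos, folded d_def] by (metis order_refl)
  define w where "w a = block_avg m (\<lambda>z. W z $ a)" for a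
  define V where "V = smooth_avg \<theta> m W"
  have V_def': "V a i j = (1 - \<theta>) * w a i j + p" for a i j
    by (simp add: V_def smooth_avg_def w_def p_def k_def)
  define H where "H a i j = ln (V a i j)" for a i j
  have Vp: "V a i j \<ge> p" if "i \<in> {1..m}" "j \<in> {1..m}" for a i j
    using smooth_avg_props(1)[OF W m \<theta>(1,2) that] by (simp add: V_def p_def k_def)
  have lg: "log_step m H"
    unfolding H_def V_def by (rule log_step_smooth_avg[OF W m \<theta>(1,2)])
  let ?b = "\<lambda>f z. f (block m (fst z)) (block m (snd z))"
  have bW: "bkernel (\<lambda>z. W z $ a)" for a by (intro vkernel_component graphon_vkernel W)
  have pt: "W z $ a * ln (W z $ a) + W z $ a * ln (1 - \<theta>) - \<bar>W z $ a - ?b (w a) z\<bar> / p \<le> W z $ a * ?b (H a) z"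
    if z: "z \<in> unit_square" for z a
  proof (cases "W z $ a = 0")
    case True
    then show ?thesis using p by simp
  next
    case False
    let ?W = "W z $ a" and ?V = "?b (V a) z"
    \<comment> \<open>\<open>?g\<close> applies the smoothing to W itself instead of its average.
      Dropping p compares it with W at the cost of \<open>ln (1 - \<theta>)\<close>, and since V is
      at least p its logarithm differs from that of V by at most the L1 integrand over p.\<close>
    let ?g = "(1 - \<theta>) * ?W + p"
    have Wp: "0 < ?W" "?W \<le> 1" using graphon_bounds(1,2)[OF W z, of a] False by (auto simp: less_le)
    have bl: "block m (fst z) \<in> {1..m}" "block m (snd z) \<in> {1..m}" using z block_range[OF m] by auto
    have Vpos: "?V \<ge> p" by (rule Vp[OF bl])
    have gpos: "?g > 0" using \<theta> Wp p by (simp add: add_nonneg_pos)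
    have "ln ((1 - \<theta>) * ?W) \<le> ln ?g" using \<theta> Wp p by (subst ln_le_cancel_iff) (auto simp: gpos)
    then have 1: "ln (1 - \<theta>) + ln ?W \<le> ln ?g" using \<theta> Wp by (simp add: ln_mult)
    have "ln ?g - ln ?V = ln (?g / ?V)" using gpos Vpos p by (simp add: ln_div)
    also have "\<dots> \<le> ?g / ?V - 1" using gpos Vpos p by (intro ln_le_minus_one divide_pos_pos) auto
    also have "\<dots> = (1 - \<theta>) * (?W - ?b (w a) z) / ?V" using Vpos p by (simp add: V_def' field_simps)
    also have "\<dots> \<le> \<bar>?W - ?b (w a) z\<bar> / p"
    proof (rule frac_le)
      show "(1 - \<theta>) * (?W - ?b (w a) z) \<le> \<bar>?W - ?b (w a) z\<bar>"
      proof -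
        have "(1 - \<theta>) * (?W - ?b (w a) z) \<le> (1 - \<theta>) * \<bar>?W - ?b (w a) z\<bar>"
          using \<theta> by (intro mult_left_mono) auto
        also have "\<dots> \<le> 1 * \<bar>?W - ?b (w a) z\<bar>" using \<theta> by (intro mult_right_mono) auto
        finally show ?thesis by simp
      qed
    qed (use p Vpos in auto)
    finally have 2: "ln ?g - \<bar>?W - ?b (w a) z\<bar> / p \<le> ln ?V" by simp
    have "?W * (ln ?W + ln (1 - \<theta>) - \<bar>?W - ?b (w a) z\<bar> / p) \<le> ?W * ln ?V"
      using 1 2 Wp by (intro mult_left_mono) auto
    moreover have "?W * (\<bar>?W - ?b (w a) z\<bar> / p) \<le> \<bar>?W - ?b (w a) z\<bar> / p"
      using Wp p by (intro mult_left_le_one_le) auto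
    ultimately show ?thesis unfolding H_def by (simp add: algebra_simps)
  qed
  have int: "(\<integral>z. W z $ a * ln (W z $ a) \<partial>square_measure) + ln (1 - \<theta>) * (\<integral>z. W z $ a \<partial>square_measure) - \<kappa> / (2 * k)
    \<le> (\<integral>z. W z $ a * ?b (H a) z \<partial>square_measure)" for a
  proof -
    have bd: "bkernel (\<lambda>z. \<bar>W z $ a - ?b (w a) z\<bar>)"
      by (intro bkernel_abs bkernel_diff bW bkernel_block m)
    have "(\<integral>z. W z $ a * ln (W z $ a) + ln (1 - \<theta>) * W z $ a - (1/p) * \<bar>W z $ a - ?b (w a) z\<bar> \<partial>square_measure)
      \<le> (\<integral>z. W z $ a * ?b (H a) z \<partial>square_measure)"
    proof (rule integral_mono)
      fix z assume "z \<in> space square_measure"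
      then have "z \<in> unit_square" by simp
      from pt[OF this, of a]
      show "W z $ a * ln (W z $ a) + ln (1 - \<theta>) * W z $ a - (1/p) * \<bar>W z $ a - ?b (w a) z\<bar> \<le> W z $ a * ?b (H a) z"
        by (simp add: mult.commute)
    qed (intro bkernel_integrable bkernel_diff bkernel_add bkernel_cmult bkernel_mult bkernel_xlnx W bW bkernel_block m bd)+
    also have "(\<integral>z. W z $ a * ln (W z $ a) + ln (1 - \<theta>) * W z $ a - (1/p) * \<bar>W z $ a - ?b (w a) z\<bar> \<partial>square_measure)
      = (\<integral>z. W z $ a * ln (W z $ a) \<partial>square_measure) + ln (1 - \<theta>) * (\<integral>z. W z $ a \<partial>square_measure)
        - (1/p) * (\<integral>z. \<bar>W z $ a - ?b (w a) z\<bar> \<partial>square_measure)"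
      by (subst Bochner_Integration.integral_diff Bochner_Integration.integral_add;
          (intro bkernel_integrable bkernel_add bkernel_cmult bkernel_xlnx W bW bd)?)+ simp
    finally have "(\<integral>z. W z $ a * ln (W z $ a) \<partial>square_measure) + ln (1 - \<theta>) * (\<integral>z. W z $ a \<partial>square_measure)
        - (1/p) * (\<integral>z. \<bar>W z $ a - ?b (w a) z\<bar> \<partial>square_measure) \<le> (\<integral>z. W z $ a * ?b (H a) z \<partial>square_measure)" .
    moreover have "(1/p) * (\<integral>z. \<bar>W z $ a - ?b (w a) z\<bar> \<partial>square_measure) \<le> (1/p) * (\<kappa> * p / (2 * k))"
      using L1[of a] p unfolding w_def d_def by (intro mult_left_mono) auto
    moreover have "(1/p) * (\<kappa> * p / (2 * k)) = \<kappa> / (2 * k)" using p by simp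
    ultimately show ?thesis by linarith
  qed
  have "(\<Sum>a\<in>UNIV. \<integral>z. W z $ a \<partial>square_measure) = (\<integral>z. (\<Sum>a\<in>UNIV. W z $ a) \<partial>square_measure)"
    by (intro Bochner_Integration.integral_sum[symmetric] bkernel_integrable bW)
  also have "\<dots> = (\<integral>z. 1 \<partial>square_measure)"
    by (rule Bochner_Integration.integral_cong) (use graphon_bounds(3)[OF W] in auto)
  finally have one: "(\<Sum>a\<in>UNIV. \<integral>z. W z $ a \<partial>square_measure) = 1"
    using square.prob_space by simp
  have "(\<Sum>a\<in>UNIV. (\<integral>z. W z $ a * ln (W z $ a) \<partial>square_measure) + ln (1 - \<theta>) * (\<integral>z. W z $ a \<partial>square_measure) - \<kappa> / (2 * k))
    \<le> (\<Sum>a\<in>UNIV. \<integral>z. W z $ a * ?b (H a) z \<partial>square_measure)"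
    by (rule sum_mono) (rule int)
  then have "entropy_fun W + ln (1 - \<theta>) - \<kappa> / 2 \<le> step_pairing m H (\<lambda>x. x) W"
    unfolding sum_subtractf sum.distrib sum_distrib_left[symmetric] one step_pairing_def entropy_fun_alt
    using k by (simp add: k_def)
  then have "entropy_fun W - \<kappa> \<le> step_pairing m H (\<lambda>x. x) W" using \<theta>(3) by linarith
  with lg show ?thesis by (rule that)
qed

text \<open>On a whole neighbourhood of W a single test function \<open>H\<close> certifies almost
  the entropy of W, and only the relabelling depends on U. Counting needs this form, since there
  \<open>H\<close> must be fixed before the colouring.\<close>

lemma entropy_local:
  assumes W: "W \<in> graphons" and \<kappa>: "\<kappa> > 0"
  obtains m H \<eta> where "log_step m H" "\<eta> > 0"
    "\<And>U. U \<in> graphons \<Longrightarrow> cut_dist U W < \<eta> \<Longrightarrow> \<exists>\<phi>\<in>mp_bijections. entropy_fun W - \<kappa> \<le> step_pairing m H \<phi> U"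
proof -
  obtain m H where H: "log_step m H" "entropy_fun W - \<kappa>/2 \<le> step_pairing m H (\<lambda>x. x) W"
    using entropy_approx[OF W, of "\<kappa>/2"] \<kappa> by auto
  have m: "m \<ge> 1" using H by (simp add: log_step_def)
  define C where "C = (\<Sum>a\<in>UNIV. \<Sum>i=1..m. \<Sum>j=1..m. \<bar>H a i j\<bar>)"
  have C: "C \<ge> 0" unfolding C_def by (intro sum_nonneg) auto
  show ?thesis
  proof (rule that[OF H(1)])
    \<comment> \<open>C is the Lipschitz constant of the pairing, so this radius costs at most
      \<kappa>/2; adding 1 keeps the denominator positive when C is zero.\<close>
    show "\<kappa> / (2 * (C + 1)) > 0" using \<kappa> C by simp
    fix U assume U: "U \<in> graphons" "cut_dist U W < \<kappa> / (2 * (C + 1))"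
    obtain \<phi> where \<phi>: "\<phi> \<in> mp_bijections" "cut_norm_vec (\<lambda>z. U z - relabel \<phi> W z) < \<kappa> / (2 * (C + 1))"
      using cut_dist_lessD[OF U(1) W U(2)] by blast
    have "\<bar>step_pairing m H \<phi> U - step_pairing m H \<phi> (relabel \<phi> W)\<bar> \<le> C * cut_norm_vec (\<lambda>z. U z - relabel \<phi> W z)"
      unfolding C_def by (intro step_pairing_lipschitz m \<phi> graphon_vkernel relabel_graphon U W)
    also have "\<dots> \<le> C * (\<kappa> / (2 * (C + 1)))" using \<phi>(2) C by (intro mult_left_mono) auto
    also have "\<dots> \<le> \<kappa> / 2" using C \<kappa> by (simp add: field_simps)
    finally have "step_pairing m H \<phi> (relabel \<phi> W) - \<kappa>/2 \<le> step_pairing m H \<phi> U" by linarith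
    then show "\<exists>\<phi>\<in>mp_bijections. entropy_fun W - \<kappa> \<le> step_pairing m H \<phi> U"
      using H(2) \<phi>(1) step_pairing_relabel[OF m \<phi>(1) graphon_vkernel[OF W], of H] by (intro bexI[OF _ \<phi>(1)]) simp
  qed
qed

lemma entropy_lower_semicontinuous:
  assumes W: "W \<in> graphons" and \<kappa>: "\<kappa> > 0"
  obtains \<eta> where "\<eta> > 0" "\<And>U. U \<in> graphons \<Longrightarrow> cut_dist U W < \<eta> \<Longrightarrow> entropy_fun W - \<kappa> \<le> entropy_fun U"
proof -
  obtain m H \<eta> where *: "log_step m H" "\<eta> > 0"
    "\<And>U. U \<in> graphons \<Longrightarrow> cut_dist U W < \<eta> \<Longrightarrow> \<exists>\<phi>\<in>mp_bijections. entropy_fun W - \<kappa> \<le> step_pairing m H \<phi> U"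
    using entropy_local[OF assms] by metis
  show ?thesis
    using *(2)
  proof (rule that)
    fix U assume U: "U \<in> graphons" "cut_dist U W < \<eta>"
    from *(3)[OF this] obtain \<phi> where \<phi>: "\<phi> \<in> mp_bijections" "entropy_fun W - \<kappa> \<le> step_pairing m H \<phi> U" by (rule bexE)
    then show "entropy_fun W - \<kappa> \<le> entropy_fun U"
      using step_pairing_le_entropy[OF *(1) \<phi>(1) U(1)] by linarith
  qed
qed

lemma entropy_bounds:
  fixes W :: "'k::finite kernel"
  assumes "W \<in> graphons" shows "- real CARD('k) \<le> entropy_fun W" "entropy_fun W \<le> 0"
proof -
  have "- 1 \<le> (\<integral>z. W z $ a * ln (W z $ a) \<partial>square_measure)" "(\<integral>z. W z $ a * ln (W z $ a) \<partial>square_measure) \<le> 0" for a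
  proof -
    have *: "-1 \<le> W z $ a * ln (W z $ a)" "W z $ a * ln (W z $ a) \<le> 0" if "z \<in> space square_measure" for z
      using xlnx_bounds[OF graphon_bounds(1,2)[OF assms]] that by (metis space_lebesgue_on)+
    have "(\<integral>z. - 1 \<partial>square_measure) \<le> (\<integral>z. W z $ a * ln (W z $ a) \<partial>square_measure)"
      by (rule integral_mono) (use * in \<open>auto intro!: bkernel_integrable bkernel_xlnx assms\<close>)
    then show "- 1 \<le> (\<integral>z. W z $ a * ln (W z $ a) \<partial>square_measure)" using square.prob_space by simp
    have "(\<integral>z. W z $ a * ln (W z $ a) \<partial>square_measure) \<le> (\<integral>z. 0 \<partial>square_measure)"
      by (rule integral_mono) (use * in \<open>auto intro!: bkernel_integrable bkernel_xlnx assms\<close>)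
    then show "(\<integral>z. W z $ a * ln (W z $ a) \<partial>square_measure) \<le> 0" by simp
  qed
  then show "- real CARD('k) \<le> entropy_fun W" "entropy_fun W \<le> 0"
    unfolding entropy_fun_alt using sum_mono[of UNIV "\<lambda>a. -1::real"] by (fastforce, intro sum_nonpos) 
qed

subsection \<open>Edge colourings\<close>

lemma sum_UN_le:
  fixes h :: "'a \<Rightarrow> real"
  assumes "finite I" "\<And>i. finite (B i)" "\<And>x. 0 \<le> h x"
  shows "sum h (\<Union>i\<in>I. B i) \<le> (\<Sum>i\<in>I. sum h (B i))"
  using assms(1)
proof (induction I rule: finite_induct)
  case (insert i I)
  have "sum h (B i \<union> (\<Union>i\<in>I. B i)) \<le> sum h (B i) + sum h (\<Union>i\<in>I. B i)"
    by (subst sum.union_inter[symmetric]) (use insert assms in \<open>auto intro!: sum_nonneg\<close>)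
  then show ?case using insert by simp
qed simp

lemma finite_complete_edges: "finite (complete_edges n)"
  by (rule finite_subset[of _ "Pow {1..n}"]) (auto simp: complete_edges_def)

lemma edge_Min_Max:
  assumes "e \<in> complete_edges n"
  shows "Min e < Max e" "Min e \<in> {1..n}" "Max e \<in> {1..n}" "e = {Min e, Max e}"
proof -
  obtain u v where "e = {u, v}" "u \<noteq> v" using assms by (auto simp: complete_edges_def card_2_iff)
  then obtain u v where e: "e = {u, v}" "u < v" by (metis insert_commute linorder_neqE_nat)
  then have "Min e = u" "Max e = v" by auto
  then show "Min e < Max e" "Min e \<in> {1..n}" "Max e \<in> {1..n}" "e = {Min e, Max e}"
    using e assms by (auto simp: complete_edges_def)
qed

text \<open>Edges are two-element sets; \<open>Min\<close> and \<open>Max\<close> give each of them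
  a canonical orientation.\<close>

lemma sum_less_pairs:
  fixes F :: "nat \<Rightarrow> nat \<Rightarrow> real"
  shows "(\<Sum>u=1..n. \<Sum>v\<in>{v\<in>{1..n}. u < v}. F u v) = (\<Sum>e\<in>complete_edges n. F (Min e) (Max e))"
proof -
  have "(\<Sum>u=1..n. \<Sum>v\<in>{v\<in>{1..n}. u < v}. F u v) = (\<Sum>(u, v)\<in>(SIGMA u:{1..n}. {v\<in>{1..n}. u < v}). F u v)"
    by (rule sum.Sigma) auto
  also have "\<dots> = (\<Sum>e\<in>complete_edges n. F (Min e) (Max e))"
  proof (rule sum.reindex_bij_witness[where i = "\<lambda>e. (Min e, Max e)" and j = "\<lambda>(u, v). {u, v}"])
    fix p assume "p \<in> (SIGMA u:{1..n}. {v\<in>{1..n}. u < v})"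
    then obtain u v where p: "p = (u, v)" "u \<in> {1..n}" "v \<in> {1..n}" "u < v" by auto
    then have mm: "Min {u, v} = u" "Max {u, v} = v" by auto
    show "(Min (case p of (u, v) \<Rightarrow> {u, v}), Max (case p of (u, v) \<Rightarrow> {u, v})) = p" using p mm by simp
    show "(case p of (u, v) \<Rightarrow> {u, v}) \<in> complete_edges n" using p by (auto simp: complete_edges_def)
    show "F (Min (case p of (u, v) \<Rightarrow> {u, v})) (Max (case p of (u, v) \<Rightarrow> {u, v})) = (case p of (u, v) \<Rightarrow> F u v)"
      using p mm by simp
  next
    fix e assume e: "e \<in> complete_edges n"
    note E = edge_Min_Max[OF e]
    show "(case (Min e, Max e) of (u, v) \<Rightarrow> {u, v}) = e" using E(4) by simp
    show "(Min e, Max e) \<in> (SIGMA u:{1..n}. {v\<in>{1..n}. u < v})" using E by auto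
  qed
  finally show ?thesis .
qed

text \<open>Every edge comes from two ordered pairs. This is where the factor 1/2 in front of the
  entropy originates.\<close>

lemma sum_distinct_pairs:
  fixes F :: "nat \<Rightarrow> nat \<Rightarrow> real"
  shows "(\<Sum>u=1..n. \<Sum>v\<in>{1..n} - {u}. F u v) = (\<Sum>e\<in>complete_edges n. F (Min e) (Max e) + F (Max e) (Min e))"
proof -
  have split: "(\<Sum>v\<in>{1..n} - {u}. F u v) = (\<Sum>v\<in>{v\<in>{1..n}. u < v}. F u v) + (\<Sum>v\<in>{v\<in>{1..n}. v < u}. F u v)" for u
  proof -
    have "{1..n} - {u} = {v\<in>{1..n}. u < v} \<union> {v\<in>{1..n}. v < u}" by auto
    show ?thesis unfolding \<open>{1..n} - {u} = _\<close> by (rule sum.union_disjoint) auto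
  qed
  have "(\<Sum>u=1..n. \<Sum>v\<in>{v\<in>{1..n}. v < u}. F u v) = (\<Sum>v=1..n. \<Sum>u\<in>{u\<in>{1..n}. v < u}. F u v)"
    by (rule sum.swap_restrict) auto
  also have "\<dots> = (\<Sum>e\<in>complete_edges n. F (Max e) (Min e))" by (rule sum_less_pairs)
  finally show ?thesis unfolding split sum.distrib sum_less_pairs by simp
qed

text \<open>Distributivity, read as independence: weights that factor over the edges have a total
  mass that factors as well.\<close>

lemma sum_prod_colourings:
  fixes h :: "nat set \<Rightarrow> 'k::finite \<Rightarrow> real"
  shows "(\<Sum>X\<in>colourings n. \<Prod>e\<in>complete_edges n. h e (X e)) = (\<Prod>e\<in>complete_edges n. \<Sum>a\<in>UNIV. h e a)"
  unfolding colourings_def by (rule prod_sum_PiE[symmetric]) (auto simp: finite_complete_edges)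

subsection \<open>Counting colourings near a graphon\<close>

text \<open>The objective is affine in each \<open>q u\<close>, so replacing the \<open>q u\<close> one after the other by a
  suitable vertex of the simplex does not decrease it.\<close>

lemma multilinear_rounding:
  fixes q :: "'v \<Rightarrow> 'i \<Rightarrow> real" and G :: "'v \<Rightarrow> 'v \<Rightarrow> 'i \<Rightarrow> 'i \<Rightarrow> real"
  assumes V: "finite V" and I: "finite I" and q: "\<And>u i. u \<in> V \<Longrightarrow> i \<in> I \<Longrightarrow> 0 \<le> q u i"
    "\<And>u. u \<in> V \<Longrightarrow> (\<Sum>i\<in>I. q u i) = 1"
  obtains \<tau> where "\<tau> \<in> V \<rightarrow>\<^sub>E I"
    "(\<Sum>u\<in>V. \<Sum>v\<in>V - {u}. \<Sum>i\<in>I. \<Sum>j\<in>I. q u i * q v j * G u v i j) \<le> (\<Sum>u\<in>V. \<Sum>v\<in>V - {u}. G u v (\<tau> u) (\<tau> v))"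
proof -
  define T where "T p u v = (\<Sum>i\<in>I. \<Sum>j\<in>I. p u i * p v j * G u v i j)" for p :: "'v \<Rightarrow> 'i \<Rightarrow> real" and u v
  define val where "val p = (\<Sum>u\<in>V. \<Sum>v\<in>V - {u}. T p u v)" for p
  define \<delta> where "\<delta> l = (\<lambda>i. if i = l then 1 else 0 :: real)" for l :: 'i
  \<comment> \<open>For u different from v the vertex w occurs in at most one of the two factors, so
    the term is affine in \<open>p w\<close>. A diagonal term would be quadratic.\<close>
  have lin: "T p u v = (\<Sum>l\<in>I. p w l * T (p(w := \<delta> l)) u v)"
    if p1: "(\<Sum>i\<in>I. p w i) = 1" and uv: "u \<noteq> v" for p w u v
  proof -
    consider "w = u" | "w = v" | "w \<noteq> u" "w \<noteq> v" by blast
    then show ?thesis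
    proof cases
      case 1
      have "T (p(w := \<delta> l)) u v = (\<Sum>j\<in>I. p v j * G u v l j)" if "l \<in> I" for l
      proof -
        have "T (p(w := \<delta> l)) u v = (\<Sum>i\<in>I. if i = l then (\<Sum>j\<in>I. p v j * G u v i j) else 0)"
          unfolding T_def using 1 uv by (intro sum.cong) (auto simp: \<delta>_def)
        then show ?thesis using that I by simp
      qed
      then have "(\<Sum>l\<in>I. p w l * T (p(w := \<delta> l)) u v) = (\<Sum>l\<in>I. p w l * (\<Sum>j\<in>I. p v j * G u v l j))" by simp
      also have "\<dots> = T p u v" unfolding T_def 1 by (simp add: sum_distrib_left mult.assoc)
      finally show ?thesis by simp
    next
      case 2
      have "T (p(w := \<delta> l)) u v = (\<Sum>i\<in>I. p u i * G u v i l)" if "l \<in> I" for l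
      proof -
        have "T (p(w := \<delta> l)) u v = (\<Sum>i\<in>I. \<Sum>j\<in>I. if j = l then p u i * G u v i j else 0)"
          unfolding T_def using 2 uv by (intro sum.cong) (auto simp: \<delta>_def)
        then show ?thesis using that I by simp
      qed
      then have "(\<Sum>l\<in>I. p w l * T (p(w := \<delta> l)) u v) = (\<Sum>l\<in>I. \<Sum>i\<in>I. p w l * (p u i * G u v i l))"
        by (simp add: sum_distrib_left)
      also have "\<dots> = (\<Sum>i\<in>I. \<Sum>l\<in>I. p w l * (p u i * G u v i l))" by (rule sum.swap)
      also have "\<dots> = T p u v" unfolding T_def 2 by (simp add: mult_ac)
      finally show ?thesis by simp
    next
      case 3
      then have "T (p(w := \<delta> l)) u v = T p u v" for l unfolding T_def by simp
      then show ?thesis using p1 by (simp add: sum_distrib_right[symmetric])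
    qed
  qed
  have val_lin: "val p = (\<Sum>l\<in>I. p w l * val (p(w := \<delta> l)))" if p1: "(\<Sum>i\<in>I. p w i) = 1" for p w
  proof -
    have "val p = (\<Sum>u\<in>V. \<Sum>v\<in>V - {u}. \<Sum>l\<in>I. p w l * T (p(w := \<delta> l)) u v)"
      unfolding val_def by (intro sum.cong refl lin p1) auto
    also have "\<dots> = (\<Sum>u\<in>V. \<Sum>l\<in>I. \<Sum>v\<in>V - {u}. p w l * T (p(w := \<delta> l)) u v)"
      by (intro sum.cong refl sum.swap)
    also have "\<dots> = (\<Sum>l\<in>I. \<Sum>u\<in>V. \<Sum>v\<in>V - {u}. p w l * T (p(w := \<delta> l)) u v)" by (rule sum.swap)
    finally show ?thesis unfolding val_def by (simp add: sum_distrib_left)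
  qed
  \<comment> \<open>Induction on the set A of vertices that have already been rounded.\<close>
  have "\<exists>\<tau>. (\<forall>u\<in>A. \<tau> u \<in> I) \<and> val q \<le> val (\<lambda>u. if u \<in> A then \<delta> (\<tau> u) else q u)" if "A \<subseteq> V" for A
    using finite_subset[OF that V] that
  proof (induction A rule: finite_induct)
    case empty
    show ?case by simp
  next
    case (insert w A)
    then obtain \<tau> where \<tau>: "\<And>u. u \<in> A \<Longrightarrow> \<tau> u \<in> I" "val q \<le> val (\<lambda>u. if u \<in> A then \<delta> (\<tau> u) else q u)" by auto
    define p where "p = (\<lambda>u. if u \<in> A then \<delta> (\<tau> u) else q u)"
    have pw: "p w = q w" using insert by (simp add: p_def)
    have w: "w \<in> V" using insert by simp
    have p1: "(\<Sum>i\<in>I. p w i) = 1" using q(2)[OF w] pw by simp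
    have "\<exists>l\<in>I. val p \<le> val (p(w := \<delta> l))"
    proof (rule ccontr)
      assume "\<not> ?thesis"
      then have less: "\<And>l. l \<in> I \<Longrightarrow> val (p(w := \<delta> l)) < val p" by force
      \<comment> \<open>A positive weight makes the averaged inequality strict: if every choice at w
        lowered the value, so would their mean, which equals the value itself.\<close>
      have "\<exists>l\<in>I. q w l > 0"
      proof (rule ccontr)
        assume "\<not> ?thesis"
        then have "(\<Sum>i\<in>I. q w i) \<le> 0" by (intro sum_nonpos) force
        then show False using q(2)[OF w] by simp
      qed
      then obtain l0 where l0: "l0 \<in> I" "q w l0 > 0" by blast
      have "(\<Sum>l\<in>I. p w l * val (p(w := \<delta> l))) < (\<Sum>l\<in>I. p w l * val p)"
      proof (rule sum_strict_mono_ex1[OF I])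
        show "\<forall>l\<in>I. p w l * val (p(w := \<delta> l)) \<le> p w l * val p"
          unfolding pw by (intro ballI mult_left_mono less_imp_le[OF less] q(1)[OF w])
        show "\<exists>l\<in>I. p w l * val (p(w := \<delta> l)) < p w l * val p"
          using l0 less unfolding pw by (intro bexI[of _ l0]) auto
      qed
      also have "(\<Sum>l\<in>I. p w l * val p) = val p" using p1 by (simp add: sum_distrib_right[symmetric])
      finally show False using val_lin[where p = p and w = w, OF p1] by simp
    qed
    then obtain l where l: "l \<in> I" "val p \<le> val (p(w := \<delta> l))" by blast
    have "p(w := \<delta> l) = (\<lambda>u. if u \<in> insert w A then \<delta> ((\<tau>(w := l)) u) else q u)"
      using insert by (auto simp: p_def fun_eq_iff)
    then show ?case
      using \<tau> l insert unfolding p_def[symmetric] by (intro exI[of _ "\<tau>(w := l)"]) auto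
  qed
  from this[OF subset_refl] obtain \<tau> where \<tau>: "\<And>u. u \<in> V \<Longrightarrow> \<tau> u \<in> I"
    "val q \<le> val (\<lambda>u. if u \<in> V then \<delta> (\<tau> u) else q u)" by blast
  show ?thesis
  proof (rule that)
    show "restrict \<tau> V \<in> V \<rightarrow>\<^sub>E I" using \<tau>(1) by auto
    have "T (\<lambda>u. if u \<in> V then \<delta> (\<tau> u) else q u) u v = G u v (\<tau> u) (\<tau> v)" if "u \<in> V" "v \<in> V" for u v
    proof -
      have "T (\<lambda>u. if u \<in> V then \<delta> (\<tau> u) else q u) u v
        = (\<Sum>i\<in>I. if i = \<tau> u then (\<Sum>j\<in>I. if j = \<tau> v then G u v i j else 0) else 0)"
        unfolding T_def using that by (intro sum.cong) (auto simp: \<delta>_def intro!: sum.cong)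
      then show ?thesis using \<tau>(1) that I by simp
    qed
    then have "val (\<lambda>u. if u \<in> V then \<delta> (\<tau> u) else q u) = (\<Sum>u\<in>V. \<Sum>v\<in>V - {u}. G u v (restrict \<tau> V u) (restrict \<tau> V v))"
      unfolding val_def by (intro sum.cong refl) auto
    then show "(\<Sum>u\<in>V. \<Sum>v\<in>V - {u}. \<Sum>i\<in>I. \<Sum>j\<in>I. q u i * q v j * G u v i j)
      \<le> (\<Sum>u\<in>V. \<Sum>v\<in>V - {u}. G u v (restrict \<tau> V u) (restrict \<tau> V v))"
      using \<tau>(2) unfolding val_def T_def by simp
  qed
qed

lemma empirical_graphon_component:
  fixes X :: "nat set \<Rightarrow> 'k::finite"
  assumes "z \<in> unit_square"
  shows "empirical_graphon n X z $ a = (if block n (fst z) = block n (snd z) then 1 / real CARD('k)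
    else if X {block n (fst z), block n (snd z)} = a then 1 else 0)"
  using assms by (cases z) (simp add: empirical_graphon_def Let_def)

lemma empirical_pairing_le:
  fixes X :: "nat set \<Rightarrow> 'k::finite"
  assumes n: "n \<ge> 1" and H: "log_step m H" and \<phi>: "\<phi> \<in> mp_bijections"
  obtains \<tau> where "\<tau> \<in> {1..n} \<rightarrow>\<^sub>E {1..m}"
    "(real n)\<^sup>2 * step_pairing m H \<phi> (empirical_graphon n X)
      \<le> (\<Sum>u=1..n. \<Sum>v\<in>{1..n} - {u}. H (X {u, v}) (\<tau> u) (\<tau> v))"
proof -
  have m: "m \<ge> 1" using H by (simp add: log_step_def)
  define c where "c x = block m (\<phi> x)" for x
  \<comment> \<open>The joint label records the vertex whose cell contains x and the block of the
    test function into which \<phi> moves x.\<close>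
  define t where "t x = (block n x, c x)" for x
  define S where "S p = {x \<in> {0..1}. t x = p}" for p
  define K where "K p r = (if fst p = fst r then 0 else H (X {fst p, fst r}) (snd p) (snd r))" for p r :: "nat \<times> nat"
  \<comment> \<open>The fraction of the cell of vertex u that is sent to block i; the factor n
    normalises the length 1/n of a cell, so each \<open>q u\<close> is a probability vector.\<close>
  define q where "q u i = n * measure unit_measure (S (u, i))" for u i
  let ?I = "{1..n} \<times> {1..m}"
  have S: "S p \<in> sets unit_measure" for p
  proof -
    have eq: "S p = cell n (fst p) \<inter> {x \<in> {0..1}. block m (\<phi> x) = snd p}"
      unfolding S_def t_def c_def by (cases p) auto
    show ?thesis unfolding eq by (rule sets.Int[OF cell_measurable block_relabel(2)[OF m \<phi>]])
  qed
  have tI: "t x \<in> ?I" if "x \<in> {0..1}" for x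
    unfolding t_def c_def using block_range[OF n that] block_relabel(1)[OF m \<phi> that] by simp
  have bkK: "bkernel (\<lambda>z. K (t (fst z)) (t (snd z)))"
    by (rule step_integral(2)[OF bkernel_const[of 1], of ?I]) (use tI S in \<open>auto simp: S_def\<close>)
  have bkH: "bkernel (\<lambda>z. empirical_graphon n X z $ a * H a (c (fst z)) (c (snd z)))" for a
    unfolding c_def
    by (intro bkernel_mult vkernel_component graphon_vkernel empirical_graphon_in_graphons bkernel_step_relabel m \<phi>)
  \<comment> \<open>Off the diagonal the empirical graphon puts all mass on the colour of the edge
    and equality holds. On the diagonal the left side is nonpositive and K was set to 0.\<close>
  have pt: "(\<Sum>a\<in>UNIV. empirical_graphon n X z $ a * H a (c (fst z)) (c (snd z))) \<le> K (t (fst z)) (t (snd z))"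
    if z: "z \<in> unit_square" for z
  proof (cases "block n (fst z) = block n (snd z)")
    case True
    have "c (fst z) \<in> {1..m}" "c (snd z) \<in> {1..m}" unfolding c_def using z block_relabel(1)[OF m \<phi>] by auto
    then have "H a (c (fst z)) (c (snd z)) \<le> 0" for a using H by (auto simp: log_step_def)
    then have "(\<Sum>a\<in>UNIV. empirical_graphon n X z $ a * H a (c (fst z)) (c (snd z))) \<le> 0"
      by (intro sum_nonpos mult_nonneg_nonpos graphon_bounds(1)[OF empirical_graphon_in_graphons z])
    then show ?thesis using True by (simp add: K_def t_def)
  next
    case False
    have "(\<Sum>a\<in>UNIV. empirical_graphon n X z $ a * H a (c (fst z)) (c (snd z)))
      = (\<Sum>a\<in>UNIV. if a = X {block n (fst z), block n (snd z)} then H a (c (fst z)) (c (snd z)) else 0)"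
      by (intro sum.cong refl) (use False in \<open>auto simp: empirical_graphon_component[OF z]\<close>)
    then show ?thesis using False by (simp add: K_def t_def)
  qed
  have "step_pairing m H \<phi> (empirical_graphon n X)
    = (\<integral>z. (\<Sum>a\<in>UNIV. empirical_graphon n X z $ a * H a (c (fst z)) (c (snd z))) \<partial>square_measure)"
    unfolding step_pairing_def c_def[symmetric]
    by (intro Bochner_Integration.integral_sum[symmetric] bkernel_integrable bkH)
  also have "\<dots> \<le> (\<integral>z. 1 * K (t (fst z)) (t (snd z)) \<partial>square_measure)"
    by (rule integral_mono) (use pt in \<open>auto intro!: bkernel_integrable bkernel_sum bkH bkK simp del: mem_Times_iff\<close>)
  also have "\<dots> = (\<Sum>p\<in>?I. \<Sum>r\<in>?I. K p r * rect_integral (S p) (S r) (\<lambda>z. 1))"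
    unfolding S_def by (rule step_integral(1)[OF bkernel_const]) (use tI S in \<open>auto simp: S_def\<close>)
  also have "\<dots> = (\<Sum>p\<in>?I. \<Sum>r\<in>?I. K p r * (measure unit_measure (S p) * measure unit_measure (S r)))"
  proof (intro sum.cong refl arg_cong2[where f = "(*)"])
    fix p r
    have "S p \<times> S r \<inter> space square_measure = S p \<times> S r"
      unfolding S_def by auto
    then show "rect_integral (S p) (S r) (\<lambda>z. 1) = measure unit_measure (S p) * measure unit_measure (S r)"
      unfolding rect_integral_def by (simp only: mult_1_right Bochner_Integration.integral_indicator measure_square_Times[OF S S])
  qed
  also have "\<dots> = (\<Sum>u=1..n. \<Sum>i=1..m. \<Sum>v=1..n. \<Sum>j=1..m. K (u, i) (v, j) * (measure unit_measure (S (u, i)) * measure unit_measure (S (v, j))))"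
    by (simp only: sum.cartesian_product')
  also have "\<dots> = (\<Sum>u=1..n. \<Sum>v=1..n. \<Sum>i=1..m. \<Sum>j=1..m. K (u, i) (v, j) * (measure unit_measure (S (u, i)) * measure unit_measure (S (v, j))))"
    by (intro sum.cong refl sum.swap)
  also have "\<dots> = (\<Sum>u=1..n. \<Sum>v\<in>{1..n} - {u}. \<Sum>i=1..m. \<Sum>j=1..m. K (u, i) (v, j) * (measure unit_measure (S (u, i)) * measure unit_measure (S (v, j))))"
    by (intro sum.cong refl sum.mono_neutral_right) (auto simp: K_def)
  also have "\<dots> = (\<Sum>u=1..n. \<Sum>v\<in>{1..n} - {u}. \<Sum>i=1..m. \<Sum>j=1..m. H (X {u, v}) i j * (measure unit_measure (S (u, i)) * measure unit_measure (S (v, j))))"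
    by (intro sum.cong refl) (auto simp: K_def)
  finally have "(real n)\<^sup>2 * step_pairing m H \<phi> (empirical_graphon n X) \<le> (real n)\<^sup>2 * \<dots>"
    by (intro mult_left_mono) auto
  also have "\<dots> = (\<Sum>u=1..n. \<Sum>v\<in>{1..n} - {u}. \<Sum>i=1..m. \<Sum>j=1..m. q u i * q v j * H (X {u, v}) i j)"
    unfolding sum_distrib_left q_def by (intro sum.cong refl) (simp add: power2_eq_square)
  finally have le: "(real n)\<^sup>2 * step_pairing m H \<phi> (empirical_graphon n X)
    \<le> (\<Sum>u=1..n. \<Sum>v\<in>{1..n} - {u}. \<Sum>i=1..m. \<Sum>j=1..m. q u i * q v j * H (X {u, v}) i j)" .
  have q0: "0 \<le> q u i" for u i by (simp add: q_def)
  have q1: "(\<Sum>i=1..m. q u i) = 1" if u: "u \<in> {1..n}" for u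
  proof -
    have "(\<Sum>i=1..m. measure unit_measure (S (u, i))) = measure unit_measure (\<Union>i\<in>{1..m}. S (u, i))"
      by (rule unit.finite_measure_finite_Union[symmetric])
        (use S in \<open>auto simp: disjoint_family_on_def S_def\<close>)
    also have "(\<Union>i\<in>{1..m}. S (u, i)) = cell n u"
      unfolding S_def t_def using tI unfolding t_def by auto
    finally show ?thesis unfolding q_def sum_distrib_left[symmetric] using cell_measure[OF n u] n by simp
  qed
  obtain \<tau> where \<tau>: "\<tau> \<in> {1..n} \<rightarrow>\<^sub>E {1..m}"
    "(\<Sum>u=1..n. \<Sum>v\<in>{1..n} - {u}. \<Sum>i=1..m. \<Sum>j=1..m. q u i * q v j * H (X {u, v}) i j)
      \<le> (\<Sum>u=1..n. \<Sum>v\<in>{1..n} - {u}. H (X {u, v}) (\<tau> u) (\<tau> v))"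
    using multilinear_rounding[of "{1..n}" "{1..m}" q "\<lambda>u v. H (X {u, v})"] q0 q1 by blast
  show ?thesis using that[OF \<tau>(1)] le \<tau>(2) by linarith
qed

text \<open>Both m and \<eta> depend on W and \<kappa> alone. For fixed m the prefactor is
  exponential in n only, which a slightly larger \<kappa> absorbs.\<close>

lemma card_near_le:
  fixes W :: "'k::finite kernel"
  assumes W: "W \<in> graphons" and \<kappa>: "\<kappa> > 0"
  obtains m \<eta> where "m \<ge> 1" "\<eta> > 0"
    "\<And>n. n \<ge> 1 \<Longrightarrow> real (card {X \<in> colourings n. cut_dist (empirical_graphon n X) W < \<eta>})
      \<le> real m ^ n * exp ((real n)\<^sup>2 * (\<kappa> - entropy_fun W) / 2)"
proof -
  obtain m H \<eta> where *: "log_step m H" "\<eta> > 0"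
    "\<And>U. U \<in> graphons \<Longrightarrow> cut_dist U W < \<eta> \<Longrightarrow> \<exists>\<phi>\<in>mp_bijections. entropy_fun W - \<kappa> \<le> step_pairing m H \<phi> U"
    using entropy_local[OF assms] by metis
  have m: "m \<ge> 1" using * by (simp add: log_step_def)
  have "real (card {X \<in> colourings n. cut_dist (empirical_graphon n X) W < \<eta>})
      \<le> real m ^ n * exp ((real n)\<^sup>2 * (\<kappa> - entropy_fun W) / 2)" if n: "n \<ge> 1" for n
  proof -
    let ?N = "{X \<in> colourings n. cut_dist (empirical_graphon n X) W < \<eta>} :: (nat set \<Rightarrow> 'k) set"
    let ?P = "{1..n} \<rightarrow>\<^sub>E {1..m}"
    \<comment> \<open>Half of n^2 times the pairing, since the sum over ordered pairs is twice the
      sum over edges by the symmetry of \<open>H\<close>.\<close>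
    define c where "c = (real n)\<^sup>2 * (entropy_fun W - \<kappa>) / 2"
    define B where "B X \<tau> = (\<Prod>e\<in>complete_edges n. exp (H (X e) (\<tau> (Min e)) (\<tau> (Max e))))" for X :: "nat set \<Rightarrow> 'k" and \<tau> :: "nat \<Rightarrow> nat"
    have finP: "finite ?P" by (intro finite_PiE) auto
    have B0: "B X \<tau> \<ge> 0" for X \<tau> unfolding B_def by (intro prod_nonneg) auto
    have lower: "exp c \<le> (\<Sum>\<tau>\<in>?P. B X \<tau>)" if X: "X \<in> ?N" for X
    proof -
      obtain \<phi> where \<phi>: "\<phi> \<in> mp_bijections" "entropy_fun W - \<kappa> \<le> step_pairing m H \<phi> (empirical_graphon n X)"
        using *(3)[OF empirical_graphon_in_graphons, of n X] X by blast
      obtain \<tau> where \<tau>: "\<tau> \<in> ?P" "(real n)\<^sup>2 * step_pairing m H \<phi> (empirical_graphon n X)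
        \<le> (\<Sum>u=1..n. \<Sum>v\<in>{1..n} - {u}. H (X {u, v}) (\<tau> u) (\<tau> v))"
        using empirical_pairing_le[OF n *(1) \<phi>(1)] by blast
      have "(\<Sum>u=1..n. \<Sum>v\<in>{1..n} - {u}. H (X {u, v}) (\<tau> u) (\<tau> v))
        = (\<Sum>e\<in>complete_edges n. H (X {Min e, Max e}) (\<tau> (Min e)) (\<tau> (Max e)) + H (X {Max e, Min e}) (\<tau> (Max e)) (\<tau> (Min e)))"
        by (rule sum_distinct_pairs)
      also have "\<dots> = (\<Sum>e\<in>complete_edges n. 2 * H (X e) (\<tau> (Min e)) (\<tau> (Max e)))"
      proof (rule sum.cong[OF refl])
        fix e assume e: "e \<in> complete_edges n"
        note E = edge_Min_Max[OF e]
        have "\<tau> (Min e) \<in> {1..m}" "\<tau> (Max e) \<in> {1..m}" using \<tau>(1) E by auto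
        then have "H (X e) (\<tau> (Max e)) (\<tau> (Min e)) = H (X e) (\<tau> (Min e)) (\<tau> (Max e))"
          using *(1) by (simp add: log_step_def)
        then show "H (X {Min e, Max e}) (\<tau> (Min e)) (\<tau> (Max e)) + H (X {Max e, Min e}) (\<tau> (Max e)) (\<tau> (Min e))
          = 2 * H (X e) (\<tau> (Min e)) (\<tau> (Max e))"
          using E(4) by (simp add: insert_commute)
      qed
      finally have "(real n)\<^sup>2 * step_pairing m H \<phi> (empirical_graphon n X) \<le> 2 * (\<Sum>e\<in>complete_edges n. H (X e) (\<tau> (Min e)) (\<tau> (Max e)))"
        using \<tau>(2) by (simp add: sum_distrib_left)
      moreover have "(real n)\<^sup>2 * (entropy_fun W - \<kappa>) \<le> (real n)\<^sup>2 * step_pairing m H \<phi> (empirical_graphon n X)"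
        using \<phi>(2) by (intro mult_left_mono) auto
      ultimately have "c \<le> (\<Sum>e\<in>complete_edges n. H (X e) (\<tau> (Min e)) (\<tau> (Max e)))" unfolding c_def by linarith
      then have "exp c \<le> B X \<tau>" unfolding B_def by (simp add: exp_sum[OF finite_complete_edges, symmetric])
      also have "\<dots> \<le> (\<Sum>\<tau>\<in>?P. B X \<tau>)" by (rule member_le_sum[OF \<tau>(1) B0 finP])
      finally show ?thesis .
    qed
    have "card ?N * exp c = (\<Sum>X\<in>?N. exp c)" by simp
    also have "\<dots> \<le> (\<Sum>X\<in>?N. \<Sum>\<tau>\<in>?P. B X \<tau>)" by (rule sum_mono) (rule lower)
    also have "\<dots> \<le> (\<Sum>X\<in>colourings n. \<Sum>\<tau>\<in>?P. B X \<tau>)"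
      by (rule sum_mono2) (auto simp: finite_colourings intro!: sum_nonneg B0)
    also have "\<dots> = (\<Sum>\<tau>\<in>?P. \<Sum>X\<in>colourings n. B X \<tau>)" by (rule sum.swap)
    also have "\<dots> = (\<Sum>\<tau>\<in>?P. 1)"
    proof (rule sum.cong[OF refl])
      fix \<tau> assume \<tau>: "\<tau> \<in> ?P"
      have "(\<Sum>X\<in>colourings n. B X \<tau>) = (\<Prod>e\<in>complete_edges n. \<Sum>a\<in>UNIV. exp (H a (\<tau> (Min e)) (\<tau> (Max e))))"
        unfolding B_def by (rule sum_prod_colourings[where h = "\<lambda>e a. exp (H a (\<tau> (Min e)) (\<tau> (Max e)))"])
      also have "\<dots> = 1"
      proof (rule prod.neutral, rule ballI)
        fix e assume e: "e \<in> complete_edges n"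
        have "\<tau> (Min e) \<in> {1..m}" "\<tau> (Max e) \<in> {1..m}" using \<tau> edge_Min_Max[OF e] by auto
        then show "(\<Sum>a\<in>UNIV. exp (H a (\<tau> (Min e)) (\<tau> (Max e)))) = 1" using *(1) by (simp add: log_step_def)
      qed
      finally show "(\<Sum>X\<in>colourings n. B X \<tau>) = 1" .
    qed
    also have "\<dots> = real m ^ n" by (simp add: card_PiE)
    finally have "card ?N * exp c \<le> real m ^ n" .
    then have "card ?N * exp c * exp (- c) \<le> real m ^ n * exp (- c)" by (rule mult_right_mono) simp
    moreover have "card ?N * exp c * exp (- c) = card ?N" by (simp add: mult.assoc exp_minus_inverse)
    moreover have e: "(real n)\<^sup>2 * (\<kappa> - entropy_fun W) / 2 = - c" by (simp add: c_def field_simps)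
    ultimately show ?thesis unfolding e by linarith
  qed
  then show ?thesis using that[OF m *(2)] by blast
qed

subsection \<open>Independent random colourings\<close>

text \<open>The point weights of independent edge colours with laws \<open>p e\<close>, used
  directly in finite sums over \<open>colourings n\<close>.\<close>

definition colour_prob :: "nat \<Rightarrow> (nat set \<Rightarrow> 'k \<Rightarrow> real) \<Rightarrow> (nat set \<Rightarrow> 'k::finite) \<Rightarrow> real" where
  "colour_prob n p X = (\<Prod>e\<in>complete_edges n. p e (X e))"

context
  fixes n :: nat and p :: "nat set \<Rightarrow> 'k::finite \<Rightarrow> real"
  assumes p_pos: "\<And>e a. e \<in> complete_edges n \<Longrightarrow> 0 < p e a"
    and p_sum: "\<And>e. e \<in> complete_edges n \<Longrightarrow> (\<Sum>a\<in>UNIV. p e a) = 1"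
begin

lemma colour_prob_pos: "0 < colour_prob n p X"
  unfolding colour_prob_def by (intro prod_pos p_pos)

lemma colour_prob_sum: "(\<Sum>X\<in>colourings n. colour_prob n p X) = 1"
  unfolding colour_prob_def sum_prod_colourings by (simp add: p_sum)

lemma colour_prob_mgf:
  "(\<Sum>X\<in>colourings n. colour_prob n p X * exp (\<Sum>e\<in>complete_edges n. h e (X e)))
    = (\<Prod>e\<in>complete_edges n. \<Sum>a\<in>UNIV. p e a * exp (h e a))"
  unfolding sum_prod_colourings[symmetric] colour_prob_def
  by (simp add: exp_sum[OF finite_complete_edges] prod.distrib)

lemma colour_prob_marginal:
  assumes e: "e \<in> complete_edges n"
  shows "(\<Sum>X\<in>colourings n. colour_prob n p X * h (X e)) = (\<Sum>a\<in>UNIV. p e a * h a)"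
proof -
  \<comment> \<open>The factor \<open>h\<close> is attached to the edge e only; all other edges then
    sum out to 1.\<close>
  let ?h = "\<lambda>e' a. p e' a * (if e' = e then h a else 1)"
  have "colour_prob n p X * h (X e) = (\<Prod>e'\<in>complete_edges n. ?h e' (X e'))" for X
    unfolding colour_prob_def prod.distrib using e finite_complete_edges by (simp add: prod.delta)
  then have "(\<Sum>X\<in>colourings n. colour_prob n p X * h (X e)) = (\<Prod>e'\<in>complete_edges n. \<Sum>a\<in>UNIV. ?h e' a)"
    by (simp only: sum_prod_colourings[where h = ?h, symmetric])
  also have "\<dots> = (\<Prod>e'\<in>complete_edges n. if e' = e then (\<Sum>a\<in>UNIV. p e a * h a) else 1)"
    by (intro prod.cong refl) (auto simp: p_sum)
  also have "\<dots> = (\<Sum>a\<in>UNIV. p e a * h a)" using e finite_complete_edges by (simp add: prod.delta)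
  finally show ?thesis .
qed

text \<open>The entropy of a product law is the sum of the entropies of its factors.\<close>

lemma colour_prob_entropy:
  "(\<Sum>X\<in>colourings n. colour_prob n p X * ln (colour_prob n p X))
    = (\<Sum>e\<in>complete_edges n. \<Sum>a\<in>UNIV. p e a * ln (p e a))"
proof -
  have "ln (colour_prob n p X) = (\<Sum>e\<in>complete_edges n. ln (p e (X e)))" for X
    unfolding colour_prob_def by (rule ln_prod[OF finite_complete_edges]) (metis p_pos less_irrefl)
  then have "(\<Sum>X\<in>colourings n. colour_prob n p X * ln (colour_prob n p X))
    = (\<Sum>X\<in>colourings n. \<Sum>e\<in>complete_edges n. colour_prob n p X * ln (p e (X e)))"
    by (simp add: sum_distrib_left)
  also have "\<dots> = (\<Sum>e\<in>complete_edges n. \<Sum>X\<in>colourings n. colour_prob n p X * ln (p e (X e)))" by (rule sum.swap)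
  also have "\<dots> = (\<Sum>e\<in>complete_edges n. \<Sum>a\<in>UNIV. p e a * ln (p e a))"
    by (intro sum.cong refl colour_prob_marginal)
  finally show ?thesis .
qed

text \<open>The Gibbs inequality on colourings with the normalised weights exp(y)/Z as reference: ln
  Z is at least mean energy plus entropy, for any trial law.\<close>

lemma gibbs_variational:
  fixes y :: "(nat set \<Rightarrow> 'k) \<Rightarrow> real"
  shows "exp ((\<Sum>X\<in>colourings n. colour_prob n p X * y X)
      - (\<Sum>e\<in>complete_edges n. \<Sum>a\<in>UNIV. p e a * ln (p e a))) \<le> (\<Sum>X\<in>colourings n. exp (y X))"
proof -
  let ?C = "colourings n :: (nat set \<Rightarrow> 'k) set"
  define Z where "Z = (\<Sum>X\<in>?C. exp (y X))"
  have Z: "Z > 0" unfolding Z_def using finite_colourings colourings_nonempty by (intro sum_pos) auto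
  have "(\<Sum>X\<in>?C. exp (y X - ln Z)) = 1"
    using Z by (simp add: exp_diff Z_def[symmetric] flip: sum_divide_distrib)
  then have "(\<Sum>X\<in>?C. colour_prob n p X * (y X - ln Z)) \<le> (\<Sum>X\<in>?C. colour_prob n p X * ln (colour_prob n p X))"
    by (intro gibbs_inequality colour_prob_sum less_imp_le colour_prob_pos)
  then have "(\<Sum>X\<in>?C. colour_prob n p X * y X) - ln Z \<le> (\<Sum>X\<in>?C. colour_prob n p X * ln (colour_prob n p X))"
    by (simp add: right_diff_distrib sum_subtractf colour_prob_sum flip: sum_distrib_right)
  then have "(\<Sum>X\<in>?C. colour_prob n p X * y X) - (\<Sum>e\<in>complete_edges n. \<Sum>a\<in>UNIV. p e a * ln (p e a)) \<le> ln Z"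
    unfolding colour_prob_entropy by linarith
  then show ?thesis using Z unfolding Z_def[symmetric] by (simp add: ln_ge_iff)
qed

lemma card_complete_edges_le: "real (card (complete_edges n)) \<le> (real n)\<^sup>2"
proof -
  have "complete_edges n \<subseteq> (\<lambda>(u, v). {u, v}) ` ({1..n} \<times> {1..n})"
  proof
    fix e assume "e \<in> complete_edges n"
    from edge_Min_Max[OF this] show "e \<in> (\<lambda>(u, v). {u, v}) ` ({1..n} \<times> {1..n})"
      by (intro image_eqI[where x = "(Min e, Max e)"]) auto
  qed
  then have "card (complete_edges n) \<le> card ({1..n} \<times> {1..n})" by (rule surj_card_le[rotated]) auto
  then show ?thesis by (simp add: power2_eq_square flip: of_nat_mult)
qed

text \<open>Exponential Chebyshev bound for a weighted sum of centred colour indicators. The weights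
  may reach 2 because both orientations of an edge can lie in a rectangle of vertices.\<close>

lemma colour_prob_tail:
  assumes c: "\<And>e. e \<in> complete_edges n \<Longrightarrow> \<bar>c e\<bar> \<le> 2" and \<eta>: "0 < \<eta>" "\<eta> \<le> 4"
  shows "(\<Sum>X\<in>{X\<in>colourings n. \<eta> * (real n)\<^sup>2 \<le> (\<Sum>e\<in>complete_edges n. c e * (of_bool (X e = a) - p e a))}. colour_prob n p X)
    \<le> exp (- (\<eta>\<^sup>2 / 16) * (real n)\<^sup>2)" (is "sum _ ?B \<le> _")
proof -
  \<comment> \<open>Each edge contributes a factor of at most exp(4 t^2), so the exponent is n^2 (4
    t^2 - t \<eta>), which t = \<eta>/8 minimises to -\<eta>^2/16. The condition \<eta> \<le> 4
    keeps the exponents \<open>h e b\<close> in [-1,1].\<close>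
  define t where "t = \<eta> / 8"
  have t: "0 < t" "t \<le> 1/2" using \<eta> by (auto simp: t_def)
  define h where "h e b = t * (c e * (of_bool (b = a) - p e a))" for e b
  have p1: "p e b \<le> 1" if "e \<in> complete_edges n" for e b
    using member_le_sum[of b UNIV "p e"] p_sum[OF that] p_pos[OF that] by (simp add: less_imp_le)
  have "(\<Sum>X\<in>?B. colour_prob n p X) * exp (t * (\<eta> * (real n)\<^sup>2)) = (\<Sum>X\<in>?B. colour_prob n p X * exp (t * (\<eta> * (real n)\<^sup>2)))"
    by (rule sum_distrib_right)
  also have "\<dots> \<le> (\<Sum>X\<in>?B. colour_prob n p X * exp (\<Sum>e\<in>complete_edges n. h e (X e)))"
  proof (rule sum_mono)
    fix X assume "X \<in> ?B"
    then have "t * (\<eta> * (real n)\<^sup>2) \<le> t * (\<Sum>e\<in>complete_edges n. c e * (of_bool (X e = a) - p e a))"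
      using t by (intro mult_left_mono) auto
    then show "colour_prob n p X * exp (t * (\<eta> * (real n)\<^sup>2)) \<le> colour_prob n p X * exp (\<Sum>e\<in>complete_edges n. h e (X e))"
      unfolding h_def sum_distrib_left by (intro mult_left_mono less_imp_le[OF colour_prob_pos]) simp
  qed
  also have "\<dots> \<le> (\<Sum>X\<in>colourings n. colour_prob n p X * exp (\<Sum>e\<in>complete_edges n. h e (X e)))"
    by (rule sum_mono2) (auto simp: finite_colourings intro!: mult_nonneg_nonneg less_imp_le[OF colour_prob_pos])
  also have "\<dots> = (\<Prod>e\<in>complete_edges n. \<Sum>b\<in>UNIV. p e b * exp (h e b))" by (rule colour_prob_mgf)
  also have "\<dots> \<le> (\<Prod>e\<in>complete_edges n. exp (4 * t\<^sup>2))"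
  proof (rule prod_mono, rule conjI)
    fix e assume e: "e \<in> complete_edges n"
    show "0 \<le> (\<Sum>b\<in>UNIV. p e b * exp (h e b))" by (intro sum_nonneg mult_nonneg_nonneg less_imp_le[OF p_pos[OF e]]) auto
    have hb: "\<bar>h e b\<bar> \<le> 2 * t" for b
    proof -
      have "\<bar>of_bool (b = a) - p e a\<bar> \<le> 1" using p1[OF e, of a] p_pos[OF e, of a] by (auto simp: of_bool_def)
      then have "\<bar>c e\<bar> * \<bar>of_bool (b = a) - p e a\<bar> \<le> 2 * 1" using c[OF e] by (intro mult_mono) auto
      then have "t * (\<bar>c e\<bar> * \<bar>of_bool (b = a) - p e a\<bar>) \<le> t * 2" using t by (intro mult_left_mono) auto
      then show ?thesis using t unfolding h_def abs_mult by simp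
    qed
    have h2: "(h e b)\<^sup>2 \<le> 4 * t\<^sup>2" for b
      using power_mono[OF hb[of b], of 2] t by (simp add: power_mult_distrib)
    have "(\<Sum>b\<in>UNIV. p e b * exp (h e b)) \<le> (\<Sum>b\<in>UNIV. p e b * (1 + h e b + 4 * t\<^sup>2))"
    proof (intro sum_mono mult_left_mono less_imp_le[OF p_pos[OF e]])
      fix b
      have "exp (h e b) \<le> 1 + h e b + (h e b)\<^sup>2"
      proof (cases "h e b \<ge> 0")
        case True
        then show ?thesis using hb[of b] t by (intro exp_bound) auto
      next
        case False
        \<comment> \<open>For negative x the quadratic bound is obtained from the Taylor lower bound
          at -x, because (1 + x + x^2/2)(1 - x + x^2/2) = 1 + x^4/4 is at least 1.\<close>
        have "exp (h e b) \<le> 1 + h e b + (h e b)\<^sup>2 / 2" if "h e b \<le> 0"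
        proof -
          have "1 + (- h e b) + (- h e b)\<^sup>2 / 2 \<le> exp (- h e b)" using that by (intro exp_lower_Taylor_quadratic) auto
          then have l: "1 - h e b + (h e b)\<^sup>2 / 2 \<le> exp (- h e b)" by simp
          have "0 \<le> 1 + h e b + (h e b)\<^sup>2 / 2" 
          proof -
            have q: "1 + h e b + (h e b)\<^sup>2 / 2 = ((h e b + 1)\<^sup>2 + 1) / 2" by (simp add: power2_eq_square field_simps)
            show ?thesis unfolding q by simp
          qed
          have "(1 + h e b + (h e b)\<^sup>2 / 2) * (1 - h e b + (h e b)\<^sup>2 / 2) = 1 + ((h e b)\<^sup>2)\<^sup>2 / 4"
            by (simp add: field_simps power2_eq_square)
          then have "1 \<le> (1 + h e b + (h e b)\<^sup>2 / 2) * (1 - h e b + (h e b)\<^sup>2 / 2)"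
            by simp
          also have "\<dots> \<le> (1 + h e b + (h e b)\<^sup>2 / 2) * exp (- h e b)"
            using l \<open>0 \<le> 1 + h e b + (h e b)\<^sup>2 / 2\<close> by (rule mult_left_mono)
          finally have "1 * exp (h e b) \<le> (1 + h e b + (h e b)\<^sup>2 / 2) * exp (- h e b) * exp (h e b)"
            by (rule mult_right_mono) simp
          then show ?thesis by (simp add: mult.assoc flip: exp_add)
        qed
        then show ?thesis using False zero_le_power2[of "h e b"] by linarith
      qed
      then show "exp (h e b) \<le> 1 + h e b + 4 * t\<^sup>2" using h2[of b] by linarith
    qed
    also have "\<dots> = 1 + (\<Sum>b\<in>UNIV. p e b * h e b) + 4 * t\<^sup>2"
      by (simp add: distrib_left sum.distrib p_sum[OF e] flip: sum_distrib_right)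
    \<comment> \<open>The linear term vanishes, as the indicator has been centred at its mean
      \<open>p e a\<close>.\<close>
    also have "(\<Sum>b\<in>UNIV. p e b * h e b) = t * c e * (\<Sum>b\<in>UNIV. p e b * of_bool (b = a)) - t * c e * p e a * (\<Sum>b\<in>UNIV. p e b)"
      unfolding h_def sum_distrib_left sum_subtractf[symmetric] by (intro sum.cong refl) (simp add: algebra_simps)
    also have "(\<Sum>b\<in>UNIV. p e b * of_bool (b = a)) = (\<Sum>b\<in>UNIV. if b = a then p e b else 0)"
      by (rule sum.cong) auto
    also have "\<dots> = p e a" by simp
    finally have "(\<Sum>b\<in>UNIV. p e b * exp (h e b)) \<le> 1 + 4 * t\<^sup>2" using p_sum[OF e] by simp
    also have "\<dots> \<le> exp (4 * t\<^sup>2)" by (rule exp_ge_add_one_self)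
    finally show "(\<Sum>b\<in>UNIV. p e b * exp (h e b)) \<le> exp (4 * t\<^sup>2)" .
  qed
  also have "\<dots> = exp (real (card (complete_edges n)) * (4 * t\<^sup>2))" by (simp add: exp_of_nat_mult)
  also have "\<dots> \<le> exp ((real n)\<^sup>2 * (4 * t\<^sup>2))" using card_complete_edges_le by (simp add: mult_right_mono)
  finally have "(\<Sum>X\<in>?B. colour_prob n p X) * exp (t * (\<eta> * (real n)\<^sup>2)) * exp (- (t * (\<eta> * (real n)\<^sup>2)))
    \<le> exp ((real n)\<^sup>2 * (4 * t\<^sup>2)) * exp (- (t * (\<eta> * (real n)\<^sup>2)))" by (rule mult_right_mono) simp
  then have "(\<Sum>X\<in>?B. colour_prob n p X) \<le> exp ((real n)\<^sup>2 * (4 * t\<^sup>2) + - (t * (\<eta> * (real n)\<^sup>2)))"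
    by (simp only: mult.assoc exp_minus_inverse mult_1_right exp_add)
  also have "(real n)\<^sup>2 * (4 * t\<^sup>2) + - (t * (\<eta> * (real n)\<^sup>2)) = - (\<eta>\<^sup>2 / 16) * (real n)\<^sup>2"
    by (simp add: t_def power2_eq_square field_simps)
  finally show ?thesis .
qed

end

section \<open>The cut norm of block kernels and of empirical graphons\<close>

text \<open>For fixed \<open>t\<close> the best \<open>s\<close> selects the rows with positive sum;
  with these rows fixed, the best \<open>t\<close> selects the columns with positive sum.\<close>

lemma bilinear_extreme:
  fixes G :: "'u \<Rightarrow> 'v \<Rightarrow> real"
  assumes "finite I" "finite J" "\<And>u. u \<in> I \<Longrightarrow> 0 \<le> s u \<and> s u \<le> 1" "\<And>v. v \<in> J \<Longrightarrow> 0 \<le> t v \<and> t v \<le> 1"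
  obtains A B where "A \<subseteq> I" "B \<subseteq> J" "(\<Sum>u\<in>I. \<Sum>v\<in>J. s u * t v * G u v) \<le> (\<Sum>u\<in>A. \<Sum>v\<in>B. G u v)"
proof -
  define y where "y u = (\<Sum>v\<in>J. t v * G u v)" for u
  define A where "A = {u\<in>I. y u > 0}"
  define x where "x v = (\<Sum>u\<in>A. G u v)" for v
  define B where "B = {v\<in>J. x v > 0}"
  have "(\<Sum>u\<in>I. \<Sum>v\<in>J. s u * t v * G u v) = (\<Sum>u\<in>I. s u * y u)"
    unfolding y_def sum_distrib_left by (intro sum.cong refl) (simp add: mult.assoc)
  also have "\<dots> \<le> (\<Sum>u\<in>I. if y u > 0 then y u else 0)"
    by (intro sum_mono) (use assms(3) in \<open>auto simp: mult_left_le_one_le mult_le_0_iff not_less\<close>)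
  also have "\<dots> = (\<Sum>u\<in>A. y u)" unfolding A_def using assms(1) by (simp add: sum.If_cases Int_def)
  also have "\<dots> = (\<Sum>v\<in>J. t v * x v)"
    unfolding y_def x_def sum_distrib_left by (rule sum.swap)
  also have "\<dots> \<le> (\<Sum>v\<in>J. if x v > 0 then x v else 0)"
    by (intro sum_mono) (use assms(4) in \<open>auto simp: mult_left_le_one_le mult_le_0_iff not_less\<close>)
  also have "\<dots> = (\<Sum>v\<in>B. x v)" unfolding B_def using assms(2) by (simp add: sum.If_cases Int_def)
  also have "\<dots> = (\<Sum>u\<in>A. \<Sum>v\<in>B. G u v)" unfolding x_def by (rule sum.swap)
  finally show ?thesis by (intro that) (auto simp: A_def B_def)
qed

text \<open>Measurable S and T enter only through the fractions of the cells that they cover. The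
  integral is bilinear in these fractions, so its extremes are attained on unions of cells; using G
  and -G bounds the absolute value.\<close>

lemma cut_norm_block_le:
  assumes n: "n \<ge> 1" and G: "\<And>A B. A \<subseteq> {1..n} \<Longrightarrow> B \<subseteq> {1..n} \<Longrightarrow> \<bar>\<Sum>u\<in>A. \<Sum>v\<in>B. G u v\<bar> \<le> c * (real n)\<^sup>2"
  shows "cut_norm (\<lambda>z. G (block n (fst z)) (block n (snd z))) \<le> c"
proof (rule cut_norm_leI)
  fix S T assume ST: "S \<in> sets unit_measure" "T \<in> sets unit_measure"
  define s where "s u = n * measure unit_measure (cell n u \<inter> S)" for u
  define t where "t v = n * measure unit_measure (cell n v \<inter> T)" for v
  have s: "0 \<le> s u \<and> s u \<le> 1" if "u \<in> {1..n}" for u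
  proof -
    have "measure unit_measure (cell n u \<inter> S) \<le> 1 / n"
      unfolding cell_measure[OF n that, symmetric] by (intro unit.finite_measure_mono cell_measurable) auto
    then show ?thesis using n by (simp add: s_def field_simps)
  qed
  have t: "0 \<le> t u \<and> t u \<le> 1" if "u \<in> {1..n}" for u
  proof -
    have "measure unit_measure (cell n u \<inter> T) \<le> 1 / n"
      unfolding cell_measure[OF n that, symmetric] by (intro unit.finite_measure_mono cell_measurable) auto
    then show ?thesis using n by (simp add: t_def field_simps)
  qed
  have "rect_integral S T (\<lambda>z. G (block n (fst z)) (block n (snd z)))
    = (\<Sum>u=1..n. \<Sum>v=1..n. G u v * rect_integral (cell n u) (cell n v) (indicator (S \<times> T)))"
    unfolding rect_integral_def[of S T]
    by (rule step_integral(1)) (use block_range[OF n] cell_measurable Times_in_square[OF ST] in auto)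
  also have "\<dots> = (\<Sum>u=1..n. \<Sum>v=1..n. G u v * (measure unit_measure (cell n u \<inter> S) * measure unit_measure (cell n v \<inter> T)))"
  proof (intro sum.cong refl arg_cong2[where f = "(*)"])
    fix u v
    have "rect_integral (cell n u) (cell n v) (indicator (S \<times> T))
      = (\<integral>z. indicator ((cell n u \<inter> S) \<times> (cell n v \<inter> T)) z \<partial>square_measure)"
      unfolding rect_integral_def by (rule Bochner_Integration.integral_cong) (auto simp: indicator_def)
    also have "\<dots> = measure square_measure ((cell n u \<inter> S) \<times> (cell n v \<inter> T) \<inter> space square_measure)"
      by (rule Bochner_Integration.integral_indicator)
    also have "(cell n u \<inter> S) \<times> (cell n v \<inter> T) \<inter> space square_measure = (cell n u \<inter> S) \<times> (cell n v \<inter> T)" by auto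
    also have "measure square_measure \<dots> = measure unit_measure (cell n u \<inter> S) * measure unit_measure (cell n v \<inter> T)"
      by (intro measure_square_Times sets.Int cell_measurable ST)
    finally show "rect_integral (cell n u) (cell n v) (indicator (S \<times> T))
      = measure unit_measure (cell n u \<inter> S) * measure unit_measure (cell n v \<inter> T)" .
  qed
  finally have eq: "(real n)\<^sup>2 * rect_integral S T (\<lambda>z. G (block n (fst z)) (block n (snd z)))
    = (\<Sum>u=1..n. \<Sum>v=1..n. s u * t v * G u v)"
    unfolding s_def t_def by (simp add: sum_distrib_left power2_eq_square mult_ac)
  obtain A B where AB: "A \<subseteq> {1..n}" "B \<subseteq> {1..n}" "(\<Sum>u=1..n. \<Sum>v=1..n. s u * t v * G u v) \<le> (\<Sum>u\<in>A. \<Sum>v\<in>B. G u v)"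
    using bilinear_extreme[of "{1..n}" "{1..n}" s t G] s t by blast
  obtain A' B' where AB': "A' \<subseteq> {1..n}" "B' \<subseteq> {1..n}" "(\<Sum>u=1..n. \<Sum>v=1..n. s u * t v * - G u v) \<le> (\<Sum>u\<in>A'. \<Sum>v\<in>B'. - G u v)"
    using bilinear_extreme[of "{1..n}" "{1..n}" s t "\<lambda>u v. - G u v"] s t by blast
  have "\<bar>\<Sum>u=1..n. \<Sum>v=1..n. s u * t v * G u v\<bar> \<le> c * (real n)\<^sup>2"
    using AB(3) AB'(3) G[OF AB(1,2)] G[OF AB'(1,2)] by (simp add: sum_negf)
  then have "(real n)\<^sup>2 * \<bar>rect_integral S T (\<lambda>z. G (block n (fst z)) (block n (snd z)))\<bar> \<le> (real n)\<^sup>2 * c"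
    unfolding eq[symmetric] by (simp add: abs_mult mult.commute)
  then show "\<bar>rect_integral S T (\<lambda>z. G (block n (fst z)) (block n (snd z)))\<bar> \<le> c"
    using n by simp
qed

lemma smooth_avg_L1:
  assumes W: "W \<in> graphons" and n: "n \<ge> 1" and \<theta>: "0 < \<theta>" "\<theta> < 1"
  shows "(\<integral>z. \<bar>W z $ a - smooth_avg \<theta> n W a (block n (fst z)) (block n (snd z))\<bar> \<partial>square_measure)
    \<le> (\<integral>z. \<bar>W z $ a - block_avg n (\<lambda>z. W z $ a) (block n (fst z)) (block n (snd z))\<bar> \<partial>square_measure) + \<theta>"
proof -
  have bW: "bkernel (\<lambda>z. W z $ a)" by (intro vkernel_component graphon_vkernel W)
  let ?w = "\<lambda>z. block_avg n (\<lambda>z. W z $ a) (block n (fst z)) (block n (snd z))"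
  let ?V = "\<lambda>z. smooth_avg \<theta> n W a (block n (fst z)) (block n (snd z))"
  have b1: "bkernel (\<lambda>z. \<bar>W z $ a - ?w z\<bar>)" "bkernel (\<lambda>z. \<bar>W z $ a - ?V z\<bar>)"
    by (intro bkernel_abs bkernel_diff bW bkernel_block n)+
  have "(\<integral>z. \<bar>W z $ a - ?V z\<bar> \<partial>square_measure) \<le> (\<integral>z. \<bar>W z $ a - ?w z\<bar> + \<theta> \<partial>square_measure)"
  proof (rule integral_mono)
    fix z assume "z \<in> space square_measure"
    then have "block n (fst z) \<in> {1..n}" "block n (snd z) \<in> {1..n}" using block_range[OF n] by auto
    from smooth_avg_props(6)[OF W n \<theta> this, of a]
    show "\<bar>W z $ a - ?V z\<bar> \<le> \<bar>W z $ a - ?w z\<bar> + \<theta>" by linarith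
  qed (intro bkernel_integrable bkernel_add b1 bkernel_const)+
  also have "\<dots> = (\<integral>z. \<bar>W z $ a - ?w z\<bar> \<partial>square_measure) + (\<integral>z. \<theta> \<partial>square_measure)"
    by (intro Bochner_Integration.integral_add bkernel_integrable b1 bkernel_const)
  also have "(\<integral>z. \<theta> \<partial>square_measure) = \<theta>" using square.prob_space by simp
  finally show ?thesis .
qed

text \<open>Since ln V is nonpositive, the uniform part of V may be dropped in front of it. What
  remains is (1 - \<theta>) times the pairing of W with ln V, which the entropy of W bounds.
  Replacing (1 - \<theta>) by 1 costs \<theta> k because the entropy is at least -k, and the n
  diagonal terms, absent from the edge sum, are each at least -k.\<close>

lemma smooth_avg_entropy_le:
  fixes W :: "'k::finite kernel"
  assumes W: "W \<in> graphons" and n: "n \<ge> 1" and \<theta>: "0 < \<theta>" "\<theta> < 1"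
  shows "(\<Sum>e\<in>complete_edges n. \<Sum>a\<in>UNIV. smooth_avg \<theta> n W a (Min e) (Max e) * ln (smooth_avg \<theta> n W a (Min e) (Max e)))
    \<le> (real n)\<^sup>2 * (entropy_fun W + \<theta> * real CARD('k)) / 2 + real n * real CARD('k) / 2"
proof -
  define k where "k = real CARD('k)"
  define V where "V = smooth_avg \<theta> n W"
  define w where "w a = block_avg n (\<lambda>z. W z $ a)" for a
  define y where "y u v = (\<Sum>a\<in>UNIV. V a u v * ln (V a u v))" for u v
  note P = smooth_avg_props[OF W n \<theta>, folded V_def]
  have bW: "bkernel (\<lambda>z. W z $ a)" for a by (intro vkernel_component graphon_vkernel W)
  have ysym: "y u v = y v u" if "u \<in> {1..n}" "v \<in> {1..n}" for u v
    unfolding y_def using P(5)[OF that] by simp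
  have ylow: "- k \<le> y u v" if uv: "u \<in> {1..n}" "v \<in> {1..n}" for u v
  proof -
    have "- 1 \<le> V a u v * ln (V a u v)" for a
      using xlnx_bounds[of "V a u v"] P(2,4)[OF uv, of a] by simp
    then have "(\<Sum>a\<in>(UNIV::'k set). - 1) \<le> y u v" unfolding y_def by (intro sum_mono)
    then show ?thesis by (simp add: k_def)
  qed
  have "(\<Sum>u=1..n. \<Sum>v\<in>{1..n} - {u}. y u v) = (\<Sum>e\<in>complete_edges n. y (Min e) (Max e) + y (Max e) (Min e))"
    by (rule sum_distinct_pairs)
  also have "\<dots> = (\<Sum>e\<in>complete_edges n. 2 * y (Min e) (Max e))"
    by (rule sum.cong[OF refl]) (use ysym edge_Min_Max in fastforce)
  finally have e1: "(\<Sum>e\<in>complete_edges n. y (Min e) (Max e)) = (\<Sum>u=1..n. \<Sum>v\<in>{1..n} - {u}. y u v) / 2"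
    by (simp add: sum_distrib_left[symmetric])
  have "(\<Sum>v\<in>{1..n} - {u}. y u v) \<le> (\<Sum>v=1..n. y u v) + k" if u: "u \<in> {1..n}" for u
  proof -
    have "(\<Sum>v=1..n. y u v) = y u u + (\<Sum>v\<in>{1..n} - {u}. y u v)" by (rule sum.remove) (use u in auto)
    then show ?thesis using ylow[OF u u] by linarith
  qed
  then have "(\<Sum>u=1..n. \<Sum>v\<in>{1..n} - {u}. y u v) \<le> (\<Sum>u=1..n. (\<Sum>v=1..n. y u v) + k)" by (rule sum_mono)
  also have "\<dots> = (\<Sum>u=1..n. \<Sum>v=1..n. y u v) + n * k" by (simp add: sum.distrib)
  finally have e2: "(\<Sum>u=1..n. \<Sum>v\<in>{1..n} - {u}. y u v) \<le> (\<Sum>u=1..n. \<Sum>v=1..n. y u v) + n * k" .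
  have pair: "(\<Sum>u=1..n. \<Sum>v=1..n. \<Sum>a\<in>UNIV. w a u v * ln (V a u v)) = (real n)\<^sup>2 * step_pairing n (\<lambda>a u v. ln (V a u v)) (\<lambda>x. x) W"
  proof -
    have "step_pairing n (\<lambda>a u v. ln (V a u v)) (\<lambda>x. x) W
      = (\<Sum>a\<in>UNIV. \<Sum>u=1..n. \<Sum>v=1..n. ln (V a u v) * rect_integral (cell n u) (cell n v) (\<lambda>z. W z $ a))"
      unfolding step_pairing_def
      by (intro sum.cong refl step_integral(1)[where t = "block n"] bW finite_atLeastAtMost block_range n cell_measurable)
    then have "(real n)\<^sup>2 * step_pairing n (\<lambda>a u v. ln (V a u v)) (\<lambda>x. x) W
      = (\<Sum>a\<in>UNIV. \<Sum>u=1..n. \<Sum>v=1..n. w a u v * ln (V a u v))"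
      unfolding w_def block_avg_def by (simp add: sum_distrib_left mult_ac)
    also have "\<dots> = (\<Sum>u=1..n. \<Sum>a\<in>UNIV. \<Sum>v=1..n. w a u v * ln (V a u v))" by (rule sum.swap)
    also have "\<dots> = (\<Sum>u=1..n. \<Sum>v=1..n. \<Sum>a\<in>UNIV. w a u v * ln (V a u v))" by (intro sum.cong refl sum.swap)
    finally show ?thesis by simp
  qed
  have "y u v \<le> (1 - \<theta>) * (\<Sum>a\<in>UNIV. w a u v * ln (V a u v))" if uv: "u \<in> {1..n}" "v \<in> {1..n}" for u v
  proof -
    have "V a u v * ln (V a u v) \<le> (1 - \<theta>) * (w a u v * ln (V a u v))" for a
    proof -
      have "ln (V a u v) \<le> 0" using P(2,4)[OF uv, of a] by simp
      then have "\<theta> / k * ln (V a u v) \<le> 0" by (intro mult_nonneg_nonpos) (use \<theta> in \<open>auto simp: k_def\<close>)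
      moreover have "V a u v = (1 - \<theta>) * w a u v + \<theta> / k" by (simp add: V_def smooth_avg_def w_def k_def)
      then have "V a u v * ln (V a u v) = (1 - \<theta>) * (w a u v * ln (V a u v)) + \<theta> / k * ln (V a u v)"
        by (metis distrib_right mult.assoc)
      ultimately show ?thesis by linarith
    qed
    then show ?thesis unfolding y_def sum_distrib_left by (rule sum_mono)
  qed
  then have "(\<Sum>u=1..n. \<Sum>v=1..n. y u v) \<le> (\<Sum>u=1..n. \<Sum>v=1..n. (1 - \<theta>) * (\<Sum>a\<in>UNIV. w a u v * ln (V a u v)))"
    by (intro sum_mono)
  also have "\<dots> = (1 - \<theta>) * ((real n)\<^sup>2 * step_pairing n (\<lambda>a u v. ln (V a u v)) (\<lambda>x. x) W)"
    unfolding pair[symmetric] by (simp add: sum_distrib_left)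
  also have "\<dots> \<le> (1 - \<theta>) * ((real n)\<^sup>2 * entropy_fun W)"
    unfolding V_def using \<theta>
    by (intro mult_left_mono step_pairing_le_entropy log_step_smooth_avg W n id_mp_bijections) auto
  also have "\<dots> = (real n)\<^sup>2 * ((1 - \<theta>) * entropy_fun W)" by simp
  also have "\<dots> \<le> (real n)\<^sup>2 * (entropy_fun W + \<theta> * k)"
  proof (rule mult_left_mono)
    have "\<theta> * - k \<le> \<theta> * entropy_fun W" using entropy_bounds(1)[OF W] \<theta> by (intro mult_left_mono) (auto simp: k_def)
    then show "(1 - \<theta>) * entropy_fun W \<le> entropy_fun W + \<theta> * k" by (simp add: left_diff_distrib)
  qed simp
  finally show ?thesis using e1 e2 unfolding y_def V_def k_def by linarith
qed

text \<open>The n diagonal blocks have total area 1/n and the kernel is at most 1 there in absolute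
  value; off the diagonal only sums over pairs of vertex sets have to be controlled.\<close>

lemma cut_norm_empirical_le:
  fixes X :: "nat set \<Rightarrow> 'k::finite"
  assumes n: "n \<ge> 1" and V: "\<And>u v. u \<in> {1..n} \<Longrightarrow> v \<in> {1..n} \<Longrightarrow> 0 \<le> V u v \<and> V u v \<le> 1"
    and c: "\<And>A B. A \<subseteq> {1..n} \<Longrightarrow> B \<subseteq> {1..n} \<Longrightarrow>
      \<bar>\<Sum>u\<in>A. \<Sum>v\<in>B. if u = v then 0 else of_bool (X {u, v} = a) - V u v\<bar> \<le> c * (real n)\<^sup>2"
  shows "cut_norm (\<lambda>z. empirical_graphon n X z $ a - V (block n (fst z)) (block n (snd z))) \<le> c + 1 / n"
proof -
  let ?G = "\<lambda>u v. if u = v then 0 else of_bool (X {u, v} = a) - V u v"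
  let ?D = "\<lambda>u v. if u = v then 1 / real CARD('k) - V u v else 0"
  have k: "1 / real CARD('k) \<le> 1" by (simp add: Suc_leI)
  have bk: "bkernel (\<lambda>z. ?G (block n (fst z)) (block n (snd z)))" "bkernel (\<lambda>z. ?D (block n (fst z)) (block n (snd z)))"
    "bkernel (\<lambda>z. \<bar>?D (block n (fst z)) (block n (snd z))\<bar>)"
    by (intro bkernel_abs bkernel_block n)+
  have "cut_norm (\<lambda>z. empirical_graphon n X z $ a - V (block n (fst z)) (block n (snd z)))
    = cut_norm (\<lambda>z. ?G (block n (fst z)) (block n (snd z)) + ?D (block n (fst z)) (block n (snd z)))"
    by (rule cut_norm_cong) (simp add: empirical_graphon_component)
  also have "\<dots> \<le> cut_norm (\<lambda>z. ?G (block n (fst z)) (block n (snd z))) + cut_norm (\<lambda>z. ?D (block n (fst z)) (block n (snd z)))"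
    by (rule cut_norm_add[OF bk(1,2)])
  also have "cut_norm (\<lambda>z. ?G (block n (fst z)) (block n (snd z))) \<le> c"
    by (rule cut_norm_block_le[OF n, of ?G]) (rule c)
  also have "cut_norm (\<lambda>z. ?D (block n (fst z)) (block n (snd z))) \<le> (\<integral>z. \<bar>?D (block n (fst z)) (block n (snd z))\<bar> \<partial>square_measure)"
    by (rule cut_norm_le_L1[OF bk(2)])
  also have "\<dots> = (\<Sum>u=1..n. \<Sum>v=1..n. \<bar>?D u v\<bar>) / (real n)\<^sup>2"
    by (rule integral_block[OF n, of "\<lambda>u v. \<bar>?D u v\<bar>"])
  also have "\<dots> \<le> (\<Sum>u=1..n. 1) / (real n)\<^sup>2"
  proof (intro divide_right_mono sum_mono)
    fix u assume u: "u \<in> {1..n}"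
    have "(\<Sum>v=1..n. \<bar>?D u v\<bar>) = (\<Sum>v=1..n. if v = u then \<bar>1 / real CARD('k) - V u u\<bar> else 0)"
      by (intro sum.cong) auto
    also have "\<dots> = \<bar>1 / real CARD('k) - V u u\<bar>" using u by simp
    also have "\<dots> \<le> 1" 
    proof -
      have "0 \<le> 1 / real CARD('k)" by simp
      then show ?thesis using V[OF u u] k unfolding abs_le_iff by linarith
    qed
    finally show "(\<Sum>v=1..n. \<bar>?D u v\<bar>) \<le> 1" .
  qed simp
  also have "\<dots> = 1 / n" using n by (simp add: power2_eq_square)
  finally show ?thesis by simp
qed

text \<open>Union bound over k colours, two signs and 4^n pairs of vertex sets, each event having
  the Chebyshev tail.\<close>

lemma colour_prob_far_le:
  fixes V :: "'k::finite \<Rightarrow> nat \<Rightarrow> nat \<Rightarrow> real"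
  assumes n: "n \<ge> 1" and \<eta>: "0 < \<eta>" "\<eta> \<le> 4"
    and V: "\<And>u v a. u \<in> {1..n} \<Longrightarrow> v \<in> {1..n} \<Longrightarrow> 0 < V a u v"
    "\<And>u v. u \<in> {1..n} \<Longrightarrow> v \<in> {1..n} \<Longrightarrow> (\<Sum>a\<in>UNIV. V a u v) = 1"
    "\<And>u v a. u \<in> {1..n} \<Longrightarrow> v \<in> {1..n} \<Longrightarrow> V a u v = V a v u"
  shows "(\<Sum>X\<in>{X\<in>colourings n. \<exists>a. \<eta> + 1 / n < cut_norm (\<lambda>z. empirical_graphon n X z $ a - V a (block n (fst z)) (block n (snd z)))}.
      colour_prob n (\<lambda>e a. V a (Min e) (Max e)) X) \<le> 2 * real CARD('k) * 4 ^ n * exp (- (\<eta>\<^sup>2 / 16) * (real n)\<^sup>2)"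
    (is "sum ?P ?far \<le> _")
proof -
  let ?p = "\<lambda>e a. V a (Min e) (Max e)"
  have pp: "0 < ?p e a" if "e \<in> complete_edges n" for e a using V(1) edge_Min_Max[OF that] by blast
  have ps: "(\<Sum>a\<in>UNIV. ?p e a) = 1" if "e \<in> complete_edges n" for e using V(2) edge_Min_Max[OF that] by blast
  have V1: "V a u v \<le> 1" if "u \<in> {1..n}" "v \<in> {1..n}" for a u v
    using member_le_sum[of a UNIV "\<lambda>a. V a u v"] V(1,2)[OF that] by (simp add: less_imp_le)
  define I where "I = (UNIV :: 'k set) \<times> {-1, 1 :: real} \<times> Pow {1..n} \<times> Pow {1..n}"
  \<comment> \<open>The signed number of orientations of the edge that lie in A x B; its absolute
    value is at most 2.\<close>
  define c where "c = (\<lambda>(a :: 'k, \<sigma>, A :: nat set, B). \<lambda>e. \<sigma> * (of_bool (Min e \<in> A \<and> Max e \<in> B) + of_bool (Max e \<in> A \<and> Min e \<in> B)) :: real)"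
  define Bad where "Bad i = {X\<in>colourings n. \<eta> * (real n)\<^sup>2 \<le> (\<Sum>e\<in>complete_edges n. c i e * (of_bool (X e = fst i) - ?p e (fst i)))}" for i
  have finI: "finite I" unfolding I_def by auto
  have sub: "?far \<subseteq> (\<Union>i\<in>I. Bad i)"
  proof
    fix X assume "X \<in> ?far"
    then obtain a where X: "X \<in> colourings n" and a: "\<not> cut_norm (\<lambda>z. empirical_graphon n X z $ a - V a (block n (fst z)) (block n (snd z))) \<le> \<eta> + 1 / n"
      unfolding mem_Collect_eq not_le by blast
    have "\<exists>A B. A \<subseteq> {1..n} \<and> B \<subseteq> {1..n} \<and> \<eta> * (real n)\<^sup>2 < \<bar>\<Sum>u\<in>A. \<Sum>v\<in>B. if u = v then 0 else of_bool (X {u, v} = a) - V a u v\<bar>"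
    proof (rule ccontr)
      assume neg: "\<not> ?thesis"
      have "cut_norm (\<lambda>z. empirical_graphon n X z $ a - V a (block n (fst z)) (block n (snd z))) \<le> \<eta> + 1 / n"
        by (rule cut_norm_empirical_le[OF n]) (use neg V(1) V1 in \<open>auto simp: not_less less_imp_le\<close>)
      then show False using a by simp
    qed
    then obtain A B where AB: "A \<subseteq> {1..n}" "B \<subseteq> {1..n}"
      and big: "\<eta> * (real n)\<^sup>2 < \<bar>\<Sum>u\<in>A. \<Sum>v\<in>B. if u = v then 0 else of_bool (X {u, v} = a) - V a u v\<bar>" by blast
    let ?d = "\<lambda>u v. of_bool (X {u, v} = a) - V a u v"
    define s where "s = (\<Sum>u\<in>A. \<Sum>v\<in>B. if u = v then 0 else ?d u v)"
    obtain \<sigma> where \<sigma>: "\<sigma> \<in> {-1, 1}" "\<bar>s\<bar> = \<sigma> * s" by (cases "s \<ge> 0") (auto intro: that[of 1] that[of "-1"])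
    have fA: "finite A" "finite B" using AB finite_subset by blast+
    have "s = (\<Sum>u=1..n. if u \<in> A then (\<Sum>v\<in>B. if u = v then 0 else ?d u v) else 0)"
      unfolding s_def by (rule sum.mono_neutral_cong_left) (use AB in auto)
    also have "\<dots> = (\<Sum>u=1..n. \<Sum>v\<in>{1..n} - {u}. of_bool (u \<in> A \<and> v \<in> B) * ?d u v)"
    proof (rule sum.cong[OF refl])
      fix u assume "u \<in> {1..n}"
      have "(\<Sum>v\<in>B. if u = v then 0 else ?d u v) = (\<Sum>v\<in>{1..n} - {u}. of_bool (v \<in> B) * ?d u v)"
        by (rule sum.mono_neutral_cong) (use AB fA in auto)
      then show "(if u \<in> A then (\<Sum>v\<in>B. if u = v then 0 else ?d u v) else 0)
        = (\<Sum>v\<in>{1..n} - {u}. of_bool (u \<in> A \<and> v \<in> B) * ?d u v)" by simp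
    qed
    also have "\<dots> = (\<Sum>e\<in>complete_edges n. of_bool (Min e \<in> A \<and> Max e \<in> B) * ?d (Min e) (Max e)
      + of_bool (Max e \<in> A \<and> Min e \<in> B) * ?d (Max e) (Min e))" by (rule sum_distinct_pairs)
    also have "\<dots> = (\<Sum>e\<in>complete_edges n. (of_bool (Min e \<in> A \<and> Max e \<in> B) + of_bool (Max e \<in> A \<and> Min e \<in> B)) * (of_bool (X e = a) - ?p e a))"
    proof (rule sum.cong[OF refl])
      fix e assume e: "e \<in> complete_edges n"
      note E = edge_Min_Max[OF e]
      have "?d (Min e) (Max e) = of_bool (X e = a) - ?p e a" "?d (Max e) (Min e) = of_bool (X e = a) - ?p e a"
        using E(4) V(3)[OF E(2,3), of a] by (simp_all add: insert_commute)
      then show "of_bool (Min e \<in> A \<and> Max e \<in> B) * ?d (Min e) (Max e) + of_bool (Max e \<in> A \<and> Min e \<in> B) * ?d (Max e) (Min e)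
        = (of_bool (Min e \<in> A \<and> Max e \<in> B) + of_bool (Max e \<in> A \<and> Min e \<in> B)) * (of_bool (X e = a) - ?p e a)"
        by (simp only: distrib_right)
    qed
    finally have "\<sigma> * s = (\<Sum>e\<in>complete_edges n. c (a, \<sigma>, A, B) e * (of_bool (X e = a) - ?p e a))"
      unfolding c_def by (simp add: sum_distrib_left mult.assoc)
    then have "X \<in> Bad (a, \<sigma>, A, B)" using X big \<sigma>(2) unfolding Bad_def s_def[symmetric] by simp
    moreover have "(a, \<sigma>, A, B) \<in> I" using \<sigma>(1) AB by (simp add: I_def)
    ultimately show "X \<in> (\<Union>i\<in>I. Bad i)" by blast
  qed
  have P0: "0 \<le> ?P X" for X by (rule less_imp_le[OF colour_prob_pos[OF pp ps]])
  have finB: "finite (Bad i)" for i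
    unfolding Bad_def by (rule finite_subset[OF _ finite_colourings]) auto
  have "sum ?P ?far \<le> sum ?P (\<Union>i\<in>I. Bad i)" by (rule sum_mono2) (use finI finB sub P0 in auto)
  also have "\<dots> \<le> (\<Sum>i\<in>I. sum ?P (Bad i))"
    by (rule sum_UN_le[OF finI finB P0])
  also have "\<dots> \<le> (\<Sum>i\<in>I. exp (- (\<eta>\<^sup>2 / 16) * (real n)\<^sup>2))"
  proof (rule sum_mono)
    fix i assume "i \<in> I"
    then have "\<bar>c i e\<bar> \<le> 2" for e unfolding I_def c_def by (auto simp: of_bool_def)
    then show "sum ?P (Bad i) \<le> exp (- (\<eta>\<^sup>2 / 16) * (real n)\<^sup>2)"
      unfolding Bad_def by (intro colour_prob_tail pp ps \<eta>)
  qed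
  also have "\<dots> = card I * exp (- (\<eta>\<^sup>2 / 16) * (real n)\<^sup>2)" by simp
  also have "card I = CARD('k) * (2 * (2 ^ n * 2 ^ n))" unfolding I_def by (simp add: card_cartesian_product card_Pow)
  also have "real (CARD('k) * (2 * (2 ^ n * 2 ^ n))) = 2 * real CARD('k) * 4 ^ n"
    by (simp add: power_mult_distrib[symmetric])
  finally show ?thesis .
qed

subsection \<open>Lower bound for partition functions\<close>

text \<open>The trial law concentrates near W, where F is almost F W. Boundedness of F controls the
  remaining colourings, whose probability tends to 0. The loss in F is at most \<kappa>/2, the
  smoothing costs at most \<kappa>/4 and the diagonal at most \<kappa>/8.\<close>

lemma partition_function_ge:
  fixes W :: "'k::finite kernel" and F :: "'k kernel \<Rightarrow> real"
  assumes W: "W \<in> graphons" and \<kappa>: "\<kappa> > 0"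
    and bdd: "\<And>U. U \<in> graphons \<Longrightarrow> \<bar>F U\<bar> \<le> C"
    and cont: "r > 0" "\<And>U. U \<in> graphons \<Longrightarrow> cut_norm_vec (\<lambda>z. U z - W z) < r \<Longrightarrow> F W - \<kappa> / 4 \<le> F U"
  obtains n0 where "n0 \<ge> 1" "\<And>n. n \<ge> n0 \<Longrightarrow>
    exp ((real n)\<^sup>2 * (F W - entropy_fun W / 2 - \<kappa>)) \<le> (\<Sum>X\<in>colourings n. exp ((real n)\<^sup>2 * F (empirical_graphon n X)))"
proof -
  define k where "k = real CARD('k)"
  have k: "k \<ge> 1" unfolding k_def by (simp add: Suc_leI)
  have C: "C \<ge> 0" using bdd[OF W] by simp
  \<comment> \<open>For each of the k colours there are four errors of at most \<rho>: the
    fluctuation \<eta>, the diagonal 1/n, the block average and the smoothing \<theta>. Together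
    they give at most 4r/5.\<close>
  define \<rho> where "\<rho> = r / (5 * k)"
  have \<rho>: "\<rho> > 0" using cont(1) k by (simp add: \<rho>_def)
  define \<eta> where "\<eta> = min 4 \<rho>"
  have \<eta>: "0 < \<eta>" "\<eta> \<le> 4" "\<eta> \<le> \<rho>" using \<rho> by (auto simp: \<eta>_def)
  \<comment> \<open>The last bound makes the entropy cost \<theta> k at most \<kappa>/2, of which
    half counts.\<close>
  define \<theta> where "\<theta> = min (1/2) (min \<rho> (\<kappa> / (2 * k)))"
  have \<theta>: "0 < \<theta>" "\<theta> < 1" "\<theta> \<le> \<rho>" and "\<theta> \<le> \<kappa> / (2 * k)" using \<rho> \<kappa> k by (auto simp: \<theta>_def)
  then have \<theta>k: "\<theta> * k \<le> \<kappa> / 2" using k by (simp add: field_simps)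
  define d where "d a n = (\<integral>z. \<bar>W z $ a - block_avg n (\<lambda>z. W z $ a) (block n (fst z)) (block n (snd z))\<bar> \<partial>square_measure)" for a n
  obtain n1 where n1: "n1 \<ge> 1" "\<And>n a. n \<ge> n1 \<Longrightarrow> d a n < \<rho>"
    using step_graphon_L1[OF W \<rho>, folded d_def] by metis
  define b where "b n = 2 * k * 4 ^ n * exp (- (\<eta>\<^sup>2 / 16) * (real n)\<^sup>2)" for n :: nat
  have "b \<longlonglongrightarrow> 0"
  proof -
    define c where "c = \<eta>\<^sup>2 / 16"
    have c: "c > 0" using \<eta> by (simp add: c_def)
    have "(\<lambda>n. 4 ^ n * exp (- c * (real n)\<^sup>2)) \<longlonglongrightarrow> 0" using c by real_asymp
    from tendsto_mult_left[OF this, of "2 * k"] show ?thesis unfolding b_def c_def by (simp add: mult.assoc)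
  qed
  \<comment> \<open>A far colouring can lower F by at most 2C, so this probability costs at most
    \<kappa>/4.\<close>
  moreover have "\<kappa> / (8 * C + 8) > 0" using \<kappa> C by simp
  ultimately have "\<forall>\<^sub>F n in sequentially. b n < \<kappa> / (8 * C + 8)" by (rule order_tendstoD(2))
  then obtain n2 where n2: "\<And>n. n \<ge> n2 \<Longrightarrow> b n < \<kappa> / (8 * C + 8)" unfolding eventually_sequentially by blast
  obtain n3 :: nat where n3: "1 / \<rho> < n3" using reals_Archimedean2 by blast
  obtain n4 :: nat where n4: "4 * k / \<kappa> < n4" using reals_Archimedean2 by blast
  show ?thesis
  proof (rule that)
    show "max n1 (max n2 (max n3 n4)) \<ge> 1" using n1 by simp
    fix n assume "n \<ge> max n1 (max n2 (max n3 n4))"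
    then have n: "n \<ge> n1" "n \<ge> n2" "n \<ge> n3" "n \<ge> n4" "n \<ge> 1" using n1(1) by auto
    have n\<rho>: "1 / n < \<rho>"
    proof -
      have "1 / \<rho> < n" using n3 n(3) by linarith
      then show ?thesis using \<rho> n(5) by (simp add: field_simps)
    qed
    have nk: "real n * k \<le> (real n)\<^sup>2 * (\<kappa> / 4)"
    proof -
      have "4 * k / \<kappa> < n" using n4 n(4) by linarith
      then have "k \<le> n * (\<kappa> / 4)" using \<kappa> by (simp add: field_simps)
      then have "n * k \<le> n * (n * (\<kappa> / 4))" by (intro mult_left_mono) auto
      then show ?thesis by (simp add: power2_eq_square mult.assoc)
    qed
    define V where "V = smooth_avg \<theta> n W"
    note P = smooth_avg_props[OF W n(5) \<theta>(1,2), folded V_def]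
    define p where "p e a = V a (Min e) (Max e)" for e :: "nat set" and a
    have pp: "0 < p e a" if "e \<in> complete_edges n" for e a
      unfolding p_def using P(2) edge_Min_Max[OF that] by blast
    have ps: "(\<Sum>a\<in>UNIV. p e a) = 1" if "e \<in> complete_edges n" for e
      unfolding p_def using P(3) edge_Min_Max[OF that] by blast
    let ?C = "colourings n :: (nat set \<Rightarrow> 'k) set"
    let ?P = "colour_prob n p"
    define E where "E X = empirical_graphon n X" for X :: "nat set \<Rightarrow> 'k"
    have EG: "E X \<in> graphons" for X unfolding E_def by (rule empirical_graphon_in_graphons)
    have P0: "0 \<le> ?P X" for X by (rule less_imp_le[OF colour_prob_pos[OF pp ps]])
    have P1: "sum ?P ?C = 1" by (rule colour_prob_sum[OF pp ps])
    define far where "far = {X\<in>?C. \<exists>a. \<eta> + 1 / n < cut_norm (\<lambda>z. empirical_graphon n X z $ a - V a (block n (fst z)) (block n (snd z)))}"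
    have "sum ?P far \<le> b n"
      unfolding far_def b_def p_def k_def
      by (rule colour_prob_far_le[OF n(5) \<eta>(1,2) P(2,3,5)])
    then have far: "sum ?P far \<le> \<kappa> / (8 * C + 8)" using n2[OF n(2)] by linarith
    have near: "F W - \<kappa> / 4 \<le> F (E X)" if X: "X \<in> ?C" "X \<notin> far" for X
    proof (rule cont(2)[OF EG])
      have bk: "bkernel (\<lambda>z. E X z $ a)" "bkernel (\<lambda>z. W z $ a)" "bkernel (\<lambda>z. V a (block n (fst z)) (block n (snd z)))" for a
        by (intro vkernel_component graphon_vkernel EG W bkernel_block n(5))+
      have "cut_norm (\<lambda>z. (E X z - W z) $ a) \<le> 4 * \<rho>" for a
      proof -
        have "cut_norm (\<lambda>z. E X z $ a - W z $ a) \<le> cut_norm (\<lambda>z. E X z $ a - V a (block n (fst z)) (block n (snd z)))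
          + cut_norm (\<lambda>z. V a (block n (fst z)) (block n (snd z)) - W z $ a)"
          by (rule cut_norm_triangle[OF bk(1) bk(3) bk(2)])
        also have "cut_norm (\<lambda>z. V a (block n (fst z)) (block n (snd z)) - W z $ a)
          = cut_norm (\<lambda>z. W z $ a - V a (block n (fst z)) (block n (snd z)))" by (rule cut_norm_minus_commute)
        also have "\<dots> \<le> (\<integral>z. \<bar>W z $ a - V a (block n (fst z)) (block n (snd z))\<bar> \<partial>square_measure)"
          by (intro cut_norm_le_L1 bkernel_diff bk)
        also have "\<dots> \<le> d a n + \<theta>" unfolding V_def d_def by (rule smooth_avg_L1[OF W n(5) \<theta>(1,2)])
        also have "cut_norm (\<lambda>z. E X z $ a - V a (block n (fst z)) (block n (snd z))) \<le> \<eta> + 1 / n"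
          using X unfolding far_def E_def by (simp add: not_less)
        finally show ?thesis using n1(2)[OF n(1), of a] n\<rho> \<eta>(3) \<theta>(3) by simp
      qed
      then have "cut_norm_vec (\<lambda>z. E X z - W z) \<le> (\<Sum>a\<in>(UNIV::'k set). 4 * \<rho>)"
        unfolding cut_norm_vec_def by (intro sum_mono)
      also have "\<dots> = 4 / 5 * r" using k by (simp add: \<rho>_def k_def[symmetric])
      also have "\<dots> < r" using cont(1) by simp
      finally show "cut_norm_vec (\<lambda>z. E X z - W z) < r" .
    qed
    have "F W - \<kappa> / 2 \<le> (\<Sum>X\<in>?C. ?P X * F (E X))"
    proof -
      have "(\<Sum>X\<in>?C. ?P X * (F W - \<kappa> / 4 - (if X \<in> far then 2 * C else 0))) \<le> (\<Sum>X\<in>?C. ?P X * F (E X))"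
      proof (intro sum_mono mult_left_mono P0)
        fix X assume X: "X \<in> ?C"
        show "F W - \<kappa> / 4 - (if X \<in> far then 2 * C else 0) \<le> F (E X)"
          using near[OF X] bdd[OF EG[of X]] bdd[OF W] \<kappa> by (cases "X \<in> far") auto
      qed
      moreover have "(\<Sum>X\<in>?C. ?P X * (F W - \<kappa> / 4 - (if X \<in> far then 2 * C else 0)))
        = (F W - \<kappa> / 4) - 2 * C * sum ?P far"
      proof -
        have "(\<Sum>X\<in>?C. ?P X * (if X \<in> far then 2 * C else 0)) = (\<Sum>X\<in>far. ?P X * (2 * C))"
          by (rule sum.mono_neutral_cong_right) (auto simp: finite_colourings far_def)
        then have "(\<Sum>X\<in>?C. ?P X * (if X \<in> far then 2 * C else 0)) = 2 * C * sum ?P far"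
          by (simp add: sum_distrib_left mult.commute)
        moreover have "(\<Sum>X\<in>?C. ?P X * (F W - \<kappa> / 4)) = F W - \<kappa> / 4"
          unfolding sum_distrib_right[symmetric] P1 by simp
        ultimately show ?thesis
          unfolding right_diff_distrib[of "?P _" "F W - \<kappa> / 4"] sum_subtractf by linarith
      qed
      moreover have "2 * C * sum ?P far \<le> \<kappa> / 4"
      proof -
        have "2 * C * sum ?P far \<le> 2 * C * (\<kappa> / (8 * C + 8))" using far C by (intro mult_left_mono) auto
        also have "\<dots> \<le> \<kappa> / 4" using C \<kappa> by (simp add: field_simps)
        finally show ?thesis .
      qed
      ultimately show ?thesis by linarith
    qed
    then have "(real n)\<^sup>2 * (F W - \<kappa> / 2) \<le> (real n)\<^sup>2 * (\<Sum>X\<in>?C. ?P X * F (E X))" by (rule mult_left_mono) simp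
    also have "\<dots> = (\<Sum>X\<in>?C. ?P X * ((real n)\<^sup>2 * F (E X)))" by (simp add: sum_distrib_left mult_ac)
    finally have e1: "(real n)\<^sup>2 * (F W - \<kappa> / 2) \<le> (\<Sum>X\<in>?C. ?P X * ((real n)\<^sup>2 * F (E X)))" .
    have e2: "(\<Sum>e\<in>complete_edges n. \<Sum>a\<in>UNIV. p e a * ln (p e a)) \<le> (real n)\<^sup>2 * (entropy_fun W + \<theta> * k) / 2 + real n * k / 2"
      unfolding p_def V_def k_def by (rule smooth_avg_entropy_le[OF W n(5) \<theta>(1,2)])
    have e3: "(real n)\<^sup>2 * (\<theta> * k) \<le> (real n)\<^sup>2 * (\<kappa> / 2)" using \<theta>k by (intro mult_left_mono) auto
    have "(real n)\<^sup>2 * (F W - entropy_fun W / 2 - \<kappa>)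
      = (real n)\<^sup>2 * (F W - \<kappa> / 2) - ((real n)\<^sup>2 * entropy_fun W / 2 + (real n)\<^sup>2 * (\<kappa> / 2))"
      by (simp add: algebra_simps)
    also have "\<dots> \<le> (\<Sum>X\<in>?C. ?P X * ((real n)\<^sup>2 * F (E X))) - (\<Sum>e\<in>complete_edges n. \<Sum>a\<in>UNIV. p e a * ln (p e a))"
    proof -
      have "0 \<le> (real n)\<^sup>2 * \<kappa>" using \<kappa> by simp
      then show ?thesis using e1 e2 e3 nk by (simp add: distrib_left add_divide_distrib)
    qed
    finally have "exp ((real n)\<^sup>2 * (F W - entropy_fun W / 2 - \<kappa>))
      \<le> exp ((\<Sum>X\<in>?C. ?P X * ((real n)\<^sup>2 * F (E X))) - (\<Sum>e\<in>complete_edges n. \<Sum>a\<in>UNIV. p e a * ln (p e a)))"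
      by simp
    also have "\<dots> \<le> (\<Sum>X\<in>?C. exp ((real n)\<^sup>2 * F (E X)))"
      by (rule gibbs_variational[OF pp ps])
    finally show "exp ((real n)\<^sup>2 * (F W - entropy_fun W / 2 - \<kappa>)) \<le> (\<Sum>X\<in>?C. exp ((real n)\<^sup>2 * F (empirical_graphon n X)))"
      unfolding E_def .
  qed
qed

subsection \<open>Rearranging blocks\<close>

text \<open>The point \<open>0\<close> is kept fixed because it is the one point of the first block that does not belong
  to the half-open interval.\<close>

definition block_shift :: "nat \<Rightarrow> (nat \<Rightarrow> nat) \<Rightarrow> real \<Rightarrow> real" where
  "block_shift n \<sigma> x = (if x = 0 then 0 else x + (real (\<sigma> (block n x)) - real (block n x)) / n)"

lemma block_shift_pos:
  assumes n: "n \<ge> 1" and \<sigma>: "\<sigma> ` {1..n} \<subseteq> {1..n}" and x: "0 < x" "x \<le> 1"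
  shows "0 < block_shift n \<sigma> x" "block_shift n \<sigma> x \<le> 1" "block n (block_shift n \<sigma> x) = \<sigma> (block n x)"
proof -
  let ?u = "block n x" and ?v = "\<sigma> (block n x)"
  have u: "?u \<in> {1..n}" using block_range[OF n] x by simp
  then have v: "?v \<in> {1..n}" using \<sigma> by blast
  have b: "(real ?u - 1) / n < x" "x \<le> real ?u / n"
    using block_eq_iff[OF n, of x ?u] u x by auto
  have y: "block_shift n \<sigma> x = x + real ?v / n - real ?u / n" using x by (simp add: block_shift_def diff_divide_distrib)
  have "(real ?v - 1) / n < block_shift n \<sigma> x" "block_shift n \<sigma> x \<le> real ?v / n"
    unfolding y using b by (simp_all add: diff_divide_distrib)
  moreover have "0 \<le> (real ?v - 1) / n" "real ?v / n \<le> 1" using v by auto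
  ultimately show "0 < block_shift n \<sigma> x" "block_shift n \<sigma> x \<le> 1" by linarith+
  then show "block n (block_shift n \<sigma> x) = \<sigma> (block n x)"
    using \<open>(real ?v - 1) / n < block_shift n \<sigma> x\<close> \<open>block_shift n \<sigma> x \<le> real ?v / n\<close> v
    by (subst block_eq_iff[OF n]) auto
qed

lemma block_shift_inverse:
  assumes n: "n \<ge> 1" and \<sigma>: "\<sigma> ` {1..n} \<subseteq> {1..n}" and \<tau>: "\<And>u. u \<in> {1..n} \<Longrightarrow> \<tau> (\<sigma> u) = u" and x: "x \<in> {0..1}"
  shows "block_shift n \<tau> (block_shift n \<sigma> x) = x"
proof (cases "x = 0")
  case False
  then have x: "0 < x" "x \<le> 1" using x by auto
  note B = block_shift_pos[OF n \<sigma> x]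
  have "block n x \<in> {1..n}" using block_range[OF n] x by simp
  then show ?thesis using B \<tau> False by (simp add: block_shift_def[of n \<tau>]) (simp add: block_shift_def diff_divide_distrib)
qed (simp add: block_shift_def)

text \<open>Up to the point 0 the preimage is the disjoint union of translates of the pieces of A in
  the half-open intervals, and the bijection \<sigma> only permutes the measures of these
  pieces.\<close>

lemma block_shift_preserves:
  assumes n: "n \<ge> 1" and \<sigma>: "bij_betw \<sigma> {1..n} {1..n}" and A: "A \<in> sets unit_measure"
  shows "block_shift n \<sigma> -` A \<inter> {0..1} \<in> sets unit_measure \<and>
    emeasure unit_measure (block_shift n \<sigma> -` A \<inter> {0..1}) = emeasure unit_measure A"
proof -
  define I where "I u = {(real u - 1) / n<..real u / n}" for u :: nat
  define d where "d u = (real (\<sigma> u) - real u) / n" for u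
  have im: "\<sigma> ` {1..n} = {1..n}" using \<sigma> by (simp add: bij_betw_def)
  have A': "A \<subseteq> {0..1}" "A \<in> sets lebesgue" using A by (auto simp: sets_unit_measure)
  have Ib: "x \<in> I u \<Longrightarrow> u \<in> {1..n} \<Longrightarrow> 0 < x \<and> x \<le> 1 \<and> block n x = u" for x u
  proof -
    assume x: "x \<in> I u" and u: "u \<in> {1..n}"
    have "0 \<le> (real u - 1) / n" "real u / n \<le> 1" using u by auto
    then have "0 < x" "x \<le> 1" using x unfolding I_def by auto
    then show ?thesis using x u unfolding I_def by (auto simp: block_eq_iff[OF n])
  qed
  have Ic: "0 < x \<Longrightarrow> x \<le> 1 \<Longrightarrow> x \<in> I (block n x) \<and> block n x \<in> {1..n}" for x
    using block_eq_iff[OF n, of x "block n x"] block_range[OF n, of x] unfolding I_def by auto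
  have disj: "disjoint_family_on (\<lambda>u. B u \<inter> I u) {1..n}" for B
    unfolding disjoint_family_on_def using Ib by blast
  define S where "S u = (\<lambda>x. - d u + x) ` (A \<inter> I (\<sigma> u))" for u
  have Sm: "S u \<in> sets lebesgue" for u
    unfolding S_def by (intro lebesgue_sets_translation sets.Int A'(2)) (simp add: I_def)
  have Se: "emeasure lebesgue (S u) = emeasure lebesgue (A \<inter> I (\<sigma> u))" for u
    unfolding S_def using emeasure_lebesgue_affine[of 1 "- d u" "A \<inter> I (\<sigma> u)"] by simp
  have SI: "S u = S u \<inter> I u" if "u \<in> {1..n}" for u
    unfolding S_def I_def d_def by (auto simp: diff_divide_distrib)
  have pre: "block_shift n \<sigma> -` A \<inter> {0..1} = (\<Union>u\<in>{1..n}. S u) \<union> (A \<inter> {0})"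
  proof (intro set_eqI iffI)
    fix x assume x: "x \<in> block_shift n \<sigma> -` A \<inter> {0..1}"
    show "x \<in> (\<Union>u\<in>{1..n}. S u) \<union> (A \<inter> {0})"
    proof (cases "x = 0")
      case False
      then have x0: "0 < x" "x \<le> 1" using x by auto
      note B = block_shift_pos[OF n equalityD1[OF im] x0]
      have "block_shift n \<sigma> x \<in> A \<inter> I (\<sigma> (block n x))" using x Ic[OF B(1,2)] B(3) by auto
      moreover have "x = - d (block n x) + block_shift n \<sigma> x" using False by (simp add: block_shift_def d_def)
      ultimately have "x \<in> S (block n x)" unfolding S_def by (rule image_eqI[rotated])
      then show ?thesis using Ic[OF x0] by blast
    qed (use x in \<open>simp add: block_shift_def\<close>)
  next
    fix x assume "x \<in> (\<Union>u\<in>{1..n}. S u) \<union> (A \<inter> {0})"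
    then consider u where "u \<in> {1..n}" "x \<in> S u" | "x \<in> A" "x = 0" by blast
    then show "x \<in> block_shift n \<sigma> -` A \<inter> {0..1}"
    proof cases
      case 1
      then have "x \<in> I u" using SI by blast
      then have b: "0 < x" "x \<le> 1" "block n x = u" using Ib 1 by blast+
      then have "block_shift n \<sigma> x = x + d u" by (simp add: block_shift_def d_def)
      moreover have "x + d u \<in> A" using 1(2) unfolding S_def by auto
      ultimately show ?thesis using b by simp
    qed (simp add: block_shift_def)
  qed
  have z: "A \<inter> {0} \<in> null_sets lebesgue" by (rule null_sets_completion_subset[of _ "{0}"]) auto
  have Um: "(\<Union>u\<in>{1..n}. S u) \<in> sets lebesgue" using Sm by auto
  have m: "block_shift n \<sigma> -` A \<inter> {0..1} \<in> sets unit_measure"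
    unfolding sets_unit_measure
  proof
    show "block_shift n \<sigma> -` A \<inter> {0..1} \<in> sets lebesgue" unfolding pre using Um z by auto
  qed auto
  have "emeasure unit_measure (block_shift n \<sigma> -` A \<inter> {0..1}) = emeasure lebesgue ((\<Union>u\<in>{1..n}. S u) \<union> (A \<inter> {0}))"
    using emeasure_unit_measure[OF m] by (simp only: pre)
  also have "\<dots> = emeasure lebesgue (\<Union>u\<in>{1..n}. S u)" using Um z by (rule emeasure_Un_null_set)
  also have "\<dots> = (\<Sum>u\<in>{1..n}. emeasure lebesgue (S u))"
  proof (rule sum_emeasure[symmetric])
    show "disjoint_family_on S {1..n}" using disj[of S] SI unfolding disjoint_family_on_def by metis
  qed (use Sm in auto)
  also have "\<dots> = (\<Sum>u\<in>{1..n}. emeasure lebesgue (A \<inter> I (\<sigma> u)))" unfolding Se ..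
  also have "\<dots> = (\<Sum>u\<in>{1..n}. emeasure lebesgue (A \<inter> I u))" by (rule sum.reindex_bij_betw[OF \<sigma>])
  also have "\<dots> = emeasure lebesgue (\<Union>u\<in>{1..n}. A \<inter> I u)"
    by (rule sum_emeasure) (use A' disj[of "\<lambda>_. A"] in \<open>auto simp: I_def\<close>)
  also have "\<dots> = emeasure lebesgue ((\<Union>u\<in>{1..n}. A \<inter> I u) \<union> (A \<inter> {0}))"
    by (rule emeasure_Un_null_set[symmetric, OF _ z]) (use A' in \<open>auto simp: I_def\<close>)
  also have "(\<Union>u\<in>{1..n}. A \<inter> I u) \<union> (A \<inter> {0}) = A"
  proof (intro set_eqI iffI)
    fix x assume x: "x \<in> A"
    then have "x = 0 \<or> 0 < x \<and> x \<le> 1" using A' by force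
    then show "x \<in> (\<Union>u\<in>{1..n}. A \<inter> I u) \<union> (A \<inter> {0})" using x Ic by blast
  qed blast
  finally show ?thesis using m emeasure_unit_measure[OF A] by simp
qed

lemma block_shift_mp:
  assumes n: "n \<ge> 1" and \<sigma>: "bij_betw \<sigma> {1..n} {1..n}"
  shows "block_shift n \<sigma> \<in> mp_bijections"
proof (rule mp_bijectionsI)
  let ?\<tau> = "inv_into {1..n} \<sigma>"
  have \<tau>: "bij_betw ?\<tau> {1..n} {1..n}" by (rule bij_betw_inv_into[OF \<sigma>])
  have im: "\<sigma> ` {1..n} \<subseteq> {1..n}" "?\<tau> ` {1..n} \<subseteq> {1..n}" using \<sigma> \<tau> by (auto simp: bij_betw_def)
  have inv: "?\<tau> (\<sigma> u) = u" "\<sigma> (?\<tau> u) = u" if "u \<in> {1..n}" for u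
    using \<sigma> that by (auto simp: bij_betw_def inv_into_f_f f_inv_into_f)
  have range: "block_shift n s x \<in> {0..1}" if "s ` {1..n} \<subseteq> {1..n}" "x \<in> {0..1}" for s x
    using block_shift_pos(1,2)[OF n that(1), of x] that(2) by (cases "x = 0") (auto simp: block_shift_def less_imp_le)
  have meas: "block_shift n s \<in> unit_measure \<rightarrow>\<^sub>M unit_measure" if "bij_betw s {1..n} {1..n}" for s
  proof (rule measurableI)
    show "block_shift n s x \<in> space unit_measure" if "x \<in> space unit_measure" for x
      using range[of s x] that \<open>bij_betw s {1..n} {1..n}\<close> by (simp add: bij_betw_def)
    show "block_shift n s -` A \<inter> space unit_measure \<in> sets unit_measure" if "A \<in> sets unit_measure" for A
      using block_shift_preserves[OF n \<open>bij_betw s {1..n} {1..n}\<close> that] by simp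
  qed
  show "block_shift n \<sigma> \<in> unit_measure \<rightarrow>\<^sub>M unit_measure" "block_shift n ?\<tau> \<in> unit_measure \<rightarrow>\<^sub>M unit_measure"
    by (rule meas[OF \<sigma>], rule meas[OF \<tau>])
  show 1: "block_shift n ?\<tau> (block_shift n \<sigma> x) = x" if "x \<in> {0..1}" for x
    by (rule block_shift_inverse[OF n im(1) inv(1) that])
  have 2: "block_shift n \<sigma> (block_shift n ?\<tau> x) = x" if "x \<in> {0..1}" for x
    by (rule block_shift_inverse[OF n im(2) inv(2) that])
  show "bij_betw (block_shift n \<sigma>) {0..1} {0..1}"
    by (rule bij_betw_byWitness[where f' = "block_shift n ?\<tau>"]) (use 1 2 range im in auto)
  show "distr unit_measure unit_measure (block_shift n \<sigma>) = unit_measure"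
    by (rule measure_eqI) (use meas[OF \<sigma>] block_shift_preserves[OF n \<sigma>] in \<open>simp_all add: emeasure_distr\<close>)
qed

text \<open>L consecutive fine intervals make up one coarse interval. Blocks are numbered from 1,
  which is why the index is shifted before and after the division.\<close>

lemma block_coarsen:
  assumes "M \<ge> 1" "L \<ge> 1" "0 < x" "x \<le> 1"
  shows "block M x = (block (M * L) x - 1) div L + 1"
proof -
  let ?n = "M * L"
  define v where "v = block ?n x"
  have n: "?n \<ge> 1" using assms by simp
  have v: "v \<ge> 1" "(real v - 1) / ?n < x" "x \<le> real v / ?n"
    using block_range[OF n, of x] block_eq_iff[OF n, of x v] assms by (auto simp: v_def)
  define g where "g = (v - 1) div L"
  have "g * L \<le> v - 1" "v - 1 < (g + 1) * L"
    using assms(2) dividend_less_div_times[of L "v - 1"] unfolding g_def by (simp_all add: mult.commute)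
  then have "g * L \<le> v - 1" "v \<le> (g + 1) * L" using v by auto
  then have g: "real g * L \<le> real v - 1" "real v \<le> (real g + 1) * L"
    using v(1) by (metis of_nat_1 of_nat_diff of_nat_le_iff of_nat_mult, metis of_nat_1 of_nat_add of_nat_le_iff of_nat_mult)
  have "(real (g + 1) - 1) / M = (real g * L) / ?n" using assms by simp
  also have "\<dots> \<le> (real v - 1) / ?n" using g by (intro divide_right_mono) auto
  also have "\<dots> < x" by (rule v)
  finally have 1: "(real (g + 1) - 1) / M < x" .
  have "x \<le> real v / ?n" by (rule v)
  also have "\<dots> \<le> ((real g + 1) * L) / ?n" using g by (intro divide_right_mono) auto
  also have "\<dots> = real (g + 1) / M" using assms by simp
  finally have "block M x = g + 1" using 1 assms by (subst block_eq_iff) auto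
  then show ?thesis by (simp add: g_def v_def)
qed

text \<open>Sort the indices by type: only the groups of consecutive indices in which the type changes are
  not monochromatic, and there are at most as many of them as types.\<close>

lemma sort_by_type:
  fixes ty :: "nat \<Rightarrow> 't"
  assumes M: "M \<ge> 1" "L \<ge> 1" and Q: "finite Q" "\<And>v. ty v \<in> Q"
  obtains \<sigma> s where "bij_betw \<sigma> {1..M * L} {1..M * L}" "range s \<subseteq> Q"
    "card {v \<in> {1..M * L}. ty (\<sigma> v) \<noteq> s ((v - 1) div L + 1)} \<le> card Q * L"
proof -
  let ?n = "M * L"
  \<comment> \<open>Types carry no order, so they are numbered in order to sort by them.\<close>
  obtain enc :: "'t \<Rightarrow> nat" where enc: "inj_on enc Q" using finite_imp_inj_to_nat_seg[OF Q(1)] by metis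
  define xs where "xs = sort_key (\<lambda>v. enc (ty v)) [1..<?n + 1]"
  have len: "length xs = ?n" unfolding xs_def length_sort length_upt by (rule add_diff_cancel_right')
  have sx: "set xs = {1..?n}" unfolding xs_def set_sort set_upt by auto
  define \<sigma> where "\<sigma> v = xs ! (v - 1)" for v
  have "bij_betw ((!) xs) {..<length xs} (set xs)" by (rule bij_betw_nth) (auto simp: xs_def)
  moreover have "bij_betw (\<lambda>v. v - 1) {1..?n} {..<?n}" by (rule bij_betw_byWitness[where f' = Suc]) auto
  ultimately have bij: "bij_betw \<sigma> {1..?n} {1..?n}"
    using bij_betw_trans[of "\<lambda>v. v - 1" "{1..?n}" "{..<?n}" "(!) xs"] unfolding \<sigma>_def len sx comp_def by blast
  define e where "e v = enc (ty (\<sigma> v))" for v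
  have mono: "e u \<le> e v" if "u \<in> {1..?n}" "v \<in> {1..?n}" "u \<le> v" for u v
  proof -
    have "sorted (map (\<lambda>v. enc (ty v)) xs)" unfolding xs_def by (rule sorted_sort_key)
    from sorted_nth_mono[OF this, of "u - 1" "v - 1"] show ?thesis
      unfolding e_def \<sigma>_def using that len by auto
  qed
  \<comment> \<open>\<open>f g\<close> is the first index of group g; the group is represented by
    the type found there.\<close>
  define f where "f g = (g - 1) * L + 1" for g
  define s where "s g = ty (\<sigma> (f g))" for g
  define G where "G v = (v - 1) div L + 1" for v
  define Bad where "Bad = {v \<in> {1..?n}. ty (\<sigma> v) \<noteq> s (G v)}"
  have G: "G v \<in> {1..M}" "f (G v) \<le> v" "v \<le> G v * L" "f (G v) \<in> {1..?n}" if v: "v \<in> {1..?n}" for v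
  proof -
    have "v - 1 < M * L" using v by auto
    then have "(v - 1) div L < M" using M by (simp add: less_mult_imp_div_less)
    then show "G v \<in> {1..M}" unfolding G_def by simp
    have "(v - 1) div L * L \<le> v - 1" by (simp add: mult.commute)
    moreover have "1 \<le> v" using v by simp
    ultimately show 1: "f (G v) \<le> v" unfolding f_def G_def add_diff_cancel_right' by linarith
    show "f (G v) \<in> {1..?n}" using 1 v unfolding f_def by auto
    have "v - 1 < ((v - 1) div L + 1) * L" using M dividend_less_div_times[of L "v - 1"] by simp
    then show "v \<le> G v * L" unfolding G_def by simp
  qed
  \<comment> \<open>Distinct groups that are not monochromatic start with distinct types: the
    numbering is nondecreasing along the sorted list, and inside the earlier group it has already
    increased strictly.\<close>
  have inj: "inj_on s (G ` Bad)"
  proof -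
    have *: "s (G u) \<noteq> s (G v)" if uv: "u \<in> Bad" "v \<in> Bad" "G u < G v" for u v
    proof -
      have b: "u \<in> {1..?n}" "v \<in> {1..?n}" "ty (\<sigma> u) \<noteq> s (G u)" using uv by (auto simp: Bad_def)
      have "e (f (G u)) \<noteq> e u" using b(3) enc Q(2) unfolding e_def s_def by (metis inj_on_eq_iff)
      moreover have "e (f (G u)) \<le> e u" by (rule mono) (use G[OF b(1)] b in auto)
      moreover have "u \<le> f (G v)"
      proof -
        have "G u * L \<le> (G v - 1) * L" using uv(3) by (intro mult_right_mono) auto
        then show ?thesis using G(3)[OF b(1)] unfolding f_def by linarith
      qed
      then have "e u \<le> e (f (G v))" by (intro mono b G(4))
      ultimately have "e (f (G u)) < e (f (G v))" by linarith
      then show ?thesis unfolding e_def s_def by auto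
    qed
    show ?thesis by (rule inj_onI) (metis * image_iff linorder_neqE_nat)
  qed
  have "Bad \<subseteq> (\<Union>g\<in>G ` Bad. {(g - 1) * L + 1..g * L})"
  proof
    fix v assume v: "v \<in> Bad"
    then have "v \<in> {1..?n}" by (simp add: Bad_def)
    from G[OF this] show "v \<in> (\<Union>g\<in>G ` Bad. {(g - 1) * L + 1..g * L})"
      using v unfolding f_def by (intro UN_I[of "G v"]) auto
  qed
  moreover have finB: "finite Bad" by (simp add: Bad_def)
  ultimately have "card Bad \<le> card (\<Union>g\<in>G ` Bad. {(g - 1) * L + 1..g * L})" by (intro card_mono) auto
  also have "\<dots> \<le> (\<Sum>g\<in>G ` Bad. card {(g - 1) * L + 1..g * L})" by (rule card_UN_le) (use finB in auto)
  also have "\<dots> \<le> (\<Sum>g\<in>G ` Bad. L)" by (intro sum_mono) (auto simp: diff_mult_distrib)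
  also have "\<dots> = card (G ` Bad) * L" by simp
  also have "\<dots> \<le> card Q * L"
    by (intro mult_right_mono card_inj_on_le[OF inj]) (use Q in \<open>auto simp: s_def\<close>)
  finally show ?thesis using that[OF bij, of s] Q(2) unfolding Bad_def G_def s_def by blast
qed

subsection \<open>Weak regularity and total boundedness\<close>

text \<open>A rectangle that witnesses a cut norm above \<epsilon> correlates with U. Subtracting
  \<epsilon> times its signed indicator changes the energy by at most -2 \<epsilon>^2 from the cross
  term and \<epsilon>^2 from the new square.\<close>

lemma energy_decrement:
  assumes U: "bkernel U" and \<epsilon>: "\<epsilon> > 0" and big: "\<epsilon> < cut_norm U"
  obtains S T c where "S \<in> sets unit_measure" "T \<in> sets unit_measure" "c \<in> {-\<epsilon>, \<epsilon>}"
    "(\<integral>z. (U z - c * indicator (S \<times> T) z)\<^sup>2 \<partial>square_measure) \<le> (\<integral>z. (U z)\<^sup>2 \<partial>square_measure) - \<epsilon>\<^sup>2"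
proof -
  obtain S T where ST: "S \<in> sets unit_measure" "T \<in> sets unit_measure" "\<epsilon> < \<bar>rect_integral S T U\<bar>"
    using cut_norm_leI[of U \<epsilon>] big by (meson linorder_not_le)
  define c where "c = (if rect_integral S T U \<ge> 0 then \<epsilon> else - \<epsilon>)"
  have c: "c \<in> {-\<epsilon>, \<epsilon>}" "c\<^sup>2 = \<epsilon>\<^sup>2" "\<epsilon>\<^sup>2 \<le> c * rect_integral S T U"
  proof -
    show "c \<in> {-\<epsilon>, \<epsilon>}" "c\<^sup>2 = \<epsilon>\<^sup>2" by (auto simp: c_def power2_eq_square)
    have "\<epsilon> * \<epsilon> \<le> \<epsilon> * \<bar>rect_integral S T U\<bar>" using ST(3) \<epsilon> by (intro mult_left_mono) auto
    then show "\<epsilon>\<^sup>2 \<le> c * rect_integral S T U" by (auto simp: c_def power2_eq_square)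
  qed
  have bk: "bkernel (\<lambda>z. (U z)\<^sup>2)" "bkernel (\<lambda>z. indicator (S \<times> T) z * U z)" "bkernel (indicator (S \<times> T))"
    unfolding power2_eq_square by (intro bkernel_mult U bkernel_rect ST bkernel_indicator Times_in_square)+
  have "(U z - c * indicator (S \<times> T) z)\<^sup>2 = (U z)\<^sup>2 - 2 * c * (indicator (S \<times> T) z * U z) + \<epsilon>\<^sup>2 * indicator (S \<times> T) z" for z
    using c(2) by (cases "z \<in> S \<times> T") (auto simp: power2_eq_square algebra_simps)
  then have "(\<integral>z. (U z - c * indicator (S \<times> T) z)\<^sup>2 \<partial>square_measure)
    = (\<integral>z. (U z)\<^sup>2 - 2 * c * (indicator (S \<times> T) z * U z) + \<epsilon>\<^sup>2 * indicator (S \<times> T) z \<partial>square_measure)" by simp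
  also have "\<dots> = (\<integral>z. (U z)\<^sup>2 \<partial>square_measure) - 2 * c * rect_integral S T U + \<epsilon>\<^sup>2 * (\<integral>z. indicator (S \<times> T) z \<partial>square_measure)"
    unfolding rect_integral_def
    by (subst Bochner_Integration.integral_add Bochner_Integration.integral_diff;
      (intro bkernel_integrable bkernel_diff bkernel_cmult bk)?)+ (simp add: mult.assoc)
  also have "\<dots> \<le> (\<integral>z. (U z)\<^sup>2 \<partial>square_measure) - 2 * \<epsilon>\<^sup>2 + \<epsilon>\<^sup>2 * 1"
  proof -
    have "(\<integral>z. indicator (S \<times> T) z \<partial>square_measure) \<le> (1 :: real)"
      unfolding Bochner_Integration.integral_indicator by (rule square.prob_le_1)
    then have "\<epsilon>\<^sup>2 * (\<integral>z. indicator (S \<times> T) z \<partial>square_measure) \<le> \<epsilon>\<^sup>2 * 1" by (intro mult_left_mono) auto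
    then show ?thesis using c(3) by linarith
  qed
  finally show ?thesis using that[OF ST(1,2) c(1)] by simp
qed

definition rect_sum :: "nat \<Rightarrow> (nat \<Rightarrow> real) \<Rightarrow> (nat \<Rightarrow> real set) \<Rightarrow> (nat \<Rightarrow> real set) \<Rightarrow> real \<times> real \<Rightarrow> real" where
  "rect_sum N c S T z = (\<Sum>i<N. c i * indicator (S i \<times> T i) z)"

text \<open>N is the energy of U in units of \<epsilon>^2, and each subtracted rectangle uses up at
  least one unit. Shorter sums are padded with coefficient 0, so N is the same for all kernels of a
  given energy and the coefficients come from three values.\<close>

lemma weak_regularity:
  assumes \<epsilon>: "\<epsilon> > 0"
  shows "bkernel U \<Longrightarrow> (\<integral>z. (U z)\<^sup>2 \<partial>square_measure) \<le> N * \<epsilon>\<^sup>2 \<Longrightarrow>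
    \<exists>S T c. (\<forall>i. S i \<in> sets unit_measure \<and> T i \<in> sets unit_measure \<and> c i \<in> {-\<epsilon>, 0, \<epsilon>}) \<and>
      cut_norm (\<lambda>z. U z - rect_sum N c S T z) \<le> \<epsilon>"
proof (induction N arbitrary: U)
  case 0
  have "cut_norm U \<le> \<epsilon>"
  proof (rule ccontr)
    assume "\<not> ?thesis"
    then obtain S T c where "(\<integral>z. (U z - c * indicator (S \<times> T) z)\<^sup>2 \<partial>square_measure) \<le> (\<integral>z. (U z)\<^sup>2 \<partial>square_measure) - \<epsilon>\<^sup>2"
      using energy_decrement[OF 0(1) \<epsilon>] by (metis not_le)
    moreover have "0 \<le> (\<integral>z. (U z - c * indicator (S \<times> T) z)\<^sup>2 \<partial>square_measure)" by (rule integral_nonneg_AE) auto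
    moreover have "\<epsilon>\<^sup>2 > 0" using \<epsilon> by simp
    ultimately show False using 0(2) by simp
  qed
  then show ?case
    by (intro exI[of _ "\<lambda>_. {}"] exI[of _ "\<lambda>_. 0"]) (simp add: rect_sum_def)
next
  case (Suc N)
  show ?case
  proof (cases "cut_norm U \<le> \<epsilon>")
    case True
    then show ?thesis
      by (intro exI[of _ "\<lambda>_. {}"] exI[of _ "\<lambda>_. 0"]) (simp add: rect_sum_def)
  next
    case False
    then have big: "\<epsilon> < cut_norm U" by simp
    obtain S T c where ST: "S \<in> sets unit_measure" "T \<in> sets unit_measure" "c \<in> {-\<epsilon>, \<epsilon>}"
      and le: "(\<integral>z. (U z - c * indicator (S \<times> T) z)\<^sup>2 \<partial>square_measure) \<le> (\<integral>z. (U z)\<^sup>2 \<partial>square_measure) - \<epsilon>\<^sup>2"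
      by (rule energy_decrement[OF Suc(2) \<epsilon> big])
    have "bkernel (\<lambda>z. U z - c * indicator (S \<times> T) z)"
      by (intro bkernel_diff bkernel_cmult Suc(2) bkernel_indicator Times_in_square ST)
    moreover have "(\<integral>z. (U z - c * indicator (S \<times> T) z)\<^sup>2 \<partial>square_measure) \<le> N * \<epsilon>\<^sup>2"
      using le Suc(3) by (simp add: algebra_simps)
    ultimately obtain S' T' c' where *: "\<And>i. S' i \<in> sets unit_measure \<and> T' i \<in> sets unit_measure \<and> c' i \<in> {-\<epsilon>, 0, \<epsilon>}"
      "cut_norm (\<lambda>z. (U z - c * indicator (S \<times> T) z) - rect_sum N c' S' T' z) \<le> \<epsilon>"
      using Suc(1) by blast
    have "(\<lambda>z. (U z - c * indicator (S \<times> T) z) - rect_sum N c' S' T' z)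
      = (\<lambda>z. U z - rect_sum (Suc N) (c'(N := c)) (S'(N := S)) (T'(N := T)) z)"
      by (rule ext) (simp add: rect_sum_def)
    then show ?thesis
      using * ST
      by - (rule exI[of _ "S'(N := S)"], rule exI[of _ "T'(N := T)"], rule exI[of _ "c'(N := c)"], auto simp: fun_upd_def)
  qed
qed

lemma bkernel_rect_sum:
  "(\<And>i. S i \<in> sets unit_measure \<and> T i \<in> sets unit_measure) \<Longrightarrow> bkernel (rect_sum N c S T)"
  unfolding rect_sum_def by (intro bkernel_sum bkernel_cmult bkernel_indicator Times_in_square) auto

text \<open>Changing the sides of a rectangle affects only points in one vertical and one horizontal
  strip over the symmetric differences of the sides.\<close>

lemma rect_sum_L1:
  assumes S: "\<And>i. S i \<in> sets unit_measure \<and> T i \<in> sets unit_measure"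
    and S': "\<And>i. S' i \<in> sets unit_measure \<and> T' i \<in> sets unit_measure"
    and d: "\<And>i. i < N \<Longrightarrow> measure unit_measure (S i - S' i \<union> (S' i - S i)) \<le> \<delta>"
      "\<And>i. i < N \<Longrightarrow> measure unit_measure (T i - T' i \<union> (T' i - T i)) \<le> \<delta>"
    and c: "\<And>i. \<bar>c i\<bar> \<le> \<epsilon>" "\<epsilon> \<ge> 0"
  shows "cut_norm (\<lambda>z. rect_sum N c S T z - rect_sum N c S' T' z) \<le> N * (\<epsilon> * (2 * \<delta>))"
proof -
  let ?A = "\<lambda>i. (S i - S' i \<union> (S' i - S i)) \<times> {0..1}" and ?B = "\<lambda>i. {0..1} \<times> (T i - T' i \<union> (T' i - T i))"
  let ?f = "\<lambda>i z. indicator (?A i) z + indicator (?B i) z :: real"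
  have I: "{0..1} \<in> sets unit_measure" by (simp add: sets_unit_measure)
  have AB: "?A i \<in> sets square_measure" "?B i \<in> sets square_measure" for i
    by (intro Times_in_square sets.Un sets.Diff S[THEN conjunct1] S'[THEN conjunct1] S[THEN conjunct2] S'[THEN conjunct2] I)+
  have bf: "bkernel (?f i)" for i by (intro bkernel_add bkernel_indicator AB)
  have bd: "bkernel (\<lambda>z. rect_sum N c S T z - rect_sum N c S' T' z)"
    by (intro bkernel_diff bkernel_rect_sum S S')
  have "cut_norm (\<lambda>z. rect_sum N c S T z - rect_sum N c S' T' z)
    \<le> (\<integral>z. \<bar>rect_sum N c S T z - rect_sum N c S' T' z\<bar> \<partial>square_measure)" by (rule cut_norm_le_L1[OF bd])
  also have "\<dots> \<le> (\<integral>z. (\<Sum>i<N. \<epsilon> * ?f i z) \<partial>square_measure)"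
  proof (rule integral_mono)
    fix z assume z: "z \<in> space square_measure"
    have "\<bar>rect_sum N c S T z - rect_sum N c S' T' z\<bar> \<le> (\<Sum>i<N. \<bar>c i * (indicator (S i \<times> T i) z - indicator (S' i \<times> T' i) z)\<bar>)"
      unfolding rect_sum_def sum_subtractf[symmetric] right_diff_distrib[symmetric] by (rule sum_abs)
    also have "\<dots> \<le> (\<Sum>i<N. \<epsilon> * ?f i z)"
      unfolding abs_mult
    proof (intro sum_mono mult_mono c)
      fix i
      show "\<bar>indicator (S i \<times> T i) z - indicator (S' i \<times> T' i) z\<bar> \<le> ?f i z"
        using z by (cases z) (auto simp: indicator_def)
    qed auto
    finally show "\<bar>rect_sum N c S T z - rect_sum N c S' T' z\<bar> \<le> (\<Sum>i<N. \<epsilon> * ?f i z)" .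
  qed (intro bkernel_integrable bkernel_abs bd bkernel_sum bkernel_cmult bf)+
  also have "\<dots> = (\<Sum>i<N. \<integral>z. \<epsilon> * ?f i z \<partial>square_measure)"
    by (intro Bochner_Integration.integral_sum bkernel_integrable bkernel_cmult bf)
  also have "\<dots> \<le> (\<Sum>i<N. \<epsilon> * (2 * \<delta>))"
  proof (rule sum_mono)
    fix i assume "i \<in> {..<N}"
    then have i: "i < N" by simp
    have m1: "(\<integral>z. indicator (?A i) z \<partial>square_measure) = measure unit_measure (S i - S' i \<union> (S' i - S i))"
    proof -
      have "?A i \<inter> space square_measure = ?A i" using sets.sets_into_space[OF AB(1)[of i]] by blast
      then have "(\<integral>z. indicator (?A i) z \<partial>square_measure) = measure square_measure (?A i)" by simp
      also have "\<dots> = measure unit_measure (S i - S' i \<union> (S' i - S i)) * measure unit_measure {0..1}"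
        by (intro measure_square_Times sets.Un sets.Diff S[THEN conjunct1] S'[THEN conjunct1] I)
      also have "measure unit_measure {0..1} = 1" using unit.prob_space by simp
      finally show ?thesis by simp
    qed
    have m2: "(\<integral>z. indicator (?B i) z \<partial>square_measure) = measure unit_measure (T i - T' i \<union> (T' i - T i))"
    proof -
      have "?B i \<inter> space square_measure = ?B i" using sets.sets_into_space[OF AB(2)[of i]] by blast
      then have "(\<integral>z. indicator (?B i) z \<partial>square_measure) = measure square_measure (?B i)" by simp
      also have "\<dots> = measure unit_measure {0..1} * measure unit_measure (T i - T' i \<union> (T' i - T i))"
        by (intro measure_square_Times sets.Un sets.Diff S[THEN conjunct2] S'[THEN conjunct2] I)
      also have "measure unit_measure {0..1} = 1" using unit.prob_space by simp
      finally show ?thesis by simp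
    qed
    have "(\<integral>z. \<epsilon> * ?f i z \<partial>square_measure) = \<epsilon> * (\<integral>z. ?f i z \<partial>square_measure)" by simp
    also have "(\<integral>z. ?f i z \<partial>square_measure) = (\<integral>z. indicator (?A i) z \<partial>square_measure) + (\<integral>z. indicator (?B i) z \<partial>square_measure)"
      by (intro Bochner_Integration.integral_add bkernel_integrable bkernel_indicator AB)
    also have "\<epsilon> * \<dots> \<le> \<epsilon> * (2 * \<delta>)" unfolding m1 m2 using d[OF i] c(2) by (intro mult_left_mono) auto
    finally show "(\<integral>z. \<epsilon> * ?f i z \<partial>square_measure) \<le> \<epsilon> * (2 * \<delta>)" .
  qed
  finally show ?thesis by simp
qed

lemma measure_block_union:
  assumes n: "n \<ge> 1" and B: "B \<subseteq> {1..n}"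
  shows "measure unit_measure {x \<in> {0..1}. block n x \<in> B} = card B / n"
proof -
  have fin: "finite B" using B finite_subset by blast
  have "{x \<in> {0..1}. block n x \<in> B} = (\<Union>u\<in>B. cell n u)" by auto
  then have "measure unit_measure {x \<in> {0..1}. block n x \<in> B} = (\<Sum>u\<in>B. measure unit_measure (cell n u))"
    using unit.finite_measure_finite_Union[OF fin, of "cell n"] cell_measurable
    by (auto simp: disjoint_family_on_def)
  also have "\<dots> = (\<Sum>u\<in>B. 1 / n)" using cell_measure[OF n] B by (intro sum.cong) auto
  finally show ?thesis by simp
qed

section \<open>Finite nets for the cut distance\<close>

text \<open>The sides of the rectangles can be arbitrary sets, so regularity alone gives no finite
  net. They are first replaced by unions of fine blocks, whose number depends on W. A fine block
  then has only finitely many types, namely the sets of sides that contain it; sorting by type makes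
  almost all of M coarse blocks pure, with M independent of W. The net consists of the finitely many
  patterns on these coarse blocks.\<close>

lemma graphons_net:
  assumes \<epsilon>: "\<epsilon> > 0"
  obtains \<K> :: "'k::finite kernel set" where "finite \<K>" "\<And>K. K \<in> \<K> \<Longrightarrow> vkernel K"
    "\<And>W. W \<in> graphons \<Longrightarrow> \<exists>\<phi>\<in>mp_bijections. \<exists>K\<in>\<K>. cut_norm_vec (\<lambda>z. relabel \<phi> W z - K z) < \<epsilon>"
proof -
  define k where "k = real CARD('k)"
  have k: "k \<ge> 1" unfolding k_def by (simp add: Suc_leI)
  \<comment> \<open>Regularity, fine blocks and sorting each cost at most e per colour, so the total
    is at most 3\<epsilon>/4.\<close>
  define e where "e = \<epsilon> / (4 * k)"
  have e: "e > 0" using \<epsilon> k by (simp add: e_def)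
  \<comment> \<open>Components of graphons have energy at most 1, so N rectangles suffice when N e^2
    is at least 1.\<close>
  obtain N :: nat where "1 / e\<^sup>2 < N" using reals_Archimedean2 by blast
  then have N: "1 \<le> N * e\<^sup>2" using e by (simp add: field_simps)
  \<comment> \<open>One index for every rectangle side: the colour, the number of the rectangle, and
    \<open>True\<close> for the first or \<open>False\<close> for the second side.\<close>
  define J where "J = (UNIV :: 'k set) \<times> {..<N} \<times> (UNIV :: bool set)"
  have finJ: "finite J" by (simp add: J_def)
  define p where "p = card (Pow J)"
  \<comment> \<open>At most p of the M coarse blocks are not pure, so each side is off by measure at
    most p/M; with this M the error 2 N e p/M is at most e.\<close>
  define M where "M = 2 * N * p + 1"
  have M: "M \<ge> 1" by (simp add: M_def)
  define \<delta> where "\<delta> = 1 / (2 * real N + 1)"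
  have \<delta>: "\<delta> > 0" by (simp add: \<delta>_def)
  have small1: "N * (e * (2 * \<delta>)) \<le> e" using e by (simp add: \<delta>_def field_simps)
  have small2: "N * (e * (2 * (real p / M))) \<le> e"
  proof -
    have "real (N * 2 * p) \<le> M" unfolding M_def by simp
    then have "real (N * 2 * p) / M \<le> 1" using M by (simp add: divide_le_eq)
    then have "e * (real (N * 2 * p) / M) \<le> e * 1" using e by (intro mult_left_mono) auto
    then show ?thesis by (simp add: mult_ac)
  qed
  define R where "R s j = {x \<in> {0..1}. j \<in> s (block M x)}" for s :: "nat \<Rightarrow> ('k \<times> nat \<times> bool) set" and j
  define Kf where "Kf = (\<lambda>(c, s). \<lambda>z. (\<chi> a. rect_sum N (\<lambda>i. c (a, i)) (\<lambda>i. R s (a, i, True)) (\<lambda>i. R s (a, i, False)) z))"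
  define \<K> where "\<K> = Kf ` (((UNIV :: 'k set) \<times> {..<N} \<rightarrow>\<^sub>E {-e, 0, e}) \<times> ({1..M} \<rightarrow>\<^sub>E Pow J))"
  have Rm: "R s j \<in> sets unit_measure" for s j
    using block_union_measurable[of M "{u. j \<in> s u}"] by (simp add: R_def)
  show ?thesis
  proof (rule that)
    show "finite \<K>" unfolding \<K>_def using finJ by (intro finite_imageI finite_cartesian_product finite_PiE) auto
    show "vkernel K" if "K \<in> \<K>" for K
      using that unfolding \<K>_def Kf_def vkernel_def by (auto intro!: bkernel_rect_sum Rm)
    fix W :: "'k kernel" assume W: "W \<in> graphons"
    have bW: "bkernel (\<lambda>z. W z $ a)" for a by (intro vkernel_component graphon_vkernel W)
    define reg where "reg a S T c \<longleftrightarrow> (\<forall>i. S i \<in> sets unit_measure \<and> T i \<in> sets unit_measure \<and> c i \<in> {-e, 0, e}) \<and>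
      cut_norm (\<lambda>z. W z $ a - rect_sum N c S T z) \<le> e" for a S T c
    have "\<exists>S T c. reg a S T c" for a
      unfolding reg_def
    proof (rule weak_regularity[OF e bW])
      have "(\<integral>z. (W z $ a)\<^sup>2 \<partial>square_measure) \<le> (\<integral>z. 1 \<partial>square_measure)"
      proof (rule integral_mono)
        show "integrable square_measure (\<lambda>z. (W z $ a)\<^sup>2)"
          unfolding power2_eq_square by (intro bkernel_integrable bkernel_mult bW)
        fix z assume "z \<in> space square_measure"
        then have "z \<in> unit_square" by simp
        from graphon_bounds(1,2)[OF W this, of a] show "(W z $ a)\<^sup>2 \<le> 1" by (simp add: power_le_one)
      qed simp
      then show "(\<integral>z. (W z $ a)\<^sup>2 \<partial>square_measure) \<le> N * e\<^sup>2" using N square.prob_space by simp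
    qed
    then obtain S T c where STc: "\<And>a. reg a (S a) (T a) (c a)" by metis
    have ST: "S a i \<in> sets unit_measure \<and> T a i \<in> sets unit_measure" and c: "c a i \<in> {-e, 0, e}" for a i
      using STc[of a] by (simp_all add: reg_def)
    have reg: "cut_norm (\<lambda>z. W z $ a - rect_sum N (c a) (S a) (T a) z) \<le> e" for a
      using STc[of a] unfolding reg_def by (rule conjunct2)
    define A where "A = (\<lambda>(a, i, b). if b then S a i else T a i)"
    have A: "A j \<in> sets unit_measure" for j using ST by (cases j) (auto simp: A_def)
    define E where "E n j P = measure unit_measure ((A j - {x \<in> {0..1}. block n x \<in> P}) \<union> ({x \<in> {0..1}. block n x \<in> P} - A j))" for n j P
    have "\<exists>n0. \<forall>n\<ge>n0. \<exists>P\<subseteq>{1..n}. E n j P < \<delta>" for j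
      using block_approx_interval[OF A[of j] \<delta>, folded E_def] by metis
    then obtain n0 where n0: "\<And>j n. n \<ge> n0 j \<Longrightarrow> \<exists>P\<subseteq>{1..n}. E n j P < \<delta>" by metis
    \<comment> \<open>Only here does W enter: L makes n = M L fine enough for all sides at once
      while keeping n a multiple of M.\<close>
    define L where "L = Suc (Max (n0 ` J))"
    have L: "L \<ge> 1" by (simp add: L_def)
    define n where "n = M * L"
    have n: "n \<ge> 1" using M L by (simp add: n_def)
    have "n0 j \<le> n" if "j \<in> J" for j
    proof -
      have "n0 j \<le> Max (n0 ` J)" by (rule Max_ge) (use finJ that in auto)
      also have "\<dots> \<le> L" by (simp add: L_def)
      also have "\<dots> \<le> n" using M by (simp add: n_def)
      finally show ?thesis .
    qed
    then have "\<forall>j\<in>J. \<exists>P. E n j P < \<delta>" using n0 by blast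
    then obtain P where P: "\<And>j. j \<in> J \<Longrightarrow> E n j (P j) < \<delta>" by metis
    define D where "D j = {x \<in> {0..1}. block n x \<in> P j}" for j
    have Dm: "D j \<in> sets unit_measure" for j unfolding D_def by (rule block_union_measurable)
    \<comment> \<open>The type of a fine block is the set of approximated sides that contain
      it.\<close>
    define ty where "ty u = {j\<in>J. u \<in> P j}" for u
    have ty: "ty u \<in> Pow J" for u by (auto simp: ty_def)
    obtain \<sigma> s where \<sigma>: "bij_betw \<sigma> {1..n} {1..n}" and s0: "range s \<subseteq> Pow J"
      and bad: "card {v \<in> {1..n}. ty (\<sigma> v) \<noteq> s ((v - 1) div L + 1)} \<le> p * L"
      unfolding n_def p_def by (rule sort_by_type[where ty = ty and Q = "Pow J", OF M L finite_Pow_iff[THEN iffD2, OF finJ] ty])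
    have s: "s g \<in> Pow J" for g using s0 by blast
    define \<phi> where "\<phi> = block_shift n \<sigma>"
    have \<phi>: "\<phi> \<in> mp_bijections" unfolding \<phi>_def by (rule block_shift_mp[OF n \<sigma>])
    have im: "\<sigma> ` {1..n} \<subseteq> {1..n}" using \<sigma> by (simp add: bij_betw_def)
    define D' where "D' j = \<phi> -` D j \<inter> {0..1}" for j
    have D'm: "D' j \<in> sets unit_measure" for j unfolding D'_def by (rule mp_bijectionsD(6)[OF \<phi> Dm])
    define c' where "c' = restrict (\<lambda>(a, i). c a i) (UNIV \<times> {..<N})"
    define s' where "s' = restrict s {1..M}"
    define B where "B = {v \<in> {1..n}. ty (\<sigma> v) \<noteq> s ((v - 1) div L + 1)}"
    have BS: "B \<subseteq> {1..n}" by (auto simp: B_def)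
    have R': "measure unit_measure (D' j - R s' j \<union> (R s' j - D' j)) \<le> real p / M" if j: "j \<in> J" for j
    proof -
      \<comment> \<open>The point 0 is set aside because the block shift fixes it instead of moving
        it along with its block.\<close>
      have sub: "D' j - R s' j \<union> (R s' j - D' j) \<subseteq> {0} \<union> {x \<in> {0..1}. block n x \<in> B}"
      proof
        fix x assume x: "x \<in> D' j - R s' j \<union> (R s' j - D' j)"
        show "x \<in> {0} \<union> {x \<in> {0..1}. block n x \<in> B}"
        proof (cases "x = 0")
          case False
          have "x \<in> {0..1}" using x unfolding D'_def R_def by blast
          then have x01: "0 < x" "x \<le> 1" using False by auto
          have b: "block n (\<phi> x) = \<sigma> (block n x)" "\<phi> x \<in> {0..1}"
            using block_shift_pos[OF n im x01] unfolding \<phi>_def by auto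
          have v: "block n x \<in> {1..n}" "block M x \<in> {1..M}" using block_range[OF n, of x] block_range[OF M, of x] x01 by auto
          have "x \<in> D' j \<longleftrightarrow> j \<in> ty (\<sigma> (block n x))"
            using x01 b j unfolding D'_def D_def ty_def by auto
          moreover have "x \<in> R s' j \<longleftrightarrow> j \<in> s ((block n x - 1) div L + 1)"
            using x01 v(2) block_coarsen[OF M L x01] unfolding R_def s'_def n_def by simp
          ultimately have "block n x \<in> B" using x v unfolding B_def by auto
          then show ?thesis using x01 by simp
        qed simp
      qed
      have z: "measure unit_measure {0} = 0"
        using emeasure_unit_measure[of "{0}"] by (simp add: sets_unit_measure measure_def)
      have sm: "{0} \<in> sets unit_measure" "{x \<in> {0..1}. block n x \<in> B} \<in> sets unit_measure"
        using block_union_measurable by (auto simp: sets_unit_measure)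
      have "measure unit_measure (D' j - R s' j \<union> (R s' j - D' j)) \<le> measure unit_measure ({0} \<union> {x \<in> {0..1}. block n x \<in> B})"
        by (rule unit.finite_measure_mono[OF sub sets.Un[OF sm]])
      also have "\<dots> \<le> measure unit_measure {0} + measure unit_measure {x \<in> {0..1}. block n x \<in> B}"
        by (rule measure_Un_le[OF sm])
      also have "\<dots> = card B / n" unfolding z measure_block_union[OF n BS] by simp
      also have "\<dots> \<le> real (p * L) / n" using bad unfolding B_def[symmetric] by (intro divide_right_mono of_nat_mono) auto
      also have "\<dots> = real p / M" using L by (simp add: n_def)
      finally show ?thesis .
    qed
    have "c' \<in> UNIV \<times> {..<N} \<rightarrow>\<^sub>E {-e, 0, e}"
      unfolding c'_def restrict_PiE_iff
    proof
      fix x :: "'k \<times> nat"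
      show "(case x of (a, i) \<Rightarrow> c a i) \<in> {-e, 0, e}" by (cases x) (simp only: prod.case c)
    qed
    moreover have "s' \<in> {1..M} \<rightarrow>\<^sub>E Pow J" unfolding s'_def restrict_PiE_iff using s by blast
    ultimately have "Kf (c', s') \<in> \<K>" unfolding \<K>_def by (intro imageI SigmaI)
    moreover have "cut_norm_vec (\<lambda>z. relabel \<phi> W z - Kf (c', s') z) < \<epsilon>"
    proof -
      have "cut_norm (\<lambda>z. (relabel \<phi> W z - Kf (c', s') z) $ a) \<le> 3 * e" for a
      proof -
        let ?m = "map_prod \<phi> \<phi>"
        let ?S = "rect_sum N (c a) (S a) (T a)"
        let ?D = "rect_sum N (c a) (\<lambda>i. D (a, i, True)) (\<lambda>i. D (a, i, False))"
        let ?D' = "rect_sum N (c a) (\<lambda>i. D' (a, i, True)) (\<lambda>i. D' (a, i, False))"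
        let ?K = "rect_sum N (c a) (\<lambda>i. R s' (a, i, True)) (\<lambda>i. R s' (a, i, False))"
        have ca: "\<bar>c a i\<bar> \<le> e" for i using c[of a i] e by auto
        have bS: "bkernel ?S" "bkernel ?D" "bkernel ?D'" "bkernel ?K"
          by (intro bkernel_rect_sum conjI ST Dm D'm Rm)+
        have m: "bkernel (\<lambda>z. U (?m z))" if "bkernel U" for U by (rule bkernel_relabel[OF that \<phi>])
        have "cut_norm (\<lambda>z. (relabel \<phi> W z - Kf (c', s') z) $ a) = cut_norm (\<lambda>z. W (?m z) $ a - ?K z)"
          by (rule cut_norm_cong) (simp add: relabel_apply Kf_def rect_sum_def c'_def)
        also have "\<dots> \<le> cut_norm (\<lambda>z. W (?m z) $ a - ?D (?m z)) + cut_norm (\<lambda>z. ?D (?m z) - ?K z)"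
          by (intro cut_norm_triangle m[OF bW] m[OF bS(2)] bS)
        also have "cut_norm (\<lambda>z. W (?m z) $ a - ?D (?m z)) = cut_norm (\<lambda>z. W z $ a - ?D z)"
          by (rule cut_norm_relabel[OF bkernel_diff[OF bW bS(2)] \<phi>])
        also have "\<dots> \<le> cut_norm (\<lambda>z. W z $ a - ?S z) + cut_norm (\<lambda>z. ?S z - ?D z)"
          by (intro cut_norm_triangle bW bS)
        also have "cut_norm (\<lambda>z. W z $ a - ?S z) \<le> e" by (rule reg)
        also have "cut_norm (\<lambda>z. ?S z - ?D z) \<le> N * (e * (2 * \<delta>))"
        proof (rule rect_sum_L1)
          fix i assume i: "i < N"
          then have "(a, i, True) \<in> J" "(a, i, False) \<in> J" by (auto simp: J_def)
          from P[OF this(1)] P[OF this(2)]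
          show "measure unit_measure (S a i - D (a, i, True) \<union> (D (a, i, True) - S a i)) \<le> \<delta>"
            "measure unit_measure (T a i - D (a, i, False) \<union> (D (a, i, False) - T a i)) \<le> \<delta>"
            unfolding E_def D_def A_def by simp_all
        qed (use ST Dm ca e in auto)
        also have "\<dots> \<le> e" by (rule small1)
        also have "cut_norm (\<lambda>z. ?D (?m z) - ?K z) = cut_norm (\<lambda>z. ?D' z - ?K z)"
          by (rule cut_norm_cong) (auto simp: rect_sum_def D'_def indicator_def intro!: sum.cong)
        also have "\<dots> \<le> N * (e * (2 * (real p / M)))"
        proof (rule rect_sum_L1)
          fix i assume i: "i < N"
          then have "(a, i, True) \<in> J" "(a, i, False) \<in> J" by (auto simp: J_def)
          from R'[OF this(1)] R'[OF this(2)]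
          show "measure unit_measure (D' (a, i, True) - R s' (a, i, True) \<union> (R s' (a, i, True) - D' (a, i, True))) \<le> real p / M"
            "measure unit_measure (D' (a, i, False) - R s' (a, i, False) \<union> (R s' (a, i, False) - D' (a, i, False))) \<le> real p / M"
            by simp_all
        qed (use D'm Rm ca e in auto)
        also have "\<dots> \<le> e" by (rule small2)
        finally show ?thesis by simp
      qed
      then have "cut_norm_vec (\<lambda>z. relabel \<phi> W z - Kf (c', s') z) \<le> (\<Sum>a\<in>(UNIV::'k set). 3 * e)"
        unfolding cut_norm_vec_def by (intro sum_mono)
      also have "\<dots> = 3 / 4 * \<epsilon>" using k by (simp add: e_def k_def[symmetric])
      also have "\<dots> < \<epsilon>" using \<epsilon> by simp
      finally show ?thesis .
    qed
    ultimately show "\<exists>\<phi>\<in>mp_bijections. \<exists>K\<in>\<K>. cut_norm_vec (\<lambda>z. relabel \<phi> W z - K z) < \<epsilon>"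
      using \<phi> by blast
  qed
qed

lemma cut_dist_relabel: "W \<in> graphons \<Longrightarrow> \<phi> \<in> mp_bijections \<Longrightarrow> cut_dist (relabel \<phi> W) W = 0"
  using cut_dist_le[of "relabel \<phi> W" W \<phi>, unfolded cut_norm_vec_self] cut_dist_nonneg[of "relabel \<phi> W" W]
    relabel_graphon[of W \<phi>] by simp

text \<open>The net elements need not be graphons. Each one that has a graphon within \<epsilon>/2
  of it, after relabelling, is replaced by such a graphon, which at most doubles the
  distance.\<close>

lemma graphons_totally_bounded:
  assumes \<epsilon>: "\<epsilon> > 0"
  obtains F :: "'k::finite kernel set" where "finite F" "F \<subseteq> graphons" "\<And>W. W \<in> graphons \<Longrightarrow> \<exists>U\<in>F. cut_dist U W < \<epsilon>"
proof -
  obtain \<K> :: "'k kernel set" where \<K>: "finite \<K>" "\<And>K. K \<in> \<K> \<Longrightarrow> vkernel K"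
    "\<And>W. W \<in> graphons \<Longrightarrow> \<exists>\<phi>\<in>mp_bijections. \<exists>K\<in>\<K>. cut_norm_vec (\<lambda>z. relabel \<phi> W z - K z) < \<epsilon> / 2"
    using graphons_net[of "\<epsilon> / 2"] \<epsilon> by (metis half_gt_zero)
  define near where "near K W \<longleftrightarrow> W \<in> graphons \<and> (\<exists>\<phi>\<in>mp_bijections. cut_norm_vec (\<lambda>z. relabel \<phi> W z - K z) < \<epsilon> / 2)" for K W :: "'k kernel"
  define F where "F = (\<lambda>K. SOME W. near K W) ` {K\<in>\<K>. \<exists>W. near K W}"
  have sel: "near K (SOME W. near K W)" if "\<exists>W. near K W" for K using that by (rule someI_ex)
  show ?thesis
  proof (rule that)
    show "finite F" using \<K>(1) by (simp add: F_def)
    show "F \<subseteq> graphons" using sel by (auto simp: F_def near_def)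
    fix W :: "'k kernel" assume W: "W \<in> graphons"
    then obtain \<phi> K where K: "\<phi> \<in> mp_bijections" "K \<in> \<K>" "cut_norm_vec (\<lambda>z. relabel \<phi> W z - K z) < \<epsilon> / 2" using \<K>(3) by blast
    then have ex: "\<exists>W. near K W" using W by (auto simp: near_def)
    define U where "U = (SOME W. near K W)"
    have "near K U" unfolding U_def by (rule sel[OF ex])
    then obtain \<psi> where U: "U \<in> graphons" "\<psi> \<in> mp_bijections" "cut_norm_vec (\<lambda>z. relabel \<psi> U z - K z) < \<epsilon> / 2"
      by (auto simp: near_def)
    note G = relabel_graphon[OF U(1,2)] relabel_graphon[OF W K(1)]
    have "cut_dist U W \<le> cut_dist U (relabel \<psi> U) + cut_dist (relabel \<psi> U) W" by (rule cut_dist_triangle[OF U(1) G(1) W])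
    also have "cut_dist (relabel \<psi> U) W \<le> cut_dist (relabel \<psi> U) (relabel \<phi> W) + cut_dist (relabel \<phi> W) W"
      by (rule cut_dist_triangle[OF G W])
    also have "cut_dist U (relabel \<psi> U) = 0" using cut_dist_commute[OF U(1) G(1)] cut_dist_relabel[OF U(1,2)] by simp
    also have "cut_dist (relabel \<phi> W) W = 0" by (rule cut_dist_relabel[OF W K(1)])
    also have "cut_dist (relabel \<psi> U) (relabel \<phi> W) \<le> cut_norm_vec (\<lambda>z. relabel \<psi> U z - relabel \<phi> W z)"
      by (rule cut_dist_le_norm[OF G])
    also have "\<dots> \<le> cut_norm_vec (\<lambda>z. relabel \<psi> U z - K z) + cut_norm_vec (\<lambda>z. K z - relabel \<phi> W z)"
      by (intro cut_norm_vec_triangle graphon_vkernel G \<K>(2) K(2))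
    finally have "cut_dist U W < \<epsilon>" using U(3) K(3) cut_norm_vec_minus_commute[of K "relabel \<phi> W"] by simp
    moreover have "U \<in> F" using K(2) ex by (auto simp: F_def U_def)
    ultimately show "\<exists>U\<in>F. cut_dist U W < \<epsilon>" by blast
  qed
qed

subsection \<open>Completeness\<close>

text \<open>Lebesgue measurable sides differ from Borel ones by null sets. Weak limits are
  constructed on Borel sets, while the cut norm runs over Lebesgue measurable rectangles.\<close>

lemma rect_integral_borel:
  assumes "S \<in> sets unit_measure" "T \<in> sets unit_measure"
  obtains S' T' where "S' \<in> sets borel" "T' \<in> sets borel" "S' \<in> sets unit_measure" "T' \<in> sets unit_measure"
    "\<And>U. bkernel U \<Longrightarrow> rect_integral S T U = rect_integral S' T' U"
proof -
  have *: "\<exists>S'. S' \<in> sets borel \<and> S' \<in> sets unit_measure \<and> S' \<subseteq> S \<and> emeasure unit_measure (S - S') = 0"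
    if "S \<in> sets unit_measure" for S
  proof -
    have SL: "S \<in> sets lebesgue" "S \<subseteq> {0..1}" using that by (auto simp: sets_unit_measure)
    have Su: "S = main_part lborel S \<union> null_part lborel S" using main_part_null_part_Un[OF SL(1)] by simp
    obtain N where N: "null_part lborel S \<subseteq> N" "N \<in> null_sets lborel" using null_part[OF SL(1)] by auto
    have b: "main_part lborel S \<in> sets borel" using main_part_sets[OF SL(1)] by simp
    have m: "main_part lborel S \<in> sets unit_measure" using b Su SL(2) by (auto simp: sets_unit_measure)
    have "S - main_part lborel S \<subseteq> N" using Su N(1) by blast
    then have "S - main_part lborel S \<in> null_sets lebesgue"
      using N(2) by (metis null_sets_completion_subset null_sets_completionI)
    then have "emeasure unit_measure (S - main_part lborel S) = 0"
      using emeasure_unit_measure[OF sets.Diff[OF that m]] by auto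
    then show ?thesis using b m Su by (intro exI[of _ "main_part lborel S"]) blast
  qed
  obtain S' where S': "S' \<in> sets borel" "S' \<in> sets unit_measure" "S' \<subseteq> S" "emeasure unit_measure (S - S') = 0"
    using *[OF assms(1)] by blast
  obtain T' where T': "T' \<in> sets borel" "T' \<in> sets unit_measure" "T' \<subseteq> T" "emeasure unit_measure (T - T') = 0"
    using *[OF assms(2)] by blast
  have I: "{0..1} \<in> sets unit_measure" by (simp add: sets_unit_measure)
  have SI: "S \<subseteq> {0..1}" "T \<subseteq> {0..1}" using assms by (auto simp: sets_unit_measure)
  define N where "N = (S - S') \<times> {0..1} \<union> {0..1} \<times> (T - T')"
  have N: "N \<in> null_sets square_measure"
    unfolding N_def
  proof (intro null_sets.Un null_setsI)
    show "emeasure square_measure ((S - S') \<times> {0..1}) = 0"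
      by (subst emeasure_square_Times) (use assms S' I in auto)
    show "emeasure square_measure ({0..1} \<times> (T - T')) = 0"
      by (subst emeasure_square_Times) (use assms T' I in auto)
    show "(S - S') \<times> {0..1} \<in> sets square_measure" "{0..1} \<times> (T - T') \<in> sets square_measure"
      by (intro Times_in_square sets.Diff assms S'(2) T'(2) I)+
  qed
  have "rect_integral S T U = rect_integral S' T' U" if U: "bkernel U" for U
    unfolding rect_integral_def
  proof (rule integral_cong_AE)
    show "AE z in square_measure. indicator (S \<times> T) z * U z = indicator (S' \<times> T') z * U z"
    proof (rule AE_I'[OF N], rule subsetI)
      fix z assume "z \<in> {z \<in> space square_measure. indicator (S \<times> T) z * U z \<noteq> indicator (S' \<times> T') z * U z}"
      then have "(z \<in> S \<times> T) \<noteq> (z \<in> S' \<times> T')" by (auto simp: indicator_def)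
      then have "z \<in> S \<times> T - S' \<times> T'" using S'(3) T'(3) by blast
      then show "z \<in> N" using SI unfolding N_def by blast
    qed
  qed (intro bkernel_measurable bkernel_rect assms S' T' U)+
  then show ?thesis using that[OF S'(1) T'(1) S'(2) T'(2)] by blast
qed

text \<open>The set functions given by integrating \<open>U j\<close> are all dominated by one
  finite measure. Hence convergence on rectangles extends to all Borel sets, the limit is again a
  measure, absolutely continuous with respect to the dominating one, and its density is the weak
  limit.\<close>

lemma weak_limit:
  fixes U :: "nat \<Rightarrow> real \<times> real \<Rightarrow> real"
  assumes U: "\<And>j. bkernel (U j)" "\<And>j z. z \<in> unit_square \<Longrightarrow> 0 \<le> U j z" "\<And>j z. z \<in> unit_square \<Longrightarrow> U j z \<le> 1"
    and conv: "\<And>S T. S \<in> sets unit_measure \<Longrightarrow> T \<in> sets unit_measure \<Longrightarrow> convergent (\<lambda>j. rect_integral S T (U j))"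
  shows "\<exists>w. w \<in> borel_measurable borel \<and> (\<forall>z. 0 \<le> w z) \<and> integrable square_measure w \<and>
    (\<forall>A\<in>sets borel. (\<lambda>j. \<integral>z. indicator A z * U j z \<partial>square_measure) \<longlonglongrightarrow> (\<integral>z. indicator A z * w z \<partial>square_measure))"
proof -
  define B0 where "B0 = distr square_measure borel (\<lambda>z. z)"
  have idm: "(\<lambda>z. z) \<in> square_measure \<rightarrow>\<^sub>M (borel :: (real \<times> real) measure)"
    by (intro measurable_restrict_space1 measurable_completion) simp
  interpret B0: prob_space B0 unfolding B0_def by (rule square.prob_space_distr[OF idm])
  have sB: "sets B0 = sets borel" "space B0 = UNIV" by (auto simp: B0_def)
  have sq: "A \<inter> unit_square \<in> sets square_measure" if "A \<in> sets borel" for A :: "(real \<times> real) set"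
    using that by (auto simp: sets_square_measure)
  have bi: "bkernel (\<lambda>z. indicator A z * V z)" if "A \<in> sets borel" "bkernel V" for A :: "(real \<times> real) set" and V
    by (rule bkernel_cong[OF bkernel_mult[OF bkernel_indicator[OF sq[OF that(1)]] that(2)]]) (auto simp: indicator_def)
  define m where "m j A = (\<integral>z. indicator A z * U j z \<partial>square_measure)" for j and A :: "(real \<times> real) set"
  have m0: "0 \<le> m j A" if "A \<in> sets borel" for j A
    unfolding m_def by (rule integral_nonneg_AE) (use U(2) in auto)
  have m1: "m j A \<le> measure B0 A" if "A \<in> sets borel" for j A
  proof -
    have "measure B0 A = measure square_measure (A \<inter> space square_measure)"
      unfolding B0_def using that by (simp add: measure_distr[OF idm])
    also have "\<dots> = (\<integral>z. indicator A z \<partial>square_measure)" by simp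
    finally have "measure B0 A = (\<integral>z. indicator A z * 1 \<partial>square_measure)" by simp
    moreover have "m j A \<le> (\<integral>z. indicator A z * 1 \<partial>square_measure)"
      unfolding m_def
    proof (rule integral_mono)
      fix z assume "z \<in> space square_measure"
      then have "z \<in> unit_square" by simp
      from U(3)[OF this, of j] show "indicator A z * U j z \<le> indicator A z * 1" by (intro mult_left_mono) auto
    qed (intro bkernel_integrable bi that U(1) bkernel_const)+
    ultimately show ?thesis by simp
  qed
  have m_UN: "m j (\<Union>i. A i) = (\<Sum>i. m j (A i))" if A: "range A \<subseteq> sets borel" "disjoint_family A" for A :: "nat \<Rightarrow> (real \<times> real) set" and j
  proof -
    define A' where "A' i = A i \<inter> unit_square" for i
    have A': "A' i \<in> sets square_measure" for i unfolding A'_def using A(1) by (intro sq) auto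
    have "m j (\<Union>i. A i) = (LINT z:(\<Union>i. A' i)|square_measure. U j z)"
      unfolding m_def set_lebesgue_integral_def A'_def
      by (rule Bochner_Integration.integral_cong) (auto simp: indicator_def)
    also have "\<dots> = (\<Sum>i. LINT z:A' i|square_measure. U j z)"
    proof (rule lebesgue_integral_countable_add[OF A'])
      show "A' i \<inter> A' l = {}" if "i \<noteq> l" for i l using A(2) that unfolding disjoint_family_on_def A'_def by blast
      show "set_integrable square_measure (\<Union>i. A' i) (U j)"
        unfolding set_integrable_def real_scaleR_def
        using A' by (intro bkernel_integrable bkernel_mult bkernel_indicator U(1)) auto
    qed
    also have "\<dots> = (\<Sum>i. m j (A i))"
      unfolding m_def set_lebesgue_integral_def A'_def
      by (intro suminf_cong Bochner_Integration.integral_cong) (auto simp: indicator_def)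
    finally show ?thesis .
  qed
  \<comment> \<open>Dominated convergence for series, with the summable majorant
    \<open>measure B0 (A i)\<close>. It gives both the closure under disjoint unions and the
    countable additivity of the limit.\<close>
  have tannery: "(\<lambda>j. m j (\<Union>i. A i)) \<longlonglongrightarrow> (\<Sum>i. L i) \<and> summable L"
    if A: "range A \<subseteq> sets borel" "disjoint_family A" and L: "\<And>i. (\<lambda>j. m j (A i)) \<longlonglongrightarrow> L i"
    for A :: "nat \<Rightarrow> (real \<times> real) set" and L
  proof -
    have bound: "eventually (\<lambda>(i, j). norm (m j (A i)) \<le> measure B0 (A i)) (at_top \<times>\<^sub>F sequentially)"
    proof -
      have "norm (m j (A i)) \<le> measure B0 (A i)" for i j
        using m0[of "A i" j] m1[of "A i" j] A(1) by auto
      then show ?thesis by (intro always_eventually) auto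
    qed
    have "summable (\<lambda>i. measure B0 (A i))"
      using B0.finite_measure_UNION[of A] A by (auto simp: sB dest: sums_summable)
    from tannerys_theorem[of "\<lambda>i j. m j (A i)" L, OF L bound this]
    have s: "summable (\<lambda>i. norm (L i))" and lim: "(\<lambda>j. \<Sum>i. m j (A i)) \<longlonglongrightarrow> suminf L" by auto
    show ?thesis unfolding m_UN[OF A] using lim summable_norm_cancel[OF s] ..
  qed
  \<comment> \<open>Rectangles are stable under intersection and generate the Borel sets, so
    induction over complements and disjoint unions suffices.\<close>
  have convA: "convergent (\<lambda>j. m j A)" if "A \<in> sets borel" for A
  proof -
    let ?G = "{S \<times> T |S T. S \<in> sets (borel :: real measure) \<and> T \<in> sets (borel :: real measure)}"
    have gen: "sets (borel :: (real \<times> real) measure) = sigma_sets UNIV ?G"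
      unfolding borel_prod[symmetric] sets_pair_measure by simp
    have st: "Int_stable ?G" using Int_stable_pair_measure_generator[of "borel :: real measure" "borel :: real measure"] by simp
    have cl: "?G \<subseteq> Pow UNIV" by simp
    have "A \<in> sigma_sets UNIV ?G" using that gen by simp
    from st cl this show ?thesis
    proof (induction A rule: sigma_sets_induct_disjoint)
      case (basic A)
      then obtain S T where A: "A = S \<times> T" "S \<in> sets borel" "T \<in> sets borel" by auto
      have "m j A = rect_integral (S \<inter> {0..1}) (T \<inter> {0..1}) (U j)" for j
        unfolding m_def rect_integral_def A(1) by (rule Bochner_Integration.integral_cong) (auto simp: indicator_def)
      moreover have "S \<inter> {0..1} \<in> sets unit_measure" "T \<inter> {0..1} \<in> sets unit_measure"
        using A by (auto simp: sets_unit_measure)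
      ultimately show ?case using conv by simp
    next
      case empty
      show ?case by (simp add: m_def convergent_const)
    next
      case (compl A)
      then have Ab: "A \<in> sets borel" using gen by simp
      have "m j (UNIV - A) = m j UNIV - m j A" for j
      proof -
        have "m j UNIV - m j A = (\<integral>z. indicator UNIV z * U j z - indicator A z * U j z \<partial>square_measure)"
          unfolding m_def by (intro Bochner_Integration.integral_diff[symmetric] bkernel_integrable bi Ab U) auto
        also have "\<dots> = m j (UNIV - A)"
          unfolding m_def by (rule Bochner_Integration.integral_cong) (auto simp: indicator_def)
        finally show ?thesis by simp
      qed
      moreover have "m j UNIV = rect_integral {0..1} {0..1} (U j)" for j
        unfolding m_def rect_integral_def by (rule Bochner_Integration.integral_cong) (auto simp: indicator_def)
      then have "convergent (\<lambda>j. m j UNIV)" using conv[of "{0..1}" "{0..1}"] by (simp add: sets_unit_measure)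
      ultimately show ?case using compl by (simp add: convergent_diff)
    next
      case (union A)
      then have "range A \<subseteq> sets borel" using gen by simp
      note range = this
      have "(\<lambda>j. m j (A i)) \<longlonglongrightarrow> lim (\<lambda>j. m j (A i))" for i
        using union(3)[of i] by (simp add: convergent_LIMSEQ_iff)
      from conjunct1[OF tannery[OF range union(1) this]] show ?case by (rule convergentI)
    qed
  qed
  define l where "l A = lim (\<lambda>j. m j A)" for A
  have l: "(\<lambda>j. m j A) \<longlonglongrightarrow> l A" if "A \<in> sets borel" for A
    using convA[OF that] by (simp add: l_def convergent_LIMSEQ_iff)
  have l0: "0 \<le> l A" if "A \<in> sets borel" for A
    using LIMSEQ_le_const[OF l[OF that]] m0[OF that] by blast
  have l1: "l A \<le> measure B0 A" if "A \<in> sets borel" for A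
    using LIMSEQ_le_const2[OF l[OF that]] m1[OF that] by blast
  define \<nu> where "\<nu> = measure_of UNIV (sets borel) (\<lambda>A. ennreal (l A))"
  have s\<nu>: "sets \<nu> = sets borel" unfolding \<nu>_def by (rule sets.sets_measure_of_eq[of borel, unfolded space_borel])
  have e\<nu>: "emeasure \<nu> A = ennreal (l A)" if "A \<in> sets borel" for A
  proof (rule emeasure_measure_of[OF \<nu>_def])
    show "sets borel \<subseteq> Pow (UNIV :: (real \<times> real) set)" by simp
    show "A \<in> sets \<nu>" using that s\<nu> by simp
    have "m j {} = 0" for j by (simp add: m_def)
    then have "l {} = 0" using l[of "{}"] by (simp add: LIMSEQ_const_iff)
    then show "positive (sets \<nu>) (\<lambda>A. ennreal (l A))" by (simp add: positive_def)
    show "countably_additive (sets \<nu>) (\<lambda>A. ennreal (l A))"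
    proof (rule countably_additiveI)
      fix A :: "nat \<Rightarrow> (real \<times> real) set" assume A: "range A \<subseteq> sets \<nu>" "disjoint_family A"
      then have A': "range A \<subseteq> sets borel" using s\<nu> by simp
      then have Ai: "A i \<in> sets borel" for i by blast
      note T = tannery[OF A' A(2) l[OF Ai]]
      have "(\<Union>i. A i) \<in> sets borel" using Ai by blast
      from LIMSEQ_unique[OF l[OF this] conjunct1[OF T]] have "l (\<Union>i. A i) = (\<Sum>i. l (A i))" .
      then show "(\<Sum>i. ennreal (l (A i))) = ennreal (l (\<Union>i. A i))"
        using suminf_ennreal2[OF l0[OF Ai] conjunct2[OF T]] by (simp only:)
    qed
  qed
  have "absolutely_continuous B0 \<nu>"
    unfolding absolutely_continuous_def
  proof
    fix A assume A: "A \<in> null_sets B0"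
    then have Ab: "A \<in> sets borel" using sB by auto
    have "measure B0 A = 0" using A by (simp add: measure_def null_sets_def)
    then have "l A = 0" using l0[OF Ab] l1[OF Ab] by simp
    then show "A \<in> null_sets \<nu>" using Ab s\<nu> e\<nu>[OF Ab] by (intro null_setsI) auto
  qed
  then obtain f where f: "f \<in> borel_measurable B0" "density B0 f = \<nu>"
    using B0.Radon_Nikodym[of \<nu>] s\<nu> sB by auto
  have nf: "(\<integral>\<^sup>+z. f z * indicator A z \<partial>B0) = ennreal (l A)" if "A \<in> sets borel" for A
    using emeasure_density[OF f(1), of A] that f(2) e\<nu> sB by simp
  have "(\<integral>\<^sup>+z. f z \<partial>B0) \<noteq> \<infinity>" using nf[of UNIV] by simp
  then have fin: "AE z in B0. f z \<noteq> \<infinity>" by (rule nn_integral_PInf_AE[OF f(1)])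
  \<comment> \<open>The density is finite almost everywhere, so sending the value \<infinity> to 0
    does not change its integrals.\<close>
  define w where "w z = enn2real (f z)" for z
  have w0: "0 \<le> w z" for z by (simp add: w_def)
  have wB: "w \<in> borel_measurable B0" unfolding w_def using f(1) by measurable
  then have wb: "w \<in> borel_measurable borel" using sB measurable_cong_sets[of B0 borel] by blast
  have nw: "(\<integral>\<^sup>+z. ennreal (indicator A z * w z) \<partial>B0) = ennreal (l A)" if "A \<in> sets borel" for A
    unfolding nf[OF that, symmetric]
    by (rule nn_integral_cong_AE) (use fin in \<open>auto elim!: eventually_mono simp: w_def indicator_def less_top\<close>)
  have iw: "integrable B0 (\<lambda>z. indicator A z * w z)" "(\<integral>z. indicator A z * w z \<partial>B0) = l A" if A: "A \<in> sets borel" for A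
  proof -
    have mm: "(\<lambda>z. indicator A z * w z) \<in> borel_measurable B0"
      using wB A sB by (intro borel_measurable_times borel_measurable_indicator) auto
    show i: "integrable B0 (\<lambda>z. indicator A z * w z)"
      by (rule integrableI_nonneg[OF mm]) (use nw[OF A] w0 in auto)
    have "ennreal (\<integral>z. indicator A z * w z \<partial>B0) = ennreal (l A)"
      using nn_integral_eq_integral[OF i] nw[OF A] w0 by simp
    then show "(\<integral>z. indicator A z * w z \<partial>B0) = l A"
      using l0[OF A] w0 by (subst (asm) ennreal_inj) (auto intro: integral_nonneg_AE)
  qed
  have tr: "(\<integral>z. indicator A z * w z \<partial>square_measure) = l A" if A: "A \<in> sets borel" for A
    unfolding iw(2)[OF A, symmetric] B0_def
    by (rule integral_distr[OF idm, symmetric]) (use A wb in measurable)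
  have "integrable square_measure w"
    using iw(1)[of UNIV] integrable_distr[OF idm, of w] unfolding B0_def by simp
  then show ?thesis
    using wb w0 l tr unfolding m_def by (intro exI[of _ w]) simp
qed

text \<open>The Cauchy condition makes every rectangle integral converge, so each component has a
  weak limit; these need to be corrected on a null set and symmetrised to form a graphon.
  Convergence in cut norm then follows because the Cauchy bound is uniform over rectangles.\<close>

lemma cut_norm_complete:
  fixes V :: "nat \<Rightarrow> 'k::finite kernel"
  assumes V: "\<And>j. V j \<in> graphons"
    and cauchy: "\<And>e. e > 0 \<Longrightarrow> \<exists>J. \<forall>i\<ge>J. \<forall>j\<ge>J. cut_norm_vec (\<lambda>z. V i z - V j z) < e"
  obtains W where "W \<in> graphons" "(\<lambda>j. cut_norm_vec (\<lambda>z. V j z - W z)) \<longlonglongrightarrow> 0"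
proof -
  have bV: "bkernel (\<lambda>z. V j z $ a)" for j a by (intro vkernel_component graphon_vkernel V)
  have close: "\<bar>rect_integral S T (\<lambda>z. V i z $ a) - rect_integral S T (\<lambda>z. V j z $ a)\<bar> \<le> cut_norm_vec (\<lambda>z. V i z - V j z)"
    if "S \<in> sets unit_measure" "T \<in> sets unit_measure" for S T i j a
  proof -
    have "\<bar>rect_integral S T (\<lambda>z. V i z $ a) - rect_integral S T (\<lambda>z. V j z $ a)\<bar> = \<bar>rect_integral S T (\<lambda>z. (V i z - V j z) $ a)\<bar>"
      using rect_integral_diff[OF that bV bV] by simp
    also have "\<dots> \<le> cut_norm (\<lambda>z. (V i z - V j z) $ a)"
      by (intro abs_rect_integral_le_cut_norm that vkernel_component graphon_diff_vkernel V)
    also have "\<dots> \<le> cut_norm_vec (\<lambda>z. V i z - V j z)" by (intro cut_norm_le_vec graphon_diff_vkernel V)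
    finally show ?thesis .
  qed
  have conv: "convergent (\<lambda>j. rect_integral S T (\<lambda>z. V j z $ a))"
    if "S \<in> sets unit_measure" "T \<in> sets unit_measure" for S T a
  proof (rule Cauchy_convergent, rule metric_CauchyI)
    fix e :: real assume "e > 0"
    then obtain J where "\<forall>i\<ge>J. \<forall>j\<ge>J. cut_norm_vec (\<lambda>z. V i z - V j z) < e" using cauchy by blast
    then show "\<exists>J. \<forall>i\<ge>J. \<forall>j\<ge>J. dist (rect_integral S T (\<lambda>z. V i z $ a)) (rect_integral S T (\<lambda>z. V j z $ a)) < e"
      using close[OF that] unfolding dist_real_def by (meson le_less_trans)
  qed
  define lim_of where "lim_of a w \<longleftrightarrow> w \<in> borel_measurable borel \<and> (\<forall>z. 0 \<le> w z) \<and> integrable square_measure w \<and>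
    (\<forall>A\<in>sets borel. (\<lambda>j. \<integral>z. indicator A z * V j z $ a \<partial>square_measure) \<longlonglongrightarrow> (\<integral>z. indicator A z * w z \<partial>square_measure))" for a and w :: "real \<times> real \<Rightarrow> real"
  have "\<exists>w. lim_of a w" for a
    unfolding lim_of_def
    by (rule weak_limit[of "\<lambda>j z. V j z $ a", OF bV graphon_bounds(1)[OF V] graphon_bounds(2)[OF V] conv])
  then obtain w where w: "\<And>a. lim_of a (w a)" by metis
  have wb: "w a \<in> borel_measurable borel" and w0: "0 \<le> w a z" and wi: "integrable square_measure (w a)"
    and wl: "A \<in> sets borel \<Longrightarrow> (\<lambda>j. \<integral>z. indicator A z * V j z $ a \<partial>square_measure) \<longlonglongrightarrow> (\<integral>z. indicator A z * w a z \<partial>square_measure)"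
    for a z A using w[of a] unfolding lim_of_def by blast+
  have wsq: "w a \<in> borel_measurable square_measure" for a using wi by (rule borel_measurable_integrable)
  have idm: "(\<lambda>z. z) \<in> square_measure \<rightarrow>\<^sub>M (borel :: (real \<times> real) measure)"
    by (intro measurable_restrict_space1 measurable_completion) simp
  have indm: "indicator A \<in> borel_measurable square_measure" if "A \<in> sets borel" for A :: "(real \<times> real) set"
    using measurable_compose[OF idm borel_measurable_indicator[OF that]] by simp
  have ii: "integrable square_measure (\<lambda>z. indicator A z * w a z)" if "A \<in> sets borel" for A a
    by (rule Bochner_Integration.integrable_bound[OF wi], intro borel_measurable_times indm that wsq)
      (use w0 in \<open>auto simp: indicator_def\<close>)
  have bi: "integrable square_measure (\<lambda>z. indicator A z * V j z $ a)" if "A \<in> sets borel" for A j a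
  proof (rule Bochner_Integration.integrable_bound[OF bkernel_integrable[OF bkernel_const[of 1]]])
    show "(\<lambda>z. indicator A z * V j z $ a) \<in> borel_measurable square_measure"
      by (intro borel_measurable_times indm that bkernel_measurable bV)
    show "AE z in square_measure. norm (indicator A z * V j z $ a) \<le> norm (1::real)"
      using graphon_bounds(1,2)[OF V] by (intro AE_I2) (auto simp: indicator_def)
  qed
  \<comment> \<open>Over every Borel set the integral of the sum of the weak limits equals the
    measure of the set, which determines the sum almost everywhere.\<close>
  have one: "AE z in square_measure. (\<Sum>a\<in>UNIV. w a z) = 1"
  proof -
    let ?B = "distr square_measure borel (\<lambda>z. z)"
    have sm: "(\<lambda>z. \<Sum>a\<in>UNIV. w a z) \<in> borel_measurable borel" using wb by measurable
    have isum: "integrable square_measure (\<lambda>z. \<Sum>a\<in>UNIV. w a z)" using wi by (intro Bochner_Integration.integrable_sum)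
    have "AE z in ?B. (\<Sum>a\<in>UNIV. w a z) = 1"
    proof (rule density_unique_real)
      show "integrable ?B (\<lambda>z. \<Sum>a\<in>UNIV. w a z)" unfolding integrable_distr_eq[OF idm sm] by (rule isum)
      show "integrable ?B (\<lambda>z. 1 :: real)"
        using integrable_distr_eq[OF idm, of "\<lambda>z. 1 :: real"] by (simp add: bkernel_integrable)
      fix A assume "A \<in> sets ?B"
      then have A: "A \<in> sets borel" by simp
      have "(\<lambda>j. \<Sum>a\<in>UNIV. \<integral>z. indicator A z * V j z $ a \<partial>square_measure) \<longlonglongrightarrow> (\<Sum>a\<in>UNIV. \<integral>z. indicator A z * w a z \<partial>square_measure)"
        by (intro tendsto_sum wl A)
      moreover have "(\<Sum>a\<in>UNIV. \<integral>z. indicator A z * V j z $ a \<partial>square_measure) = (\<integral>z. indicator A z \<partial>square_measure)" for j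
      proof -
        have "(\<Sum>a\<in>UNIV. \<integral>z. indicator A z * V j z $ a \<partial>square_measure) = (\<integral>z. (\<Sum>a\<in>UNIV. indicator A z * V j z $ a) \<partial>square_measure)"
          by (intro Bochner_Integration.integral_sum[symmetric] bi A)
        also have "\<dots> = (\<integral>z. indicator A z \<partial>square_measure)"
          unfolding sum_distrib_left[symmetric]
          by (rule Bochner_Integration.integral_cong) (simp_all add: graphon_bounds(3)[OF V])
        finally show ?thesis .
      qed
      ultimately have "(\<Sum>a\<in>UNIV. \<integral>z. indicator A z * w a z \<partial>square_measure) = (\<integral>z. indicator A z \<partial>square_measure)"
        by (simp add: LIMSEQ_const_iff)
      moreover have "(\<Sum>a\<in>UNIV. \<integral>z. indicator A z * w a z \<partial>square_measure) = (\<integral>z. indicator A z * (\<Sum>a\<in>UNIV. w a z) \<partial>square_measure)"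
        unfolding sum_distrib_left by (intro Bochner_Integration.integral_sum[symmetric] ii A)
      ultimately show "(LINT z:A|?B. (\<Sum>a\<in>UNIV. w a z)) = (LINT z:A|?B. 1)"
        unfolding set_lebesgue_integral_def real_scaleR_def
        by (subst (1 2) integral_distr[OF idm]) (use A sm in \<open>auto intro!: borel_measurable_times borel_measurable_indicator\<close>)
    qed
    then show ?thesis by (rule AE_distrD[OF idm])
  qed
  have "AE z in distr square_measure square_measure prod.swap. (\<Sum>a\<in>UNIV. w a z) = 1" using one unfolding swap_square(2) .
  then have one': "AE z in square_measure. (\<Sum>a\<in>UNIV. w a (prod.swap z)) = 1" by (rule AE_distrD[OF swap_square(1)])
  \<comment> \<open>The good set is invariant under the swap, so averaging on it and taking the
    uniform law off it gives a kernel that is symmetric and has sum 1 at every point, not just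
    almost everywhere.\<close>
  define G where "G z \<longleftrightarrow> (\<Sum>a\<in>UNIV. w a z) = 1 \<and> (\<Sum>a\<in>UNIV. w a (prod.swap z)) = 1" for z
  define W0 :: "'k kernel" where "W0 z = (\<chi> a. if G z then (w a z + w a (prod.swap z)) / 2 else 1 / real CARD('k))" for z
  have wsw: "(\<lambda>z. w a (prod.swap z)) \<in> borel_measurable square_measure" for a
    by (rule measurable_compose[OF swap_square(1) wsq])
  have W: "restrict W0 unit_square \<in> graphons"
  proof (rule graphonsI)
    have [measurable]: "Measurable.pred square_measure G"
      unfolding G_def[abs_def] using wsq wsw by measurable
    show "(\<lambda>z. W0 z $ a) \<in> borel_measurable square_measure" for a
      unfolding W0_def using wsq[of a] wsw[of a] by simp
    show "0 \<le> W0 z $ a" for z a using w0 by (simp add: W0_def)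
    show "(\<Sum>a\<in>UNIV. W0 z $ a) = 1" for z
    proof (cases "G z")
      case True
      then have "(\<Sum>a\<in>UNIV. W0 z $ a) = ((\<Sum>a\<in>UNIV. w a z) + (\<Sum>a\<in>UNIV. w a (prod.swap z))) / 2"
        by (simp add: W0_def sum.distrib sum_divide_distrib[symmetric])
      then show ?thesis using True by (simp add: G_def)
    qed (simp add: W0_def)
    show "W0 (x, y) = W0 (y, x)" for x y by (auto simp: W0_def G_def add.commute vec_eq_iff)
  qed
  define W where "W = restrict W0 unit_square"
  have WG: "W \<in> graphons" using W by (simp add: W_def)
  have bW: "bkernel (\<lambda>z. W z $ a)" for a by (intro vkernel_component graphon_vkernel WG)
  \<comment> \<open>By symmetry of the \<open>V j\<close>, integrals over S x T and T x S agree
    along the sequence, so the symmetrised density has the same limits.\<close>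
  have limB: "(\<lambda>j. rect_integral S T (\<lambda>z. V j z $ a)) \<longlonglongrightarrow> rect_integral S T (\<lambda>z. W z $ a)"
    if ST: "S \<in> sets borel" "T \<in> sets borel" "S \<in> sets unit_measure" "T \<in> sets unit_measure" for S T a
  proof -
    have b: "S \<times> T \<in> sets borel" "T \<times> S \<in> sets borel" using ST by (auto simp: borel_prod[symmetric])
    have l1: "(\<lambda>j. rect_integral S T (\<lambda>z. V j z $ a)) \<longlonglongrightarrow> rect_integral S T (w a)"
      using wl[OF b(1), of a] by (simp add: rect_integral_def)
    have l2: "(\<lambda>j. rect_integral T S (\<lambda>z. V j z $ a)) \<longlonglongrightarrow> rect_integral T S (w a)"
      using wl[OF b(2), of a] by (simp add: rect_integral_def)
    have "rect_integral T S (\<lambda>z. V j z $ a) = rect_integral S T (\<lambda>z. V j z $ a)" for j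
    proof -
      have "rect_integral T S (\<lambda>z. V j z $ a) = rect_integral S T (\<lambda>z. V j (prod.swap z) $ a)"
        by (rule rect_integral_swap[symmetric]) (use ST bV in auto)
      also have "\<dots> = rect_integral S T (\<lambda>z. V j z $ a)"
        by (rule rect_integral_cong) (use graphon_sym[OF V] in \<open>auto simp: prod.swap_def\<close>)
      finally show ?thesis .
    qed
    with l2 have l3: "(\<lambda>j. rect_integral S T (\<lambda>z. V j z $ a)) \<longlonglongrightarrow> rect_integral T S (w a)" by simp
    have sw: "rect_integral T S (w a) = (\<integral>z. indicator (S \<times> T) z * w a (prod.swap z) \<partial>square_measure)"
    proof -
      have "rect_integral T S (w a) = (\<integral>z. indicator (T \<times> S) z * w a z \<partial>distr square_measure square_measure prod.swap)"
        by (simp add: rect_integral_def swap_square(2))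
      also have "\<dots> = (\<integral>z. indicator (T \<times> S) (prod.swap z) * w a (prod.swap z) \<partial>square_measure)"
        by (rule integral_distr[OF swap_square(1)]) (intro borel_measurable_times indm b wsq)
      also have "\<dots> = (\<integral>z. indicator (S \<times> T) z * w a (prod.swap z) \<partial>square_measure)"
        by (rule Bochner_Integration.integral_cong) (auto simp: indicator_def)
      finally show ?thesis .
    qed
    have isw: "integrable square_measure (\<lambda>z. indicator (S \<times> T) z * w a (prod.swap z))"
    proof -
      have "integrable (distr square_measure square_measure prod.swap) (w a)" using wi unfolding swap_square(2) .
      then have "integrable square_measure (\<lambda>z. w a (prod.swap z))" by (rule integrable_distr[OF swap_square(1)])
      then show ?thesis
        by (rule Bochner_Integration.integrable_bound, intro borel_measurable_times indm b wsw)
          (use w0 in \<open>auto simp: indicator_def\<close>)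
    qed
    have "rect_integral S T (\<lambda>z. W z $ a) = (\<integral>z. (indicator (S \<times> T) z * w a z + indicator (S \<times> T) z * w a (prod.swap z)) / 2 \<partial>square_measure)"
      unfolding rect_integral_def
    proof (rule integral_cong_AE)
      show "AE z in square_measure. indicator (S \<times> T) z * W z $ a = (indicator (S \<times> T) z * w a z + indicator (S \<times> T) z * w a (prod.swap z)) / 2"
        using one one' AE_space
      proof eventually_elim
        case (elim z)
        then show ?case unfolding W_def W0_def G_def by (simp add: algebra_simps)
      qed
    qed (intro bkernel_measurable bkernel_rect ST bW borel_measurable_divide borel_measurable_add borel_measurable_times indm b wsq wsw borel_measurable_const)+
    also have "\<dots> = (rect_integral S T (w a) + rect_integral T S (w a)) / 2"
      unfolding sw using ii[OF b(1), of a] isw by (simp add: rect_integral_def)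
    finally have e: "rect_integral S T (\<lambda>z. W z $ a) = (rect_integral S T (w a) + rect_integral T S (w a)) / 2" .
    show ?thesis
      unfolding e using tendsto_divide[OF tendsto_add[OF l1 l3] tendsto_const[of 2]] by simp
  qed
  have lim: "(\<lambda>j. rect_integral S T (\<lambda>z. V j z $ a)) \<longlonglongrightarrow> rect_integral S T (\<lambda>z. W z $ a)"
    if ST: "S \<in> sets unit_measure" "T \<in> sets unit_measure" for S T a
  proof -
    obtain S' T' where "S' \<in> sets borel" "T' \<in> sets borel" "S' \<in> sets unit_measure" "T' \<in> sets unit_measure"
      and eq: "\<And>U. bkernel U \<Longrightarrow> rect_integral S T U = rect_integral S' T' U"
      using rect_integral_borel[OF ST] by metis
    from limB[OF this(1-4)] show ?thesis unfolding eq[OF bV] eq[OF bW] .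
  qed
  have "(\<lambda>j. cut_norm_vec (\<lambda>z. V j z - W z)) \<longlonglongrightarrow> 0"
  proof (rule metric_LIMSEQ_I)
    fix e :: real assume e: "e > 0"
    define d where "d = e / (2 * real CARD('k))"
    have d: "d > 0" using e by (simp add: d_def)
    obtain J where J: "\<forall>i\<ge>J. \<forall>j\<ge>J. cut_norm_vec (\<lambda>z. V i z - V j z) < d" using cauchy[OF d] by blast
    have "cut_norm_vec (\<lambda>z. V j z - W z) < e" if j: "j \<ge> J" for j
    proof -
      have "cut_norm (\<lambda>z. (V j z - W z) $ a) \<le> d" for a
      proof (rule cut_norm_leI)
        fix S T assume ST: "S \<in> sets unit_measure" "T \<in> sets unit_measure"
        \<comment> \<open>At a fixed rectangle i tends to infinity; the bound d survives and does
          not depend on the rectangle.\<close>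
        have "(\<lambda>i. \<bar>rect_integral S T (\<lambda>z. V j z $ a) - rect_integral S T (\<lambda>z. V i z $ a)\<bar>)
          \<longlonglongrightarrow> \<bar>rect_integral S T (\<lambda>z. V j z $ a) - rect_integral S T (\<lambda>z. W z $ a)\<bar>"
          by (intro tendsto_intros lim ST)
        moreover have "\<exists>N. \<forall>i\<ge>N. \<bar>rect_integral S T (\<lambda>z. V j z $ a) - rect_integral S T (\<lambda>z. V i z $ a)\<bar> \<le> d"
          using close[where i = j and a = a, OF ST] J j by (meson less_imp_le order_trans)
        ultimately have "\<bar>rect_integral S T (\<lambda>z. V j z $ a) - rect_integral S T (\<lambda>z. W z $ a)\<bar> \<le> d"
          by (rule LIMSEQ_le_const2)
        moreover have "rect_integral S T (\<lambda>z. (V j z - W z) $ a) = rect_integral S T (\<lambda>z. V j z $ a) - rect_integral S T (\<lambda>z. W z $ a)"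
        proof -
          have "bkernel (\<lambda>z. V j z $ a)" "bkernel (\<lambda>z. W z $ a)" by (rule bV, rule bW)
          then show ?thesis using rect_integral_diff[OF ST, of "\<lambda>z. V j z $ a" "\<lambda>z. W z $ a"] by simp
        qed
        ultimately show "\<bar>rect_integral S T (\<lambda>z. (V j z - W z) $ a)\<bar> \<le> d" by simp
      qed
      then have "cut_norm_vec (\<lambda>z. V j z - W z) \<le> (\<Sum>a\<in>(UNIV::'k set). d)"
        unfolding cut_norm_vec_def by (intro sum_mono)
      also have "\<dots> = e / 2" by (simp add: d_def)
      finally show ?thesis using e by simp
    qed
    then show "\<exists>J. \<forall>j\<ge>J. dist (cut_norm_vec (\<lambda>z. V j z - W z)) 0 < e"
      using cut_norm_vec_nonneg[OF graphon_diff_vkernel[OF V WG]] by (intro exI[of _ J]) (simp add: dist_real_def)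
  qed
  with WG show ?thesis by (rule that)
qed

subsection \<open>Compactness of the space of unlabelled graphons\<close>

lemma cut_dist_zero_cong:
  assumes "U \<in> graphons" "U' \<in> graphons" "W \<in> graphons" "W' \<in> graphons" "cut_dist U U' = 0" "cut_dist W W' = 0"
  shows "cut_dist U W = cut_dist U' W'"
  using cut_dist_triangle[of U U' W] cut_dist_triangle[of U' U W] cut_dist_triangle[of U' W W'] cut_dist_triangle[of U' W' W]
    cut_dist_commute[of U U'] cut_dist_commute[of W W'] assms by simp

lemma equiv_cut_equiv: "equiv graphons cut_equiv"
proof (rule equivI)
  show "cut_equiv \<subseteq> graphons \<times> graphons" by (auto simp: cut_equiv_def)
  show "refl_on graphons cut_equiv" by (rule refl_onI) (auto simp: cut_equiv_def cut_dist_self)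
  show "sym cut_equiv" by (rule symI) (auto simp: cut_equiv_def cut_dist_commute)
  show "trans cut_equiv"
    by (rule transI) (auto simp: cut_equiv_def dest: cut_dist_zero_cong[OF _ _ _ _ _ cut_dist_self])
qed

lemma unlabel_mem: "U \<in> unlabel W \<longleftrightarrow> U \<in> graphons \<and> W \<in> graphons \<and> cut_dist W U = 0"
  by (auto simp: unlabel_def cut_equiv_def)

lemma unlabel_self: "W \<in> graphons \<Longrightarrow> W \<in> unlabel W"
  by (simp add: unlabel_mem cut_dist_self)

lemma ugraphons_eq: "ugraphons = unlabel ` graphons"
  by (auto simp: ugraphons_def quotient_def unlabel_def)

lemma unlabel_in_ugraphons: "W \<in> graphons \<Longrightarrow> unlabel W \<in> ugraphons"
  by (simp add: ugraphons_eq)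

lemma unlabel_eq_iff: "U \<in> graphons \<Longrightarrow> W \<in> graphons \<Longrightarrow> unlabel U = unlabel W \<longleftrightarrow> cut_dist U W = 0"
  unfolding unlabel_def using eq_equiv_class_iff[OF equiv_cut_equiv, of U W] by (simp add: cut_equiv_def)

lemma ucut_dist_unlabel:
  assumes "U \<in> graphons" "W \<in> graphons"
  shows "ucut_dist (unlabel U) (unlabel W) = cut_dist U W"
proof -
  have "(\<lambda>(U, W). cut_dist U W) ` (unlabel U \<times> unlabel W) = {cut_dist U W}"
  proof (rule set_eqI, rule iffI)
    fix x assume "x \<in> (\<lambda>(U, W). cut_dist U W) ` (unlabel U \<times> unlabel W)"
    then obtain U' W' where "x = cut_dist U' W'" "U' \<in> unlabel U" "W' \<in> unlabel W" by auto
    then show "x \<in> {cut_dist U W}" using cut_dist_zero_cong[of U U' W W'] by (simp add: unlabel_mem)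
  qed (use assms unlabel_self in force)
  then show ?thesis by (simp add: ucut_dist_def)
qed

text \<open>Nonnegativity and symmetry are required by \<open>Metric_space\<close> for all
  arguments, also outside the carrier, hence the value 0 there.\<close>

definition ugraphon_metric :: "'k::finite unlabelled \<Rightarrow> 'k unlabelled \<Rightarrow> real" where
  "ugraphon_metric A B = (if A \<in> ugraphons \<and> B \<in> ugraphons then ucut_dist A B else 0)"

lemma ugraphon_metric_unlabel:
  "U \<in> graphons \<Longrightarrow> W \<in> graphons \<Longrightarrow> ugraphon_metric (unlabel U) (unlabel W) = cut_dist U W"
  by (simp add: ugraphon_metric_def ugraphons_eq ucut_dist_unlabel)

interpretation ugraphon: Metric_space ugraphons ugraphon_metric
proof
  fix A B C :: "'k::finite unlabelled"
  show "0 \<le> ugraphon_metric A B"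
  proof (cases "A \<in> ugraphons \<and> B \<in> ugraphons")
    case True
    then show ?thesis by (auto simp: ugraphons_eq ugraphon_metric_unlabel cut_dist_nonneg)
  qed (auto simp: ugraphon_metric_def)
  show "ugraphon_metric A B = ugraphon_metric B A"
  proof (cases "A \<in> ugraphons \<and> B \<in> ugraphons")
    case True
    then show ?thesis by (auto simp: ugraphons_eq ugraphon_metric_unlabel cut_dist_commute)
  qed (auto simp: ugraphon_metric_def)
  show "A \<in> ugraphons \<Longrightarrow> B \<in> ugraphons \<Longrightarrow> ugraphon_metric A B = 0 \<longleftrightarrow> A = B"
    unfolding ugraphons_eq by (elim imageE) (simp add: ugraphon_metric_unlabel unlabel_eq_iff)
  show "A \<in> ugraphons \<Longrightarrow> B \<in> ugraphons \<Longrightarrow> C \<in> ugraphons \<Longrightarrow>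
    ugraphon_metric A C \<le> ugraphon_metric A B + ugraphon_metric B C"
    by (auto simp: ugraphons_eq ugraphon_metric_unlabel cut_dist_triangle)
qed

lemma ugraphons_totally_bounded: "ugraphon.mtotally_bounded (ugraphons :: 'k::finite unlabelled set)"
  unfolding ugraphon.mtotally_bounded_def
proof (intro allI impI)
  fix \<epsilon> :: real assume "\<epsilon> > 0"
  then obtain F :: "'k kernel set" where F: "finite F" "F \<subseteq> graphons" "\<And>W. W \<in> graphons \<Longrightarrow> \<exists>U\<in>F. cut_dist U W < \<epsilon>"
    using graphons_totally_bounded by metis
  have "ugraphons \<subseteq> (\<Union>A\<in>unlabel ` F. ugraphon.mball A \<epsilon>)"
  proof
    fix A :: "'k unlabelled" assume "A \<in> ugraphons"
    then obtain W where W: "W \<in> graphons" "A = unlabel W" by (auto simp: ugraphons_eq)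
    then obtain U where U: "U \<in> F" "cut_dist U W < \<epsilon>" using F(3) by blast
    then have "A \<in> ugraphon.mball (unlabel U) \<epsilon>"
      using W F(2) by (auto simp: ugraphon.in_mball unlabel_in_ugraphons ugraphon_metric_unlabel)
    then show "A \<in> (\<Union>A\<in>unlabel ` F. ugraphon.mball A \<epsilon>)" using U by blast
  qed
  note cover = this
  have "finite (unlabel ` F)" "unlabel ` F \<subseteq> ugraphons" using F(1,2) unlabel_in_ugraphons by auto
  with cover show "\<exists>K. finite (K :: 'k unlabelled set) \<and> K \<subseteq> ugraphons \<and> ugraphons \<subseteq> (\<Union>A\<in>K. ugraphon.mball A \<epsilon>)"
    by blast
qed

text \<open>A subsequence with distances below (1/2)^i can be relabelled term by term so that
  consecutive terms are equally close in cut norm. It is then Cauchy in that norm, and completeness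
  for labelled graphons applies.\<close>

lemma graphons_sequentially_compact:
  fixes X :: "nat \<Rightarrow> 'k::finite kernel"
  assumes X: "\<And>j. X j \<in> graphons"
  obtains r W where "strict_mono r" "W \<in> graphons" "(\<lambda>j. cut_dist (X (r j)) W) \<longlonglongrightarrow> 0"
proof -
  have "range (\<lambda>j. unlabel (X j)) \<subseteq> ugraphons" using X by (auto simp: ugraphons_eq)
  then obtain r0 where r0: "strict_mono r0" "ugraphon.MCauchy ((\<lambda>j. unlabel (X j)) \<circ> r0)"
    using ugraphons_totally_bounded unfolding ugraphon.mtotally_bounded_sequentially by blast
  define Y where "Y j = X (r0 j)" for j
  have Y: "Y j \<in> graphons" for j by (simp add: Y_def X)
  have "\<exists>N. \<forall>n n'. N \<le> n \<longrightarrow> N \<le> n' \<longrightarrow> cut_dist (Y n) (Y n') < e" if "e > 0" for e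
    using r0(2) that unfolding ugraphon.MCauchy_def by (simp add: ugraphon_metric_unlabel X Y_def)
  then have "\<exists>N. \<forall>n n'. N \<le> n \<longrightarrow> N \<le> n' \<longrightarrow> cut_dist (Y n) (Y n') < (1/2) ^ i" for i :: nat by simp
  then obtain N where N: "\<And>i n n'. N i \<le> n \<Longrightarrow> N i \<le> n' \<Longrightarrow> cut_dist (Y n) (Y n') < (1/2) ^ i" by metis
  \<comment> \<open>A strictly increasing sequence of indices that dominates the thresholds
    N.\<close>
  define M where "M i = i + (\<Sum>l\<le>i. N l)" for i
  have M: "strict_mono M" by (rule strict_monoI_Suc) (simp add: M_def)
  have NM: "N i \<le> M i" for i
    using member_le_sum[of i "{..i}" N] by (simp add: M_def)
  define Z where "Z i = Y (M i)" for i
  have Z: "Z i \<in> graphons" for i by (simp add: Z_def Y)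
  have ZZ: "cut_dist (Z i) (Z (Suc i)) < (1/2) ^ i" for i
    unfolding Z_def using NM[of i] strict_mono_less_eq[OF M, of i "Suc i"] by (intro N) auto
  \<comment> \<open>Each representative is chosen close in norm to the one chosen before, while its
    class stays that of \<open>Z i\<close>.\<close>
  have "\<exists>V. \<forall>i. (V i \<in> graphons \<and> cut_dist (V i) (Z i) = 0) \<and> cut_norm_vec (\<lambda>z. V i z - V (Suc i) z) < (1/2) ^ i"
  proof (rule dependent_nat_choice)
    show "\<exists>V. V \<in> graphons \<and> cut_dist V (Z 0) = 0" using Z[of 0] cut_dist_self by blast
    fix V i assume V: "V \<in> graphons \<and> cut_dist V (Z i) = 0"
    have "cut_dist V (Z (Suc i)) \<le> cut_dist V (Z i) + cut_dist (Z i) (Z (Suc i))" using V Z by (intro cut_dist_triangle) auto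
    then have "cut_dist V (Z (Suc i)) < (1/2) ^ i" using ZZ[of i] V by simp
    then obtain \<phi> where \<phi>: "\<phi> \<in> mp_bijections" "cut_norm_vec (\<lambda>z. V z - relabel \<phi> (Z (Suc i)) z) < (1/2) ^ i"
      using cut_dist_lessD[OF conjunct1[OF V] Z] by blast
    then show "\<exists>V'. (V' \<in> graphons \<and> cut_dist V' (Z (Suc i)) = 0) \<and> cut_norm_vec (\<lambda>z. V z - V' z) < (1/2) ^ i"
      using relabel_graphon[OF Z \<phi>(1)] cut_dist_relabel[OF Z \<phi>(1)] by blast
  qed
  then obtain V where V: "\<And>i. V i \<in> graphons" "\<And>i. cut_dist (V i) (Z i) = 0"
    "\<And>i. cut_norm_vec (\<lambda>z. V i z - V (Suc i) z) < (1/2) ^ i" by blast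
  \<comment> \<open>The exact partial sum of the geometric series makes the induction close.\<close>
  have tail: "cut_norm_vec (\<lambda>z. V i z - V (i + p) z) \<le> 2 * (1/2) ^ i - 2 * (1/2) ^ (i + p)" for i p
  proof (induction p)
    case (Suc p)
    have "cut_norm_vec (\<lambda>z. V i z - V (i + Suc p) z)
      \<le> cut_norm_vec (\<lambda>z. V i z - V (i + p) z) + cut_norm_vec (\<lambda>z. V (i + p) z - V (i + Suc p) z)"
      by (intro cut_norm_vec_triangle graphon_vkernel V)
    then show ?case using Suc V(3)[of "i + p"] by simp
  next
    case 0
    show ?case using cut_norm_vec_self[of "V i"] by simp
  qed
  have tail': "cut_norm_vec (\<lambda>z. V i z - V j z) \<le> 2 * (1/2) ^ i" if le: "i \<le> j" for i j
  proof -
    obtain p where p: "j = i + p" using le by (auto simp: le_iff_add)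
    have "0 \<le> 2 * (1/2 :: real) ^ (i + p)" by simp
    with tail[of i p] show ?thesis unfolding p by linarith
  qed
  obtain W where W: "W \<in> graphons" "(\<lambda>j. cut_norm_vec (\<lambda>z. V j z - W z)) \<longlonglongrightarrow> 0"
  proof (rule cut_norm_complete[OF V(1)])
    fix e :: real assume e: "e > 0"
    have "(\<lambda>n. 2 * (1/2 :: real) ^ n) \<longlonglongrightarrow> 2 * 0" by (intro tendsto_intros LIMSEQ_realpow_zero) auto
    then have "\<forall>\<^sub>F n in sequentially. 2 * (1/2 :: real) ^ n < e" using e by (intro order_tendstoD(2)) auto
    then obtain J where J: "\<And>n. n \<ge> J \<Longrightarrow> 2 * (1/2 :: real) ^ n < e" unfolding eventually_sequentially by blast
    have "cut_norm_vec (\<lambda>z. V i z - V j z) < e" if "i \<ge> J" "j \<ge> J" for i j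
    proof (cases "i \<le> j")
      case True
      then show ?thesis using tail'[OF True] J[OF that(1)] by simp
    next
      case False
      then show ?thesis using tail'[of j i] J[OF that(2)] cut_norm_vec_minus_commute[of "V i" "V j"] by simp
    qed
    then show "\<exists>J. \<forall>i\<ge>J. \<forall>j\<ge>J. cut_norm_vec (\<lambda>z. V i z - V j z) < e" by blast
  qed
  have "cut_dist (Z i) W \<le> cut_norm_vec (\<lambda>z. V i z - W z)" for i
    using cut_dist_triangle[OF Z V(1) W(1), of i i] cut_dist_commute[OF Z V(1), of i i] V(2)[of i]
      cut_dist_le_norm[OF V(1) W(1), of i] by simp
  then have "(\<lambda>i. cut_dist (Z i) W) \<longlonglongrightarrow> 0"
    by (intro tendsto_sandwich[OF _ _ tendsto_const W(2)] always_eventually allI cut_dist_nonneg Z W(1))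
  moreover have "strict_mono (r0 \<circ> M)" using r0(1) M by (rule strict_mono_o)
  ultimately show ?thesis using that[of "r0 \<circ> M" W] W(1) by (simp add: Z_def Y_def)
qed

text \<open>Compactness in the form used later: the radius of each ball may depend on its centre in
  an arbitrary way, and the centres are labelled graphons.\<close>

lemma graphons_finite_cover:
  assumes rad: "\<And>W. W \<in> graphons \<Longrightarrow> rad W > 0"
  obtains F :: "'k::finite kernel set" where "finite F" "F \<subseteq> graphons" "\<And>U. U \<in> graphons \<Longrightarrow> \<exists>W\<in>F. cut_dist U W < rad W"
proof -
  have "compact_space (ugraphon.mtopology :: 'k unlabelled topology)"
    unfolding ugraphon.compact_space_sequentially
  proof (intro allI impI)
    fix \<sigma> :: "nat \<Rightarrow> 'k unlabelled" assume "range \<sigma> \<subseteq> ugraphons"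
    then have "\<forall>j. \<exists>W. W \<in> graphons \<and> \<sigma> j = unlabel W" by (auto simp: ugraphons_eq)
    then obtain X where X: "\<And>j. X j \<in> graphons" "\<And>j. \<sigma> j = unlabel (X j)" by metis
    obtain r W where rW: "strict_mono r" "W \<in> graphons" "(\<lambda>j. cut_dist (X (r j)) W) \<longlonglongrightarrow> 0"
      by (rule graphons_sequentially_compact[OF X(1)])
    have "limitin ugraphon.mtopology (\<sigma> \<circ> r) (unlabel W) sequentially"
      unfolding ugraphon.limitin_metric_dist_null using rW X by (simp add: ugraphons_eq ugraphon_metric_unlabel)
    then show "\<exists>l r. l \<in> ugraphons \<and> strict_mono r \<and> limitin ugraphon.mtopology (\<sigma> \<circ> r) l sequentially"
      using rW by (intro exI[of _ "unlabel W"] exI[of _ r]) (auto simp: ugraphons_eq)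
  qed
  moreover define \<U> where "\<U> = (\<lambda>W. ugraphon.mball (unlabel W) (rad W)) ` (graphons :: 'k kernel set)"
  have "(\<forall>U\<in>\<U>. openin ugraphon.mtopology U)" by (auto simp: \<U>_def)
  moreover have "topspace ugraphon.mtopology \<subseteq> \<Union>\<U>"
    unfolding ugraphon.topspace_mtopology \<U>_def
  proof
    fix A :: "'k unlabelled" assume "A \<in> ugraphons"
    then obtain W where W: "W \<in> graphons" "A = unlabel W" by (auto simp: ugraphons_eq)
    then have "A \<in> ugraphon.mball (unlabel W) (rad W)"
      by (simp add: ugraphon.in_mball unlabel_in_ugraphons ugraphon_metric_unlabel cut_dist_self rad)
    then show "A \<in> \<Union>((\<lambda>W. ugraphon.mball (unlabel W) (rad W)) ` graphons)" using W(1) by blast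
  qed
  ultimately obtain \<F> where \<F>: "finite \<F>" "\<F> \<subseteq> \<U>" "topspace ugraphon.mtopology \<subseteq> \<Union>\<F>"
    unfolding compact_space_alt by (metis (no_types, lifting))
  obtain F where F: "F \<subseteq> graphons" "finite F" "\<F> = (\<lambda>W. ugraphon.mball (unlabel W) (rad W)) ` F"
    using finite_subset_image[OF \<F>(1) \<F>(2)[unfolded \<U>_def]] by blast
  show ?thesis
  proof (rule that[OF F(2,1)])
    fix U :: "'k kernel" assume U: "U \<in> graphons"
    then have "unlabel U \<in> \<Union>\<F>"
      using \<F>(3) unlabel_in_ugraphons[OF U] unfolding ugraphon.topspace_mtopology by blast
    then obtain W where W: "W \<in> F" "unlabel U \<in> ugraphon.mball (unlabel W) (rad W)" unfolding F(3) by blast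
    then have "cut_dist W U < rad W" using F(1) U by (auto simp: ugraphon.in_mball ugraphon_metric_unlabel)
    moreover have "W \<in> graphons" using W(1) F(1) by blast
    ultimately have "cut_dist U W < rad W" using cut_dist_commute[OF U] by simp
    then show "\<exists>W\<in>F. cut_dist U W < rad W" using W(1) by (rule bexI)
  qed
qed

subsection \<open>Functions on unlabelled graphons\<close>

definition cut_continuous :: "('k::finite kernel \<Rightarrow> real) \<Rightarrow> bool" where
  "cut_continuous f \<longleftrightarrow> (\<forall>W\<in>graphons. \<forall>e>0. \<exists>r>0. \<forall>U\<in>graphons. cut_dist U W < r \<longrightarrow> \<bar>f U - f W\<bar> < e)"

lemma cut_continuousD:
  assumes "cut_continuous f" "W \<in> graphons" "e > 0"
  obtains r where "r > 0" "\<And>U. U \<in> graphons \<Longrightarrow> cut_dist U W < r \<Longrightarrow> \<bar>f U - f W\<bar> < e"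
  using assms unfolding cut_continuous_def by meson

text \<open>A graphon close to W in cut distance has a relabelling close to W in cut norm, and
  invariance says that f does not see the relabelling.\<close>

lemma cut_continuousI:
  fixes f :: "'k::finite kernel \<Rightarrow> real"
  assumes cont: "continuous_map cut_topology euclideanreal f" and inv: "relabelling_invariant f"
  shows "cut_continuous f"
  unfolding cut_continuous_def
proof (intro ballI allI impI)
  fix W :: "'k kernel" and e :: real assume W: "W \<in> graphons" and e: "e > 0"
  have "openin cut_topology {U \<in> topspace cut_topology. f U \<in> ball (f W) e}"
    using cont by (rule openin_continuous_map_preimage) simp
  then obtain r where r: "r > 0" "{U \<in> graphons. cut_norm_vec (\<lambda>z. U z - W z) < r} \<subseteq> {U \<in> graphons. f U \<in> ball (f W) e}"
    using W e unfolding openin_cut_topology topspace_cut_topology by fastforce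
  have "\<bar>f U - f W\<bar> < e" if U: "U \<in> graphons" "cut_dist U W < r" for U
  proof -
    obtain \<phi> where \<phi>: "\<phi> \<in> mp_bijections" "cut_norm_vec (\<lambda>z. U z - relabel \<phi> W z) < r"
      using cut_dist_lessD[OF U(1) W U(2)] by blast
    obtain \<psi> where \<psi>: "\<psi> \<in> mp_bijections" "cut_norm_vec (\<lambda>z. relabel \<psi> U z - W z) = cut_norm_vec (\<lambda>z. U z - relabel \<phi> W z)"
      by (rule relabel_shift[OF U(1) W \<phi>(1)])
    have "relabel \<psi> U \<in> {U \<in> graphons. cut_norm_vec (\<lambda>z. U z - W z) < r}"
      using relabel_graphon[OF U(1) \<psi>(1)] \<psi>(2) \<phi>(2) by simp
    then have "f (relabel \<psi> U) \<in> ball (f W) e" using r(2) by blast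
    moreover have "f (relabel \<psi> U) = f U" using inv U(1) \<psi>(1) by (simp add: relabelling_invariant_def)
    ultimately show ?thesis by (simp add: dist_real_def abs_minus_commute)
  qed
  then show "\<exists>r>0. \<forall>U\<in>graphons. cut_dist U W < r \<longrightarrow> \<bar>f U - f W\<bar> < e" using r(1) by blast
qed

lemma cut_continuous_lincomb:
  assumes f: "cut_continuous f" and g: "cut_continuous g"
  shows "cut_continuous (\<lambda>W. \<beta> * f W + g W)"
  unfolding cut_continuous_def
proof (intro ballI allI impI)
  fix W :: "'a kernel" and e :: real assume W: "W \<in> graphons" and e: "e > 0"
  obtain r where r: "r > 0" "\<And>U. U \<in> graphons \<Longrightarrow> cut_dist U W < r \<Longrightarrow> \<bar>f U - f W\<bar> < e / (2 * (\<bar>\<beta>\<bar> + 1))"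
    by (rule cut_continuousD[OF f W, of "e / (2 * (\<bar>\<beta>\<bar> + 1))"]) (use e in auto)
  obtain s where s: "s > 0" "\<And>U. U \<in> graphons \<Longrightarrow> cut_dist U W < s \<Longrightarrow> \<bar>g U - g W\<bar> < e / 2"
    by (rule cut_continuousD[OF g W, of "e / 2"]) (use e in auto)
  have "\<bar>\<beta> * f U + g U - (\<beta> * f W + g W)\<bar> < e" if U: "U \<in> graphons" "cut_dist U W < min r s" for U
  proof -
    have "\<bar>\<beta>\<bar> * \<bar>f U - f W\<bar> \<le> \<bar>\<beta>\<bar> * (e / (2 * (\<bar>\<beta>\<bar> + 1)))" using r(2)[OF U(1)] U(2) by (intro mult_left_mono) auto
    also have "\<dots> \<le> e / 2" using e by (simp add: field_simps)
    finally have "\<bar>\<beta> * (f U - f W)\<bar> \<le> e / 2" by (simp add: abs_mult)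
    moreover have "\<bar>g U - g W\<bar> < e / 2" using s(2)[OF U(1)] U(2) by simp
    ultimately show ?thesis unfolding right_diff_distrib by linarith
  qed
  then show "\<exists>r>0. \<forall>U\<in>graphons. cut_dist U W < r \<longrightarrow> \<bar>\<beta> * f U + g U - (\<beta> * f W + g W)\<bar> < e"
    using r(1) s(1) by (intro exI[of _ "min r s"]) auto
qed

text \<open>On each of finitely many balls f varies by less than 1 around its value at the
  centre.\<close>

lemma cut_continuous_bounded:
  fixes f :: "'k::finite kernel \<Rightarrow> real"
  assumes f: "cut_continuous f"
  obtains C where "\<And>U. U \<in> graphons \<Longrightarrow> \<bar>f U\<bar> \<le> C"
proof -
  have "\<forall>W\<in>graphons. \<exists>r>0. \<forall>U\<in>graphons. cut_dist U W < r \<longrightarrow> \<bar>f U - f W\<bar> < 1"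
    using f unfolding cut_continuous_def by simp
  then obtain rad where rad: "\<And>W. W \<in> graphons \<Longrightarrow> rad W > 0"
    "\<And>W U. W \<in> graphons \<Longrightarrow> U \<in> graphons \<Longrightarrow> cut_dist U W < rad W \<Longrightarrow> \<bar>f U - f W\<bar> < 1" by metis
  obtain F :: "'k kernel set" where F: "finite F" "F \<subseteq> graphons" "\<And>U. U \<in> graphons \<Longrightarrow> \<exists>W\<in>F. cut_dist U W < rad W"
    using graphons_finite_cover[of rad] rad(1) by blast
  show ?thesis
  proof (rule that)
    fix U :: "'k kernel" assume U: "U \<in> graphons"
    then obtain W where W: "W \<in> F" "cut_dist U W < rad W" using F(3) by blast
    then have "\<bar>f U - f W\<bar> < 1" using rad(2) F(2) U by blast
    moreover have "\<bar>f W\<bar> \<le> (\<Sum>W\<in>F. \<bar>f W\<bar>)" by (rule member_le_sum[OF W(1) _ F(1)]) simp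
    ultimately show "\<bar>f U\<bar> \<le> 1 + (\<Sum>W\<in>F. \<bar>f W\<bar>)" by linarith
  qed
qed

lemma induced_unlabel:
  assumes "\<And>U. U \<in> graphons \<Longrightarrow> cut_dist W U = 0 \<Longrightarrow> h U = h W" "W \<in> graphons"
  shows "induced h (unlabel W) = h W"
proof -
  have "h ` unlabel W = (\<lambda>_. h W) ` unlabel W"
    by (rule image_cong[OF refl], rule assms(1)) (simp_all add: unlabel_mem)
  also have "\<dots> = {h W}" using unlabel_self[OF assms(2)] by auto
  finally show ?thesis by (simp add: induced_def)
qed

text \<open>Two graphons at distance 0 need not be relabellings of each other, since the distance is
  an infimum; constancy on classes comes from continuity in the cut distance.\<close>

lemma induced_cut_continuous:
  assumes f: "cut_continuous f" and W: "W \<in> graphons"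
  shows "induced f (unlabel W) = f W"
proof (rule induced_unlabel[OF _ W], rule ccontr)
  fix U assume U: "U \<in> graphons" "cut_dist W U = 0" "f U \<noteq> f W"
  then have pos: "\<bar>f U - f W\<bar> > 0" by simp
  obtain r where r: "r > 0" "\<And>U'. U' \<in> graphons \<Longrightarrow> cut_dist U' W < r \<Longrightarrow> \<bar>f U' - f W\<bar> < \<bar>f U - f W\<bar>"
    using cut_continuousD[OF f W pos] by metis
  show False using r(2)[OF U(1)] r(1) U(2) cut_dist_commute[OF U(1) W] by simp
qed

text \<open>Lower semicontinuity applied in both directions between two graphons at distance
  0.\<close>

lemma induced_entropy:
  assumes W: "W \<in> graphons"
  shows "induced entropy_fun (unlabel W) = entropy_fun W"
proof (rule induced_unlabel[OF _ W])
  have le: "entropy_fun W \<le> entropy_fun U" if U: "U \<in> graphons" and W: "W \<in> graphons" and UW: "cut_dist U W = 0" for U W :: "'a kernel"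
  proof (rule field_le_epsilon)
    fix e :: real assume "e > 0"
    then obtain \<eta> where "\<eta> > 0" "\<And>U. U \<in> graphons \<Longrightarrow> cut_dist U W < \<eta> \<Longrightarrow> entropy_fun W - e \<le> entropy_fun U"
      using entropy_lower_semicontinuous[OF W] by metis
    then have "entropy_fun W - e \<le> entropy_fun U" using U UW by simp
    then show "entropy_fun W \<le> entropy_fun U + e" by simp
  qed
  fix U assume "U \<in> graphons" "cut_dist W U = 0"
  then show "entropy_fun U = entropy_fun W"
    using le[of U W] le[of W U] cut_dist_commute[OF _ W, of U] W by simp
qed

section \<open>Upper semicontinuous functionals and their maximisers\<close>

definition upper_semi :: "('k::finite kernel \<Rightarrow> real) \<Rightarrow> bool" where
  "upper_semi h \<longleftrightarrow> (\<exists>C. \<forall>U\<in>graphons. h U \<le> C) \<and>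
    (\<forall>W\<in>graphons. \<forall>e>0. \<exists>r>0. \<forall>U\<in>graphons. cut_dist U W < r \<longrightarrow> h U < h W + e)"

lemma upper_semi_free_energy:
  assumes f: "cut_continuous f"
  shows "upper_semi (\<lambda>W. f W - entropy_fun W / 2)"
  unfolding upper_semi_def
proof (intro conjI ballI allI impI)
  obtain C where C: "\<And>U. U \<in> graphons \<Longrightarrow> \<bar>f U\<bar> \<le> C" using cut_continuous_bounded[OF f] by metis
  have "f U - entropy_fun U / 2 \<le> C + real CARD('a) / 2" if "U \<in> graphons" for U
    using C[OF that] entropy_bounds(1)[OF that] by linarith
  then show "\<exists>C. \<forall>U\<in>graphons. f U - entropy_fun U / 2 \<le> C" by blast
  fix W :: "'a kernel" and e :: real assume W: "W \<in> graphons" and e: "e > 0"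
  obtain r where r: "r > 0" "\<And>U. U \<in> graphons \<Longrightarrow> cut_dist U W < r \<Longrightarrow> \<bar>f U - f W\<bar> < e / 2"
    by (rule cut_continuousD[OF f W, of "e / 2"]) (use e in auto)
  obtain s where s: "s > 0" "\<And>U. U \<in> graphons \<Longrightarrow> cut_dist U W < s \<Longrightarrow> entropy_fun W - e / 2 \<le> entropy_fun U"
    by (rule entropy_lower_semicontinuous[OF W, of "e / 2"]) (use e in auto)
  have "f U - entropy_fun U / 2 < f W - entropy_fun W / 2 + e" if "U \<in> graphons" "cut_dist U W < min r s" for U
  proof -
    have "\<bar>f U - f W\<bar> < e / 2" "entropy_fun W - e / 2 \<le> entropy_fun U"
      using r(2)[OF that(1)] s(2)[OF that(1)] that(2) by auto
    then show ?thesis using e by linarith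
  qed
  then show "\<exists>r>0. \<forall>U\<in>graphons. cut_dist U W < r \<longrightarrow> f U - entropy_fun U / 2 < f W - entropy_fun W / 2 + e"
    using r(1) s(1) by (intro exI[of _ "min r s"]) auto
qed

text \<open>The lower bounds \<open>c j\<close> are arbitrary, so that the lemma applies to values
  known only up to a vanishing error.\<close>

lemma upper_semi_limit:
  assumes h: "upper_semi h" and W: "W \<in> graphons" and X: "\<And>j. X j \<in> graphons" and lim: "(\<lambda>j. cut_dist (X j) W) \<longlonglongrightarrow> 0"
    and c: "\<And>j. c j \<le> h (X j)" "c \<longlonglongrightarrow> L"
  shows "L \<le> h W"
proof (rule field_le_epsilon)
  fix e :: real assume "e > 0"
  then obtain r where r: "r > 0" "\<And>U. U \<in> graphons \<Longrightarrow> cut_dist U W < r \<Longrightarrow> h U < h W + e"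
    using h W unfolding upper_semi_def by meson
  have "\<forall>\<^sub>F j in sequentially. cut_dist (X j) W < r" using lim r(1) by (rule order_tendstoD(2))
  then have "\<forall>\<^sub>F j in sequentially. c j \<le> h W + e"
  proof eventually_elim
    case (elim j)
    then show ?case using r(2)[OF X elim] c(1)[of j] by simp
  qed
  then show "L \<le> h W + e" by (rule tendsto_upperbound[OF c(2)]) simp
qed

lemma cut_continuous_limit:
  assumes f: "cut_continuous f" and W: "W \<in> graphons" and X: "\<And>j. X j \<in> graphons" and lim: "(\<lambda>j. cut_dist (X j) W) \<longlonglongrightarrow> 0"
  shows "(\<lambda>j. f (X j)) \<longlonglongrightarrow> f W"
proof (rule tendstoI)
  fix e :: real assume "e > 0"
  then obtain r where r: "r > 0" "\<And>U. U \<in> graphons \<Longrightarrow> cut_dist U W < r \<Longrightarrow> \<bar>f U - f W\<bar> < e"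
    using f W unfolding cut_continuous_def by meson
  have "\<forall>\<^sub>F j in sequentially. cut_dist (X j) W < r" using lim r(1) by (rule order_tendstoD(2))
  then show "\<forall>\<^sub>F j in sequentially. dist (f (X j)) (f W) < e"
    by eventually_elim (simp add: dist_real_def r(2)[OF X])
qed

text \<open>A maximising sequence has a limit point by compactness, and upper semicontinuity shows
  that nothing is lost there. Closedness of S is stated for sequences because that is how limit
  points are produced.\<close>

lemma upper_semi_attains_max:
  fixes h :: "'k::finite kernel \<Rightarrow> real"
  assumes h: "upper_semi h" and S: "S \<subseteq> graphons" "S \<noteq> {}"
    and closed: "\<And>X W. (\<And>j. X j \<in> S) \<Longrightarrow> W \<in> graphons \<Longrightarrow> (\<lambda>j::nat. cut_dist (X j) W) \<longlonglongrightarrow> 0 \<Longrightarrow> W \<in> S"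
  shows "\<exists>W\<in>S. \<forall>U\<in>S. h U \<le> h W"
proof -
  obtain C where "\<forall>U\<in>graphons. h U \<le> C" using h unfolding upper_semi_def by blast
  then have bdd: "bdd_above (h ` S)" using S(1) by (intro bdd_aboveI2[where M = C]) auto
  define s where "s = (SUP U\<in>S. h U)"
  have "\<exists>U\<in>S. s - 1 / real (Suc j) < h U" for j
    using less_cSUP_iff[OF S(2) bdd, of "s - 1 / real (Suc j)"] unfolding s_def by simp
  then obtain X where X: "\<And>j. X j \<in> S" "\<And>j. s - 1 / real (Suc j) < h (X j)" by metis
  have XG: "X j \<in> graphons" for j using X(1) S(1) by blast
  obtain r W where rW: "strict_mono r" "W \<in> graphons" "(\<lambda>j. cut_dist (X (r j)) W) \<longlonglongrightarrow> 0"
    by (rule graphons_sequentially_compact[OF XG])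
  have "(\<lambda>j. s - 1 / real (Suc j)) \<longlonglongrightarrow> s - 0" by (intro tendsto_intros LIMSEQ_Suc lim_1_over_n)
  then have "(\<lambda>j. s - 1 / real (Suc (r j))) \<longlonglongrightarrow> s"
    using LIMSEQ_subseq_LIMSEQ[OF _ rW(1)] by (fastforce simp: comp_def)
  then have "s \<le> h W" by (rule upper_semi_limit[OF h rW(2) XG rW(3) less_imp_le[OF X(2)]])
  moreover have "h U \<le> s" if "U \<in> S" for U unfolding s_def by (rule cSUP_upper[OF that bdd])
  moreover have "W \<in> S" using X(1) rW(2,3) by (rule closed)
  ultimately show ?thesis using order_trans by blast
qed

text \<open>Moves a variational problem on classes to one on labelled graphons, where the analysis
  takes place.\<close>

lemma argmax_on_unlabel:
  assumes "\<And>W. W \<in> S \<Longrightarrow> F (unlabel W) = h W"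
  shows "argmax_on F (unlabel ` S) = unlabel ` {W \<in> S. \<forall>U\<in>S. h U \<le> h W}"
proof -
  have "argmax_on F (unlabel ` S) = {A \<in> unlabel ` S. \<forall>B\<in>unlabel ` S. F B \<le> F A}"
    unfolding argmax_on_def is_arg_max_def by (auto simp: not_less)
  also have "\<dots> = unlabel ` {W \<in> S. \<forall>U\<in>S. F (unlabel U) \<le> F (unlabel W)}" by blast
  also have "{W \<in> S. \<forall>U\<in>S. F (unlabel U) \<le> F (unlabel W)} = {W \<in> S. \<forall>U\<in>S. h U \<le> h W}"
    by (rule Collect_cong) (simp cong: conj_cong add: assms)
  finally show ?thesis .
qed

subsection \<open>Concentration near the optimal maximisers\<close>

locale graphon_model =
  fixes f g :: "'k::finite kernel \<Rightarrow> real"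
  assumes f: "cut_continuous f" and g: "cut_continuous g"
begin

definition energy :: "real \<Rightarrow> 'k kernel \<Rightarrow> real" where
  "energy \<beta> W = \<beta> * f W + g W - entropy_fun W / 2"

definition max_set :: "'k kernel set" where
  "max_set = {W \<in> graphons. \<forall>U\<in>graphons. f U \<le> f W}"

text \<open>At \<beta> = 0 the energy is g minus half the entropy functional, so these are
  representatives of the classes in \<open>N_star f g\<close>.\<close>

definition opt_set :: "'k kernel set" where
  "opt_set = {W \<in> max_set. \<forall>U\<in>max_set. energy 0 U \<le> energy 0 W}"

definition opt_dist :: "'k kernel \<Rightarrow> real" where
  "opt_dist W = (INF V\<in>opt_set. cut_dist W V)"

lemma upper_semi_energy: "upper_semi (energy \<beta>)"
  unfolding energy_def by (rule upper_semi_free_energy[OF cut_continuous_lincomb[OF f g]])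

lemma max_set_graphons: "max_set \<subseteq> graphons" by (auto simp: max_set_def)

lemma opt_set_graphons: "opt_set \<subseteq> graphons" using max_set_graphons by (auto simp: opt_set_def)

lemma N_set_eq: "N_set f = unlabel ` max_set"
  unfolding N_set_def ugraphons_eq max_set_def by (rule argmax_on_unlabel) (rule induced_cut_continuous[OF f])

lemma N_star_eq: "N_star f g = unlabel ` opt_set"
  unfolding N_star_def N_set_eq opt_set_def
proof (rule argmax_on_unlabel)
  fix W assume "W \<in> max_set"
  then have "W \<in> graphons" using max_set_graphons by blast
  then show "induced g (unlabel W) - 1 / 2 * induced entropy_fun (unlabel W) = energy 0 W"
    by (simp add: energy_def induced_cut_continuous[OF g] induced_entropy)
qed

lemma Gamma_set_eq: "Gamma_set f g \<beta> = unlabel ` {W \<in> graphons. \<forall>U\<in>graphons. energy \<beta> U \<le> energy \<beta> W}"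
  unfolding Gamma_set_def ugraphons_eq
proof (rule argmax_on_unlabel)
  fix W :: "'k kernel" assume "W \<in> graphons"
  then show "\<beta> * induced f (unlabel W) + induced g (unlabel W) - 1 / 2 * induced entropy_fun (unlabel W) = energy \<beta> W"
    by (simp add: energy_def induced_cut_continuous[OF f] induced_cut_continuous[OF g] induced_entropy)
qed

lemma graphons_nonempty: "(graphons :: 'k kernel set) \<noteq> {}"
  using empirical_graphon_in_graphons by blast

lemma max_set_nonempty: "max_set \<noteq> {}"
proof -
  have "upper_semi f"
    unfolding upper_semi_def
  proof (intro conjI ballI allI impI)
    show "\<exists>C. \<forall>U\<in>graphons. f U \<le> C" using cut_continuous_bounded[OF f] by (metis abs_le_D1)
    fix W :: "'k kernel" and e :: real assume "W \<in> graphons" "e > 0"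
    then obtain r where "r > 0" "\<And>U. U \<in> graphons \<Longrightarrow> cut_dist U W < r \<Longrightarrow> \<bar>f U - f W\<bar> < e" using cut_continuousD[OF f] by metis
    then show "\<exists>r>0. \<forall>U\<in>graphons. cut_dist U W < r \<longrightarrow> f U < f W + e" by (intro exI[of _ r]) force
  qed
  then have "\<exists>W\<in>graphons. \<forall>U\<in>graphons. f U \<le> f W"
    by (rule upper_semi_attains_max[OF _ subset_refl graphons_nonempty])
  then show ?thesis unfolding max_set_def by blast
qed

lemma opt_set_nonempty: "opt_set \<noteq> {}"
proof -
  have cl: "W \<in> max_set" if X: "\<And>j. X j \<in> max_set" and W: "W \<in> graphons" and lim: "(\<lambda>j::nat. cut_dist (X j) W) \<longlonglongrightarrow> 0" for X W
  proof -
    have XG: "X j \<in> graphons" for j using X max_set_graphons by blast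
    have "f U \<le> f W" if "U \<in> graphons" for U
      using LIMSEQ_le_const[OF cut_continuous_limit[OF f W XG lim], of "f U"] X that by (auto simp: max_set_def)
    then show ?thesis using W by (simp add: max_set_def)
  qed
  have "\<exists>W\<in>max_set. \<forall>U\<in>max_set. energy 0 U \<le> energy 0 W"
    by (rule upper_semi_attains_max[OF upper_semi_energy max_set_graphons max_set_nonempty cl])
  then show ?thesis unfolding opt_set_def by blast
qed

lemma opt_dist_le: "W \<in> graphons \<Longrightarrow> V \<in> opt_set \<Longrightarrow> opt_dist W \<le> cut_dist W V"
  unfolding opt_dist_def
  by (intro cINF_lower bdd_belowI2[where m = 0] cut_dist_nonneg) (use opt_set_graphons in auto)

lemma opt_dist_nonneg: "W \<in> graphons \<Longrightarrow> 0 \<le> opt_dist W"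
  unfolding opt_dist_def using opt_set_nonempty opt_set_graphons
  by (intro cINF_greatest cut_dist_nonneg) auto

lemma opt_dist_lessD: "W \<in> graphons \<Longrightarrow> opt_dist W < e \<Longrightarrow> \<exists>V\<in>opt_set. cut_dist W V < e"
  unfolding opt_dist_def
  by (subst (asm) cINF_less_iff[OF opt_set_nonempty])
    (use opt_set_graphons in \<open>auto intro!: bdd_belowI2[where m = 0] cut_dist_nonneg\<close>)

lemma ucut_dist_set_eq: "W \<in> graphons \<Longrightarrow> ucut_dist_set (unlabel W) (N_star f g) = opt_dist W"
  unfolding ucut_dist_set_def N_star_eq opt_dist_def image_image
  by (intro INF_cong refl ucut_dist_unlabel) (use opt_set_graphons in auto)

lemma energy_gap:
  assumes \<epsilon>: "\<epsilon> > 0"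
  obtains \<beta>\<^sub>0 K where "\<beta>\<^sub>0 > 0" "K > 0"
    "\<And>\<beta> W V. \<beta> \<ge> \<beta>\<^sub>0 \<Longrightarrow> W \<in> graphons \<Longrightarrow> opt_dist W \<ge> \<epsilon> \<Longrightarrow> V \<in> opt_set \<Longrightarrow> energy \<beta> W \<le> energy \<beta> V - K"
proof (rule ccontr)
  assume neg: "\<not> thesis"
  obtain V0 where V0: "V0 \<in> opt_set" using opt_set_nonempty by blast
  define m where "m = f V0"
  define c where "c = energy 0 V0"
  have mx: "f U \<le> m" if "U \<in> graphons" for U using V0 that by (simp add: opt_set_def max_set_def m_def)
  \<comment> \<open>All optimal graphons share the maximal f and the maximal tie-break value, so
    their energy is the same affine function of \<beta>.\<close>
  have same: "energy \<beta> V = \<beta> * m + c" if "V \<in> opt_set" for \<beta> V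
  proof -
    have "f V = m" "energy 0 V = c"
      using that V0 unfolding opt_set_def max_set_def m_def c_def by (auto intro: antisym)
    then show ?thesis by (simp add: energy_def)
  qed
  \<comment> \<open>The negated claim is used with threshold j + 1 for \<beta> and gap 1/(j +
    1).\<close>
  have "\<exists>\<beta> W. \<beta> \<ge> real (Suc j) \<and> W \<in> graphons \<and> opt_dist W \<ge> \<epsilon> \<and> \<beta> * m + c - 1 / real (Suc j) < energy \<beta> W" for j
  proof (rule ccontr)
    assume "\<not> ?thesis"
    then have "energy \<beta> W \<le> energy \<beta> V - 1 / real (Suc j)"
      if "\<beta> \<ge> real (Suc j)" "W \<in> graphons" "opt_dist W \<ge> \<epsilon>" "V \<in> opt_set" for \<beta> W V
      using that same[of V \<beta>] by force
    then show False using neg that[of "real (Suc j)" "1 / real (Suc j)"] by force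
  qed
  then obtain B X where B: "\<And>j. B j \<ge> real (Suc j)" and X: "\<And>j. X j \<in> graphons" "\<And>j. opt_dist (X j) \<ge> \<epsilon>"
    and big: "\<And>j. B j * m + c - 1 / real (Suc j) < energy (B j) (X j)" by metis
  obtain r W where rW: "strict_mono r" "W \<in> graphons" "(\<lambda>j. cut_dist (X (r j)) W) \<longlonglongrightarrow> 0"
    by (rule graphons_sequentially_compact[OF X(1)])
  obtain C where C: "\<And>U. U \<in> graphons \<Longrightarrow> energy 0 U \<le> C" using upper_semi_energy unfolding upper_semi_def by blast
  have en: "energy (B j) (X j) = B j * f (X j) + energy 0 (X j)" for j by (simp add: energy_def)
  have z: "(\<lambda>j. 1 / real (Suc (r j))) \<longlonglongrightarrow> 0"
    using LIMSEQ_subseq_LIMSEQ[OF LIMSEQ_Suc[OF lim_1_over_n] rW(1)] by (simp add: comp_def)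
  \<comment> \<open>The \<beta>-independent part of the energy is bounded by C, so a deficit in f,
    multiplied by \<open>B j\<close>, must stay bounded; dividing by \<open>B j\<close> forces f
    towards its maximum.\<close>
  have f_low: "m - (C - c + 1) * (1 / real (Suc j)) \<le> f (X j)" for j
  proof -
    have "B j * (m - f (X j)) < energy 0 (X j) - c + 1 / real (Suc j)"
      using big[of j] unfolding en by (simp add: right_diff_distrib)
    also have "\<dots> \<le> C - c + 1"
    proof -
      have "1 / real (Suc j) \<le> 1" by simp
      then show ?thesis using C[OF X(1)[of j]] by linarith
    qed
    finally have "B j * (m - f (X j)) \<le> C - c + 1" by simp
    moreover have "real (Suc j) * (m - f (X j)) \<le> B j * (m - f (X j))"
      using B[of j] mx[OF X(1)[of j]] by (intro mult_right_mono) auto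
    ultimately have "m - f (X j) \<le> (C - c + 1) / real (Suc j)" by (simp add: field_simps)
    then show ?thesis by simp
  qed
  have "(\<lambda>j. m - (C - c + 1) * (1 / real (Suc (r j)))) \<longlonglongrightarrow> m - (C - c + 1) * 0" by (intro tendsto_intros z)
  then have "m - (C - c + 1) * 0 \<le> f W"
    by (rule LIMSEQ_le[OF _ cut_continuous_limit[OF f rW(2) X(1) rW(3)]]) (use f_low in blast)
  then have "m \<le> f W" by simp
  then have "f U \<le> f W" if "U \<in> graphons" for U using mx[OF that] by linarith
  then have WM: "W \<in> max_set" using rW(2) by (simp add: max_set_def)
  \<comment> \<open>Since f never exceeds m, the terms with \<open>B j\<close> can be cancelled in
    favour of the remaining part of the energy.\<close>
  have "c - 1 / real (Suc j) \<le> energy 0 (X j)" for j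
  proof -
    have "B j * f (X j) \<le> B j * m" using B[of j] mx[OF X(1)[of j]] by (intro mult_left_mono) auto
    then show ?thesis using big[of j] unfolding en by linarith
  qed
  moreover have "(\<lambda>j. c - 1 / real (Suc (r j))) \<longlonglongrightarrow> c - 0" by (intro tendsto_intros z)
  ultimately have "c - 0 \<le> energy 0 W"
    by (intro upper_semi_limit[OF upper_semi_energy rW(2) X(1) rW(3), where c = "\<lambda>j. c - 1 / real (Suc (r j))"])
  then have "W \<in> opt_set" using WM V0 unfolding opt_set_def c_def by fastforce
  \<comment> \<open>The limit is itself optimal, so the sequence must keep distance \<epsilon> from
    it although it converges to it.\<close>
  then have "\<epsilon> \<le> cut_dist (X (r j)) W" for j using opt_dist_le[OF X(1)] X(2) order_trans by blast
  then have "\<epsilon> \<le> 0" using LIMSEQ_le_const[OF rW(3)] by blast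
  then show False using \<epsilon> by simp
qed

section \<open>Exponential bounds for the Gibbs measure\<close>

lemma gibbs_prob_le:
  "measure_pmf.prob (gibbs f g n \<beta>) S \<le> (\<Sum>X\<in>S \<inter> colourings n. gibbs_weight f g n \<beta> X) / (\<Sum>X\<in>colourings n. gibbs_weight f g n \<beta> X)"
proof -
  let ?p = "gibbs f g n \<beta>" and ?Z = "\<Sum>X\<in>colourings n. gibbs_weight f g n \<beta> X"
  have fin: "finite (S \<inter> colourings n)" using finite_colourings by blast
  have "set_pmf ?p \<subseteq> colourings n" by (auto simp: set_pmf_eq pmf_gibbs split: if_splits)
  then have "measure_pmf.prob ?p (S \<inter> set_pmf ?p) \<le> measure_pmf.prob ?p (S \<inter> colourings n)"
    by (intro measure_pmf.finite_measure_mono) auto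
  then have "measure_pmf.prob ?p S \<le> measure_pmf.prob ?p (S \<inter> colourings n)" by (simp add: measure_Int_set_pmf)
  also have "\<dots> = (\<Sum>X\<in>S \<inter> colourings n. pmf ?p X)" by (rule measure_measure_pmf_finite[OF fin])
  also have "\<dots> = (\<Sum>X\<in>S \<inter> colourings n. gibbs_weight f g n \<beta> X / ?Z)" by (rule sum.cong) (auto simp: pmf_gibbs)
  finally show ?thesis by (simp add: sum_divide_distrib)
qed

text \<open>The far colourings are covered by finitely many balls. In each ball the weight is at
  most the number of colourings times the largest weight, that is, the exponential of n^2 times the
  energy of the centre up to 2\<kappa>, times a factor exponential in n.\<close>

lemma far_weight_le:
  assumes \<epsilon>: "\<epsilon> > 0" and \<kappa>: "\<kappa> > 0"
    and gap: "\<And>W. W \<in> graphons \<Longrightarrow> opt_dist W \<ge> \<epsilon> \<Longrightarrow> energy \<beta> W \<le> b"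
  obtains a m :: real where "\<And>n. n \<ge> 1 \<Longrightarrow>
    (\<Sum>X\<in>{X. opt_dist (empirical_graphon n X) \<ge> \<epsilon>} \<inter> colourings n. gibbs_weight f g n \<beta> X)
      \<le> a * exp (m * real n) * exp ((real n)\<^sup>2 * (b + 2 * \<kappa>))"
proof -
  define F where "F = (\<lambda>W. \<beta> * f W + g W)"
  have F: "cut_continuous F" unfolding F_def by (rule cut_continuous_lincomb[OF f g])
  \<comment> \<open>Three demands on the radius: a ball that meets the far region has a far centre,
    F varies by at most \<kappa>, and the counting bound holds. The first lets \<open>gap\<close> be
    used at the centre.\<close>
  define good where "good W r m \<longleftrightarrow> r > 0 \<and> (\<forall>U\<in>graphons. cut_dist U W < r \<longrightarrow> opt_dist U \<ge> \<epsilon> \<longrightarrow> opt_dist W \<ge> \<epsilon> \<and> F U \<le> F W + \<kappa>) \<and>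
    (\<forall>n\<ge>1. real (card {X \<in> colourings n. cut_dist (empirical_graphon n X) W < r}) \<le> exp (real m * real n) * exp ((real n)\<^sup>2 * (\<kappa> - entropy_fun W / 2)))"
    for W :: "'k kernel" and r :: real and m :: nat
  have ex: "\<exists>r m. good W r m" if W: "W \<in> graphons" for W
  proof -
    obtain r1 where r1: "r1 > 0" "\<And>U. U \<in> graphons \<Longrightarrow> cut_dist U W < r1 \<Longrightarrow> \<bar>F U - F W\<bar> < \<kappa>" using cut_continuousD[OF F W \<kappa>] by metis
    \<comment> \<open>The set of graphons at distance less than \<epsilon> from the optimal set is
      open, so a near centre has a ball without far points.\<close>
    obtain r2 where r2: "r2 > 0" "\<And>U. U \<in> graphons \<Longrightarrow> cut_dist U W < r2 \<Longrightarrow> opt_dist U \<ge> \<epsilon> \<Longrightarrow> opt_dist W \<ge> \<epsilon>"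
    proof (cases "opt_dist W \<ge> \<epsilon>")
      case True
      then show ?thesis using that[of 1] by simp
    next
      case False
      then obtain V where V: "V \<in> opt_set" "cut_dist W V < \<epsilon>" using opt_dist_lessD[OF W] by force
      have VG: "V \<in> graphons" using V opt_set_graphons by blast
      have "opt_dist U < \<epsilon>" if "U \<in> graphons" "cut_dist U W < \<epsilon> - cut_dist W V" for U
        using opt_dist_le[OF that(1) V(1)] cut_dist_triangle[OF that(1) W VG] that(2) by simp
      then show ?thesis using that[of "\<epsilon> - cut_dist W V"] V(2) by force
    qed
    \<comment> \<open>The counting bound halves its parameter together with the entropy, so it is
      invoked with 2\<kappa>.\<close>
    have \<kappa>2: "2 * \<kappa> > 0" using \<kappa> by simp
    define cn where "cn r n = real (card {X \<in> colourings n. cut_dist (empirical_graphon n X) W < r})" for r n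
    obtain m r3 where "m \<ge> 1" and r3: "r3 > 0" "\<And>n. n \<ge> 1 \<Longrightarrow> cn r3 n \<le> real m ^ n * exp ((real n)\<^sup>2 * (2 * \<kappa> - entropy_fun W) / 2)"
      using card_near_le[OF W \<kappa>2, folded cn_def] by metis
    define r where "r = min r1 (min r2 r3)"
    have "real (card {X \<in> colourings n. cut_dist (empirical_graphon n X) W < r}) \<le> exp (real m * real n) * exp ((real n)\<^sup>2 * (\<kappa> - entropy_fun W / 2))"
      if n: "n \<ge> 1" for n
    proof -
      have "card {X \<in> colourings n. cut_dist (empirical_graphon n X) W < r} \<le> card {X \<in> colourings n. cut_dist (empirical_graphon n X) W < r3}"
        by (rule card_mono) (auto simp: finite_colourings r_def)
      then have "real (card {X \<in> colourings n. cut_dist (empirical_graphon n X) W < r}) \<le> real m ^ n * exp ((real n)\<^sup>2 * (2 * \<kappa> - entropy_fun W) / 2)"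
        using r3(2)[OF n] unfolding cn_def by linarith
      also have "real m ^ n \<le> exp (real m) ^ n"
      proof (rule power_mono)
        show "real m \<le> exp (real m)" using exp_ge_add_one_self[of "real m"] by linarith
      qed simp
      also have "exp (real m) ^ n = exp (real m * real n)" by (simp add: exp_of_nat2_mult)
      finally show ?thesis by (simp add: right_diff_distrib diff_divide_distrib)
    qed
    moreover have "F U \<le> F W + \<kappa>" if "U \<in> graphons" "cut_dist U W < r" for U
      using r1(2)[OF that(1)] that(2) by (simp add: r_def)
    ultimately have "good W r m" using r1(1) r2 r3(1) unfolding good_def r_def by auto
    then show ?thesis by blast
  qed
  then obtain rad mm where rad: "\<And>W. W \<in> graphons \<Longrightarrow> good W (rad W) (mm W)" by metis
  have "rad W > 0" if "W \<in> graphons" for W using rad[OF that] by (simp add: good_def)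
  then obtain C :: "'k kernel set" where C: "finite C" "C \<subseteq> graphons" "\<And>U. U \<in> graphons \<Longrightarrow> \<exists>W\<in>C. cut_dist U W < rad W"
    using graphons_finite_cover[of rad] by blast
  \<comment> \<open>The sum serves as a common upper bound for the finitely many block
    numbers.\<close>
  define m where "m = (\<Sum>W\<in>C. mm W)"
  show ?thesis
  proof (rule that[of "real (card C)" "real m"])
    fix n :: nat assume n: "n \<ge> 1"
    let ?E = "empirical_graphon n :: (nat set \<Rightarrow> 'k) \<Rightarrow> 'k kernel"
    let ?w = "gibbs_weight f g n \<beta>"
    have w0: "0 \<le> ?w X" for X by (simp add: gibbs_weight_def)
    define N where "N W = {X \<in> colourings n. cut_dist (?E X) W < rad W \<and> opt_dist (?E X) \<ge> \<epsilon>}" for W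
    have finN: "finite (N W)" for W by (rule finite_subset[OF _ finite_colourings]) (auto simp: N_def)
    have "{X. opt_dist (?E X) \<ge> \<epsilon>} \<inter> colourings n \<subseteq> (\<Union>W\<in>C. N W)"
      using C(3)[OF empirical_graphon_in_graphons] unfolding N_def by blast
    then have "(\<Sum>X\<in>{X. opt_dist (?E X) \<ge> \<epsilon>} \<inter> colourings n. ?w X) \<le> (\<Sum>X\<in>(\<Union>W\<in>C. N W). ?w X)"
      by (rule sum_mono2[rotated]) (use C(1) finN w0 in auto)
    also have "\<dots> \<le> (\<Sum>W\<in>C. \<Sum>X\<in>N W. ?w X)" by (rule sum_UN_le) (use C(1) finN w0 in auto)
    also have "\<dots> \<le> (\<Sum>W\<in>C. exp (real m * real n) * exp ((real n)\<^sup>2 * (b + 2 * \<kappa>)))"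
    proof (rule sum_mono)
      fix W assume W: "W \<in> C"
      then have WG: "W \<in> graphons" using C(2) by blast
      note G = rad[OF WG, unfolded good_def]
      show "(\<Sum>X\<in>N W. ?w X) \<le> exp (real m * real n) * exp ((real n)\<^sup>2 * (b + 2 * \<kappa>))"
      proof (cases "N W = {}")
        case False
        then obtain X0 where "X0 \<in> N W" by blast
        then have "opt_dist W \<ge> \<epsilon>" using G empirical_graphon_in_graphons[of n X0] unfolding N_def by blast
        then have eb: "energy \<beta> W \<le> b" by (rule gap[OF WG])
        have "?w X \<le> exp ((real n)\<^sup>2 * (F W + \<kappa>))" if "X \<in> N W" for X
        proof -
          have "F (?E X) \<le> F W + \<kappa>" using G empirical_graphon_in_graphons[of n X] that unfolding N_def by blast
          then show ?thesis unfolding gibbs_weight_def F_def by (simp add: mult_left_mono)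
        qed
        then have "(\<Sum>X\<in>N W. ?w X) \<le> (\<Sum>X\<in>N W. exp ((real n)\<^sup>2 * (F W + \<kappa>)))" by (rule sum_mono)
        also have "\<dots> = real (card (N W)) * exp ((real n)\<^sup>2 * (F W + \<kappa>))" by simp
        also have "real (card (N W)) \<le> real (card {X \<in> colourings n. cut_dist (?E X) W < rad W})"
          unfolding N_def by (intro of_nat_mono card_mono) (auto simp: finite_colourings)
        also have "\<dots> \<le> exp (real (mm W) * real n) * exp ((real n)\<^sup>2 * (\<kappa> - entropy_fun W / 2))" using G n by blast
        also have "\<dots> \<le> exp (real m * real n) * exp ((real n)\<^sup>2 * (\<kappa> - entropy_fun W / 2))"
        proof -
          have "real (mm W) \<le> real m" unfolding m_def by (intro of_nat_mono member_le_sum[OF W _ C(1)]) simp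
          then show ?thesis by (simp add: mult_right_mono)
        qed
        finally have "(\<Sum>X\<in>N W. ?w X) \<le> exp (real m * real n) * exp ((real n)\<^sup>2 * (\<kappa> - entropy_fun W / 2)) * exp ((real n)\<^sup>2 * (F W + \<kappa>))"
          by (simp add: mult_right_mono)
        also have "\<dots> = exp (real m * real n) * exp ((real n)\<^sup>2 * (energy \<beta> W + 2 * \<kappa>))"
          unfolding mult.assoc exp_add[symmetric] by (simp add: energy_def F_def algebra_simps)
        also have "\<dots> \<le> exp (real m * real n) * exp ((real n)\<^sup>2 * (b + 2 * \<kappa>))"
          using eb by (simp add: mult_left_mono)
        finally show ?thesis .
      qed simp
    qed
    finally show "(\<Sum>X\<in>{X. opt_dist (?E X) \<ge> \<epsilon>} \<inter> colourings n. ?w X)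
      \<le> real (card C) * exp (real m * real n) * exp ((real n)\<^sup>2 * (b + 2 * \<kappa>))" by simp
  qed
qed

lemma gibbs_far_prob_le:
  assumes \<epsilon>: "\<epsilon> > 0" and K: "K > 0" and V: "V \<in> opt_set"
    and gap: "\<And>W. W \<in> graphons \<Longrightarrow> opt_dist W \<ge> \<epsilon> \<Longrightarrow> energy \<beta> W \<le> energy \<beta> V - K"
  obtains n0 where "n0 \<ge> 1" "\<And>n. n \<ge> n0 \<Longrightarrow>
    measure_pmf.prob (gibbs f g n \<beta>) {X. opt_dist (empirical_graphon n X) \<ge> \<epsilon>} \<le> exp (- (K / 2) * (real n)\<^sup>2)"
proof -
  define F where "F = (\<lambda>W. \<beta> * f W + g W)"
  have F: "cut_continuous F" unfolding F_def by (rule cut_continuous_lincomb[OF f g])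
  have VG: "V \<in> graphons" using V opt_set_graphons by blast
  \<comment> \<open>The numerator has exponent -K + 2\<kappa> relative to the energy of V and the
    partition function gives -\<kappa>. The quotient thus has -K + 3\<kappa> = -K/2 - \<kappa>, and
    the spare \<kappa> absorbs \<open>a * exp (m * real n)\<close>.\<close>
  define \<kappa> where "\<kappa> = K / 8"
  have \<kappa>: "\<kappa> > 0" "\<kappa> / 4 > 0" using K by (auto simp: \<kappa>_def)
  obtain B where B: "\<And>U. U \<in> graphons \<Longrightarrow> \<bar>F U\<bar> \<le> B" using cut_continuous_bounded[OF F] by metis
  obtain r where r: "r > 0" "\<And>U. U \<in> graphons \<Longrightarrow> cut_dist U V < r \<Longrightarrow> \<bar>F U - F V\<bar> < \<kappa> / 4" using cut_continuousD[OF F VG \<kappa>(2)] by metis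
  have "F V - \<kappa> / 4 \<le> F U" if "U \<in> graphons" "cut_norm_vec (\<lambda>z. U z - V z) < r" for U
  proof -
    have "\<bar>F U - F V\<bar> < \<kappa> / 4" using cut_dist_le_norm[OF that(1) VG] that(2) by (intro r(2) that(1)) simp
    then show ?thesis by linarith
  qed
  note near = this
  define Z where "Z n = (\<Sum>X\<in>colourings n. exp ((real n)\<^sup>2 * F (empirical_graphon n X)))" for n
  obtain n1 where n1: "n1 \<ge> 1" "\<And>n. n \<ge> n1 \<Longrightarrow> exp ((real n)\<^sup>2 * (F V - entropy_fun V / 2 - \<kappa>)) \<le> Z n"
    using partition_function_ge[where F = F, OF VG \<kappa>(1) B r(1) near, folded Z_def] by metis
  obtain a m :: real where am: "\<And>n. n \<ge> 1 \<Longrightarrow>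
    (\<Sum>X\<in>{X. opt_dist (empirical_graphon n X) \<ge> \<epsilon>} \<inter> colourings n. gibbs_weight f g n \<beta> X)
      \<le> a * exp (m * real n) * exp ((real n)\<^sup>2 * (energy \<beta> V - K + 2 * \<kappa>))"
    using far_weight_le[OF \<epsilon> \<kappa>(1) gap] by metis
  have "(\<lambda>n. exp (m * real n) * exp (- \<kappa> * (real n)\<^sup>2)) \<longlonglongrightarrow> 0"
  proof (cases m "0 :: real" rule: linorder_cases)
    case less then show ?thesis using \<kappa>(1) by real_asymp
  next
    case equal
    have "(\<lambda>n. exp (- \<kappa> * (real n)\<^sup>2)) \<longlonglongrightarrow> 0" using \<kappa>(1) by real_asymp
    then show ?thesis by (simp add: equal)
  next
    case greater then show ?thesis using \<kappa>(1) by real_asymp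
  qed
  from tendsto_mult_left[OF this, of a]
  have "(\<lambda>n. a * exp (m * real n) * exp (- \<kappa> * (real n)\<^sup>2)) \<longlonglongrightarrow> 0" by (simp add: mult.assoc)
  then have "\<forall>\<^sub>F n in sequentially. a * exp (m * real n) * exp (- \<kappa> * (real n)\<^sup>2) < 1" by (rule order_tendstoD(2)) simp
  then obtain n2 where n2: "\<And>n. n \<ge> n2 \<Longrightarrow> a * exp (m * real n) * exp (- \<kappa> * (real n)\<^sup>2) < 1" unfolding eventually_sequentially by blast
  show ?thesis
  proof (rule that[of "max n1 n2"])
    show "max n1 n2 \<ge> 1" using n1(1) by simp
    fix n assume "n \<ge> max n1 n2"
    then have n: "n \<ge> n1" "n \<ge> n2" "n \<ge> 1" using n1(1) by auto
    let ?S = "{X. opt_dist (empirical_graphon n X) \<ge> \<epsilon>}"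
    have Zn: "Z n = (\<Sum>X\<in>colourings n. gibbs_weight f g n \<beta> X)"
      by (simp add: Z_def gibbs_weight_def F_def)
    define z where "z = exp ((real n)\<^sup>2 * (energy \<beta> V - \<kappa>))"
    have z: "z > 0" "z \<le> Z n"
      using n1(2)[OF n(1)] by (auto simp: z_def F_def energy_def)
    have "measure_pmf.prob (gibbs f g n \<beta>) ?S \<le> (\<Sum>X\<in>?S \<inter> colourings n. gibbs_weight f g n \<beta> X) / Z n"
      unfolding Zn by (rule gibbs_prob_le)
    also have "\<dots> \<le> (\<Sum>X\<in>?S \<inter> colourings n. gibbs_weight f g n \<beta> X) / z"
      using z by (intro divide_left_mono sum_nonneg mult_pos_pos) (auto simp: gibbs_weight_def)
    also have "\<dots> \<le> a * exp (m * real n) * exp ((real n)\<^sup>2 * (energy \<beta> V - K + 2 * \<kappa>)) / z"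
      using am[OF n(3)] z by (intro divide_right_mono) auto
    also have "\<dots> = a * exp (m * real n) * exp ((real n)\<^sup>2 * (energy \<beta> V - K + 2 * \<kappa>) - (real n)\<^sup>2 * (energy \<beta> V - \<kappa>))"
      unfolding z_def by (simp add: exp_diff)
    also have "(real n)\<^sup>2 * (energy \<beta> V - K + 2 * \<kappa>) - (real n)\<^sup>2 * (energy \<beta> V - \<kappa>) = - \<kappa> * (real n)\<^sup>2 + - (K / 2) * (real n)\<^sup>2"
      by (simp add: \<kappa>_def algebra_simps)
    also have "a * exp (m * real n) * exp (- \<kappa> * (real n)\<^sup>2 + - (K / 2) * (real n)\<^sup>2)
      = (a * exp (m * real n) * exp (- \<kappa> * (real n)\<^sup>2)) * exp (- (K / 2) * (real n)\<^sup>2)" by (simp only: exp_add mult.assoc)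
    also have "\<dots> \<le> 1 * exp (- (K / 2) * (real n)\<^sup>2)" using n2[OF n(2)] by (intro mult_right_mono) auto
    finally show "measure_pmf.prob (gibbs f g n \<beta>) ?S \<le> exp (- (K / 2) * (real n)\<^sup>2)" by simp
  qed
qed

lemma far_set_prob:
  "measure_pmf.prob (ugibbs f g n \<beta>) (far_set f g \<epsilon>)
    = measure_pmf.prob (gibbs f g n \<beta>) {X. ucut_dist_set (unlabel (empirical_graphon n X)) (N_star f g) \<ge> \<epsilon>}"
  unfolding ugibbs_def measure_map_pmf far_set_def
  by (rule arg_cong[where f = "measure_pmf.prob (gibbs f g n \<beta>)"])
    (auto simp: unlabel_in_ugraphons empirical_graphon_in_graphons)

text \<open>Beyond the threshold for e/2 a graphon at distance at least e/2 from the optimal set has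
  less energy than an optimal one and cannot be a maximiser. Maximisers exist for every \<beta>, so
  the supremum is over a nonempty set.\<close>

lemma Gamma_set_limit:
  "((\<lambda>\<beta>. SUP A\<in>Gamma_set f g \<beta>. ucut_dist_set A (N_star f g)) \<longlongrightarrow> 0) at_top"
proof (rule tendstoI)
  fix e :: real assume "e > 0"
  then have e2: "e / 2 > 0" by simp
  obtain \<beta>\<^sub>0 K where gap: "\<beta>\<^sub>0 > 0" "K > 0"
    "\<And>\<beta> W V. \<beta> \<ge> \<beta>\<^sub>0 \<Longrightarrow> W \<in> graphons \<Longrightarrow> opt_dist W \<ge> e / 2 \<Longrightarrow> V \<in> opt_set \<Longrightarrow> energy \<beta> W \<le> energy \<beta> V - K"
    using energy_gap[OF e2] by metis
  obtain V where V: "V \<in> opt_set" using opt_set_nonempty by blast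
  have VG: "V \<in> graphons" using V opt_set_graphons by blast
  show "\<forall>\<^sub>F \<beta> in at_top. dist (SUP A\<in>Gamma_set f g \<beta>. ucut_dist_set A (N_star f g)) 0 < e"
    using eventually_ge_at_top[of \<beta>\<^sub>0]
  proof eventually_elim
    case (elim \<beta>)
    define G where "G = {W \<in> graphons. \<forall>U\<in>graphons. energy \<beta> U \<le> energy \<beta> W}"
    have GG: "G \<subseteq> graphons" by (auto simp: G_def)
    have "\<exists>W\<in>graphons. \<forall>U\<in>graphons. energy \<beta> U \<le> energy \<beta> W"
      by (rule upper_semi_attains_max[OF upper_semi_energy subset_refl graphons_nonempty])
    then have "G \<noteq> {}" unfolding G_def by blast
    then obtain W0 where W0: "W0 \<in> G" by blast
    have eq: "(SUP A\<in>Gamma_set f g \<beta>. ucut_dist_set A (N_star f g)) = (SUP W\<in>G. opt_dist W)"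
      unfolding Gamma_set_eq G_def[symmetric] image_image by (intro SUP_cong refl ucut_dist_set_eq) (use GG in blast)
    have small: "opt_dist W \<le> e / 2" if W: "W \<in> G" for W
    proof (rule ccontr)
      assume "\<not> ?thesis"
      then have "energy \<beta> W \<le> energy \<beta> V - K" using gap(3)[OF elim _ _ V] W GG by auto
      moreover have "energy \<beta> V \<le> energy \<beta> W" using W VG by (simp add: G_def)
      ultimately show False using gap(2) by simp
    qed
    have "(SUP W\<in>G. opt_dist W) \<le> e / 2" by (rule cSUP_least[OF \<open>G \<noteq> {}\<close> small])
    moreover have "0 \<le> (SUP W\<in>G. opt_dist W)"
      by (rule cSUP_upper2[OF _ W0 opt_dist_nonneg]) (use W0 GG small in \<open>auto intro!: bdd_aboveI2[where M = "e / 2"]\<close>)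
    ultimately show ?case unfolding eq using \<open>e > 0\<close> by (simp add: dist_real_def)
  qed
qed

end

theorem theorem3p22:
  fixes f g :: "'k::finite kernel \<Rightarrow> real"
  assumes "CARD('k) \<ge> 2"
    and "continuous_map cut_topology euclideanreal f"
    and "continuous_map cut_topology euclideanreal g"
    and "relabelling_invariant f"
    and "relabelling_invariant g"
  shows "(\<forall>\<epsilon>>0. \<exists>\<beta>\<^sub>0>0. \<exists>K>0. \<forall>\<beta>\<ge>\<beta>\<^sub>0. \<exists>n\<^sub>0. \<forall>n\<ge>n\<^sub>0.
            measure_pmf.prob (ugibbs f g n \<beta>) (far_set f g \<epsilon>)
              = measure_pmf.prob (gibbs f g n \<beta>)
                  {X. ucut_dist_set (unlabel (empirical_graphon n X)) (N_star f g) \<ge> \<epsilon>}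
          \<and> measure_pmf.prob (ugibbs f g n \<beta>) (far_set f g \<epsilon>) \<le> exp (- K * (real n)\<^sup>2))
      \<and> ((\<lambda>\<beta>. SUP A\<in>Gamma_set f g \<beta>. ucut_dist_set A (N_star f g)) \<longlongrightarrow> 0) at_top"
proof -
  interpret graphon_model f g
    by unfold_locales (rule cut_continuousI[OF assms(2,4)], rule cut_continuousI[OF assms(3,5)])
  have "\<exists>\<beta>\<^sub>0>0. \<exists>K>0. \<forall>\<beta>\<ge>\<beta>\<^sub>0. \<exists>n\<^sub>0. \<forall>n\<ge>n\<^sub>0.
      measure_pmf.prob (ugibbs f g n \<beta>) (far_set f g \<epsilon>) \<le> exp (- K * (real n)\<^sup>2)" if \<epsilon>: "\<epsilon> > 0" for \<epsilon>
  proof -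
    obtain \<beta>\<^sub>0 K where gap: "\<beta>\<^sub>0 > 0" "K > 0"
      "\<And>\<beta> W V. \<beta> \<ge> \<beta>\<^sub>0 \<Longrightarrow> W \<in> graphons \<Longrightarrow> opt_dist W \<ge> \<epsilon> \<Longrightarrow> V \<in> opt_set \<Longrightarrow> energy \<beta> W \<le> energy \<beta> V - K"
      using energy_gap[OF \<epsilon>] by metis
    obtain V where V: "V \<in> opt_set" using opt_set_nonempty by blast
    have "\<exists>n\<^sub>0. \<forall>n\<ge>n\<^sub>0. measure_pmf.prob (ugibbs f g n \<beta>) (far_set f g \<epsilon>) \<le> exp (- (K / 2) * (real n)\<^sup>2)" if "\<beta> \<ge> \<beta>\<^sub>0" for \<beta>
      using gibbs_far_prob_le[OF \<epsilon> gap(2) V gap(3)[OF that _ _ V]]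
      unfolding far_set_prob ucut_dist_set_eq[OF empirical_graphon_in_graphons] by metis
    then show ?thesis using gap(1,2) by (intro exI[of _ \<beta>\<^sub>0] conjI exI[of _ "K / 2"]) auto
  qed
  then show ?thesis using Gamma_set_limit far_set_prob by simp
qed

end
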